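(* For every integer $n>8$ there is no simple ideal Coxeter polytope in the hyperbolic space $\mathbb{H}^n$.
   Context: Let $\mathbb{H}^n$ be hyperbolic $n$-space with ideal boundary $\partial\mathbb{H}^n$. A hyperbolic polytope $P\subset\mathbb{H}^n$ is a convex intersection of finitely many closed half-spaces having finite volume; its vertices may be ordinary points of $\mathbb{H}^n$ or ideal points on $\partial\mathbb{H}^n$. $P$ is a Coxeter polytope if every dihedral angle between two intersecting facets equals $\pi/m$ for some integer $m\ge 2$. $P$ is simple if every $k$-dimensional face (including every vertex, ideal or not) is contained in exactly $n-k$ facets. $P$ is ideal if all its vertices lie on $\partial\mathbb{H}^n$. *)

theory Defs
  imports "HOL-Analysis.Analysis"
begin

text \<open>Klein (projective) model of hyperbolic n-space: the open unit ball of an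
n-dimensional Euclidean space 'a; the ideal boundary is the unit sphere.
Hyperbolic hyperplanes/half-spaces are the intersections of Euclidean ones with
the ball.  The Klein point x corresponds to the point (x,1) of Minkowski space
with the Lorentzian form  ((x,s),(y,t)) = x.y - s t, and the Euclidean half-space
a.x <= b corresponds to the Lorentzian half-space with outer normal (a,b).\<close>

definition hyp_space :: "'a::euclidean_space set" where
  "hyp_space = ball 0 1"

definition ideal_boundary :: "'a::euclidean_space set" where
  "ideal_boundary = sphere 0 1"

definition hyp_volume :: "'a::euclidean_space set \<Rightarrow> ennreal" where
  "hyp_volume S =
     (\<integral>\<^sup>+ x. indicator S x * ennreal ((1 - (norm x)\<^sup>2) powr (- (real DIM('a) + 1) / 2)) \<partial>lborel)"

definition hyp_polytope :: "'a::euclidean_space set \<Rightarrow> bool" where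
  "hyp_polytope P \<longleftrightarrow>
     (\<exists>Q. polyhedron Q \<and> P = hyp_space \<inter> Q) \<and> interior P \<noteq> {} \<and> hyp_volume P < \<infinity>"

text \<open>The faces of P (ordinary faces and ideal vertices) are exactly the nonempty
faces of the closure of P in the closed ball, i.e. of the Euclidean closure of P;
vertices are the 0-dimensional such faces, ideal ones lie on the sphere.\<close>

definition hyp_vertex :: "'a::euclidean_space set \<Rightarrow> 'a \<Rightarrow> bool" where
  "hyp_vertex P v \<longleftrightarrow> {v} face_of closure P"

definition hyp_ideal :: "'a::euclidean_space set \<Rightarrow> bool" where
  "hyp_ideal P \<longleftrightarrow> (\<forall>v. hyp_vertex P v \<longrightarrow> v \<in> ideal_boundary)"

definition hyp_simple :: "'a::euclidean_space set \<Rightarrow> bool" where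
  "hyp_simple P \<longleftrightarrow>
     (\<forall>F. F face_of closure P \<and> F \<noteq> {} \<longrightarrow>
        int (card {G. G facet_of closure P \<and> F \<subseteq> G}) = int DIM('a) - aff_dim F)"

definition outer_normal :: "'a::euclidean_space set \<Rightarrow> 'a set \<Rightarrow> 'a \<times> real \<Rightarrow> bool" where
  "outer_normal C F e \<longleftrightarrow>
     fst e \<noteq> 0 \<and> C \<subseteq> {x. fst e \<bullet> x \<le> snd e} \<and> F = C \<inter> {x. fst e \<bullet> x = snd e}"

text \<open>Cosine of the interior dihedral angle, computed from the Lorentzian
(Minkowski) inner product of the unit outer normals: cos theta = - <e1,e2>.\<close>
definition lorentz_angle_cos :: "'a::euclidean_space \<times> real \<Rightarrow> 'a \<times> real \<Rightarrow> real" where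
  "lorentz_angle_cos e1 e2 =
     - (fst e1 \<bullet> fst e2 - snd e1 * snd e2)
       / (sqrt (fst e1 \<bullet> fst e1 - (snd e1)\<^sup>2) * sqrt (fst e2 \<bullet> fst e2 - (snd e2)\<^sup>2))"

definition hyp_dihedral_angle :: "'a::euclidean_space set \<Rightarrow> 'a set \<Rightarrow> 'a set \<Rightarrow> real" where
  "hyp_dihedral_angle P F G =
     arccos (lorentz_angle_cos (SOME e. outer_normal (closure P) F e)
                               (SOME e. outer_normal (closure P) G e))"

definition hyp_coxeter :: "'a::euclidean_space set \<Rightarrow> bool" where
  "hyp_coxeter P \<longleftrightarrow>
     (\<forall>F G. F facet_of closure P \<and> G facet_of closure P \<and> F \<noteq> G \<and>
            F \<inter> G \<inter> hyp_space \<noteq> {} \<longrightarrow>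
        (\<exists>m::nat. m \<ge> 2 \<and> hyp_dihedral_angle P F G = pi / real m))"

end

theory Submission
  imports Defs
begin

text \<open>Let e_i be the Lorentzian unit normals of the facets and g the Gram matrix.  Off the diagonal g is
  - cos (pi / m), or < -1 for disjoint facets.  The normals at an ideal vertex form a parabolic (affine)
  subdiagram with n facets; conversely every elliptic subdiagram lies in, and every parabolic one is,
  the diagram of a vertex.  Comparing the diagrams of the vertices along an edge and around a 2-face,
  using the reverse Cauchy-Schwarz inequality, shows that no 2-face is a triangle and bounds the number
  of quadrangular 2-faces: each of them spreads a unit charge over its vertices, and a vertex receives
  at most n / 2 (at most 4 if n = 9).  On the other hand a generic linear height function has a
  highest and a lowest vertex on each 2-face, and at each vertex every pair of descending (or ascending)
  edges spans a 2-face with extremum there; this makes the average number of vertices of a 2-face too small.\<close>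

text \<open>The hypothesis n >= 9 acts twice. A set of facets with a positive null vector is a
  vertex and so has n nodes; hence the small affine diagrams of types A, B, C, D, F are forbidden
  for arbitrary facets, which limits the labels to 2, 3, 4 and dotted edges and decides nearly every
  case. The second use is the final count. For d descending and u ascending edges, d + u >= n gives
  4 (C(d,2) + C(u,2)) >= n (n - 2) + (n mod 2). With v vertices, f 2-faces and q quadrangles this
  yields 8 f > v (n (n - 2) + (n mod 2)), while the vertex counts of the 2-faces yield 5 f <= v
  C(n,2) + q. With q <= v n / 2 this means n < 10. For n = 9 the parity term turns the comparison
  into 320 < 320, provided q <= 4 v; the easy bound 9 v / 2 does not suffice. Dimension 9 is also
  where affine E8, which has nine nodes, can be a vertex diagram and an edge of a 2-face can lead
  from a cycle to a tree. This is why quadrangles with cyclic corners need explicit test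
  vectors.\<close>

section \<open>Gram forms and the possible cosines\<close>

definition rt :: real where "rt = sqrt 2 / 2"

lemma rt_sq: "rt * rt = 1/2" by (simp add: rt_def)
lemma rt_sq_left: "rt * (rt * a) = a / 2" by (simp add: rt_def)
lemma rt_bounds: "7/10 < rt" "rt < 5/7" "0 < rt"
proof -
  have "sqrt (49/25) < sqrt 2" "sqrt 2 < sqrt (100/49)" by simp_all
  moreover have "sqrt (49/25) = 7/5" "sqrt (100/49) = 10/7" by (simp_all add: real_sqrt_divide)
  ultimately show "7/10 < rt" "rt < 5/7" "0 < rt" by (simp_all add: rt_def)
qed

definition bil :: "('f => 'f => real) => 'f set => ('f => real) => ('f => real) => real" where
  "bil g T c d = (\<Sum>i\<in>T. \<Sum>j\<in>T. c i * d j * g i j)"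

definition pd :: "('f => 'f => real) => 'f set => bool" where
  "pd g T \<longleftrightarrow> (\<forall>c. (\<exists>i\<in>T. c i ~= 0) --> 0 < bil g T c c)"

lemma pd_subset:
  assumes "pd g T" "S \<subseteq> T" "finite T" shows "pd g S"
  unfolding pd_def
proof (intro allI impI)
  fix c assume "\<exists>i\<in>S. c i ~= (0::real)"
  define c' where "c' = (\<lambda>i. if i \<in> S then c i else 0)"
  have "\<exists>i\<in>T. c' i ~= 0" using \<open>\<exists>i\<in>S. c i ~= 0\<close> assms(2) by (auto simp: c'_def)
  hence "0 < bil g T c' c'" using assms(1) by (simp add: pd_def)
  also have "bil g T c' c' = (\<Sum>i\<in>S. \<Sum>j\<in>T. c' i * c' j * g i j)"
    unfolding bil_def by (rule sum.mono_neutral_right) (use assms in \<open>auto simp: c'_def\<close>)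
  also have "\<dots> = (\<Sum>i\<in>S. \<Sum>j\<in>S. c' i * c' j * g i j)"
    by (rule sum.cong[OF refl], rule sum.mono_neutral_right) (use assms in \<open>auto simp: c'_def\<close>)
  also have "\<dots> = bil g S c c" unfolding bil_def by (auto simp: c'_def intro!: sum.cong)
  finally show "0 < bil g S c c" .
qed

lemma bil_Un:
  assumes "finite S" "finite T" "S \<inter> T = {}" "!!i j. i \<in> S ==> j \<in> T ==> g i j = 0 & g j i = 0"
  shows "bil g (S \<union> T) c d = bil g S c d + bil g T c d"
proof -
  have 1: "(\<Sum>j\<in>S \<union> T. c i * d j * g i j) = (\<Sum>j\<in>S. c i * d j * g i j)" if "i \<in> S" for i
    by (rule sum.mono_neutral_right) (use assms that in auto)
  have 2: "(\<Sum>j\<in>S \<union> T. c i * d j * g i j) = (\<Sum>j\<in>T. c i * d j * g i j)" if "i \<in> T" for i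
    by (rule sum.mono_neutral_right) (use assms that in auto)
  show ?thesis unfolding bil_def using assms by (simp add: sum.union_disjoint 1 2)
qed

lemma pd_Un:
  assumes "pd g S" "pd g T" "finite S" "finite T" "!!i j. i \<in> S ==> j \<in> T ==> g i j = 0 & g j i = 0"
    and "S \<inter> T = {}"
  shows "pd g (S \<union> T)"
  unfolding pd_def
proof (intro allI impI)
  fix c assume ex: "\<exists>i\<in>S \<union> T. c i ~= (0::real)"
  have nn: "0 <= bil g U c c" if "pd g U" for U
  proof (cases "\<exists>i\<in>U. c i ~= 0")
    case True thus ?thesis using that by (simp add: pd_def less_imp_le)
  next
    case False thus ?thesis by (simp add: bil_def)
  qed
  have "0 < bil g S c c \<or> 0 < bil g T c c" using ex assms(1,2) by (auto simp: pd_def)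
  thus "0 < bil g (S \<union> T) c c" using nn[OF assms(1)] nn[OF assms(2)]
    by (subst bil_Un) (use assms in auto)
qed

lemma bil_insert:
  assumes "finite T" "x ~: T" "!!i j. g i j = g j i"
  shows "bil g (insert x T) c c = c x * c x * g x x + 2 * c x * (\<Sum>j\<in>T. c j * g x j) + bil g T c c"
proof -
  have "(\<Sum>i\<in>T. c i * c x * g i x) = c x * (\<Sum>j\<in>T. c j * g x j)"
    using assms(3) by (simp add: sum_distrib_left mult_ac)
  moreover have "(\<Sum>j\<in>T. c x * c j * g x j) = c x * (\<Sum>j\<in>T. c j * g x j)"
    by (simp add: sum_distrib_left mult_ac)
  ultimately show ?thesis using assms(1,2) by (simp add: bil_def sum.distrib algebra_simps)
qed

text \<open>Labels of at least 5 need not be told apart: the bound 4/5 alone rules them out inside a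
  vertex diagram.\<close>

lemma cos_label:
  assumes "2 <= (m::nat)"
  shows "cos (pi/m) = 0 \<or> cos (pi/m) = 1/2 \<or> cos (pi/m) = rt \<or> (4/5 < cos (pi/m) & cos (pi/m) < 1)"
proof -
  consider "m = 2" | "m = 3" | "m = 4" | "5 <= m" using assms by linarith
  thus ?thesis
  proof cases
    case 4
    have p: "0 < pi / m" "pi / m <= pi / 5" using 4 by (auto simp: field_simps)
    have "pi / m <= pi" using p pi_gt_zero by linarith
    have "cos (pi/m) < cos 0" by (rule cos_monotone_0_pi) (use p \<open>pi/m <= pi\<close> in auto)
    moreover have "4/5 < cos (pi/5)"
    proof -
      have a: "cos (pi/5) > 0" by (rule cos_gt_zero) (use pi_gt_zero in \<open>auto simp: field_simps\<close>)
      define y where "y = cos (pi/5)"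
      have "cos (3 * (pi/5)) = - cos (2*(pi/5))"
      proof -
        have "3*(pi/5) = pi - 2*(pi/5)" by simp
        thus ?thesis by (simp only: cos_pi_minus)
      qed
      moreover have "cos (3*(pi/5)) = 4 * y^3 - 3 * y" using cos_treble_cos[of "pi/5"] by (simp add: y_def)
      moreover have "cos (2*(pi/5)) = 2 * y^2 - 1" by (simp only: cos_double_cos y_def)
      ultimately have "4*y^3 + 2*y^2 - 3*y - 1 = 0" by simp
      \<comment> \<open>The relation between the cosines of 2 pi / 5 and 3 pi / 5 is a cubic for y;
        its factor y + 1 is positive, which leaves the minimal polynomial of cos (pi / 5).\<close>
      hence "(y + 1) * (4*y^2 - 2*y - 1) = 0" by (simp add: algebra_simps power2_eq_square power3_eq_cube)
      hence q: "4*y^2 - 2*y - 1 = 0" using a y_def by auto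
      show ?thesis
      proof -
        \<comment> \<open>The quadratic takes the value -1/25 at 4/5, so splitting off the factor y
          - 4/5 leaves 1/25.\<close>
        have "(y - 4/5) * (4 * y + 6/5) = 1/25" using q by (simp add: algebra_simps power2_eq_square)
        hence "0 < (y - 4/5) * (4 * y + 6/5)" by simp
        hence "0 < y - 4/5" using a y_def by (simp add: zero_less_mult_iff)
        thus ?thesis by (simp add: y_def)
      qed
    qed
    moreover have "cos (pi/5) <= cos (pi/m)"
      by (rule cos_monotone_0_pi_le) (use p \<open>pi/m <= pi\<close> pi_gt_zero in auto)
    ultimately show ?thesis by auto
  qed (auto simp: cos_60 cos_45 rt_def)
qed

section \<open>Axioms for the facet diagram\<close>

text \<open>\<open>I\<close> is the set of facets, \<open>g\<close> their Gram matrix, and each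
  vertex in \<open>V\<close> is identified with the set of its n facets. \<open>null\<close>,
  \<open>pdp\<close>, \<open>psd\<close> and \<open>psd0\<close> describe the affine diagram of a
  vertex. \<open>ell\<close> and \<open>par\<close> go back from subdiagrams to vertices.
  \<open>lor\<close> is the reverse Cauchy-Schwarz inequality, the only trace of the Lorentzian
  signature. \<open>nbr\<close> gives the two ends of the edge that leaves the facet
  \<open>x\<close>.\<close>

locale ideal_diagram =
  fixes I :: "'f set" and g :: "'f => 'f => real" and V :: "'f set set" and n :: nat
  assumes finI: "finite I" and n9: "9 <= n"
    and gsym: "g i j = g j i"
    and diag: "i \<in> I ==> g i i = 1"
    and off: "i \<in> I ==> j \<in> I ==> i ~= j ==> (\<exists>m::nat. 2 <= m & g i j = - cos (pi / m)) \<or> g i j < -1"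
    and common: "i \<in> I ==> j \<in> I ==> i ~= j ==> -1 <= g i j ==> \<exists>A\<in>V. i \<in> A & j \<in> A"
    and meets: "A \<in> V ==> i \<in> A ==> j \<in> A ==> i ~= j ==> -1 < g i j"
    and V_sub: "A \<in> V ==> A \<subseteq> I" and V_card: "A \<in> V ==> card A = n" and V_ne: "V ~= {}"
    and null: "A \<in> V ==> \<exists>m. (\<forall>i\<in>A. 0 < m i) & (\<forall>i\<in>A. (\<Sum>j\<in>A. m j * g i j) = 0)"
    and pdp: "A \<in> V ==> T \<subset> A ==> pd g T"
    and psd: "A \<in> V ==> 0 <= bil g A c c"
    and psd0: "A \<in> V ==> bil g A c c = 0 ==> i \<in> A ==> (\<Sum>j\<in>A. c j * g i j) = 0"
    and ell: "T \<subseteq> I ==> pd g T ==> \<exists>A\<in>V. T \<subseteq> A"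
    and par: "T \<subseteq> I ==> T ~= {} ==> (!!i. i \<in> T ==> 0 < c i) ==> (!!i. i \<in> T ==> (\<Sum>j\<in>T. c j * g i j) = 0) ==> T \<in> V"
    and lor: "bil g I c c < 0 ==> bil g I c c * bil g I d d <= (bil g I c d)\<^sup>2"
    and nbr: "A \<in> V ==> x \<in> A ==> \<exists>y. y \<in> I - A & {A'\<in>V. A - {x} \<subseteq> A'} = {A, insert y (A - {x})}"
begin

section \<open>Counting edges: a vertex diagram is a tree or a cycle\<close>

abbreviation adj where "adj i j \<equiv> i ~= j & g i j ~= 0"
definition nb where "nb T i = {j\<in>T. adj i j}"
definition dg where "dg T i = card (nb T i)"
text \<open>The degree sum is twice the number of edges: on n connected nodes, 2 n - 2 means a tree
  and 2 n means one cycle. Trees and cycles are told apart by this number throughout.\<close>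

definition ed where "ed T = (\<Sum>i\<in>T. dg T i)"
definition conn where "conn T \<longleftrightarrow> (\<forall>U. U \<subset> T --> U ~= {} --> (\<exists>i\<in>U. \<exists>j\<in>T - U. g i j ~= 0))"

lemma V_fin: "A \<in> V ==> finite A" using V_sub finI finite_subset by blast
lemma fin_sub: "T \<subseteq> I ==> finite T" using finI finite_subset by blast

lemma g_cases:
  assumes "i \<in> I" "j \<in> I" "i ~= j"
  shows "g i j = 0 \<or> g i j = -1/2 \<or> g i j = -rt \<or> (g i j < -4/5 & -1 < g i j) \<or> g i j < -1"
  using off[OF assms] cos_label by fastforce

lemma g_le0: "i \<in> I ==> j \<in> I ==> i ~= j ==> g i j <= 0"
  using g_cases[of i j] rt_bounds by auto

lemma g_half: "i \<in> I ==> j \<in> I ==> adj i j ==> g i j <= -1/2"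
  using g_cases[of i j] rt_bounds by auto

lemma pdD: "pd g T ==> i \<in> T ==> c i ~= 0 ==> bil g T c c > 0" by (auto simp: pd_def)

lemma not_pd_V: assumes "A \<in> V" shows "~ pd g A"
proof
  assume "pd g A"
  obtain m where m: "\<forall>i\<in>A. 0 < m i" "\<forall>i\<in>A. (\<Sum>j\<in>A. m j * g i j) = 0" using null[OF assms] by blast
  have "A ~= {}" using V_card[OF assms] n9 by auto
  then obtain i where i: "i \<in> A" by blast
  hence "m i ~= 0" using m(1) by force
  from pdD[OF \<open>pd g A\<close> i, of m, OF this] have "0 < bil g A m m" .
  moreover have "bil g A m m = (\<Sum>i\<in>A. m i * (\<Sum>j\<in>A. m j * g i j))"
    by (simp add: bil_def sum_distrib_left mult_ac)
  ultimately show False using m(2) by simp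
qed

text \<open>An elliptic set lies in a vertex, and it is a proper part of it because the vertex has a
  null vector.\<close>

lemma pd_card: assumes "T \<subseteq> I" "pd g T" shows "card T < n"
proof -
  obtain A where A: "A \<in> V" "T \<subseteq> A" using ell[OF assms] by blast
  hence "T ~= A" using not_pd_V assms(2) by blast
  hence "T \<subset> A" using A by blast
  thus ?thesis using psubset_card_mono[OF V_fin[OF A(1)]] V_card[OF A(1)] by simp
qed

lemma small_pd: assumes "T \<subseteq> A" "A \<in> V" "card T < n" shows "pd g T"
proof -
  have "T ~= A" using assms V_card by auto
  thus ?thesis using pdp assms by blast
qed

lemma par_card: assumes "T \<subseteq> I" "T ~= {}" "!!i. i \<in> T ==> 0 < c i" "!!i. i \<in> T ==> (\<Sum>j\<in>T. c j * g i j) = 0"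
  shows "card T = n"
  using par[OF assms] V_card by blast

text \<open>Each ordered adjacent pair contributes at most -1/2 to the value of the form at the
  all-ones vector.\<close>

lemma bil_ones_le:
  assumes "T \<subseteq> I" shows "2 * bil g T (\<lambda>_. 1) (\<lambda>_. 1) <= 2 * real (card T) - real (ed T)"
proof -
  have fT: "finite T" using assms fin_sub by blast
  have row: "(\<Sum>j\<in>T. g i j) <= 1 - real (dg T i) / 2" if i: "i \<in> T" for i
  proof -
    have "(\<Sum>j\<in>T. g i j) = g i i + (\<Sum>j\<in>T-{i}. g i j)" using fT i by (simp add: sum.remove)
    also have "(\<Sum>j\<in>T-{i}. g i j) = (\<Sum>j\<in>nb T i. g i j)"
      by (rule sum.mono_neutral_right) (use fT i in \<open>auto simp: nb_def\<close>)
    also have "\<dots> <= (\<Sum>j\<in>nb T i. -1/2)"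
      by (rule sum_mono) (use i assms g_half in \<open>auto simp: nb_def\<close>)
    finally show ?thesis using diag i assms by (auto simp: dg_def)
  qed
  have "bil g T (\<lambda>_. 1) (\<lambda>_. 1) = (\<Sum>i\<in>T. \<Sum>j\<in>T. g i j)" by (simp add: bil_def)
  also have "\<dots> <= (\<Sum>i\<in>T. 1 - real (dg T i) / 2)" by (rule sum_mono) (rule row)
  finally show ?thesis by (simp add: ed_def sum_subtractf sum_divide_distrib[symmetric])
qed

lemma ed_pd: assumes "T \<subseteq> I" "pd g T" "T ~= {}" shows "ed T < 2 * card T"
proof -
  have "bil g T (\<lambda>_. 1) (\<lambda>_. 1) > 0" using assms by (auto simp: pd_def)
  thus ?thesis using bil_ones_le[OF assms(1)] by linarith
qed

lemma ed_V: assumes "A \<in> V" shows "ed A <= 2 * n"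
  using bil_ones_le[OF V_sub[OF assms]] psd[OF assms, of "\<lambda>_. 1"] V_card[OF assms] by linarith

lemma nb_insert: "i ~= x ==> nb (insert x T) i = (if g i x ~= 0 then insert x (nb T i) else nb T i)"
  by (auto simp: nb_def)
lemma nb_insert_self: "nb (insert x T) x = nb T x" by (auto simp: nb_def)
lemma finite_nb: "finite T ==> finite (nb T i)" by (simp add: nb_def)
lemma nbD: "j \<in> nb T i ==> j \<in> T & j ~= i & g i j ~= 0 & g j i ~= 0" by (auto simp: nb_def gsym)

lemma dg_insert: "finite T ==> x ~: T ==> i ~= x ==> dg (insert x T) i = dg T i + (if g i x ~= 0 then 1 else 0)"
  unfolding dg_def by (subst nb_insert) (auto simp: finite_nb nb_def)

lemma ed_insert: assumes "finite T" "x ~: T" shows "ed (insert x T) = ed T + 2 * dg T x"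
proof -
  have "(\<Sum>i\<in>T. if g i x ~= 0 then 1 else 0) = card {i\<in>T. g i x ~= 0}"
    using assms by (simp add: sum.If_cases Int_def)
  also have "{i\<in>T. g i x ~= 0} = nb T x" using assms by (auto simp: nb_def gsym[of x])
  finally have s: "(\<Sum>i\<in>T. if g i x ~= 0 then 1 else 0) = dg T x" by (simp add: dg_def)
  have "(\<Sum>i\<in>T. dg (insert x T) i) = (\<Sum>i\<in>T. dg T i + (if g i x ~= 0 then 1 else 0))"
    by (rule sum.cong[OF refl], rule dg_insert) (use assms in auto)
  moreover have "dg (insert x T) x = dg T x" by (simp add: dg_def nb_insert_self)
  ultimately show ?thesis using assms s by (simp add: ed_def sum.distrib)
qed

lemma ed_remove: assumes "finite T" "x \<in> T" shows "ed T = ed (T - {x}) + 2 * dg T x"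
proof -
  have "T = insert x (T - {x})" using assms by blast
  hence "ed T = ed (T - {x}) + 2 * dg (T - {x}) x" using ed_insert[of "T-{x}" x] assms by simp
  moreover have "nb (T - {x}) x = nb T x" by (auto simp: nb_def)
  ultimately show ?thesis by (simp add: dg_def)
qed

lemma ed_empty: "ed {} = 0" by (simp add: ed_def)
lemma ed_even: "finite T ==> even (ed T)"
  by (induction T rule: finite_induct) (auto simp: ed_insert ed_empty)

lemma ed_pd2: assumes "T \<subseteq> I" "pd g T" "T ~= {}" shows "ed T + 2 <= 2 * card T"
proof -
  obtain k where k: "ed T = 2 * k" using ed_even[OF fin_sub[OF assms(1)]] by (rule evenE)
  hence "k < card T" using ed_pd[OF assms] by simp
  thus ?thesis using k by simp
qed

text \<open>Subsets are grown one node at a time, and each new node brings at least one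
  edge.\<close>

lemma conn_ed: assumes "conn T" "finite T" "T ~= {}" shows "2 * card T <= ed T + 2"
proof -
  have "\<exists>U\<subseteq>T. card U = k & 2 * k <= ed U + 2" if "1 <= k" "k <= card T" for k
    using that
  proof (induction k rule: nat_induct_at_least)
    case base
    obtain x where "x \<in> T" using assms by blast
    thus ?case by (intro exI[of _ "{x}"]) auto
  next
    case (Suc k)
    then obtain U where U: "U \<subseteq> T" "card U = k" "2 * k <= ed U + 2" by auto
    have "U ~= {}" using U Suc.hyps by auto
    moreover have "U \<subset> T" using U Suc.prems by (metis Suc_n_not_le_n psubsetI)
    ultimately obtain i j where ij: "i \<in> U" "j \<in> T - U" "g i j ~= 0" using assms(1) unfolding conn_def by blast
    have fU: "finite U" using U assms finite_subset by blast
    have "i \<in> nb U j" using ij gsym[of j i] by (auto simp: nb_def)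
    hence "1 <= dg U j" using finite_nb[OF fU] unfolding dg_def by (metis One_nat_def Suc_leI card_gt_0_iff empty_iff)
    hence "2 * Suc k <= ed (insert j U) + 2" using ed_insert[OF fU, of j] ij U by auto
    thus ?case using U ij fU by (intro exI[of _ "insert j U"]) auto
  qed
  from this[of "card T"] obtain U where "U \<subseteq> T" "card U = card T" "2 * card T <= ed U + 2"
    using assms by (metis One_nat_def Suc_leI card_gt_0_iff order_refl)
  thus ?thesis using card_subset_eq assms by metis
qed

text \<open>An orthogonal splitting would have two proper, hence elliptic, parts; the whole would
  then be elliptic as well.\<close>

lemma conn_V: assumes "A \<in> V" shows "conn A"
  unfolding conn_def
proof (intro allI impI, rule ccontr)
  fix U assume U: "U \<subset> A" "U ~= {}" and no: "~ (\<exists>i\<in>U. \<exists>j\<in>A - U. g i j ~= 0)"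
  have "pd g (U \<union> (A - U))"
  proof (rule pd_Un)
    show "pd g U" "pd g (A - U)" using U pdp[OF assms] by (blast, metis Diff_subset U(1) U(2) double_diff Diff_eq_empty_iff pdp[OF assms] psubsetE psubsetI)
    show "finite U" "finite (A - U)" using U V_fin[OF assms] by (auto intro: finite_subset)
    show "g i j = 0 & g j i = 0" if "i \<in> U" "j \<in> A - U" for i j using no that gsym[of j i] by auto
  qed auto
  moreover have "U \<union> (A - U) = A" using U by blast
  ultimately show False using not_pd_V[OF assms] by simp
qed

text \<open>Connectedness gives at least n - 1 edges, semidefiniteness at the all-ones vector gives
  at most n.\<close>

lemma ed_V_cases: assumes "A \<in> V" shows "ed A = 2 * n - 2 \<or> ed A = 2 * n"
proof -
  have "A ~= {}" using V_card[OF assms] n9 by auto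
  hence "2 * n <= ed A + 2" using conn_ed[OF conn_V V_fin] assms V_card by metis
  moreover obtain k where k: "ed A = 2 * k" using ed_even[OF V_fin[OF assms]] by (rule evenE)
  ultimately have "n <= k + 1" "k <= n" using ed_V[OF assms] by simp_all
  hence "k = n \<or> k = n - 1" by linarith
  thus ?thesis using k by auto
qed

text \<open>With n edges the all-ones vector is isotropic, hence in the radical, and every row sums
  to zero. As nonzero entries are at most -1/2, degrees are at most 2; their sum makes them equal to
  2, with entries exactly -1/2.\<close>

lemma cycle_V:
  assumes "A \<in> V" "ed A = 2 * n"
  shows "i \<in> A ==> dg A i = 2" "i \<in> A ==> j \<in> A ==> adj i j ==> g i j = -1/2"
proof -
  have sub: "A \<subseteq> I" and fA: "finite A" and cA: "card A = n" using V_sub V_fin V_card assms by auto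
  have z: "bil g A (\<lambda>_. 1) (\<lambda>_. 1) = 0"
    using bil_ones_le[OF sub] psd[OF assms(1), of "\<lambda>_. 1"] cA assms(2) by simp
  have row0: "(\<Sum>j\<in>A. g i j) = 0" if "i \<in> A" for i using psd0[OF assms(1) z that] by simp
  have row: "(\<Sum>j\<in>A. g i j) = 1 + (\<Sum>j\<in>nb A i. g i j)" if i: "i \<in> A" for i
  proof -
    have "(\<Sum>j\<in>A. g i j) = g i i + (\<Sum>j\<in>A-{i}. g i j)" using fA i by (simp add: sum.remove)
    also have "(\<Sum>j\<in>A-{i}. g i j) = (\<Sum>j\<in>nb A i. g i j)"
      by (rule sum.mono_neutral_right) (use fA i in \<open>auto simp: nb_def\<close>)
    finally show ?thesis using diag i sub by auto
  qed
  have le: "real (dg A i) <= 2" if i: "i \<in> A" for i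
  proof -
    have "(\<Sum>j\<in>nb A i. g i j) <= (\<Sum>j\<in>nb A i. -1/2)"
      by (rule sum_mono) (use i sub g_half in \<open>auto simp: nb_def\<close>)
    thus ?thesis using row[OF i] row0[OF i] by (simp add: dg_def)
  qed
  have tot: "(\<Sum>i\<in>A. 2 - dg A i) = 0"
  proof -
    have "(\<Sum>i\<in>A. 2 - dg A i) + (\<Sum>i\<in>A. dg A i) = (\<Sum>i\<in>A. 2)"
      unfolding sum.distrib[symmetric] by (rule sum.cong) (use le in auto)
    thus ?thesis using assms(2) cA by (simp add: ed_def)
  qed
  have two: "dg A i = 2" if "i \<in> A" for i
    using tot that le[OF that] fA by (auto intro: le_antisym)
  show "i \<in> A ==> dg A i = 2" for i by (rule two)
  show "g i j = -1/2" if i: "i \<in> A" and j: "j \<in> A" and a: "adj i j" for i j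
  proof -
    have z: "(\<Sum>k\<in>nb A i. -1/2 - g i k) = 0"
      using row[OF i] row0[OF i] two[OF i] by (simp add: sum_subtractf dg_def)
    have nn: "0 <= -1/2 - g i k" if "k \<in> nb A i" for k
      using g_half[of i k] i sub nbD[OF that] by auto
    have jn: "j \<in> nb A i" using j a by (simp add: nb_def)
    have "-1/2 - g i j = 0"
      by (rule sum_nonneg_0[OF finite_nb[OF fA] nn z jn])
    thus ?thesis by linarith
  qed
qed

end

section \<open>Labels inside a vertex diagram\<close>

context ideal_diagram begin

text \<open>A test vector with a nonpositive value. The coefficients inserted later are mostly the
  marks of an affine diagram that is dominated.\<close>

lemma npd5:
  assumes "a \<in> I" "b \<in> I" "c \<in> I" "d \<in> I" "e \<in> I" "distinct [a,b,c,d,e]" "xa ~= 0"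
    and "xa*xa + xb*xb + xc*xc + xd*xd + xe*xe + 2 * (xa*xb*g a b + xa*xc*g a c + xa*xd*g a d + xa*xe*g a e
       + xb*xc*g b c + xb*xd*g b d + xb*xe*g b e + xc*xd*g c d + xc*xe*g c e + xd*xe*g d e) <= 0"
  shows "~ pd g {a,b,c,d,e}"
proof
  assume p: "pd g {a,b,c,d,e}"
  define f where "f = (\<lambda>_. 0)(a := xa, b := xb, c := xc, d := xd, e := xe)"
  have f: "f a = xa" "f b = xb" "f c = xc" "f d = xd" "f e = xe" using assms(6) by (auto simp: f_def)
  have "bil g {a,b,c,d,e} f f = xa*xa + xb*xb + xc*xc + xd*xd + xe*xe + 2 * (xa*xb*g a b + xa*xc*g a c + xa*xd*g a d + xa*xe*g a e
       + xb*xc*g b c + xb*xd*g b d + xb*xe*g b e + xc*xd*g c d + xc*xe*g c e + xd*xe*g d e)"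
    using assms(1-6) by (simp add: bil_def f diag gsym[of b a] gsym[of c a] gsym[of d a] gsym[of e a] gsym[of c b]
      gsym[of d b] gsym[of e b] gsym[of d c] gsym[of e c] gsym[of e d] algebra_simps)
  moreover have "bil g {a,b,c,d,e} f f > 0" by (rule pdD[OF p, of a]) (use f assms in auto)
  ultimately show False using assms(8) by linarith
qed

lemma npd4:
  assumes "a \<in> I" "b \<in> I" "c \<in> I" "d \<in> I" "distinct [a,b,c,d]" "xa ~= 0"
    and "xa*xa + xb*xb + xc*xc + xd*xd + 2 * (xa*xb*g a b + xa*xc*g a c + xa*xd*g a d
       + xb*xc*g b c + xb*xd*g b d + xc*xd*g c d) <= 0"
  shows "~ pd g {a,b,c,d}"
proof
  assume p: "pd g {a,b,c,d}"
  define f where "f = (\<lambda>_. 0)(a := xa, b := xb, c := xc, d := xd)"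
  have f: "f a = xa" "f b = xb" "f c = xc" "f d = xd" using assms(5) by (auto simp: f_def)
  have "bil g {a,b,c,d} f f = xa*xa + xb*xb + xc*xc + xd*xd + 2 * (xa*xb*g a b + xa*xc*g a c + xa*xd*g a d
       + xb*xc*g b c + xb*xd*g b d + xc*xd*g c d)"
    using assms(1-5) by (simp add: bil_def f diag gsym[of b a] gsym[of c a] gsym[of d a] gsym[of c b]
      gsym[of d b] gsym[of d c] algebra_simps)
  moreover have "bil g {a,b,c,d} f f > 0" by (rule pdD[OF p, of a]) (use f assms in auto)
  ultimately show False using assms(7) by linarith
qed

lemma npd3:
  assumes "a \<in> I" "b \<in> I" "c \<in> I" "distinct [a,b,c]" "xa ~= 0"
    and "xa*xa + xb*xb + xc*xc + 2 * (xa*xb*g a b + xa*xc*g a c + xb*xc*g b c) <= 0"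
  shows "~ pd g {a,b,c}"
proof
  assume p: "pd g {a,b,c}"
  define f where "f = (\<lambda>_. 0)(a := xa, b := xb, c := xc)"
  have f: "f a = xa" "f b = xb" "f c = xc" using assms(4) by (auto simp: f_def)
  have "bil g {a,b,c} f f = xa*xa + xb*xb + xc*xc + 2 * (xa*xb*g a b + xa*xc*g a c + xb*xc*g b c)"
    using assms(1-4) by (simp add: bil_def f diag gsym[of b a] gsym[of c a] gsym[of c b] algebra_simps)
  moreover have "bil g {a,b,c} f f > 0" by (rule pdD[OF p, of a]) (use f assms in auto)
  ultimately show False using assms(6) by linarith
qed

text \<open>The last two coefficients carry a factor \<open>rt\<close>, so that null vectors across
  a label 4 get integer entries and the condition is linear in products
  \<open>rt * g\<close>.\<close>

lemma npd5r:
  assumes "a \<in> I" "b \<in> I" "c \<in> I" "d \<in> I" "e \<in> I" "distinct [a,b,c,d,e]" "xa ~= 0"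
    and "xa*xa + xb*xb + xc*xc + p*p/2 + q*q/2 + 2 * (xa*xb*g a b + xa*xc*g a c + xb*xc*g b c
       + p*(xa*(rt*g a d) + xb*(rt*g b d) + xc*(rt*g c d)) + q*(xa*(rt*g a e) + xb*(rt*g b e) + xc*(rt*g c e)) + p*q/2*g d e) <= 0"
  shows "~ pd g {a,b,c,d,e}"
proof -
  have e: "p*rt*(p*rt) = p*p/2" "q*rt*(q*rt) = q*q/2" "p*rt*(q*rt) = p*q/2" using rt_sq by (simp_all add: algebra_simps rt_sq_left)
  show ?thesis
    by (rule npd5[OF assms(1-7), where xb=xb and xc=xc and xd="p*rt" and xe="q*rt"], unfold e)
       (use assms(8) in \<open>simp add: algebra_simps\<close>)
qed

lemma npd4r:
  assumes "a \<in> I" "b \<in> I" "c \<in> I" "d \<in> I" "distinct [a,b,c,d]" "xa ~= 0"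
    and "xa*xa + xb*xb + xc*xc + p*p/2 + 2 * (xa*xb*g a b + xa*xc*g a c + xb*xc*g b c
       + p*(xa*(rt*g a d) + xb*(rt*g b d) + xc*(rt*g c d))) <= 0"
  shows "~ pd g {a,b,c,d}"
proof -
  have e: "p*rt*(p*rt) = p*p/2" using rt_sq by (simp_all add: algebra_simps rt_sq_left)
  show ?thesis
    by (rule npd4[OF assms(1-6), where xb=xb and xc=xc and xd="p*rt"], unfold e)
       (use assms(7) in \<open>simp add: algebra_simps\<close>)
qed

lemma card_small: "card {a,b,c} < n" "card {a,b,c,d} < n" "card {a,b,c,d,e} < n" "card {a,b,c,d,e,f} < n"
proof -
  have "card (set [a,b,c,d,e,f]) <= length [a,b,c,d,e,f]" by (rule card_length)
  hence 6: "card {a,b,c,d,e,f} <= 6" by simp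
  have "card {a,b,c} <= card {a,b,c,d,e,f}" "card {a,b,c,d} <= card {a,b,c,d,e,f}" "card {a,b,c,d,e} <= card {a,b,c,d,e,f}"
    by (rule card_mono; auto)+
  thus "card {a,b,c} < n" "card {a,b,c,d} < n" "card {a,b,c,d,e} < n" "card {a,b,c,d,e,f} < n"
    using 6 n9 by linarith+
qed

lemma V_I: "A \<in> V ==> i \<in> A ==> i \<in> I" using V_sub by blast

lemma pd3: "A \<in> V ==> a \<in> A ==> b \<in> A ==> c \<in> A ==> pd g {a,b,c}"
  by (rule small_pd[of _ A]) (auto simp only: card_small insert_subset empty_subsetI)
lemma pd4: "A \<in> V ==> a \<in> A ==> b \<in> A ==> c \<in> A ==> d \<in> A ==> pd g {a,b,c,d}"
  by (rule small_pd[of _ A]) (auto simp only: card_small insert_subset empty_subsetI)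
lemma pd5: "A \<in> V ==> a \<in> A ==> b \<in> A ==> c \<in> A ==> d \<in> A ==> e \<in> A ==> pd g {a,b,c,d,e}"
  by (rule small_pd[of _ A]) (auto simp only: card_small insert_subset empty_subsetI)

text \<open>On a cycle of length 3 or 4 the all-ones vector has a nonpositive value, but so few
  nodes of a vertex are elliptic.\<close>

lemma no_tri:
  assumes "A \<in> V" "i \<in> A" "j \<in> A" "k \<in> A" "adj i j" "adj j k" "i ~= k" shows "g i k = 0"
proof (rule ccontr)
  assume "g i k ~= 0"
  have I: "i \<in> I" "j \<in> I" "k \<in> I" using assms V_I by auto
  have "g i j <= -1/2" "g j k <= -1/2" "g i k <= -1/2" using g_half I assms \<open>g i k ~= 0\<close> by auto
  hence "~ pd g {i,j,k}" by (intro npd3[where xa=1 and xb=1 and xc=1]) (use I assms in auto)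
  thus False using pd3 assms by blast
qed

lemma no_sq:
  assumes "A \<in> V" "i \<in> A" "j \<in> A" "k \<in> A" "l \<in> A" "adj i j" "adj j k" "adj k l" "i ~= k" "i ~= l" "j ~= l" shows "g i l = 0"
proof (rule ccontr)
  assume "g i l ~= 0"
  have I: "i \<in> I" "j \<in> I" "k \<in> I" "l \<in> I" using assms V_I by auto
  have "g i j <= -1/2" "g j k <= -1/2" "g k l <= -1/2" "g i l <= -1/2" "g i k <= 0" "g j l <= 0"
    using g_half g_le0 I assms \<open>g i l ~= 0\<close> by auto
  hence "~ pd g {i,j,k,l}" by (intro npd4[where xa=1 and xb=1 and xc=1 and xd=1]) (use I assms in auto)
  thus False using pd4 assms by blast
qed

lemma conn_step:
  assumes "A \<in> V" "U \<subseteq> A" "U ~= {}" "card U < n"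
  shows "\<exists>e\<in>A - U. \<exists>u\<in>U. adj u e & adj e u"
proof -
  have "U ~= A" using assms V_card by auto
  hence "\<exists>i\<in>U. \<exists>j\<in>A-U. g i j ~= 0" using conn_V[OF assms(1)] assms unfolding conn_def by blast
  thus ?thesis using gsym by (metis DiffD2)
qed

lemma conn_step3:
  assumes "A \<in> V" "a \<in> A" "b \<in> A" "c \<in> A"
  obtains e where "e \<in> A" "e ~= a" "e ~= b" "e ~= c" "adj a e \<or> adj b e \<or> adj c e"
proof -
  have "\<exists>e\<in>A - {a,b,c}. \<exists>u\<in>{a,b,c}. adj u e & adj e u" by (rule conn_step) (use assms card_small in \<open>auto simp only: insert_subset empty_subsetI insert_not_empty\<close>)
  thus thesis using that by blast
qed
lemma conn_step4:
  assumes "A \<in> V" "a \<in> A" "b \<in> A" "c \<in> A" "d \<in> A"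
  obtains e where "e \<in> A" "e ~= a" "e ~= b" "e ~= c" "e ~= d" "adj a e \<or> adj b e \<or> adj c e \<or> adj d e"
proof -
  have "\<exists>e\<in>A - {a,b,c,d}. \<exists>u\<in>{a,b,c,d}. adj u e & adj e u" by (rule conn_step) (use assms card_small in \<open>auto simp only: insert_subset empty_subsetI insert_not_empty\<close>)
  thus thesis using that by blast
qed

text \<open>The heavy edge has a further neighbour on each side. A fifth node at \<open>c\<close>
  gives a diagram dominating affine F4, with marks 1, 2, 3, 4 \<open>rt\<close>, 2
  \<open>rt\<close>; one at \<open>i\<close> dominates affine B3, with marks 1, 1, 2, 2
  \<open>rt\<close>.\<close>

lemma HL_aux:
  assumes A: "A \<in> V" and S: "c \<in> A" "i \<in> A" "j \<in> A" "d \<in> A" "e \<in> A" and ad: "adj c i" "adj j d" "c ~= j" "d ~= i" "c ~= d"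
    and ne: "e ~: {c,i,j,d}" and h: "g i j <= -rt" "i ~= j" and e: "adj c e \<or> adj i e"
  shows False
proof -
  have I: "c \<in> I" "i \<in> I" "j \<in> I" "d \<in> I" "e \<in> I" using A S V_I by auto
  have aij: "adj i j" using h rt_bounds by auto
  have le: "g c i <= -1/2" "g j d <= -1/2" using g_half I ad by auto
  from e show False
  proof
    assume ce: "adj c e"
    have "g c e <= -1/2" using g_half I ce by auto
    moreover have "g c j <= 0" "g c d <= 0" "g i d <= 0" "g i e <= 0" "g j e <= 0" "g d e <= 0" using g_le0 I ne ad h by auto
    moreover have "rt * g i j <= -1/2" using mult_left_mono[OF h(1), of rt] rt_sq rt_bounds by simp
    moreover have "rt * g c j <= 0" "rt * g c d <= 0" "rt * g i d <= 0" "rt * g j e <= 0" "rt * g d e <= 0"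
      using calculation rt_bounds by (auto simp: mult_le_0_iff)
    ultimately have "~ pd g {e,c,i,j,d}"
      apply (intro npd5r[where xa=1 and xb=2 and xc=3 and p=4 and q=2])
      using I ad ne h le by (auto simp: gsym[of e])
    thus False using pd5[OF A, of e c i j d] A S  by auto
  next
    assume ie: "adj i e"
    have "g i e <= -1/2" using g_half I ie by auto
    moreover have "g c j <= 0" "g c e <= 0" "g j e <= 0" using g_le0 I ne ad h by auto
    moreover have "rt * g i j <= -1/2" using mult_left_mono[OF h(1), of rt] rt_sq rt_bounds by simp
    moreover have "rt * g c j <= 0" "rt * g j e <= 0"
      using calculation rt_bounds by (auto simp: mult_le_0_iff)
    ultimately have "~ pd g {e,c,i,j}"
      apply (intro npd4r[where xa=1 and xb=1 and xc=2 and p=2])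
      using I ad ne h le by (auto simp: gsym[of e])
    thus False using pd4[OF A, of e c i j] A S  by auto
  qed
qed

text \<open>A heavy edge with neighbours on both sides occurs in elliptic F4. A vertex has more than
  four nodes and is connected, so a fifth node attaches, and by symmetry it attaches on the side of
  \<open>i\<close>.\<close>

lemma heavy_leaf:
  assumes A: "A \<in> V" and S: "i \<in> A" "j \<in> A" "i ~= j" and h: "g i j < -1/2"
  shows "nb A i = {j} \<or> nb A j = {i}"
proof (rule ccontr)
  assume no: "~ (nb A i = {j} \<or> nb A j = {i})"
  have I: "i \<in> I" "j \<in> I" using A S V_I by auto
  have hr: "g i j <= -rt" using g_cases[OF I S(3)] h rt_bounds meets[OF A S] by auto
  have "j \<in> nb A i" "i \<in> nb A j" using S h gsym[of j i] by (auto simp: nb_def)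
  then obtain c d where cd: "c \<in> nb A i" "c ~= j" "d \<in> nb A j" "d ~= i" using no by blast
  have c: "c \<in> A" "adj c i" "adj i c" and d: "d \<in> A" "adj j d" "adj d j" using cd nbD by blast+
  have aij: "adj i j" "adj j i" using S h gsym[of j i] by auto
  have "c ~= d" using no_tri[OF A c(1) S(1,2)] c aij cd(2) d by auto
  obtain e where e: "e \<in> A" "e ~= c" "e ~= i" "e ~= j" "e ~= d" "adj c e \<or> adj i e \<or> adj j e \<or> adj d e"
    by (rule conn_step4[OF A c(1) S(1,2) d(1)])
  thus False
    using HL_aux[OF A c(1) S(1,2) d(1), of e] HL_aux[OF A d(1) S(2,1) c(1), of e]
      c d cd \<open>c ~= d\<close> e hr S gsym[of j i] by auto
qed

text \<open>Connected elliptic diagrams with an edge of label at least 5 and more than two nodes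
  stop at four nodes, as H3 and H4 do; so it suffices to grow the connected diagram to five
  nodes.\<close>

lemma heavy_value_aux:
  assumes A: "A \<in> V" and S: "i \<in> A" "j \<in> A" "i ~= j" and h: "g i j < -4/5" and leaf: "nb A i = {j}"
  shows False
proof -
  have inb: "x = j" if "x \<in> A" "adj i x" for x using that leaf by (auto simp: nb_def)
  have I: "i \<in> I" "j \<in> I" using A S V_I by auto
  have aij: "adj i j" "adj j i" using S h gsym[of j i] by auto
  obtain c where c: "c \<in> A" "c ~= i" "c ~= j" "adj i c \<or> adj j c"
    using conn_step3[OF A S(1,2,2)] by metis
  have jc: "adj j c" "adj c j" using c inb[of c] gsym[of j c] by auto
  have cA: "c \<in> A" "c \<in> I" using c A V_I by auto
  have gic: "g i c = 0" using inb[of c] c by auto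
  have two: False if d: "d \<in> A" "d ~: {i,j,c}" "adj j d" for d
  proof -
    have dI: "d \<in> I" using d A V_I by auto
    have "g j c <= -1/2" "g j d <= -1/2" "g c d <= 0" "g i d <= 0" using g_half g_le0 I cA dI jc d by auto
    \<comment> \<open>With coefficient 1 at \<open>j\<close>, the coefficient 4/5 at
      \<open>i\<close> is the minimiser allowed by the bound -4/5 on \<open>g i j\<close>; the two
      prongs at \<open>j\<close> get 1/2 each.\<close>
    hence "~ pd g {i,j,c,d}"
      apply (intro npd4[where xa="4/5" and xb=1 and xc="1/2" and xd="1/2"])
      using I cA dI d c S h gic by auto
    thus False using pd4[OF A, of i j c d] A S  cA d by auto
  qed
  obtain d where d: "d \<in> A" "d ~= i" "d ~= j" "d ~= c" "adj i d \<or> adj j d \<or> adj c d"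
    by (rule conn_step3[OF A S(1,2) cA(1)])
  have cd: "adj c d" using d inb[of d] two[of d] by auto
  have dA: "d \<in> A" "d \<in> I" using d A V_I by auto
  obtain e where e: "e \<in> A" "e ~= i" "e ~= j" "e ~= c" "e ~= d" "adj i e \<or> adj j e \<or> adj c e \<or> adj d e"
    by (rule conn_step4[OF A S(1,2) cA(1) dA(1)])
  have eA: "e \<in> A" "e \<in> I" using e A V_I by auto
  have z: "g i d <= 0" "g i e <= 0" "g j d <= 0" "g j e <= 0" "g c d <= -1/2" "g j c <= -1/2" "g c e <= 0" "g d e <= 0"
    using g_le0 g_half I cA dA eA jc cd d e by auto
  have "adj c e \<or> adj d e" using e inb[of e] two[of e] by auto
  hence "~ pd g {i,j,c,d,e}"
  proof
    assume "adj c e"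
    hence "g c e <= -1/2" using g_half cA eA by auto
    thus ?thesis
      apply (intro npd5[where xa="4/5" and xb=1 and xc=1 and xd="1/2" and xe="1/2"])
      using I cA dA eA c d e S h gic z by auto
  next
    assume "adj d e"
    hence "g d e <= -1/2" using g_half dA eA by auto
    thus ?thesis
      apply (intro npd5[where xa="4/5" and xb=1 and xc="3/4" and xd="1/2" and xe="1/4"])
      using I cA dA eA c d e S h gic z by auto
  qed
  thus False using pd5[OF A, of i j c d e] A S  cA dA eA by auto
qed

lemma heavy_value:
  assumes A: "A \<in> V" and S: "i \<in> A" "j \<in> A" "i ~= j"
  shows "g i j = 0 \<or> g i j = -1/2 \<or> g i j = -rt"
proof (rule ccontr)
  assume no: "~ ?thesis"
  have I: "i \<in> I" "j \<in> I" using A S V_I by auto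
  have h: "g i j < -4/5" using g_cases[OF I S(3)] no meets[OF A S] by auto
  show False using heavy_leaf[OF A S] h heavy_value_aux[OF A S h] heavy_value_aux[OF A S(2,1)] S gsym[of j i] by auto
qed

text \<open>An entry of at least -1 puts both facets at a common vertex, where the labels are known.
  In particular the value -1, of parallel facets, does not occur.\<close>

lemma g_vals:
  assumes "i \<in> I" "j \<in> I" "i ~= j"
  shows "g i j = 0 \<or> g i j = -1/2 \<or> g i j = -rt \<or> g i j < -1"
proof (cases "g i j < -1")
  case False
  then obtain A where "A \<in> V" "i \<in> A" "j \<in> A" using common[OF assms] by force
  thus ?thesis using heavy_value[of A i j] assms by blast
qed simp

end

section \<open>Small affine and elliptic diagrams, cycles and components\<close>

context ideal_diagram begin

lemma rt_sq2: "2 * rt * rt = 1" using rt_sq by simp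

lemma g_ne: "i \<in> I ==> g i j ~= 1 ==> i ~= j" using diag by auto

text \<open>A positive null vector would make these few nodes a vertex. Unlike the test vectors
  above, this applies to facets that are not known to share a vertex.\<close>

lemma parab3:
  assumes "a \<in> I" "b \<in> I" "c \<in> I" "distinct [a,b,c]" "xa > 0" "xb > 0" "xc > 0"
    "xa + xb * g a b + xc * g a c = 0" "xa * g a b + xb + xc * g b c = 0" "xa * g a c + xb * g b c + xc = 0"
  shows False
proof -
  define f where "f = (\<lambda>_. 0)(a := xa, b := xb, c := xc)"
  have f: "f a = xa" "f b = xb" "f c = xc" using assms(4) by (auto simp: f_def)
  have "card {a,b,c} = n"
    by (rule par_card[of _ f]) (use assms in \<open>auto simp: f diag gsym[of b a] gsym[of c a] gsym[of c b] algebra_simps\<close>)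
  thus False using card_small(1)[of a b c] by simp
qed

lemma parab4:
  assumes "a \<in> I" "b \<in> I" "c \<in> I" "d \<in> I" "distinct [a,b,c,d]" "xa > 0" "xb > 0" "xc > 0" "xd > 0"
    "xa + xb * g a b + xc * g a c + xd * g a d = 0" "xa * g a b + xb + xc * g b c + xd * g b d = 0"
    "xa * g a c + xb * g b c + xc + xd * g c d = 0" "xa * g a d + xb * g b d + xc * g c d + xd = 0"
  shows False
proof -
  define f where "f = (\<lambda>_. 0)(a := xa, b := xb, c := xc, d := xd)"
  have f: "f a = xa" "f b = xb" "f c = xc" "f d = xd" using assms(5) by (auto simp: f_def)
  have "card {a,b,c,d} = n"
    by (rule par_card[of _ f]) (use assms in \<open>auto simp: f diag gsym[of b a] gsym[of c a] gsym[of d a] gsym[of c b]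
      gsym[of d b] gsym[of d c] algebra_simps\<close>)
  thus False using card_small(2)[of a b c d] by simp
qed

lemma parab5:
  assumes "a \<in> I" "b \<in> I" "c \<in> I" "d \<in> I" "e \<in> I" "distinct [a,b,c,d,e]" "xa > 0" "xb > 0" "xc > 0" "xd > 0" "xe > 0"
    "xa + xb * g a b + xc * g a c + xd * g a d + xe * g a e = 0" "xa * g a b + xb + xc * g b c + xd * g b d + xe * g b e = 0"
    "xa * g a c + xb * g b c + xc + xd * g c d + xe * g c e = 0" "xa * g a d + xb * g b d + xc * g c d + xd + xe * g d e = 0"
    "xa * g a e + xb * g b e + xc * g c e + xd * g d e + xe = 0"
  shows False
proof -
  define f where "f = (\<lambda>_. 0)(a := xa, b := xb, c := xc, d := xd, e := xe)"
  have f: "f a = xa" "f b = xb" "f c = xc" "f d = xd" "f e = xe" using assms(6) by (auto simp: f_def)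
  have "card {a,b,c,d,e} = n"
    by (rule par_card[of _ f]) (use assms in \<open>auto simp: f diag gsym[of b a] gsym[of c a] gsym[of d a] gsym[of e a] gsym[of c b]
      gsym[of d b] gsym[of e b] gsym[of d c] gsym[of e c] gsym[of e d] algebra_simps\<close>)
  thus False using card_small(3)[of a b c d e] by simp
qed

lemma parab6:
  assumes "a \<in> I" "b \<in> I" "c \<in> I" "d \<in> I" "e \<in> I" "h \<in> I" "distinct [a,b,c,d,e,h]" "xa > 0" "xb > 0" "xc > 0" "xd > 0" "xe > 0" "xh > 0"
    "xa + xb * g a b + xc * g a c + xd * g a d + xe * g a e + xh * g a h = 0"
    "xa * g a b + xb + xc * g b c + xd * g b d + xe * g b e + xh * g b h = 0"
    "xa * g a c + xb * g b c + xc + xd * g c d + xe * g c e + xh * g c h = 0"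
    "xa * g a d + xb * g b d + xc * g c d + xd + xe * g d e + xh * g d h = 0"
    "xa * g a e + xb * g b e + xc * g c e + xd * g d e + xe + xh * g e h = 0"
    "xa * g a h + xb * g b h + xc * g c h + xd * g d h + xe * g e h + xh = 0"
  shows False
proof -
  define f where "f = (\<lambda>_. 0)(a := xa, b := xb, c := xc, d := xd, e := xe, h := xh)"
  have f: "f a = xa" "f b = xb" "f c = xc" "f d = xd" "f e = xe" "f h = xh" using assms(7) by (auto simp: f_def)
  have "card {a,b,c,d,e,h} = n"
    by (rule par_card[of _ f]) (use assms in \<open>auto simp: f diag gsym[of b a] gsym[of c a] gsym[of d a] gsym[of e a] gsym[of c b]
      gsym[of d b] gsym[of e b] gsym[of d c] gsym[of e c] gsym[of e d] gsym[of h a] gsym[of h b] gsym[of h c] gsym[of h d] gsym[of h e] algebra_simps\<close>)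
  thus False using card_small(4)[of a b c d e h] by simp
qed

text \<open>This and the next names are affine types, and the coefficients are their positive null
  vectors; a factor \<open>rt\<close> stands on one side of each label 4.\<close>

lemma C2: assumes "a \<in> I" "b \<in> I" "c \<in> I" "g a b = -rt" "g b c = -rt" "g a c = 0" shows False
  by (rule parab3[of a b c 1 "2*rt" 1]) (use assms rt_bounds g_ne[of a b] g_ne[of b c] g_ne[of a c] in \<open>auto simp: rt_sq rt_sq_left rt_sq2\<close>)

lemma C3: assumes "a \<in> I" "b \<in> I" "c \<in> I" "d \<in> I" "g a b = -rt" "g b c = -1/2" "g c d = -rt" "g a c = 0" "g a d = 0" "g b d = 0" shows False
  by (rule parab4[of a b c d 1 "2*rt" "2*rt" 1]) (use assms rt_bounds g_ne[of a b] g_ne[of b c] g_ne[of a c] g_ne[of a d] g_ne[of b d] g_ne[of c d] in \<open>auto simp: rt_sq rt_sq_left rt_sq2\<close>)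

lemma B3: assumes "p \<in> I" "q \<in> I" "c \<in> I" "s \<in> I" "g p c = -1/2" "g q c = -1/2" "g c s = -rt" "p ~= q" "g p q = 0" "g p s = 0" "g q s = 0" shows False
  by (rule parab4[of p q c s 1 1 2 "2*rt"]) (use assms rt_bounds g_ne[of p c] g_ne[of q c] g_ne[of p s] g_ne[of q s] g_ne[of c s] in \<open>auto simp: rt_sq rt_sq_left rt_sq2\<close>)

lemma B4: assumes "p \<in> I" "q \<in> I" "c \<in> I" "d \<in> I" "s \<in> I" "g p c = -1/2" "g q c = -1/2" "g c d = -1/2" "g d s = -rt" "p ~= q"
    "g p q = 0" "g p d = 0" "g p s = 0" "g q d = 0" "g q s = 0" "g c s = 0" shows False
  by (rule parab5[of p q c d s 1 1 2 2 "2*rt"]) (use assms rt_bounds g_ne[of p c] g_ne[of q c] g_ne[of p s] g_ne[of q s] g_ne[of c s] g_ne[of p d] g_ne[of q d] g_ne[of c d] g_ne[of d s] in \<open>auto simp: rt_sq rt_sq_left rt_sq2\<close>)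

lemma B5: assumes "p \<in> I" "q \<in> I" "c \<in> I" "d \<in> I" "e \<in> I" "s \<in> I" "g p c = -1/2" "g q c = -1/2" "g c d = -1/2" "g d e = -1/2" "g e s = -rt" "p ~= q"
    "g p q = 0" "g p d = 0" "g p e = 0" "g p s = 0" "g q d = 0" "g q e = 0" "g q s = 0" "g c e = 0" "g c s = 0" "g d s = 0" shows False
  by (rule parab6[of p q c d e s 1 1 2 2 2 "2*rt"]) (use assms rt_bounds g_ne[of p c] g_ne[of q c] g_ne[of p s] g_ne[of q s] g_ne[of c s] g_ne[of p d] g_ne[of q d] g_ne[of c d] g_ne[of d s]
    g_ne[of p e] g_ne[of q e] g_ne[of c e] g_ne[of d e] g_ne[of e s] in \<open>auto simp: rt_sq rt_sq_left rt_sq2\<close>)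

lemma F4: assumes "y \<in> I" "a \<in> I" "b \<in> I" "z \<in> I" "t \<in> I" "g y a = -1/2" "g a b = -rt" "g b z = -1/2" "g z t = -1/2"
    "g y b = 0" "g y z = 0" "g y t = 0" "g a z = 0" "g a t = 0" "g b t = 0" shows False
  by (rule parab5[of y a b z t "2*rt" "4*rt" 3 2 1]) (use assms rt_bounds g_ne[of y a] g_ne[of y b] g_ne[of y z] g_ne[of y t] g_ne[of a b] g_ne[of a z] g_ne[of a t]
     g_ne[of b z] g_ne[of b t] g_ne[of z t] in \<open>auto simp: rt_sq rt_sq_left rt_sq2\<close>)

lemma pd2: assumes "a \<in> I" "b \<in> I" "a ~= b" "-1 < g a b" shows "pd g {a,b}"
  unfolding pd_def
proof (intro allI impI)
  fix f assume ne: "\<exists>i\<in>{a,b}. f i ~= (0::real)"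
  have e: "bil g {a,b} f f = f a * f a + f b * f b + 2 * (f a * f b) * g a b"
    using assms by (simp add: bil_def diag gsym[of b a] algebra_simps)
  have le: "g a b <= 0" using g_le0 assms by auto
  show "0 < bil g {a,b} f f"
  proof (cases "f a * f b > 0")
    case True
    have "f a * f a + f b * f b - 2 * (f a * f b) \<ge> 0" using sum_squares_bound[of "f a" "f b"] by (simp add: power2_eq_square)
    moreover have "2 * (f a * f b) * (1 + g a b) > 0" using True assms(4) by simp
    ultimately show ?thesis unfolding e by (simp add: algebra_simps)
  next
    case False
    hence "0 <= 2 * (f a * f b) * g a b" using le by (simp add: mult_nonpos_nonpos)
    moreover have "f a * f a + f b * f b > 0" using ne by (auto simp: sum_squares_gt_zero_iff)
    ultimately show ?thesis unfolding e by linarith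
  qed
qed

text \<open>Elliptic B3 by completing squares; elliptic F4 is treated in the same way below. These
  are the sets that will be exchanged for smaller ones.\<close>

lemma pdB3: assumes "a \<in> I" "b \<in> I" "c \<in> I" "g a b = -rt" "g b c = -1/2" "g a c = 0" shows "pd g {a,b,c}"
  unfolding pd_def
proof (intro allI impI)
  fix f assume ne: "\<exists>i\<in>{a,b,c}. f i ~= (0::real)"
  have d: "a ~= b" "b ~= c" "a ~= c" using assms g_ne[of a b] g_ne[of b c] g_ne[of a c] rt_bounds by auto
  have e: "bil g {a,b,c} f f = (f a - rt * f b)\<^sup>2 + (f b - f c)\<^sup>2 / 2 + (f c)\<^sup>2 / 2"
    using assms d by (simp add: bil_def diag gsym[of b a] gsym[of c a] gsym[of c b] power2_eq_square field_simps rt_sq rt_sq_left)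

  have "bil g {a,b,c} f f ~= 0"
  proof
    assume "bil g {a,b,c} f f = 0"
    hence "(f a - rt * f b)\<^sup>2 = 0 & (f b - f c)\<^sup>2 = 0 & (f c)\<^sup>2 = 0" unfolding e
      using zero_le_power2[of "f a - rt * f b"] zero_le_power2[of "f b - f c"] zero_le_power2[of "f c"] by linarith
    thus False using ne by auto
  qed
  moreover have "0 <= bil g {a,b,c} f f" unfolding e by simp
  ultimately show "0 < bil g {a,b,c} f f" by linarith
qed

lemma pdF4: assumes "a \<in> I" "b \<in> I" "c \<in> I" "d \<in> I" "g a b = -1/2" "g b c = -rt" "g c d = -1/2" "g a c = 0" "g a d = 0" "g b d = 0" shows "pd g {a,b,c,d}"
  unfolding pd_def
proof (intro allI impI)
  fix f assume ne: "\<exists>i\<in>{a,b,c,d}. f i ~= (0::real)"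
  have dd: "a ~= b" "b ~= c" "a ~= c" "a ~= d" "b ~= d" "c ~= d" using assms g_ne[of a b] g_ne[of b c] g_ne[of a c] g_ne[of a d] g_ne[of b d] g_ne[of c d] rt_bounds by auto
  have e: "bil g {a,b,c,d} f f = (f a - f b / 2)\<^sup>2 + (f d - f c / 2)\<^sup>2 + 3/4 * (f b - 4/3 * (rt * f c))\<^sup>2 + (f c)\<^sup>2 / 12"
    using assms dd by (simp add: bil_def diag gsym[of b a] gsym[of c a] gsym[of c b] gsym[of d a] gsym[of d b] gsym[of d c] power2_eq_square algebra_simps rt_sq rt_sq_left)
  have "bil g {a,b,c,d} f f ~= 0"
  proof
    assume "bil g {a,b,c,d} f f = 0"
    hence "(f a - f b / 2)\<^sup>2 = 0 & (f d - f c / 2)\<^sup>2 = 0 & (f b - 4/3 * (rt * f c))\<^sup>2 = 0 & (f c)\<^sup>2 = 0" unfolding e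
      using zero_le_power2[of "f a - f b / 2"] zero_le_power2[of "f d - f c / 2"] zero_le_power2[of "f b - 4/3 * (rt * f c)"] zero_le_power2[of "f c"] by linarith
    thus False using ne by auto
  qed
  moreover have "0 <= bil g {a,b,c,d} f f" unfolding e by simp
  ultimately show "0 < bil g {a,b,c,d} f f" by linarith
qed

lemma cycle_in_V:
  assumes "W \<subseteq> I" "W ~= {}" "!!i. i \<in> W ==> dg W i = 2" "!!i j. i \<in> W ==> j \<in> W ==> adj i j ==> g i j = -1/2"
  shows "W \<in> V"
proof (rule par[of W "\<lambda>_. 1"])
  fix i assume i: "i \<in> W"
  have fW: "finite W" using assms fin_sub by blast
  have "(\<Sum>j\<in>W. g i j) = g i i + (\<Sum>j\<in>W-{i}. g i j)" using fW i by (simp add: sum.remove)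
  also have "(\<Sum>j\<in>W-{i}. g i j) = (\<Sum>j\<in>nb W i. g i j)"
    by (rule sum.mono_neutral_right) (use fW i in \<open>auto simp: nb_def\<close>)
  also have "\<dots> = (\<Sum>j\<in>nb W i. -1/2)" by (rule sum.cong) (use i assms(4) in \<open>auto simp: nb_def\<close>)
  finally show "(\<Sum>j\<in>W. 1 * g i j) = 0" using diag i assms(1) assms(3)[OF i] by (auto simp: dg_def)
qed (use assms in auto)

text \<open>A nonempty subset of least size with at least as many edges as nodes. If it has e edges
  in excess, minimality makes every degree at least e + 2; summing the degrees over at least three
  nodes forces e = 0, and then all degrees are 2.\<close>

lemma min_cycle:
  assumes "T \<subseteq> I" "T ~= {}" "2 * card T <= ed T"
  obtains W where "W \<subseteq> T" "W ~= {}" "!!i. i \<in> W ==> dg W i = 2" "2 * card W <= ed W"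
proof -
  define P where "P = (\<lambda>W. W \<subseteq> T & W ~= {} & 2 * card W <= ed W)"
  have "P T" using assms by (simp add: P_def)
  then obtain W where W: "P W" "!!U. P U ==> card W <= card U" using ex_has_least_nat[of P T card] by blast
  have fW: "finite W" using W(1) assms(1) fin_sub unfolding P_def by blast
  have lower: "ed W + 2 < 2 * card W + 2 * dg W i" if i: "i \<in> W" for i
  proof (cases "W = {i}")
    case True
    have "nb {i} i = {}" by (auto simp: nb_def)
    thus ?thesis using W(1) True by (simp add: P_def ed_def dg_def)
  next
    case False
    hence "~ P (W - {i})" using W(2)[of "W-{i}"] fW i by (metis card_Diff1_less linorder_not_le)
    hence "ed (W - {i}) < 2 * card (W - {i})" using W(1) False i unfolding P_def by (metis Diff_eq_empty_iff Diff_subset insert_Diff le_neq_implies_less linorder_not_less order_trans subset_singletonD)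
    moreover have "card (W - {i}) = card W - 1" using i fW by simp
    moreover have "card W \<ge> 1" using i fW by (metis One_nat_def Suc_leI card_gt_0_iff empty_iff)
    ultimately show ?thesis using ed_remove[OF fW i] by linarith
  qed
  obtain e where e: "ed W = 2 * card W + 2 * e"
  proof -
    obtain k where k: "ed W = 2 * k" using ed_even[OF fW] by (rule evenE)
    have "card W <= k" using W(1) k by (simp add: P_def)
    hence "ed W = 2 * card W + 2 * (k - card W)" using k by simp
    thus thesis using that by blast
  qed
  have d: "e + 2 <= dg W i" if "i \<in> W" for i using lower[OF that] e by linarith
  have "(\<Sum>i\<in>W. e + 2) <= (\<Sum>i\<in>W. dg W i)" by (rule sum_mono) (rule d)
  hence le: "card W * (e + 2) <= 2 * card W + 2 * e" using e by (simp add: ed_def)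
  hence "card W * e <= 2 * e" by (simp add: algebra_simps)
  moreover have "3 <= card W"
  proof (rule ccontr)
    assume "~ 3 <= card W"
    obtain i where i: "i \<in> W" using W(1) P_def by auto
    have "nb W i \<subseteq> W - {i}" by (auto simp: nb_def)
    hence "dg W i <= card W - 1" using i fW unfolding dg_def by (metis card_Diff_singleton card_mono finite_Diff)
    thus False using d[OF i] \<open>~ 3 <= card W\<close> by linarith
  qed
  ultimately have "e = 0" by (metis le_zero_eq mult.commute mult_le_cancel2 not_gr_zero numeral_le_iff order_trans semiring_norm(69) linorder_not_less numeral_2_eq_2 numeral_3_eq_3 Suc_n_not_le_n)
  have two: "dg W i = 2" if i: "i \<in> W" for i
  proof (rule ccontr)
    assume "dg W i ~= 2"
    have d2: "2 <= dg W j" if "j \<in> W" for j using d[OF that] \<open>e = 0\<close> by linarith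
    have "(\<Sum>i\<in>W. 2) < (\<Sum>i\<in>W. dg W i)"
      by (intro sum_strict_mono_ex1) (use fW d2 \<open>dg W i ~= 2\<close> i in \<open>auto simp: order.strict_iff_order\<close>)
    thus False using e \<open>e = 0\<close> by (simp add: ed_def)
  qed
  show thesis by (rule that[of W]) (use W(1) two in \<open>auto simp: P_def\<close>)
qed

text \<open>The connected component of \<open>k\<close> in the diagram on \<open>U\<close>.\<close>

definition rch where "rch U k = {j. (k, j) \<in> {(a,b). a \<in> U & b \<in> U & g a b ~= 0}\<^sup>*}"

lemma rch_self: "k \<in> rch U k" by (simp add: rch_def)
lemma rch_sub: assumes "k \<in> U" shows "rch U k \<subseteq> U"
proof
  fix j assume "j \<in> rch U k"
  hence "(k, j) \<in> {(a,b). a \<in> U & b \<in> U & g a b ~= 0}\<^sup>*" by (simp add: rch_def)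
  thus "j \<in> U" by (induction rule: rtrancl_induct) (use assms in auto)
qed
lemma rch_closed: assumes "k \<in> U" "i \<in> rch U k" "j \<in> U" "g i j ~= 0" shows "j \<in> rch U k"
proof -
  have "i \<in> U" using rch_sub assms by blast
  hence "(i, j) \<in> {(a,b). a \<in> U & b \<in> U & g a b ~= 0}" using assms by auto
  thus ?thesis using assms(2) unfolding rch_def by (auto intro: rtrancl_into_rtrancl)
qed
lemma rch_least: assumes "k \<in> C" "!!i j. i \<in> C ==> j \<in> U ==> g i j ~= 0 ==> j \<in> C" shows "rch U k \<subseteq> C"
proof
  fix j assume "j \<in> rch U k"
  hence "(k, j) \<in> {(a,b). a \<in> U & b \<in> U & g a b ~= 0}\<^sup>*" by (simp add: rch_def)
  thus "j \<in> C" by (induction rule: rtrancl_induct) (use assms in auto)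
qed
lemma rch_sep: assumes "k \<in> U" "i \<in> rch U k" "j \<in> U" "j ~: rch U k" shows "g i j = 0" "g j i = 0"
  using rch_closed[OF assms(1,2,3)] assms gsym[of j i] by auto

lemma rch_conn: assumes "k \<in> U" shows "conn (rch U k)"
  unfolding conn_def
proof (intro allI impI)
  fix X assume X: "X \<subset> rch U k" "X ~= {}"
  have key: "\<exists>i\<in>Y. \<exists>j\<in>rch U k - Y. g i j ~= 0" if Y: "Y \<subset> rch U k" "k \<in> Y" for Y
  proof (rule ccontr)
    assume no: "~ ?thesis"
    have "rch U k \<subseteq> Y"
    proof (rule rch_least[OF Y(2)])
      fix i j assume "i \<in> Y" "j \<in> U" "g i j ~= 0"
      moreover hence "j \<in> rch U k" using rch_closed[OF assms] Y by blast
      ultimately show "j \<in> Y" using no by blast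
    qed
    thus False using Y by blast
  qed
  show "\<exists>i\<in>X. \<exists>j\<in>rch U k - X. g i j ~= 0"
  proof (cases "k \<in> X")
    case True thus ?thesis using key X by blast
  next
    case False
    have "rch U k - X \<subset> rch U k" "k \<in> rch U k - X" using X False rch_self by blast+
    from key[OF this] obtain i j where "i \<in> rch U k - X" "j \<in> rch U k - (rch U k - X)" "g i j ~= 0" by blast
    thus ?thesis using gsym[of i j] by auto
  qed
qed

lemma rch_eq: assumes "k \<in> U" "j \<in> rch U k" shows "rch U j = rch U k"
proof
  have jU: "j \<in> U" using rch_sub assms by blast
  show "rch U j \<subseteq> rch U k" by (rule rch_least) (use assms rch_closed in auto)
  show "rch U k \<subseteq> rch U j"
  proof (rule rch_least)
    show "k \<in> rch U j"
    proof (rule ccontr)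
      assume k: "k ~: rch U j"
      have "rch U k \<subseteq> U - rch U j"
        by (rule rch_least) (use k assms rch_sep[OF jU] in auto)
      thus False using assms(2) rch_self by blast
    qed
  qed (use jU rch_closed in auto)
qed

lemma forest: assumes "A \<in> V" "ed A ~= 2 * n" "U \<subseteq> A" "U ~= {}" shows "ed U + 2 <= 2 * card U"
proof (cases "U = A")
  case True
  hence "ed U = 2 * n - 2" using ed_V_cases[OF assms(1)] assms(2) by blast
  thus ?thesis using True V_card[OF assms(1)] n9 by simp
next
  case False
  thus ?thesis using ed_pd2[of U] pdp[OF assms(1), of U] assms V_sub by blast
qed

text \<open>Two edges from \<open>w\<close> into a connected set would close a cycle, that is, give
  too many edges for a forest. The last assumption sets aside the case where this cycle is the whole
  vertex.\<close>

lemma nb_le1: assumes "A \<in> V" "K \<subseteq> A" "conn K" "K ~= {}" "w \<in> A" "w ~: K" "ed A ~= 2 * n \<or> insert w K ~= A" shows "dg K w <= 1"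
proof -
  have fK: "finite K" using assms V_fin finite_subset by blast
  have "ed (insert w K) + 2 <= 2 * card (insert w K)"
  proof (cases "insert w K = A")
    case True thus ?thesis using forest[OF assms(1)] assms by blast
  next
    case False
    hence "insert w K \<subset> A" using assms by blast
    thus ?thesis using ed_pd2[of "insert w K"] pdp[OF assms(1)] V_sub[OF assms(1)] by blast
  qed
  moreover have "2 * card K <= ed K + 2" using conn_ed assms fK by blast
  ultimately show ?thesis using ed_insert[OF fK assms(6)] fK assms(6) by simp
qed

lemma nb_unique: assumes "A \<in> V" "K \<subseteq> A" "conn K" "w \<in> A" "w ~: K" "ed A ~= 2 * n \<or> insert w K ~= A"
   "s \<in> K" "t \<in> K" "g s w ~= 0" "g t w ~= 0" shows "s = t"
proof -
  have fK: "finite K" using assms V_fin finite_subset by blast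
  have "dg K w <= 1" using nb_le1[OF assms(1-3) _ assms(4-6)] assms(7) by blast
  moreover have "s \<in> nb K w" "t \<in> nb K w" using assms gsym[of w] by (auto simp: nb_def)
  ultimately show ?thesis unfolding dg_def using finite_nb[OF fK] by (metis card_le_Suc0_iff_eq One_nat_def)
qed

end

section \<open>Two vertices joined by an edge\<close>

text \<open>\<open>G\<close> consists of the n - 1 facets through an edge of the polytope;
  \<open>x\<close> and \<open>x'\<close> complete it to the two end vertices. The aim is to find the
  possible values of \<open>g x x'\<close>.\<close>

locale edge_diagram = ideal_diagram +
  fixes G :: "'a set" and x x' :: 'a
  assumes AV: "insert x G \<in> V" and AV': "insert x' G \<in> V" and xG: "x ~: G" and xG': "x' ~: G" and xx: "x ~= x'"
begin

lemma swap: "edge_diagram I g V n G x' x"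
  by unfold_locales (use AV AV' xG xG' xx in auto)

lemma xI: "x \<in> I" and xI': "x' \<in> I" and GI: "G \<subseteq> I" using V_sub AV AV' by auto
lemma GI': "i \<in> G ==> i \<in> I" using GI by auto
lemma fG: "finite G" using GI fin_sub by auto
lemma cG: "card G = n - 1" using V_card[OF AV] fG xG by simp
lemma G_pd: "U \<subseteq> G ==> pd g U" using pdp[OF AV, of U] xG by blast

text \<open>Two orthogonal elliptic sets form one elliptic set, which has fewer than n nodes. Most
  cases below end here or in a forbidden affine diagram.\<close>

lemma FU:
  assumes "X \<subseteq> I" "Y \<subseteq> I" "pd g X" "pd g Y" "X \<inter> Y = {}" "!!i j. i \<in> X ==> j \<in> Y ==> g i j = 0" "n <= card X + card Y"
  shows False
proof -
  have f: "finite X" "finite Y" using assms fin_sub by auto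
  have "pd g (X \<union> Y)" by (rule pd_Un) (use assms f gsym in \<open>auto simp: gsym\<close>)
  hence "card (X \<union> Y) < n" using pd_card assms by blast
  thus False using assms(5,7) f by (simp add: card_Un_disjoint)
qed

text \<open>The exchange form of this obstruction: \<open>G\<close> has n - 1 nodes, so exchanging
  \<open>D\<close> for a larger elliptic set orthogonal to the rest gives at least n.\<close>

lemma FG:
  assumes "X \<subseteq> I" "pd g X" "D \<subseteq> G" "X \<inter> (G - D) = {}" "!!i j. i \<in> X ==> j \<in> G - D ==> g i j = 0" "card D < card X"
  shows False
proof (rule FU[OF assms(1) _ assms(2)])
  have "card D <= card G" using assms(3) fG card_mono by blast
  thus "n <= card X + card (G - D)" using cG assms n9 fG by (simp add: card_Diff_subset finite_subset)
qed (use assms GI G_pd in auto)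

lemma dg_x: "ed (insert x G) = ed G + 2 * dg G x"
  using ed_insert[OF fG xG] by simp

text \<open>The end vertex is connected, so each component of \<open>G\<close> is reached from
  \<open>x\<close>. In a tree it is reached exactly once.\<close>

lemma comp_x:
  assumes "k \<in> G"
  obtains s where "s \<in> rch G k" "g x s ~= 0"
proof -
  have "rch G k \<subset> insert x G" using rch_sub[OF assms] xG by blast
  moreover have "rch G k ~= {}" using rch_self by blast
  ultimately obtain i j where ij: "i \<in> rch G k" "j \<in> insert x G - rch G k" "g i j ~= 0"
    using conn_V[OF AV] unfolding conn_def by blast
  have "j = x" using ij rch_sep(1)[OF assms] by blast
  thus thesis using that[of i] ij gsym[of x i] by auto
qed

lemma comp_x_unique:
  assumes "k \<in> G" "s \<in> rch G k" "t \<in> rch G k" "g x s ~= 0" "g x t ~= 0" "ed (insert x G) ~= 2 * n"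
  shows "s = t"
  by (rule nb_unique[OF AV _ rch_conn[OF assms(1)], of x]) (use assms rch_sub[OF assms(1)] xG gsym[of x] in auto)

lemma nb_single:
  assumes "dg G x = 1" obtains s where "nb G x = {s}" "s \<in> G" "g x s ~= 0" "!!t. t \<in> G ==> t ~= s ==> g x t = 0"
proof -
  obtain s where "nb G x = {s}" using assms unfolding dg_def by (meson card_1_singletonE)
  thus thesis using that[of s] xG by (auto simp: nb_def)
qed

lemma conn_G:
  assumes "dg G x = 1" shows "conn G"
proof -
  obtain s where s: "nb G x = {s}" "s \<in> G" "g x s ~= 0" "!!t. t \<in> G ==> t ~= s ==> g x t = 0" using nb_single[OF assms] by metis
  have "G \<subseteq> rch G s"
  proof
    fix k assume k: "k \<in> G"
    obtain t where t: "t \<in> rch G k" "g x t ~= 0" by (rule comp_x[OF k])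
    hence "t = s" using s(4) rch_sub[OF k] by blast
    thus "k \<in> rch G s" using rch_eq[OF k] t rch_self by blast
  qed
  thus ?thesis using rch_conn[OF s(2)] rch_sub[OF s(2)] by (metis subset_antisym)
qed

lemma G_step:
  assumes "conn G" "U \<subseteq> G" "U ~= {}" "card U < 8" obtains i j where "i \<in> U" "j \<in> G" "j ~: U" "g i j ~= 0" "g j i ~= 0"
proof -
  have "U ~= G" using assms(4) cG n9 by auto
  hence "U \<subset> G" using assms by auto
  then obtain i j where "i \<in> U" "j \<in> G - U" "g i j ~= 0" using assms(1,3) unfolding conn_def by blast
  thus thesis using that[of i j] gsym[of j i] by auto
qed

lemma G_not2: assumes "conn G" "s \<in> G" "s' \<in> G" "!!t. t \<in> G ==> t ~= s' ==> t ~= s ==> g s t = 0" "!!t. t \<in> G ==> t ~= s ==> t ~= s' ==> g s' t = 0" shows False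
proof -
  have "card {s,s'} <= 2" by (cases "s = s'") auto
  hence c: "card {s,s'} < 8" by linarith
  obtain i j where "i \<in> {s,s'}" "j \<in> G" "j ~: {s,s'}" "g i j ~= 0"
    by (rule G_step[OF assms(1) _ _ c]) (use assms(2,3) in simp_all)
  thus False using assms(4)[of j] assms(5)[of j] by auto
qed

lemma G_heavy: "i \<in> insert x G ==> j \<in> insert x G ==> i ~= j ==> g i j ~= 0 ==> g i j = -1/2 \<or> g i j = -rt"
  using heavy_value[OF AV] by blast
lemma G_heavy': "i \<in> insert x' G ==> j \<in> insert x' G ==> i ~= j ==> g i j ~= 0 ==> g i j = -1/2 \<or> g i j = -rt"
  using heavy_value[OF AV'] by blast

lemma leaf: assumes "i \<in> insert x G" "j \<in> insert x G" "i ~= j" "g i j = -rt" "a \<in> insert x G" "a ~= i" "a ~= j" "g i a ~= 0" "b \<in> insert x G" "b ~= j"  "b ~= i"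
  shows "g j b = 0"
proof (rule ccontr)
  assume "g j b ~= 0"
  hence "b \<in> nb (insert x G) j" "a \<in> nb (insert x G) i" using assms by (auto simp: nb_def)
  thus False using heavy_leaf[OF AV assms(1-3)] assms rt_bounds by auto
qed

lemma leaf': assumes "i \<in> insert x' G" "j \<in> insert x' G" "i ~= j" "g i j = -rt" "a \<in> insert x' G" "a ~= i" "a ~= j" "g i a ~= 0" "b \<in> insert x' G" "b ~= j"  "b ~= i"
  shows "g j b = 0"
  using edge_diagram.leaf[OF swap] assms by blast

text \<open>Otherwise the elliptic pair \<open>x, x'\<close> could be exchanged for the common
  neighbour.\<close>

lemma h_common: assumes "dg G x = 1" "dg G x' = 1" "nb G x = nb G x'" shows "g x x' < -1"
proof (rule ccontr)
  assume no: "~ ?thesis"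
  obtain s where s: "nb G x = {s}" "s \<in> G" "g x s ~= 0" "!!t. t \<in> G ==> t ~= s ==> g x t = 0" using nb_single[OF assms(1)] by metis
  obtain s' where s': "nb G x' = {s'}" "!!t. t \<in> G ==> t ~= s' ==> g x' t = 0" using edge_diagram.nb_single[OF swap assms(2)] by metis
  have "s' = s" using s s' assms by auto
  have "-1 < g x x'" using g_vals[OF xI xI' xx] no rt_bounds by linarith
  thus False
    by (intro FG[of "{x,x'}" "{s}"] pd2) (use s s' \<open>s' = s\<close> xI xI' xx xG xG' in auto)
qed

text \<open>Folding of type D onto type B. The chain \<open>x', x, s\<close> with label 4 at its end
  has, up to a square, the form of a fork at \<open>s\<close> with prongs \<open>x\<close> and
  \<open>s'\<close>. If the component \<open>L\<close> of \<open>s\<close> in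
  \<open>G - {s'}\<close> omitted a node, the fork with \<open>L\<close> would be elliptic, hence so
  would the chain with \<open>L\<close>, and the rest of \<open>U\<close> completes it to n
  nodes.\<close>

lemma fold_conn:
  assumes h: "g x x' = -rt" and s: "s \<in> G" "g x s = -1/2" "!!t. t \<in> G ==> t ~= s ==> g x t = 0"
    and s': "s' \<in> G" "!!t. t \<in> G ==> t ~= s' ==> g x' t = 0" and ss: "s ~= s'" "g s s' = -1/2" and tr: "ed (insert x G) ~= 2 * n"
  shows "!!t. t \<in> G ==> t ~= s ==> t ~= s' ==> g s' t = 0"
proof -
  define U where "U = G - {s'}"
  have sU: "s \<in> U" using s ss by (simp add: U_def)
  define L where "L = rch U s"
  have LU: "L \<subseteq> U" using rch_sub[OF sU] L_def by simp
  have LG: "L \<subseteq> G" "s' ~: L" "s \<in> L" "conn L" "finite L" using LU U_def rch_self[of s U] rch_conn[OF sU] L_def fG finite_subset by auto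
  have s'L: "t = s" if "t \<in> L" "g s' t ~= 0" for t
    by (rule nb_unique[OF AV _ LG(4), of s']) (use that LG s' ss tr gsym[of t s'] in auto)
  have "L = U"
  proof (rule ccontr)
    assume "L ~= U"
    then obtain r where r: "r \<in> U" "r ~: L" using LU by auto
    have pd1: "pd g (insert x (insert s' L))"
    proof (rule pdp[OF AV])
      have "r \<in> insert x G - insert x (insert s' L)" using r LG U_def xG by auto
      thus "insert x (insert s' L) \<subset> insert x G" using LG s' by blast
    qed
    have "pd g (insert x' (insert x L))"
      unfolding pd_def
    proof (intro allI impI)
      fix f assume ne: "\<exists>i\<in>insert x' (insert x L). f i ~= (0::real)"
      have xL: "x ~: L" "x' ~: insert x L" "s' ~: L" "x ~: insert s' L" using LG xG xG' xx s' by auto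
      have a1: "(\<Sum>j\<in>L. f j * g x' j) = 0" by (rule sum.neutral) (use s'(2) LG in auto)
      have a2: "(\<Sum>j\<in>L. f j * g x j) = f s * g x s"
        by (rule trans[OF sum.mono_neutral_right[of L "{s}"]]) (use s(3) LG in auto)
      have q1: "bil g (insert x' (insert x L)) f f = (f x' - rt * f x)\<^sup>2 + f x * f x / 2 - f x * f s + bil g L f f"
        using xL LG h s xI xI' by (simp add: bil_insert[OF _ _ gsym] diag a1 a2 gsym[of x' x] power2_eq_square algebra_simps rt_sq rt_sq_left)
      \<comment> \<open>The coefficient of \<open>x\<close> in the chain is shared equally by the
        two prongs of the fork.\<close>
      define f' where "f' = (\<lambda>i. if i = x \<or> i = s' then f x / 2 else f i)"
      have xs': "x ~= s'" using s' xG by auto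
      have f': "f' x = f x / 2" "f' s' = f x / 2" "!!j. j \<in> L ==> f' j = f j" "f' s = f s" using xL LG by (auto simp: f'_def)
      have b1: "(\<Sum>j\<in>L. f j * g s' j) = f s * g s' s"
        by (rule trans[OF sum.mono_neutral_right[of L "{s}"]]) (use s'L LG f' in auto)
      have b2: "(\<Sum>j\<in>L. f j * g x j) = f s * g x s"
        by (rule trans[OF sum.mono_neutral_right[of L "{s}"]]) (use s(3) LG f' in auto)
      have b3: "bil g L f' f' = bil g L f f" unfolding bil_def by (intro sum.cong refl) (simp add: f')
      have "g x s' = 0" using s(3) s' ss by auto
      hence q2: "bil g (insert x (insert s' L)) f' f' = f x * f x / 2 - f x * f s + bil g L f f"
        using xL LG s s' ss xI GI' by (simp add: bil_insert[OF _ _ gsym] diag b1 b2 b3 f' gsym[of s' s] power2_eq_square algebra_simps)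
      show "0 < bil g (insert x' (insert x L)) f f"
      proof (cases "\<exists>i\<in>insert x (insert s' L). f' i ~= 0")
        case True
        hence "bil g (insert x (insert s' L)) f' f' > 0" using pd1 by (simp add: pd_def)
        thus ?thesis using q1 q2 zero_le_power2[of "f x' - rt * f x"] by linarith
      next
        case False
        hence z: "f x = 0" "!!j. j \<in> L ==> f j = 0" using f' by auto
        hence "f x' ~= 0" using ne by auto
        moreover have "bil g L f f = 0" by (simp add: bil_def z)
        ultimately show ?thesis using q1 z by simp
      qed
    qed
    moreover have "g i j = 0" if "i \<in> insert x' (insert x L)" "j \<in> U - L" for i j
    proof -
      have "j \<in> U" "j ~: L" "j \<in> G" "j ~= s" "j ~= s'" using that U_def LG(3) by auto
      thus ?thesis using that(1) s(3) s'(2) rch_sep(1)[OF sU, folded L_def] by blast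
    qed
    moreover have "card (insert x' (insert x L)) + card (U - L) = n"
    proof -
      have "card (insert x' (insert x L)) = card L + 2" using LG xG xG' xx by (auto simp: card_insert_if)
      moreover have "card (U - L) = card U - card L" "card L <= card U" using LU LG fG U_def card_mono[of U L] by (auto simp: card_Diff_subset)
      moreover have "card U = n - 2" using s' cG fG U_def by simp
      ultimately show ?thesis using n9 by simp
    qed
    ultimately show False
      by (intro FU[of "insert x' (insert x L)" "U - L"] G_pd[of "U - L"]) (use LG U_def GI xI xI' xG xG' in auto)
  qed
  thus "!!t. t \<in> G ==> t ~= s ==> t ~= s' ==> g s' t = 0" using s'L U_def by blast
qed

end

context edge_diagram begin

text \<open>If \<open>s\<close> and \<open>s'\<close> are not adjacent, affine C3 and F4 are avoided
  only by a single common neighbour \<open>y\<close>; then elliptic F4 on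
  \<open>s, x, x', s'\<close> can be exchanged for \<open>y, s, s'\<close>. If they are adjacent,
  neither has another neighbour in \<open>G\<close>, by \<open>fold_conn\<close> or because a heavy
  edge ends in a leaf, and the connected set \<open>G\<close> would have two nodes.\<close>

lemma EL_rt1:
  assumes h: "g x x' = -rt" and d: "dg G x = 1" "dg G x' = 1" and tr: "ed (insert x G) ~= 2 * n" "ed (insert x' G) ~= 2 * n"
  shows False
proof -
  interpret sw: edge_diagram I g V n G x' x by (rule swap)
  obtain s where s: "nb G x = {s}" "s \<in> G" "g x s ~= 0" "!!t. t \<in> G ==> t ~= s ==> g x t = 0" using nb_single[OF d(1)] by metis
  obtain s' where s': "nb G x' = {s'}" "s' \<in> G" "g x' s' ~= 0" "!!t. t \<in> G ==> t ~= s' ==> g x' t = 0" using sw.nb_single[OF d(2)] by metis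
  have z: "g t x = 0" if "t \<in> G" "t ~= s" for t using s(4) that gsym[of x t] by simp
  have z': "g t x' = 0" if "t \<in> G" "t ~= s'" for t using s'(4) that gsym[of x' t] by simp
  have cn: "conn G" by (rule conn_G[OF d(1)])
  have ss: "s ~= s'" using h_common[OF d] s s' h rt_bounds by auto
  have I: "s \<in> I" "s' \<in> I" using s s' GI' by auto
  have hx: "g x s = -1/2"
  proof (rule ccontr)
    assume "g x s ~= -1/2"
    hence "g x s = -rt" using G_heavy[of x s] s xG by auto
    thus False using C2[of s x x'] I xI xI' h z'[of s] s ss gsym[of s x] by auto
  qed
  have hx': "g x' s' = -1/2"
  proof (rule ccontr)
    assume "g x' s' ~= -1/2"
    hence "g x' s' = -rt" using G_heavy'[of x' s'] s' xG' by auto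
    thus False using C2[of s' x' x] I xI xI' h z[of s'] s' ss gsym[of s' x'] gsym[of x' x] by auto
  qed
  show False
  proof (cases "g s s' = 0")
    case True
    have cl: "g t s' ~= 0" if t: "t \<in> G" "t ~= s" "g s t ~= 0" for t
    proof
      assume ts: "g t s' = 0"
      have ne: "t ~= s'" using True t by auto
      have tI: "t \<in> I" using t GI' by auto
      have "g s t = -1/2 \<or> g s t = -rt" using G_heavy[of s t] s t by auto
      thus False
      proof
        assume "g s t = -1/2"
        thus False using F4[of s' x' x s t] I xI xI' tI hx hx' h True ts z[of s'] z'[of s] s s' ss ne t z'[of t] z[of t] gsym[of s' x'] gsym[of x' x] gsym[of x' s] gsym[of x' t] gsym[of x t] gsym[of s' s] gsym[of s' t]
          by auto
      next
        assume "g s t = -rt"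
        thus False using C3[of t s x x'] I xI xI' tI hx h s ss ne t z[of t] z'[of t] z'[of s] gsym[of t s] gsym[of s x] by auto
      qed
    qed
    have cl': "g t s ~= 0" if t: "t \<in> G" "t ~= s'" "g s' t ~= 0" for t
    proof
      assume ts: "g t s = 0"
      have ne: "t ~= s" using True t gsym[of s s'] by auto
      have tI: "t \<in> I" using t GI' by auto
      have "g s' t = -1/2 \<or> g s' t = -rt" using G_heavy[of s' t] s' t by auto
      thus False
      proof
        assume "g s' t = -1/2"
        thus False using F4[of s x x' s' t] I xI xI' tI hx hx' h True ts z[of s'] z'[of s] s s' ss ne t z'[of t] z[of t] gsym[of s x] gsym[of x s'] gsym[of x t] gsym[of x' t] gsym[of s t]
          by auto
      next
        assume "g s' t = -rt"
        thus False using C3[of t s' x' x] I xI xI' tI hx' h s' ss ne t z[of t] z'[of t] z[of s'] gsym[of t s'] gsym[of s' x'] gsym[of x' x] by auto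
      qed
    qed
    obtain y where y: "y \<in> G" "y ~= s" "g s y ~= 0"
      by (rule G_step[OF cn, of "{s}"]) (use s in simp_all)
    have un: "t = y" if t: "t \<in> G" "t ~= s" "g s t ~= 0" for t
    proof (rule ccontr)
      assume "t ~= y"
      have ne: "t ~= s'" "y ~= s'" using True t y by auto
      have "g s y = 0" by (rule no_sq[OF AV, of s t s' y]) (use t y s s' ss \<open>t ~= y\<close> ne cl[of t] cl[of y] gsym[of s' y] in auto)
      thus False using y by simp
    qed
    have un': "t = y" if t: "t \<in> G" "t ~= s'" "g s' t ~= 0" for t
      using un[of t] t cl'[OF t] gsym[of s t] True gsym[of s' s] by auto
    have ys': "y ~= s'" using y True by auto
    have n1: "g s t = 0" if "t \<in> G" "t ~= s" "t ~= y" for t using un that by blast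
    have n2: "g s' t = 0" if "t \<in> G" "t ~= s'" "t ~= y" for t using un' that by blast
    show False
    proof (rule FG[of "{s,x,x',s'}" "{y,s,s'}"])
      show "pd g {s,x,x',s'}" by (rule pdF4) (use I xI xI' h hx hx' True z z' s s' ss gsym[of s x] gsym[of x s'] in auto)
    qed (use I xI xI' s s' ss y ys' n1 n2 xG xG' xx in \<open>auto simp: card_insert_if\<close>)
  next
    case False
    have half: "g s s' = -1/2"
    proof (rule ccontr)
      assume "g s s' ~= -1/2"
      hence hv: "g s s' = -rt" using G_heavy[of s s'] s s' ss False by auto
      show False
      proof (rule G_not2[OF cn s(2) s'(2)])
        fix t assume t: "t \<in> G" "t ~= s'" "t ~= s"
        show "g s t = 0" by (rule leaf'[of s' s x']) (use t s s' ss hv gsym[of s' s] xG' gsym[of s' x'] in auto)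
        show "g s' t = 0" by (rule leaf[of s s' x]) (use t s s' ss hv xG gsym[of s x] in auto)
      qed
    qed
    show False
      by (rule G_not2[OF cn s(2) s'(2) sw.fold_conn[of s' s] fold_conn[of s s']])
        (use h gsym[of x' x] s s' hx hx' ss half gsym[of s' s] tr in auto)
  qed
qed

end

context ideal_diagram begin

lemma pd1: "k \<in> I ==> pd g {k}"
  by (auto simp: pd_def bil_def diag zero_less_mult_iff linorder_neq_iff)

lemma ex_cycle:
  assumes "T \<subseteq> I" "T ~= {}" "2 * card T <= ed T" shows "\<exists>W. W \<subseteq> T & W ~= {} & (\<forall>i\<in>W. dg W i = 2)"
proof (rule min_cycle[OF assms])
  fix W assume "W \<subseteq> T" "W ~= {}" "!!i. i \<in> W ==> dg W i = 2" "2 * card W <= ed W"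
  thus ?thesis by (intro exI[of _ W]) simp
qed

end

context edge_diagram begin

lemma cH: "card (insert x (insert x' G)) = n + 1" using cG fG xG xG' xx n9 by simp

lemma two_nb: assumes "dg W i = 2" obtains a where "a \<in> nb W i" "a ~= j"
proof -
  have "~ nb W i \<subseteq> {j}"
  proof
    assume "nb W i \<subseteq> {j}"
    hence "card (nb W i) <= card {j}" by (intro card_mono) auto
    thus False using assms by (simp add: dg_def)
  qed
  thus thesis using that by blast
qed

text \<open>A heavy edge has a leaf end in either end vertex, while on the cycle both its ends have
  two neighbours. The missing neighbours can only be \<open>x'\<close> at \<open>u\<close> and
  \<open>x\<close> at \<open>v\<close>; inside \<open>G\<close> the edge is therefore a whole
  component.\<close>

lemma int_heavy_aux:
  assumes W: "W \<subseteq> insert x (insert x' G)" "!!i. i \<in> W ==> dg W i = 2" and uv: "u \<in> W" "v \<in> W" "u \<in> G" "v \<in> G" "u ~= v" "g u v = -rt"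
    and lf: "nb (insert x G) u = {v}"
  shows "g x v ~= 0 & g x' u ~= 0 & nb (insert x' G) v = {u}"
proof -
  obtain a where a: "a \<in> nb W u" "a ~= v" by (rule two_nb[OF W(2)[OF uv(1)]])
  have "a ~: insert x G"
  proof
    assume "a \<in> insert x G"
    hence "a \<in> nb (insert x G) u" using a by (auto simp: nb_def)
    thus False using lf a by auto
  qed
  hence ax: "a = x'" using a W by (auto simp: nb_def)
  hence "x' \<in> nb (insert x' G) u" using a by (auto simp: nb_def)
  moreover have "x' ~= v" using uv(4) xG' by auto
  ultimately have "nb (insert x' G) u ~= {v}" by auto
  hence n: "nb (insert x' G) v = {u}" using heavy_leaf[OF AV', of u v] uv rt_bounds by auto
  obtain b where b: "b \<in> nb W v" "b ~= u" by (rule two_nb[OF W(2)[OF uv(2)]])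
  have "b ~: insert x' G"
  proof
    assume "b \<in> insert x' G"
    hence "b \<in> nb (insert x' G) v" using b by (auto simp: nb_def)
    thus False using n b by auto
  qed
  hence "b = x" using b W by (auto simp: nb_def)
  thus ?thesis using a b ax n gsym[of x v] gsym[of x' u] by (auto simp: nb_def)
qed

lemma int_heavy:
  assumes W: "W \<subseteq> insert x (insert x' G)" "!!i. i \<in> W ==> dg W i = 2" and uv: "u \<in> W" "v \<in> W" "u \<in> G" "v \<in> G" "u ~= v" "g u v = -rt"
  obtains s s' where "s \<in> G" "s' \<in> G" "s \<in> W" "s' \<in> W" "s ~= s'" "g s s' = -rt" "!!t. t \<in> G ==> t ~= s ==> t ~= s' ==> g s t = 0" "!!t. t \<in> G ==> t ~= s ==> t ~= s' ==> g s' t = 0"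
    "g x s ~= 0" "g x' s' ~= 0"
proof -
  note outer = that
  have key: thesis if "nb (insert x G) u = {v}" "u \<in> W" "v \<in> W" "u \<in> G" "v \<in> G" "u ~= v" "g u v = -rt" for u v
  proof -
    have k: "g x v ~= 0" "g x' u ~= 0" "nb (insert x' G) v = {u}" using int_heavy_aux[OF W that(2-7) that(1)] by auto
    show thesis
    proof (rule outer)
      show "g v u = -rt" using that gsym by simp
      show "g v t = 0" if "t \<in> G" "t ~= v" "t ~= u" for t using k(3) that by (auto simp: nb_def)
      show "g u t = 0" if "t \<in> G" "t ~= v" "t ~= u" for t using \<open>nb (insert x G) u = {v}\<close> that by (auto simp: nb_def)
    qed (use that k in auto)
  qed
  have "nb (insert x G) u = {v} \<or> nb (insert x G) v = {u}" using heavy_leaf[OF AV, of u v] uv rt_bounds by auto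
  thus thesis
  proof
    assume "nb (insert x G) u = {v}" thus thesis by (rule key) (use uv in auto)
  next
    assume "nb (insert x G) v = {u}" thus thesis by (rule key) (use uv gsym[of v u] in auto)
  qed
qed

lemma W_half:
  assumes W: "W \<subseteq> insert x (insert x' G)" "W ~= {}" "!!i. i \<in> W ==> dg W i = 2"
    and h: "g x x' = 0 \<or> g x x' = -1/2" and hx: "!!t. t \<in> G ==> t \<in> W ==> g x t ~= -rt" and hx': "!!t. t \<in> G ==> t \<in> W ==> g x' t ~= -rt"
    and hi: "!!s t. s \<in> G ==> t \<in> G ==> s \<in> W ==> t \<in> W ==> s ~= t ==> g s t ~= -rt"
  shows "W \<in> V"
proof (rule cycle_in_V[OF _ W(2,3)])
  show "W \<subseteq> I" using W xI xI' GI by blast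
  fix i j assume ij: "i \<in> W" "j \<in> W" "adj i j"
  have 1: "g x t = -1/2" if "t \<in> G" "t \<in> W" "g x t ~= 0" for t using G_heavy[of x t] hx[of t] that xG by auto
  have 2: "g x' t = -1/2" if "t \<in> G" "t \<in> W" "g x' t ~= 0" for t using G_heavy'[of x' t] hx'[of t] that xG' by auto
  have 3: "g s t = -1/2" if "s \<in> G" "t \<in> G" "s \<in> W" "t \<in> W" "s ~= t" "g s t ~= 0" for s t using G_heavy[of s t] hi[of s t] that by auto
  have "i \<in> G \<or> i = x \<or> i = x'" "j \<in> G \<or> j = x \<or> j = x'" using ij W by auto
  thus "g i j = -1/2"
  proof (elim disjE)
    assume "i \<in> G" "j \<in> G" thus ?thesis using 3 ij by blast
  next
    assume "i \<in> G" "j = x" thus ?thesis using 1[of i] ij gsym[of i x] by simp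
  next
    assume "i \<in> G" "j = x'" thus ?thesis using 2[of i] ij gsym[of i x'] by simp
  next
    assume "i = x" "j \<in> G" thus ?thesis using 1[of j] ij by simp
  next
    assume "i = x" "j = x'" thus ?thesis using h ij by simp
  next
    assume "i = x'" "j \<in> G" thus ?thesis using 2[of j] ij by simp
  next
    assume "i = x'" "j = x" thus ?thesis using h ij gsym[of x' x] by simp
  qed (use ij in simp_all)
qed

lemma ed_H: "ed (insert x (insert x' G)) = ed G + 2 * dg G x + 2 * dg G x' + (if g x x' = 0 then 0 else 2)"
proof -
  have "ed (insert x (insert x' G)) = ed (insert x' G) + 2 * dg (insert x' G) x" using ed_insert[of "insert x' G" x] fG xG xx by simp
  moreover have "dg (insert x' G) x = dg G x + (if g x x' = 0 then 0 else 1)"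
    using dg_insert[OF fG xG', of x] xx gsym[of x' x] by auto
  moreover have "ed (insert x' G) = ed G + 2 * dg G x'" using ed_insert[OF fG xG'] by simp
  ultimately show ?thesis by auto
qed

lemma dg_eq:
  assumes "ed (insert x G) ~= 2 * n" "ed (insert x' G) ~= 2 * n"
  shows "dg G x = dg G x'" "ed G + 2 * dg G x = 2 * n - 2"
proof -
  have 1: "ed (insert x G) = 2 * n - 2" "ed (insert x' G) = 2 * n - 2" using ed_V_cases[OF AV] ed_V_cases[OF AV'] assms by auto
  have "ed (insert x' G) = ed G + 2 * dg G x'" using ed_insert[OF fG xG'] by simp
  thus "dg G x = dg G x'" "ed G + 2 * dg G x = 2 * n - 2" using 1 dg_x by simp_all
qed

text \<open>The n + 1 nodes carry n + 1 edges, so the node \<open>k\<close> off the cycle hangs on a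
  single node \<open>t\<close>. Then \<open>k\<close> and the elliptic path \<open>W - {t}\<close>
  are orthogonal and have n nodes together.\<close>

lemma whole_cycle:
  assumes W: "W \<subseteq> insert x (insert x' G)" "W \<in> V" "!!i. i \<in> W ==> dg W i = 2"
    and tr: "ed (insert x G) ~= 2 * n" "ed (insert x' G) ~= 2 * n"
    and e: "ed (insert x (insert x' G)) = 2 * n + 2"
  shows False
proof -
  have fW: "finite W" and cW: "card W = n" using W(2) V_fin V_card by auto
  have "card (insert x (insert x' G) - W) = 1" using cH cW W fW by (simp add: card_Diff_subset)
  then obtain k where k: "insert x (insert x' G) - W = {k}" by (rule card_1_singletonE)
  hence H: "insert x (insert x' G) = insert k W" "k ~: W" using W by auto
  have eW: "ed W = 2 * n" using W(3) cW by (simp add: ed_def)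
  have "ed (insert k W) = ed W + 2 * dg W k" using ed_insert[OF fW H(2)] by simp
  hence dk: "dg W k = 1" using e eW H by simp
  then obtain t where t: "nb W k = {t}" unfolding dg_def by (meson card_1_singletonE)
  hence tW: "t \<in> W" and kz: "!!j. j \<in> W ==> j ~= t ==> g k j = 0" using H(2) by (auto simp: nb_def)
  have "W ~= insert x' G" "W ~= insert x G" using eW tr by auto
  have "k ~= x"
  proof
    assume "k = x"
    hence "insert x' G = W" using insert_ident[of x "insert x' G" W] H xG xx by auto
    thus False using \<open>W ~= insert x' G\<close> by simp
  qed
  have "k ~= x'"
  proof
    assume "k = x'"
    hence "insert x G = W" using insert_ident[of x' "insert x G" W] H xG' xx insert_commute[of x x' G] by auto
    thus False using \<open>W ~= insert x G\<close> by simp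
  qed
  have "k \<in> insert x (insert x' G)" using H(1) by simp
  hence kI: "k \<in> I" using GI xI xI' by auto
  show False
  proof (rule FU[of "{k}" "W - {t}"])
    show "pd g (W - {t})" by (rule pdp[OF W(2)]) (use tW in auto)
    show "pd g {k}" by (rule pd1[OF kI])
    show "n <= card {k} + card (W - {t})" using fW cW tW n9 by simp
  qed (use kI V_sub[OF W(2)] kz H in auto)
qed

text \<open>Around the label 4 edge from \<open>x\<close> to \<open>s\<close>, a label 4 at
  \<open>s\<close> gives affine C2 and a second label 3 gives affine B3.\<close>

lemma EL_half_a:
  assumes h: "g x x' = -1/2" and s: "s \<in> G" "g x s = -rt" "!!t. t \<in> G ==> t ~= s ==> g x t = 0"
    and s': "s' \<in> G" "g x' s' ~= 0" "!!t. t \<in> G ==> t ~= s' ==> g x' t = 0" and ss: "s ~= s'" "g s s' ~= 0"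
  shows "g s s' = -1/2" "!!t. t \<in> G ==> t ~= s ==> t ~= s' ==> g s t = 0"
proof -
  have I: "s \<in> I" "s' \<in> I" using s s' GI' by auto
  show a: "g s s' = -1/2"
  proof (rule ccontr)
    assume "g s s' ~= -1/2"
    hence "g s s' = -rt" using G_heavy[of s s'] s s' ss by auto
    thus False using C2[of x s s'] I xI s s' ss by auto
  qed
  fix t assume t: "t \<in> G" "t ~= s" "t ~= s'"
  show "g s t = 0"
  proof (rule ccontr)
    assume nz: "g s t ~= 0"
    have tI: "t \<in> I" using t GI' by auto
    have "g s t = -1/2"
    proof (rule ccontr)
      assume "g s t ~= -1/2"
      hence "g s t = -rt" using G_heavy[of s t] s t nz by auto
      thus False using C2[of x s t] I xI s s' ss t tI by auto
    qed
    moreover have "g s' t = 0" by (rule no_tri[OF AV, of s' s t]) (use s s' t nz ss gsym[of s' s] in auto)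
    ultimately show False
      using B3[of s' t s x] I tI xI a t s s' ss gsym[of s' s] gsym[of t s] gsym[of s x] gsym[of s' x] gsym[of t x] by auto
  qed
qed

text \<open>If \<open>s\<close> and \<open>s'\<close> are adjacent, elliptic B3 on
  \<open>s, x, x'\<close> is exchanged for \<open>s, s'\<close>. Otherwise a single common neighbour
  \<open>y\<close> is forced, and elliptic F4 on \<open>y, s, x, x'\<close> is exchanged for
  \<open>y, s, s'\<close>.\<close>

lemma EL_half_b:
  assumes h: "g x x' = -1/2" and s: "s \<in> G" "g x s = -rt" "!!t. t \<in> G ==> t ~= s ==> g x t = 0"
    and s': "s' \<in> G" "g x' s' = -1/2" "!!t. t \<in> G ==> t ~= s' ==> g x' t = 0" and ss: "s ~= s'" and cn: "conn G"
  shows False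
proof -
  have I: "s \<in> I" "s' \<in> I" using s s' GI' by auto
  have z: "g t x = 0" if "t \<in> G" "t ~= s" for t using s(3) that gsym[of x t] by simp
  have z': "g t x' = 0" if "t \<in> G" "t ~= s'" for t using s'(3) that gsym[of x' t] by simp
  show False
  proof (cases "g s s' = 0")
    case False
    have a: "g s t = 0" if "t \<in> G" "t ~= s" "t ~= s'" for t
      by (rule EL_half_a(2)[OF h s, of s']) (use s' ss False that in auto)
    show False
    proof (rule FG[of "{s,x,x'}" "{s,s'}"])
      show "pd g {s,x,x'}" by (rule pdB3) (use I xI xI' h s z'[of s] ss gsym[of s x] in auto)
    qed (use I xI xI' s s' ss a xG xG' xx in \<open>auto simp: card_insert_if\<close>)
  next
    case True
    have half: "g s t = -1/2" if t: "t \<in> G" "t ~= s" "g s t ~= 0" for t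
    proof (rule ccontr)
      assume "g s t ~= -1/2"
      hence "g s t = -rt" using G_heavy[of s t] s t by auto
      thus False using C2[of x s t] I xI s t GI' by auto
    qed
    have cl: "g t s' ~= 0" if t: "t \<in> G" "t ~= s" "g s t ~= 0" for t
    proof
      assume ts: "g t s' = 0"
      have ne: "t ~= s'" using True t by auto
      have tI: "t \<in> I" using t GI' by auto
      show False using F4[of t s x x' s'] I xI xI' tI h True ts z[of s'] z'[of s] s s' ss ne t z'[of t] z[of t] half[OF t] gsym[of t s] gsym[of s x] gsym[of x s'] by auto
    qed
    obtain y where y: "y \<in> G" "y ~= s" "g s y ~= 0" by (rule G_step[OF cn, of "{s}"]) (use s in simp_all)
    have ys': "y ~= s'" using y True by auto
    have un: "t = y" if t: "t \<in> G" "t ~= s" "g s t ~= 0" for t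
    proof (rule ccontr)
      assume "t ~= y"
      have ne: "t ~= s'" using True t by auto
      have "g s y = 0" by (rule no_sq[OF AV, of s t s' y]) (use t y s s' ss \<open>t ~= y\<close> ne ys' cl[of t] cl[of y] gsym[of s' y] in auto)
      thus False using y by simp
    qed
    have yI: "y \<in> I" using y GI' by auto
    have sy: "g s y = -1/2" using half y by blast
    have ys: "g y s' = -1/2"
    proof (rule ccontr)
      assume "g y s' ~= -1/2"
      hence "g y s' = -rt" using G_heavy[of y s'] s' y ys' cl[OF y] by auto
      hence "g s' x' = 0" by (intro leaf'[of y s' s]) (use y s s' ss ys' xG' sy gsym[of y s] in auto)
      thus False using s' gsym[of s' x'] by simp
    qed
    have yn: "g y w = 0" if w: "w \<in> G" "w ~= y" "w ~= s" "w ~= s'" for w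
    proof (rule ccontr)
      assume nz: "g y w ~= 0"
      have wI: "w \<in> I" using w GI' by auto
      have ws: "g w s = 0" by (rule no_tri[OF AV, of w y s]) (use w y s nz gsym[of y s] gsym[of w y] in auto)
      have ws': "g w s' = 0" by (rule no_tri[OF AV, of w y s']) (use w y s' ys' nz ys gsym[of w y] in auto)
      have "g y w = -1/2 \<or> g y w = -rt" using G_heavy[of y w] y w nz by auto
      thus False
      proof
        assume "g y w = -1/2"
        thus False using B4[of w s' y s x] wI I yI xI w ws ws' ys sy s s' ss y ys' z[of w] z[of s'] z[of y] True gsym[of w y] gsym[of s' y] gsym[of y s] gsym[of s x] gsym[of s' s] by auto
      next
        assume "g y w = -rt"
        thus False using C3[of w y s x] wI I yI xI w ws sy s y z[of w] z[of y] gsym[of w y] gsym[of y s] gsym[of s x] by auto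
      qed
    qed
    have n1: "g s t = 0" if "t \<in> G" "t ~= s" "t ~= y" for t using un that by blast
    show False
    proof (rule FG[of "{y,s,x,x'}" "{y,s,s'}"])
      show "pd g {y,s,x,x'}" by (rule pdF4) (use I xI xI' yI h s y ys' ss sy z[of y] z'[of y] z'[of s] gsym[of y s] gsym[of s x] in auto)
    qed (use I xI xI' yI s s' ss y ys' n1 yn xG xG' xx in \<open>auto simp: card_insert_if\<close>)
  qed
qed

lemma EL_half1:
  assumes h: "g x x' = -1/2" and d: "dg G x = 1" "dg G x' = 1" and tr: "ed (insert x G) ~= 2 * n" "ed (insert x' G) ~= 2 * n"
  shows False
proof -
  interpret sw: edge_diagram I g V n G x' x by (rule swap)
  obtain s where s: "nb G x = {s}" "s \<in> G" "g x s ~= 0" "!!t. t \<in> G ==> t ~= s ==> g x t = 0" using nb_single[OF d(1)] by metis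
  obtain s' where s': "nb G x' = {s'}" "s' \<in> G" "g x' s' ~= 0" "!!t. t \<in> G ==> t ~= s' ==> g x' t = 0" using sw.nb_single[OF d(2)] by metis
  have cn: "conn G" by (rule conn_G[OF d(1)])
  have ss: "s ~= s'" using h_common[OF d] s s' h by auto
  have I: "s \<in> I" "s' \<in> I" using s s' GI' by auto
  have h': "g x' x = -1/2" using h gsym[of x' x] by simp
  have vx: "g x s = -1/2 \<or> g x s = -rt" using G_heavy[of x s] s xG by auto
  have vx': "g x' s' = -1/2 \<or> g x' s' = -rt" using G_heavy'[of x' s'] s' xG' by auto
  show False
  proof (cases "g x s = -rt")
    case xs: True
    show False
    proof (cases "g x' s' = -rt")
      case True
      show False
      proof (cases "g s s' = 0")
        case z: True
        show False using C3[of s x x' s'] I xI xI' h xs True s s' ss z gsym[of s x] gsym[of s x'] by auto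
      next
        case False
        hence F': "g s' s ~= 0" using gsym[of s' s] by simp
        show False
        proof (rule G_not2[OF cn s(2) s'(2)])
          fix t assume t: "t \<in> G" "t ~= s'" "t ~= s"
          show "g s t = 0" by (rule EL_half_a(2)[OF h s(2) xs s(4) s'(2,3,4) ss False t(1,3,2)])
          show "g s' t = 0" by (rule sw.EL_half_a(2)[OF h' s'(2) True s'(4) s(2,3,4) ss[symmetric] F' t(1,2,3)])
        qed
      qed
    next
      case False
      thus False using EL_half_b[OF h s(2) xs s(4) s'(2) _ s'(4) ss cn] vx' by blast
    qed
  next
    case xs: False
    show False
    proof (cases "g x' s' = -rt")
      case True
      show False using sw.EL_half_b[OF h' s'(2) True s'(4) s(2) _ s(4) ss[symmetric] cn] vx xs by blast
    next
      case False
      \<comment> \<open>There are as many edges as nodes, hence a cycle. A heavy edge of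
        \<open>G\<close> on it would be a component of the connected set \<open>G\<close>, so all
        labels on the cycle are 3 and it is a vertex.\<close>
      have e: "ed (insert x (insert x' G)) = 2 * n + 2" using ed_H dg_eq(2)[OF tr] d h n9 by simp
      have sub: "insert x (insert x' G) \<subseteq> I" using xI xI' GI by auto
      have le: "2 * card (insert x (insert x' G)) <= ed (insert x (insert x' G))" using e cH by linarith
      obtain W where W0: "W \<subseteq> insert x (insert x' G) & W ~= {} & (\<forall>i\<in>W. dg W i = 2)"
        using ex_cycle[OF sub insert_not_empty le] by (rule exE)
      hence W: "W \<subseteq> insert x (insert x' G)" "W ~= {}" "!!i. i \<in> W ==> dg W i = 2" by simp_all
      have "W \<in> V"
      proof (rule W_half[OF W disjI2[OF h]])
        fix u v assume uv: "u \<in> G" "v \<in> G" "u \<in> W" "v \<in> W" "u ~= v"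
        show "g u v ~= -rt"
        proof
          assume "g u v = -rt"
          show False
          proof (rule int_heavy[OF W(1,3) uv(3,4,1,2,5) \<open>g u v = -rt\<close>])
            fix p q assume pq: "p \<in> G" "q \<in> G" and z: "!!t. t \<in> G ==> t ~= p ==> t ~= q ==> g p t = 0" "!!t. t \<in> G ==> t ~= p ==> t ~= q ==> g q t = 0"
            show False by (rule G_not2[OF cn pq]) (use z in auto)
          qed
        qed
      next
        show "g x t ~= - rt" if "t \<in> G" "t \<in> W" for t using that s(4)[of t] xs rt_bounds by (cases "t = s") auto
        show "g x' t ~= - rt" if "t \<in> G" "t \<in> W" for t using that s'(4)[of t] False rt_bounds by (cases "t = s'") auto
      qed
      thus False using whole_cycle[OF W(1) _ W(3) tr e] by blast
    qed
  qed
qed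

end

context ideal_diagram begin

lemma dg_Un: assumes "finite S" "finite T" "S \<inter> T = {}" shows "dg (S \<union> T) i = dg S i + dg T i"
proof -
  have "nb (S \<union> T) i = nb S i \<union> nb T i" by (auto simp: nb_def)
  moreover have "nb S i \<inter> nb T i = {}" using assms by (auto simp: nb_def)
  ultimately show ?thesis using assms unfolding dg_def by (simp add: card_Un_disjoint finite_nb)
qed

lemma dg_0: assumes "!!j. j \<in> T ==> g i j = 0" shows "dg T i = 0"
proof -
  have "nb T i = {}" using assms by (auto simp: nb_def)
  thus ?thesis by (simp add: dg_def)
qed

lemma ed_Un: assumes "finite S" "finite T" "S \<inter> T = {}" "!!i j. i \<in> S ==> j \<in> T ==> g i j = 0" shows "ed (S \<union> T) = ed S + ed T"
proof -
  have "(\<Sum>i\<in>S. dg (S \<union> T) i) = (\<Sum>i\<in>S. dg S i)" by (rule sum.cong) (use dg_Un[OF assms(1-3)] dg_0 assms(4) in auto)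
  moreover have "(\<Sum>i\<in>T. dg (S \<union> T) i) = (\<Sum>i\<in>T. dg T i)"
  proof (rule sum.cong[OF refl])
    fix i assume "i \<in> T"
    hence "dg S i = 0" using assms(4) by (intro dg_0) (metis gsym)
    thus "dg (S \<union> T) i = dg T i" using dg_Un[OF assms(1-3)] by simp
  qed
  ultimately show ?thesis using assms by (simp add: ed_def sum.union_disjoint)
qed

lemma nb2_eq: assumes "dg T i = 2" "a \<in> nb T i" "b \<in> nb T i" "a ~= b" shows "nb T i = {a,b}"
proof -
  have "finite (nb T i)" using assms(1) unfolding dg_def by (metis card.infinite zero_neq_numeral)
  moreover have "card {a,b} = card (nb T i)" using assms by (simp add: dg_def)
  ultimately have "{a,b} = nb T i" using assms by (intro card_subset_eq) auto
  thus ?thesis by simp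
qed

text \<open>On affine A the all-ones vector is the null vector.\<close>

lemma cycle_row:
  assumes "W \<in> V" "!!i. i \<in> W ==> dg W i = 2" "i \<in> W" shows "(\<Sum>j\<in>W. g i j) = 0"
proof -
  have c: "card W = n" using V_card assms by auto
  have "ed W = 2 * n" using assms(2) c by (simp add: ed_def)
  hence half: "!!i j. i \<in> W ==> j \<in> W ==> adj i j ==> g i j = -1/2" using cycle_V[OF assms(1)] by blast
  have fW: "finite W" using assms V_fin by blast
  have "(\<Sum>j\<in>W. g i j) = g i i + (\<Sum>j\<in>W-{i}. g i j)" using fW assms(3) by (simp add: sum.remove)
  also have "(\<Sum>j\<in>W-{i}. g i j) = (\<Sum>j\<in>nb W i. g i j)"
    by (rule sum.mono_neutral_right) (use fW in \<open>auto simp: nb_def\<close>)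
  also have "\<dots> = (\<Sum>j\<in>nb W i. -1/2)" by (rule sum.cong) (use assms(3) half in \<open>auto simp: nb_def\<close>)
  finally show ?thesis using diag V_I[OF assms(1,3)] assms(2)[OF assms(3)] by (simp add: dg_def)
qed

end

section \<open>Edges between two tree vertices\<close>

locale tree_edge = edge_diagram +
  assumes tr: "ed (insert x G) ~= 2 * n" and tr': "ed (insert x' G) ~= 2 * n"
begin

lemma swapt: "tree_edge I g V n G x' x"
  by (intro tree_edge.intro swap tree_edge_axioms.intro tr tr')

lemma ed_comp: assumes "k \<in> G" shows "ed (rch G k) + 2 = 2 * card (rch G k)"
proof -
  have f: "finite (rch G k)" "rch G k \<subseteq> insert x G" "rch G k ~= {}" using rch_sub[OF assms] finite_subset[OF _ fG] rch_self[of k G] by auto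
  have "ed (rch G k) + 2 <= 2 * card (rch G k)" by (rule forest[OF AV tr f(2,3)])
  moreover have "2 * card (rch G k) <= ed (rch G k) + 2" by (rule conn_ed[OF rch_conn[OF assms] f(1) f(3)])
  ultimately show ?thesis by simp
qed

lemma dg_comp: assumes "k \<in> G" shows "dg (rch G k) x = 1"
proof -
  obtain s where s: "s \<in> rch G k" "g x s ~= 0" by (rule comp_x[OF assms])
  have "x ~= s" using s rch_sub[OF assms] xG by auto
  hence "nb (rch G k) x = {s}" using s comp_x_unique[OF assms _ _ _ _ tr] by (auto simp: nb_def)
  thus ?thesis by (simp add: dg_def)
qed
lemma dg_comp': assumes "k \<in> G" shows "dg (rch G k) x' = 1"
  by (rule tree_edge.dg_comp[OF swapt assms])

lemma ed_two: assumes "K \<subseteq> G"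
  shows "ed (insert x (insert x' K)) = ed K + 2 * dg K x' + 2 * dg K x + (if g x x' = 0 then 0 else 2)"
proof -
  have K: "finite K" "x ~: K" "x' ~: K" using assms fG finite_subset xG xG' by auto
  have "ed (insert x (insert x' K)) = ed (insert x' K) + 2 * dg (insert x' K) x" using ed_insert[of "insert x' K" x] K xx by simp
  moreover have "dg (insert x' K) x = dg K x + (if g x x' = 0 then 0 else 1)"
    using dg_insert[OF K(1,3), of x] xx gsym[of x' x] by auto
  moreover have "ed (insert x' K) = ed K + 2 * dg K x'" using ed_insert[OF K(1,3)] by simp
  ultimately show ?thesis by auto
qed

lemma card_two: assumes "K \<subseteq> G" shows "card (insert x (insert x' K)) = card K + 2" "insert x (insert x' K) \<subseteq> I"
proof -
  have K: "finite K" "x ~: K" "x' ~: K" using assms fG finite_subset xG xG' by auto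
  thus "card (insert x (insert x' K)) = card K + 2" "insert x (insert x' K) \<subseteq> I" using xx xI xI' GI assms by auto
qed

text \<open>A component is a tree hanging by one edge on each of \<open>x\<close> and
  \<open>x'\<close>; the edge between these two closes a cycle.\<close>

lemma cyc1: assumes "k \<in> G" "g x x' ~= 0"
  shows "\<exists>W. W \<subseteq> insert x (insert x' (rch G k)) & W ~= {} & (\<forall>i\<in>W. dg W i = 2)"
proof (rule ex_cycle)
  have s: "rch G k \<subseteq> G" using rch_sub assms by blast
  show "insert x (insert x' (rch G k)) \<subseteq> I" by (rule card_two[OF s])
  show "2 * card (insert x (insert x' (rch G k))) <= ed (insert x (insert x' (rch G k)))"
    using card_two(1)[OF s] ed_two[OF s] ed_comp[OF assms(1)] dg_comp[OF assms(1)] dg_comp'[OF assms(1)] assms(2) by simp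
qed simp

lemma rch_disj: assumes "s \<in> G" "t \<in> G" "g x s ~= 0" "g x t ~= 0" "s ~= t" shows "rch G s \<inter> rch G t = {}"
proof (rule ccontr)
  assume "~ ?thesis"
  then obtain j where "j \<in> rch G s" "j \<in> rch G t" by blast
  hence "rch G s = rch G t" using rch_eq assms by metis
  hence "t \<in> rch G s" using rch_self by metis
  thus False using comp_x_unique[OF assms(1) rch_self _ assms(3,4) tr] assms(5) by blast
qed

text \<open>Two components, each hanging on both \<open>x\<close> and \<open>x'\<close>, close a
  cycle whether or not \<open>x\<close> and \<open>x'\<close> are adjacent.\<close>

lemma cyc2: assumes "s \<in> G" "t \<in> G" "g x s ~= 0" "g x t ~= 0" "s ~= t"
  shows "\<exists>W. W \<subseteq> insert x (insert x' (rch G s \<union> rch G t)) & W ~= {} & (\<forall>i\<in>W. dg W i = 2)"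
proof (rule ex_cycle)
  have K: "rch G s \<subseteq> G" "rch G t \<subseteq> G" "rch G s \<union> rch G t \<subseteq> G" using rch_sub assms by blast+
  have f: "finite (rch G s)" "finite (rch G t)" using K fG finite_subset by auto
  note dj = rch_disj[OF assms]
  show "insert x (insert x' (rch G s \<union> rch G t)) \<subseteq> I" by (rule card_two[OF K(3)])
  have "g i j = 0" if "i \<in> rch G s" "j \<in> rch G t" for i j
    using rch_sep(1)[OF assms(1) that(1), of j] that dj K by blast
  hence "ed (rch G s \<union> rch G t) = ed (rch G s) + ed (rch G t)" by (intro ed_Un f dj) auto
  thus "2 * card (insert x (insert x' (rch G s \<union> rch G t))) <= ed (insert x (insert x' (rch G s \<union> rch G t)))"
    using card_two(1)[OF K(3)] ed_two[OF K(3)] ed_comp[OF assms(1)] ed_comp[OF assms(2)] dg_Un[OF f dj] card_Un_disjoint[OF f dj]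
      dg_comp[OF assms(1)] dg_comp'[OF assms(1)] dg_comp[OF assms(2)] dg_comp'[OF assms(2)] by simp
qed simp

lemma nbG: "t \<in> nb G x \<longleftrightarrow> t \<in> G & g x t ~= 0" using xG by (auto simp: nb_def)

lemma other2: assumes "3 <= dg G x" obtains p q where "p \<in> G" "q \<in> G" "g x p ~= 0" "g x q ~= 0" "p ~= q" "p ~= t" "q ~= t"
proof -
  have "card (nb G x - {t}) \<ge> 2" using assms unfolding dg_def by (metis (no_types, lifting) add_le_imp_le_right card_Diff1_le card_Diff_singleton diff_le_mono eval_nat_numeral(3) diff_Suc_1 Diff_empty Diff_insert0 Suc_leD)
  then obtain p where p: "p \<in> nb G x - {t}" by (metis card.empty ex_in_conv not_numeral_le_zero)
  have "card (nb G x - {t} - {p}) \<ge> 1" using \<open>card (nb G x - {t}) \<ge> 2\<close> p by (simp add: card_Diff_singleton_if)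
  then obtain q where "q \<in> nb G x - {t} - {p}" by (metis card.empty ex_in_conv not_one_le_zero)
  thus thesis using p that[of p q] nbG by auto
qed

text \<open>Two further neighbours of \<open>x\<close> would complete affine C2 or B3. A heavy edge
  one step away from \<open>x\<close> is excluded next by affine B4, so that the cycles above
  consist of label 3 edges.\<close>

lemma heavy_end3: assumes "3 <= dg G x" "t \<in> G" shows "g x t ~= -rt"
proof
  assume h: "g x t = -rt"
  obtain p q where pq: "p \<in> G" "q \<in> G" "g x p ~= 0" "g x q ~= 0" "p ~= q" "p ~= t" "q ~= t" by (rule other2[OF assms(1)])
  have I: "p \<in> I" "q \<in> I" "t \<in> I" using pq assms GI' by auto
  have ne: "p ~= x" "q ~= x" "t ~= x" using pq assms xG by auto
  have z: "g p q = 0" "g p t = 0" "g q t = 0"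
    using no_tri[OF AV, of p x q] no_tri[OF AV, of p x t] no_tri[OF AV, of q x t] pq assms ne h rt_bounds gsym[of p x] gsym[of q x] by auto
  have "g x p = -1/2"
    using G_heavy[of x p] C2[of p x t] I xI pq ne h z gsym[of p x] by auto
  moreover have "g x q = -1/2"
    using G_heavy[of x q] C2[of q x t] I xI pq ne h z gsym[of q x] by auto
  ultimately show False using B3[of p q x t] I xI pq h z gsym[of p x] gsym[of q x] by auto
qed

lemma int_end3: assumes "3 <= dg G x" "s \<in> G" "t \<in> G" "s ~= t" "g x s ~= 0" shows "g s t ~= -rt"
proof
  assume h: "g s t = -rt"
  obtain p q where pq: "p \<in> G" "q \<in> G" "g x p ~= 0" "g x q ~= 0" "p ~= q" "p ~= s" "q ~= s" by (rule other2[OF assms(1)])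
  have I: "p \<in> I" "q \<in> I" "t \<in> I" "s \<in> I" using pq assms GI' by auto
  have ne: "p ~= x" "q ~= x" "t ~= x" "s ~= x" using pq assms xG by auto
  have z: "g x t = 0" using no_tri[OF AV, of x s t] assms h rt_bounds ne by auto
  have ne2: "p ~= t" "q ~= t" using z pq by auto
  have z2: "g p q = 0" "g p s = 0" "g q s = 0"
    using no_tri[OF AV, of p x q] no_tri[OF AV, of p x s] no_tri[OF AV, of q x s] pq assms ne gsym[of p x] gsym[of q x] by auto
  have z3: "g p t = 0" "g q t = 0"
    using no_sq[OF AV, of p x s t] no_sq[OF AV, of q x s t] pq assms ne ne2 h rt_bounds gsym[of p x] gsym[of q x] by auto
  have v: "g x u = -1/2" if "u \<in> G" "g x u ~= 0" for u
    using G_heavy[of x u] heavy_end3[OF assms(1), of u] that xG by auto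
  show False using B4[of p q x s t] I xI pq h z z2 z3 v[of p] v[of q] v[of s] assms gsym[of p x] gsym[of q x] by auto
qed

lemma dg_x': "dg G x' = dg G x" using dg_eq[OF tr tr'] by simp

lemma half3:
  assumes "3 <= dg G x" "g x x' = 0 \<or> g x x' = -1/2"
    and W: "W \<subseteq> insert x (insert x' G)" "W ~= {}" "!!i. i \<in> W ==> dg W i = 2"
  shows "W \<in> V"
proof (rule W_half[OF W assms(2)])
  have d': "3 <= dg G x'" using assms(1) dg_x' by simp
  show "g x t ~= -rt" if "t \<in> G" for t using heavy_end3[OF assms(1) that] .
  show "g x' t ~= -rt" if "t \<in> G" for t using tree_edge.heavy_end3[OF swapt d' that] .
  fix u v assume uv: "u \<in> G" "v \<in> G" "u \<in> W" "v \<in> W" "u ~= v"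
  show "g u v ~= -rt"
  proof
    assume "g u v = -rt"
    show False
    proof (rule int_heavy[OF W(1,3) uv(3,4,1,2,5) \<open>g u v = -rt\<close>])
      fix p q assume "p \<in> G" "q \<in> G" "p ~= q" "g p q = -rt" "g x p ~= 0"
      thus False using int_end3[OF assms(1), of p q] by blast
    qed
  qed
qed

text \<open>A cycle inside one component with \<open>x\<close> and \<open>x'\<close> is a vertex and
  needs n nodes, but at least two nodes of \<open>G\<close> lie in other components.\<close>

lemma EL_half3: assumes "3 <= dg G x" "g x x' = -1/2" shows False
proof -
  obtain s where s: "s \<in> G" "g x s ~= 0" by (rule other2[OF assms(1)])
  obtain p q where pq: "p \<in> G" "q \<in> G" "g x p ~= 0" "g x q ~= 0" "p ~= q" "p ~= s" "q ~= s" by (rule other2[OF assms(1)])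
  have h: "g x x' ~= 0" using assms by simp
  obtain W where "W \<subseteq> insert x (insert x' (rch G s)) & W ~= {} & (\<forall>i\<in>W. dg W i = 2)" using cyc1[OF s(1) h] by (rule exE)
  hence W: "W \<subseteq> insert x (insert x' (rch G s))" "W ~= {}" "!!i. i \<in> W ==> dg W i = 2" by simp_all
  have K: "rch G s \<subseteq> G" using rch_sub s by blast
  hence "W \<subseteq> insert x (insert x' G)" using W(1) by blast
  hence "W \<in> V" by (rule half3[OF assms(1) disjI2[OF assms(2)] _ W(2,3)])
  hence "n <= card (insert x (insert x' (rch G s)))" using V_card[of W] card_mono[OF _ W(1)] finite_subset[OF K fG] by simp
  hence "n <= card (rch G s) + 2" using card_two(1)[OF K] by simp
  moreover have "rch G s \<subseteq> G - {p,q}" using rch_disj[OF s(1) pq(1) s(2) pq(3)] rch_disj[OF s(1) pq(2) s(2) pq(4)] pq K rch_self[of p G] rch_self[of q G] by blast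
  hence "card (rch G s) <= card (G - {p,q})" using fG by (intro card_mono) auto
  moreover have "card (G - {p,q}) = n - 1 - 2" using pq fG cG by (simp add: card_Diff_subset)
  ultimately show False using n9 by linarith
qed

text \<open>Any two of three components contain, together with \<open>x\<close> and
  \<open>x'\<close>, a vertex. The sum of the three resulting inequalities exceeds what the n - 1
  nodes of \<open>G\<close> allow.\<close>

lemma EL_zero3: assumes "3 <= dg G x" "g x x' = 0" shows False
proof -
  obtain s where s: "s \<in> G" "g x s ~= 0" by (rule other2[OF assms(1)])
  obtain p q where pq: "p \<in> G" "q \<in> G" "g x p ~= 0" "g x q ~= 0" "p ~= q" "p ~= s" "q ~= s" by (rule other2[OF assms(1)])
  have key: "n <= card (rch G a) + card (rch G b) + 2" if ab: "a \<in> G" "b \<in> G" "g x a ~= 0" "g x b ~= 0" "a ~= b" for a b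
  proof -
    obtain W where "W \<subseteq> insert x (insert x' (rch G a \<union> rch G b)) & W ~= {} & (\<forall>i\<in>W. dg W i = 2)" using cyc2[OF ab] by (rule exE)
    hence W: "W \<subseteq> insert x (insert x' (rch G a \<union> rch G b))" "W ~= {}" "!!i. i \<in> W ==> dg W i = 2" by simp_all
    have K: "rch G a \<union> rch G b \<subseteq> G" using rch_sub ab by blast
    hence "W \<subseteq> insert x (insert x' G)" using W(1) by blast
    hence "W \<in> V" by (rule half3[OF assms(1) disjI1[OF assms(2)] _ W(2,3)])
    hence "n <= card (insert x (insert x' (rch G a \<union> rch G b)))" using V_card[of W] card_mono[OF _ W(1)] finite_subset[OF K fG] by simp
    thus ?thesis using card_two(1)[OF K] card_Un_le[of "rch G a" "rch G b"] by linarith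
  qed
  have f: "finite (rch G s)" "finite (rch G p)" "finite (rch G q)" "rch G s \<union> rch G p \<union> rch G q \<subseteq> G" using rch_sub[OF s(1)] rch_sub[OF pq(1)] rch_sub[OF pq(2)] finite_subset[OF _ fG] by auto
  have dj: "rch G s \<inter> rch G p = {}" "rch G s \<inter> rch G q = {}" "rch G p \<inter> rch G q = {}" using rch_disj s pq by auto
  have "card (rch G s \<union> rch G p \<union> rch G q) <= n - 1" using card_mono[OF fG f(4)] cG by simp
  moreover have "card (rch G s \<union> rch G p \<union> rch G q) = card (rch G s) + card (rch G p) + card (rch G q)"
    using f dj by (subst card_Un_disjoint) (auto simp: card_Un_disjoint)
  ultimately show False using key[OF s(1) pq(1) s(2) pq(3)] key[OF s(1) pq(2) s(2) pq(4)] key[OF pq(1,2,3,4,5)] pq(6,7)[symmetric] n9 by linarith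
qed

end

context ideal_diagram begin

text \<open>The positive null vector is paired with the all-ones vector. When the row sums are known
  to be nonnegative, all of them must vanish.\<close>

lemma null_rows: assumes "A \<in> V"
  shows "\<exists>m. (\<forall>i\<in>A. 0 < m i) & (\<forall>i\<in>A. (\<Sum>j\<in>A. m j * g i j) = 0) & (\<Sum>j\<in>A. m j * (\<Sum>i\<in>A. g j i)) = 0"
proof -
  obtain m where m: "\<forall>i\<in>A. 0 < m i" "\<forall>i\<in>A. (\<Sum>j\<in>A. m j * g i j) = 0" using null[OF assms] by blast
  have "(\<Sum>j\<in>A. m j * (\<Sum>i\<in>A. g j i)) = (\<Sum>j\<in>A. \<Sum>i\<in>A. m j * g j i)" by (simp add: sum_distrib_left)
  also have "\<dots> = (\<Sum>i\<in>A. \<Sum>j\<in>A. m j * g j i)" by (rule sum.swap)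
  also have "\<dots> = (\<Sum>i\<in>A. \<Sum>j\<in>A. m j * g i j)" by (intro sum.cong refl) (metis gsym)
  also have "\<dots> = 0" using m(2) by simp
  finally show ?thesis using m by blast
qed

end

context edge_diagram begin

lemma leaf_G: assumes "s \<in> G" "g x s = -rt" "t \<in> G" "t ~= s" "g x t ~= 0" "j \<in> G" "j ~= s" shows "g s j = 0"
  by (rule leaf[of x s t]) (use assms xG in auto)

end

context tree_edge begin

lemma rch_single: assumes "!!j. j \<in> G ==> j ~= s ==> g s j = 0" shows "rch G s \<subseteq> {s}"
  by (rule rch_least) (use assms in auto)

lemma rch_pair: assumes "!!j. j \<in> G ==> j ~= s ==> j ~= t ==> g s j = 0" "!!j. j \<in> G ==> j ~= s ==> j ~= t ==> g t j = 0"
  shows "rch G s \<subseteq> {s,t}"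
  by (rule rch_least) (use assms in auto)

text \<open>The vertex \<open>insert x G\<close> arises from the cycle by exchanging
  \<open>x'\<close> for the leaf \<open>t\<close>. As \<open>m t = rt * m x\<close>, the rows of
  \<open>x\<close> and \<open>t\<close> cancel in the pairing with the all-ones vector. The other
  row sums are \<open>- g j x'\<close>; being nonnegative they vanish, although \<open>x'\<close>
  has a neighbour in \<open>K\<close>.\<close>

lemma T0_row:
  assumes W: "insert x (insert x' K) \<in> V" "!!i. i \<in> insert x (insert x' K) ==> dg (insert x (insert x' K)) i = 2"
    and G: "G = insert t K" "t ~: K" "!!j. j \<in> K ==> g j t = 0" and h: "g x x' = -1/2" "g x t = -rt"
  shows False
proof -
  obtain m where m0: "(\<forall>i\<in>insert x G. 0 < m i) & (\<forall>i\<in>insert x G. (\<Sum>j\<in>insert x G. m j * g i j) = 0) & (\<Sum>j\<in>insert x G. m j * (\<Sum>i\<in>insert x G. g j i)) = 0"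
    using null_rows[OF AV] by (rule exE)
  hence m: "!!i. i \<in> insert x G ==> 0 < m i" "!!i. i \<in> insert x G ==> (\<Sum>j\<in>insert x G. m j * g i j) = 0"
    "(\<Sum>j\<in>insert x G. m j * (\<Sum>i\<in>insert x G. g j i)) = 0" by blast+
  have K: "finite K" "x ~: insert x' K" "x' ~: K" "t ~= x" "t ~= x'" using G fG xG xG' xx by auto
  have tI: "t \<in> I" using G GI by auto
  note row = cycle_row[OF W]
  have RK: "(\<Sum>i\<in>insert x G. g j i) = - g j x'" if j: "j \<in> K" for j
  proof -
    have "(\<Sum>i\<in>insert x (insert x' K). g j i) = 0" by (rule row) (use j in auto)
    thus ?thesis using K G(2) G(3)[OF j] unfolding G(1) by simp
  qed
  have Rx: "(\<Sum>i\<in>insert x G. g x i) = 1/2 - rt"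
  proof -
    have "(\<Sum>i\<in>insert x (insert x' K). g x i) = 0" by (rule row) auto
    thus ?thesis using K G(2) h unfolding G(1) by simp
  qed
  have z: "g t j = 0" if "j \<in> K" for j using G(3)[OF that] gsym[of t j] by simp
  have tx: "g t x = -rt" using h gsym[of t x] by simp
  have Rt: "(\<Sum>i\<in>insert x G. g t i) = 1 - rt" using K G(2) z tx diag[OF tI] unfolding G(1) by simp
  have "(\<Sum>j\<in>insert x G. m j * g t j) = 0" by (rule m(2)) (use G in auto)
  hence mt: "m t = rt * m x" using K G(2) z tx diag[OF tI] unfolding G(1) by simp
  have "(\<Sum>j\<in>insert x G. m j * (\<Sum>i\<in>insert x G. g j i)) = m x * (1/2 - rt) + m t * (1 - rt) + (\<Sum>j\<in>K. m j * (- g j x'))"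
  proof -
    have "(\<Sum>j\<in>insert x G. m j * (\<Sum>i\<in>insert x G. g j i)) = m x * (\<Sum>i\<in>insert x G. g x i) + m t * (\<Sum>i\<in>insert x G. g t i) + (\<Sum>j\<in>K. m j * (\<Sum>i\<in>insert x G. g j i))"
      using K G(2) G(1) by (simp del: sum.insert add: sum.insert[of _ _ "\<lambda>j. m j * (\<Sum>i\<in>insert x (insert t K). g j i)"])
    thus ?thesis by (simp add: RK Rx Rt cong: sum.cong)
  qed
  moreover have "m x * (1/2 - rt) + m t * (1 - rt) = 0" unfolding mt by (simp add: algebra_simps rt_sq rt_sq_left)
  ultimately have s0: "(\<Sum>j\<in>K. m j * (- g j x')) = 0" using m(3) by simp
  have "tree_edge I g V n G x' x" by (rule swapt)
  obtain s where s: "s \<in> rch G t" by (rule edge_diagram.comp_x[OF swap]) (use G in auto)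
  have "\<exists>k\<in>K. g x' k ~= 0"
  proof (rule ccontr)
    assume no: "~ ?thesis"
    have "nb (insert x (insert x' K)) x' \<subseteq> {x}" using no by (auto simp: nb_def)
    hence "card (nb (insert x (insert x' K)) x') <= card {x}" by (intro card_mono) auto
    thus False using W(2)[of x'] by (simp add: dg_def)
  qed
  then obtain k where k: "k \<in> K" "g x' k ~= 0" by blast
  have KI: "j \<in> I & j ~= x'" if "j \<in> K" for j using that G GI K by auto
  have nn: "0 <= m j * (- g j x')" if "j \<in> K" for j
    using m(1)[of j] g_le0[of j x'] that KI[OF that] xI' G by (auto simp: mult_nonneg_nonpos)
  have "m k * (- g k x') = 0" using sum_nonneg_eq_0_iff[OF K(1), of "\<lambda>j. m j * (- g j x')"] nn s0 k(1) by blast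
  moreover have "0 < m k" using m(1)[of k] k G by auto
  ultimately show False using k(2) gsym[of k x'] by auto
qed

text \<open>A larger component contains no heavy edge that is a component, so it yields a cycle that
  is a vertex. Counting leaves only \<open>t\<close> outside it; \<open>T0_row\<close> makes both
  edges from \<open>t\<close> light, and \<open>x, x', t\<close> is affine A2.\<close>

lemma half2_small:
  assumes h: "g x x' = -1/2" and d: "dg G x = 2" and st: "nb G x = {s,t}" "s ~= t"
  shows "card (rch G s) <= 2"
proof (rule ccontr)
  assume big: "~ ?thesis"
  interpret sw: tree_edge I g V n G x' x by (rule swapt)
  have sG: "s \<in> G" "g x s ~= 0" and tG: "t \<in> G" "g x t ~= 0" using st nbG by blast+
  have nz: "g x x' ~= 0" using h by simp
  have small: False if "rch G s \<subseteq> {a,b}" for a b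
  proof -
    have "card (rch G s) <= card {a,b}" using that by (intro card_mono) auto
    also have "\<dots> <= 2" by (cases "a = b") auto
    finally show False using big by simp
  qed
  have xs: "g x s ~= -rt"
  proof
    assume "g x s = -rt"
    hence "rch G s \<subseteq> {s}" by (intro rch_single leaf_G[of s t]) (use sG tG st in auto)
    thus False using small[of s s] by auto
  qed
  obtain s' where s': "s' \<in> rch G s" "g x' s' ~= 0" by (rule sw.comp_x[OF sG(1)])
  have s'G: "s' \<in> G" using s' rch_sub sG by blast
  have eq: "rch G s' = rch G s" using rch_eq sG s' by blast
  have xs': "g x' s' ~= -rt"
  proof
    assume hv: "g x' s' = -rt"
    have "dg G x' = 2" using d dg_x' by simp
    then obtain t' where "t' \<in> nb G x'" "t' ~= s'" by (rule two_nb)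
    hence "rch G s' \<subseteq> {s'}" by (intro rch_single sw.leaf_G[of s' t']) (use s'G hv sw.nbG in auto)
    thus False using small[of s' s'] eq by auto
  qed
  have KG: "rch G s \<subseteq> G" using rch_sub sG by blast
  obtain W where "W \<subseteq> insert x (insert x' (rch G s)) & W ~= {} & (\<forall>i\<in>W. dg W i = 2)" using cyc1[OF sG(1) nz] by (rule exE)
  hence W: "W \<subseteq> insert x (insert x' (rch G s))" "W ~= {}" "!!i. i \<in> W ==> dg W i = 2" by simp_all
  have WH: "W \<subseteq> insert x (insert x' G)" using W(1) KG by blast
  have WK: "j \<in> rch G s" if "j \<in> W" "j \<in> G" for j using W(1) that xG xG' by auto
  have WV: "W \<in> V"
  proof (rule W_half[OF WH W(2,3) disjI2[OF h]])
    fix j assume j: "j \<in> G" "j \<in> W"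
    show "g x j ~= -rt"
    proof
      assume e: "g x j = -rt"
      hence "j = s" using comp_x_unique[OF sG(1) WK[OF j(2,1)] rch_self _ sG(2) tr] rt_bounds by auto
      thus False using xs e by simp
    qed
    show "g x' j ~= -rt"
    proof
      assume e: "g x' j = -rt"
      hence "j = s'" using sw.comp_x_unique[OF sG(1) WK[OF j(2,1)] s'(1) _ s'(2) tr'] rt_bounds by auto
      thus False using xs' e by simp
    qed
  next
    fix u v assume uv: "u \<in> G" "v \<in> G" "u \<in> W" "v \<in> W" "u ~= v"
    show "g u v ~= -rt"
    proof
      assume "g u v = -rt"
      show False
      proof (rule int_heavy[OF WH W(3) uv(3,4,1,2,5) \<open>g u v = -rt\<close>])
        fix p q assume pq: "p \<in> G" "q \<in> G" "p \<in> W"  and z: "!!t. t \<in> G ==> t ~= p ==> t ~= q ==> g p t = 0" "!!t. t \<in> G ==> t ~= p ==> t ~= q ==> g q t = 0"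
        have "rch G p \<subseteq> {p,q}" by (rule rch_pair) (use z in auto)
        moreover have "rch G p = rch G s" using rch_eq[OF sG(1) WK[OF pq(3,1)]] .
        ultimately show False using small by simp
      qed
    qed
  qed
  have dj: "rch G s \<inter> rch G t = {}" by (rule rch_disj) (use sG tG st in auto)
  have tn: "t ~: rch G s" using dj rch_self by blast
  have fK: "finite (rch G s)" using KG fG finite_subset by blast
  have "n <= card (insert x (insert x' (rch G s)))" using V_card[OF WV] card_mono[OF _ W(1)] fK by simp
  hence c1: "n <= card (rch G s) + 2" using card_two(1)[OF KG] by simp
  have sub: "insert t (rch G s) \<subseteq> G" using KG tG by blast
  have c2: "card (insert t (rch G s)) = card (rch G s) + 1" using fK tn by simp
  have "card (insert t (rch G s)) <= n - 1" using card_mono[OF fG sub] cG by simp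
  hence c3: "card (rch G s) = n - 2" using c1 c2 n9 by linarith
  have Geq: "G = insert t (rch G s)" by (rule card_subset_eq[OF fG sub, symmetric]) (use c2 c3 cG n9 in simp)
  have "card W = card (insert x (insert x' (rch G s)))" using V_card[OF WV] card_two(1)[OF KG] c3 n9 by simp
  hence Weq: "W = insert x (insert x' (rch G s))" using card_subset_eq[OF _ W(1)] fK by simp
  have sep: "g j t = 0" if "j \<in> rch G s" for j by (rule rch_sep(1)[OF sG(1) that tG(1) tn])
  have W': "insert x (insert x' (rch G s)) \<in> V" "!!i. i \<in> insert x (insert x' (rch G s)) ==> dg (insert x (insert x' (rch G s))) i = 2"
    using WV W(3) Weq by simp_all
  have W'': "insert x' (insert x (rch G s)) \<in> V" "!!i. i \<in> insert x' (insert x (rch G s)) ==> dg (insert x' (insert x (rch G s))) i = 2"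
    using W' by (simp_all add: insert_commute)
  have h': "g x' x = -1/2" using h gsym[of x' x] by simp
  have x1: "g x t ~= -rt" using T0_row[OF W' Geq tn sep h] by blast
  have x2: "g x' t ~= -rt" using sw.T0_row[OF W'' Geq tn sep h'] by blast
  obtain t' where t': "t' \<in> rch G t" "g x' t' ~= 0" by (rule sw.comp_x[OF tG(1)])
  have "t' \<in> G" "t' ~: rch G s" using t' rch_sub[OF tG(1)] dj by auto
  hence "t' = t" using Geq by auto
  hence "g x' t = -1/2" using G_heavy'[of x' t] t' tG x2 xG' by auto
  moreover have "g x t = -1/2" using G_heavy[of x t] tG x1 xG by auto
  ultimately show False using parab3[of x x' t 1 1 1] xI xI' GI'[OF tG(1)] h xx tG(1) xG xG' by auto
qed

lemma two_comps:
  assumes st: "nb G x = {s,t}" shows "G \<subseteq> rch G s \<union> rch G t"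
proof
  fix k assume k: "k \<in> G"
  obtain a where a: "a \<in> rch G k" "g x a ~= 0" by (rule comp_x[OF k])
  hence "a \<in> nb G x" using rch_sub[OF k] nbG by blast
  hence "a = s \<or> a = t" using st by auto
  thus "k \<in> rch G s \<union> rch G t" using rch_eq[OF k a(1)] rch_self by blast
qed

lemma EL_half2: assumes h: "g x x' = -1/2" and d: "dg G x = 2" shows False
proof -
  obtain s where s: "s \<in> nb G x" using d unfolding dg_def by (metis card.empty ex_in_conv zero_neq_numeral)
  obtain t where t: "t \<in> nb G x" "t ~= s" by (rule two_nb[OF d])
  have st: "nb G x = {s,t}" using nb2_eq[OF d s t(1)] t(2) by auto
  have ts: "nb G x = {t,s}" using st by auto
  have "card (rch G s) <= 2" "card (rch G t) <= 2"
    using half2_small[OF h d st] half2_small[OF h d ts] t by auto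
  moreover have "finite (rch G s \<union> rch G t)" using rch_sub s t nbG fG finite_subset by (metis finite_UnI)
  ultimately have "card G <= 4" using card_mono[OF _ two_comps[OF st]] card_Un_le[of "rch G s" "rch G t"] by force
  thus False using cG n9 by simp
qed

text \<open>\<open>x\<close> sees only \<open>s\<close>, so it is orthogonal to the n - 1 elliptic
  nodes that remain of the other end vertex without \<open>s\<close>.\<close>

lemma EL_zero1: assumes h: "g x x' = 0" and d: "dg G x = 1" shows False
proof -
  obtain s where s: "nb G x = {s}" "s \<in> G" "!!t. t \<in> G ==> t ~= s ==> g x t = 0" using nb_single[OF d] by metis
  show False
  proof (rule FU[of "{x}" "insert x' (G - {s})"])
    show "pd g {x}" by (rule pd1[OF xI])
    show "pd g (insert x' (G - {s}))"
    proof (rule pdp[OF AV'])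
      have "s \<in> insert x' G - insert x' (G - {s})" using s xG' by auto
      thus "insert x' (G - {s}) \<subset> insert x' G" by blast
    qed
    show "n <= card {x} + card (insert x' (G - {s}))" using s fG cG xG' n9 by simp
  qed (use xI xI' GI xG xx s h in auto)
qed

text \<open>\<open>s\<close> is a one-node component of \<open>G\<close> hanging on \<open>x\<close>
  and \<open>x'\<close>. If both reach the other component at the same node, elliptic B3 on
  \<open>x, s, x'\<close> is too large. Otherwise \<open>t\<close> and \<open>t'\<close> are
  adjacent, or affine F4 appears, and elliptic F4 on \<open>t, x, s, x'\<close> is too
  large.\<close>

lemma zero_T1: assumes h: "g x x' = 0" and d: "dg G x = 2" and st: "nb G x = {s,t}" "s ~= t" and hv: "g x s = -rt" shows False
proof -
  interpret sw: tree_edge I g V n G x' x by (rule swapt)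
  have sG: "s \<in> G" "g x s ~= 0" and tG: "t \<in> G" "g x t ~= 0" using st nbG by blast+
  have I: "s \<in> I" "t \<in> I" using sG tG GI' by auto
  have zs: "g s j = 0" if "j \<in> G" "j ~= s" for j by (rule leaf_G[of s t]) (use sG tG hv st that in auto)
  have zs': "g j s = 0" if "j \<in> G" "j ~= s" for j using zs[OF that] gsym[of j s] by simp
  have zx: "g x j = 0" if "j \<in> G" "j ~= s" "j ~= t" for j
  proof (rule ccontr)
    assume "g x j ~= 0" hence "j \<in> nb G x" using that nbG by blast
    thus False using st that by auto
  qed
  have Rs: "rch G s \<subseteq> {s}" by (rule rch_single) (rule zs)
  obtain s0 where "s0 \<in> rch G s" "g x' s0 ~= 0" by (rule sw.comp_x[OF sG(1)])
  hence x's: "g x' s ~= 0" using Rs by auto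
  have d': "dg G x' = 2" using d dg_x' by simp
  obtain t' where t': "t' \<in> nb G x'" "t' ~= s" by (rule two_nb[OF d'])
  have "s \<in> nb G x'" using x's sG sw.nbG by blast
  hence st': "nb G x' = {s,t'}" using nb2_eq[OF d' _ t'(1)] t'(2) by auto
  have t'G: "t' \<in> G" "g x' t' ~= 0" using t' sw.nbG by blast+
  have zx': "g x' j = 0" if "j \<in> G" "j ~= s" "j ~= t'" for j
  proof (rule ccontr)
    assume "g x' j ~= 0" hence "j \<in> nb G x'" using that sw.nbG by blast
    thus False using st' that by auto
  qed
  have I': "t' \<in> I" using t'G GI' by auto
  have G2: "G \<subseteq> insert s (rch G t)" using two_comps[OF st(1)] Rs by auto
  have cs: "j = s \<or> j \<in> rch G t" if "j \<in> G" for j using G2 that by auto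
  have vs: "g x' s = -1/2"
    using G_heavy'[of x' s] C2[of x s x'] I xI xI' x's sG hv h xG' gsym[of s x'] by auto
  have vt: "g x t = -1/2"
    using G_heavy[of x t] C2[of s x t] I xI tG hv zs[of t] st(2) xG gsym[of s x] by auto
  have three: False if "rch G t \<subseteq> {a,b}" for a b
  proof -
    have "G \<subseteq> {s,a,b}" using G2 that by auto
    hence "card G <= card {s,a,b}" by (intro card_mono) auto
    thus False using cG n9 card_length[of "[s,a,b]"] by simp
  qed
  have vt': "g x' t' = -1/2"
  proof (rule ccontr)
    assume "g x' t' ~= -1/2"
    hence "g x' t' = -rt" using G_heavy'[of x' t'] t'G xG' by auto
    hence "rch G t' \<subseteq> {t'}" by (intro rch_single sw.leaf_G[of t' s]) (use sG t'G t' x's in auto)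
    moreover have "t' \<in> rch G t" using cs[OF t'G(1)] t'(2) by simp
    ultimately have "rch G t \<subseteq> {t',t'}" using rch_eq[OF tG(1)] by auto
    thus False by (rule three)
  qed
  show False
  proof (cases "t = t'")
    case True
    show False
    proof (rule FG[of "{x,s,x'}" "{s,t}"])
      show "pd g {x,s,x'}" by (rule pdB3) (use I xI xI' hv vs h gsym[of s x'] in auto)
    qed (use I xI xI' sG tG st zx zx' zs True xG xG' xx in \<open>auto simp: card_insert_if\<close>)
  next
    case tt: False
    have xt': "g x t' = 0" using zx t'G t' tt by auto
    have x't: "g x' t = 0" using zx' tG tt st(2) by auto
    show False
    proof (cases "g t t' = 0")
      case True
      show False using F4[of t x s x' t'] I I' xI xI' vt hv vs vt' zs'[of t] tG st(2) x't True h xt' zs[of t'] t'G t' gsym[of t x] gsym[of s x'] gsym[of t x'] by auto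
    next
      case False
      have half: "g t t' = -1/2"
      proof (rule ccontr)
        assume "g t t' ~= -1/2"
        hence hvt: "g t t' = -rt" using G_heavy[of t t'] tG t'G tt False by auto
        have "rch G t \<subseteq> {t,t'}"
        proof (rule rch_pair)
          fix j assume j: "j \<in> G" "j ~= t" "j ~= t'"
          show "g t' j = 0" by (rule leaf[of t t' x]) (use j tG t'G tt hvt xG gsym[of t x] in auto)
          show "g t j = 0" by (rule leaf'[of t' t x']) (use j tG t'G tt hvt xG' gsym[of t' x'] gsym[of t' t] in auto)
        qed
        thus False by (rule three)
      qed
      have n1: "g t j = 0" if j: "j \<in> G" "j ~= t" "j ~= t'" for j
      proof (cases "j = s")
        case True thus ?thesis using zs' tG st(2) by simp
      next
        case js: False
        show ?thesis
        proof (rule ccontr)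
          assume nz: "g t j ~= 0"
          have jI: "j \<in> I" using j GI' by auto
          have "g j t' = 0" by (rule no_tri[OF AV, of j t t']) (use j tG t'G nz tt False gsym[of j t] in auto)
          moreover have "g j x = 0" using zx j js gsym[of j x] by simp
          moreover have "g j s = 0" using zs' j js by simp
          moreover have "g t j = -1/2 \<or> g t j = -rt" using G_heavy[of t j] j tG nz by auto
          moreover have "g t' x = 0" "g t' s = 0" "g t s = 0" using xt' gsym[of t' x] zs' t'G t' tG st(2) by auto
          ultimately show False using B4[of j t' t x s] C3[of j t x s] jI I I' xI half vt hv j gsym[of j t] gsym[of t' t] gsym[of t x] by auto
        qed
      qed
      show False
      proof (rule FG[of "{t,x,s,x'}" "{t,s,t'}"])
        show "pd g {t,x,s,x'}" by (rule pdF4) (use I xI xI' vt hv vs h x't zs'[of t] tG st(2) gsym[of t x] gsym[of s x'] gsym[of t x'] in auto)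
      qed (use I xI xI' sG tG t'G st zx zx' zs n1 xG xG' xx in \<open>auto simp: card_insert_if\<close>)
    qed
  qed
qed

text \<open>The pair \<open>p, q\<close> is a component of \<open>G\<close>. If the second
  neighbours of \<open>x\<close> and \<open>x'\<close> coincide, elliptic F4 on
  \<open>x, p, q, x'\<close> is exchanged for \<open>p, q, s\<close>; otherwise \<open>t\<close>
  extends it to affine F4.\<close>

lemma zero_T2: assumes h: "g x x' = 0" and d: "dg G x = 2"
   and pq: "p \<in> G" "q \<in> G" "p ~= q" "g p q = -rt" "g x p ~= 0" "g x' q ~= 0"
   and z: "!!t. t \<in> G ==> t ~= p ==> t ~= q ==> g p t = 0" "!!t. t \<in> G ==> t ~= p ==> t ~= q ==> g q t = 0"
   and nh: "!!t. t \<in> G ==> g x t ~= -rt" "!!t. t \<in> G ==> g x' t ~= -rt"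
  shows False
proof -
  interpret sw: tree_edge I g V n G x' x by (rule swapt)
  have d': "dg G x' = 2" using d dg_x' by simp
  obtain s where s: "s \<in> nb G x" "s ~= p" by (rule two_nb[OF d])
  obtain t where t: "t \<in> nb G x'" "t ~= q" by (rule two_nb[OF d'])
  have sG: "s \<in> G" "g x s ~= 0" and tG: "t \<in> G" "g x' t ~= 0" using s t nbG sw.nbG by blast+
  have ps: "nb G x = {p,s}" using nb2_eq[OF d _ s(1)] s(2) pq nbG by auto
  have qt: "nb G x' = {q,t}" using nb2_eq[OF d' _ t(1)] t(2) pq sw.nbG by auto
  have zx: "g x j = 0" if "j \<in> G" "j ~= p" "j ~= s" for j
  proof (rule ccontr)
    assume "g x j ~= 0" hence "j \<in> nb G x" using that nbG by blast
    thus False using ps that by auto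
  qed
  have zx': "g x' j = 0" if "j \<in> G" "j ~= q" "j ~= t" for j
  proof (rule ccontr)
    assume "g x' j ~= 0" hence "j \<in> nb G x'" using that sw.nbG by blast
    thus False using qt that by auto
  qed
  have I: "p \<in> I" "q \<in> I" "s \<in> I" "t \<in> I" using pq sG tG GI' by auto
  have xq: "g x q = 0" by (rule no_tri[OF AV, of x p q]) (use pq xG rt_bounds in auto)
  have x'p: "g x' p = 0" by (rule no_tri[OF AV', of x' q p]) (use pq xG' rt_bounds gsym[of q p] in auto)
  have ne: "s ~= q" "t ~= p" using xq x'p sG tG by auto
  have v: "g x p = -1/2" "g x s = -1/2" "g x' q = -1/2" "g x' t = -1/2"
    using G_heavy[of x p] G_heavy[of x s] G_heavy'[of x' q] G_heavy'[of x' t] nh pq sG tG xG xG' by auto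
  show False
  proof (cases "s = t")
    case True
    show False
    proof (rule FG[of "{x,p,q,x'}" "{p,q,s}"])
      show "pd g {x,p,q,x'}" by (rule pdF4) (use I xI xI' v pq h xq x'p gsym[of q x'] gsym[of p x'] in auto)
    qed (use I xI xI' pq sG zx zx' z True xG xG' xx in \<open>auto simp: card_insert_if\<close>)
  next
    case False
    show False using F4[of x p q x' t] I xI xI' v pq h xq x'p zx[of t] z[of t] tG t ne False gsym[of q x'] gsym[of p x'] by auto
  qed
qed

lemma EL_zero2: assumes h: "g x x' = 0" and d: "dg G x = 2" shows False
proof -
  interpret sw: tree_edge I g V n G x' x by (rule swapt)
  have d': "dg G x' = 2" using d dg_x' by simp
  have h': "g x' x = 0" using h gsym[of x' x] by simp
  have nh: "g x t ~= -rt" if "t \<in> G" for t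
  proof
    assume hv: "g x t = -rt"
    hence tn: "t \<in> nb G x" using that nbG rt_bounds by auto
    obtain s where s: "s \<in> nb G x" "s ~= t" by (rule two_nb[OF d])
    show False by (rule zero_T1[OF h d nb2_eq[OF d tn s(1)] _ hv]) (use s in auto)
  qed
  have nh': "g x' t ~= -rt" if "t \<in> G" for t
  proof
    assume hv: "g x' t = -rt"
    hence tn: "t \<in> nb G x'" using that sw.nbG rt_bounds by auto
    obtain s where s: "s \<in> nb G x'" "s ~= t" by (rule two_nb[OF d'])
    show False by (rule sw.zero_T1[OF h' d' nb2_eq[OF d' tn s(1)] _ hv]) (use s in auto)
  qed
  have e: "ed (insert x (insert x' G)) = 2 * n + 2" using ed_H dg_eq(2)[OF tr tr'] d d' h n9 by simp
  have sub: "insert x (insert x' G) \<subseteq> I" using xI xI' GI by auto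
  have le: "2 * card (insert x (insert x' G)) <= ed (insert x (insert x' G))" using e cH by linarith
  obtain W where W0: "W \<subseteq> insert x (insert x' G) & W ~= {} & (\<forall>i\<in>W. dg W i = 2)"
    using ex_cycle[OF sub insert_not_empty le] by (rule exE)
  hence W: "W \<subseteq> insert x (insert x' G)" "W ~= {}" "!!i. i \<in> W ==> dg W i = 2" by simp_all
  have "W \<in> V"
  proof (rule W_half[OF W disjI1[OF h]])
    fix u v assume uv: "u \<in> G" "v \<in> G" "u \<in> W" "v \<in> W" "u ~= v"
    show "g u v ~= -rt"
    proof
      assume "g u v = -rt"
      show False
      proof (rule int_heavy[OF W(1,3) uv(3,4,1,2,5) \<open>g u v = -rt\<close>])
        fix p q assume pq: "p \<in> G" "q \<in> G" "p ~= q" "g p q = -rt" "g x p ~= 0" "g x' q ~= 0" and z: "!!t. t \<in> G ==> t ~= p ==> t ~= q ==> g p t = 0" "!!t. t \<in> G ==> t ~= p ==> t ~= q ==> g q t = 0"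
        show False by (rule zero_T2[OF h d pq z nh nh'])
      qed
    qed
  qed (use nh nh' in auto)
  thus False using whole_cycle[OF W(1) _ W(3) tr tr' e] by blast
qed

lemma edge_tree: "g x x' < -1 \<or> (g x x' = -rt & 2 <= dg G x)"
proof -
  have "dg G x ~= 0"
  proof
    assume "dg G x = 0"
    hence z: "nb G x = {}" using fG by (simp add: dg_def finite_nb)
    have "G ~= {}" using cG n9 by auto
    then obtain k where "k \<in> G" by blast
    then obtain s where "s \<in> rch G k" "g x s ~= 0" by (rule comp_x)
    thus False using z nbG rch_sub[OF \<open>k \<in> G\<close>] by blast
  qed
  hence "dg G x = 1 \<or> dg G x = 2 \<or> 3 <= dg G x" by linarith
  moreover have "g x x' = 0 \<or> g x x' = -1/2 \<or> g x x' = -rt \<or> g x x' < -1" by (rule g_vals[OF xI xI' xx])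
  moreover have False if "g x x' = 0" "dg G x = 1" using EL_zero1 that .
  moreover have False if "g x x' = 0" "dg G x = 2" using EL_zero2 that .
  moreover have False if "g x x' = 0" "3 <= dg G x" using EL_zero3 that by blast
  moreover have False if "g x x' = -1/2" "dg G x = 1" using EL_half1[OF that _ tr tr'] that dg_x' by simp
  moreover have False if "g x x' = -1/2" "dg G x = 2" using EL_half2 that .
  moreover have False if "g x x' = -1/2" "3 <= dg G x" using EL_half3 that by blast
  moreover have False if "g x x' = -rt" "dg G x = 1" using EL_rt1[OF that _ tr tr'] that dg_x' by simp
  ultimately show ?thesis by (elim disjE) auto
qed

end

section \<open>Numbering a cycle, and affine E8 next to it\<close>

context ideal_diagram begin

lemma two_nb': assumes "dg W i = 2" obtains a where "a \<in> nb W i" "a ~= j"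
proof -
  have "~ nb W i \<subseteq> {j}"
  proof
    assume "nb W i \<subseteq> {j}"
    hence "card (nb W i) <= card {j}" by (intro card_mono) auto
    thus False using assms by (simp add: dg_def)
  qed
  thus thesis using that by blast
qed

lemma connD: "conn T ==> U \<subset> T ==> U ~= {} ==> \<exists>i\<in>U. \<exists>j\<in>T - U. g i j ~= 0"
  unfolding conn_def by blast

text \<open>A numbering of a vertex of affine type A by 0, ..., n - 1 along its cycle, wrapping
  around from n - 1 to 0, with all Gram entries explicit.\<close>

definition cyc where "cyc A c \<longleftrightarrow> A \<in> V & inj_on c {..<n} & c ` {..<n} = A &
  (\<forall>i<n. \<forall>j<n. g (c i) (c j) = (if i = j then 1 else if j = Suc i \<or> i = Suc j \<or> (i = 0 & j = n - 1) \<or> (j = 0 & i = n - 1) then -1/2 else 0))"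

lemma cycD: assumes "cyc A c"
  shows "A \<in> V" "inj_on c {..<n}" "c ` {..<n} = A" "!!i. i < n ==> c i \<in> A"
    "!!i j. i < n ==> j < n ==> g (c i) (c j) = (if i = j then 1 else if j = Suc i \<or> i = Suc j \<or> (i = 0 & j = n - 1) \<or> (j = 0 & i = n - 1) then -1/2 else 0)"
  using assms unfolding cyc_def by auto

text \<open>A walk that never turns back is followed to its first repetition. It returns to its
  start, since an inner node has both neighbours on the walk already, and by connectedness it has
  visited everything.\<close>

lemma cyc_enum:
  assumes A: "A \<in> V" "ed A = 2 * n" and xy: "x \<in> A" "y \<in> nb A x"
  shows "\<exists>c. cyc A c & c 0 = x & c 1 = y"
proof -
  \<comment> \<open>The state is the previous and the current node; the choice picks the other
    neighbour of the current node.\<close>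
  define st where "st = (\<lambda>(a,b). (b, SOME z. z \<in> nb A b & z ~= a))"
  define p where "p = (\<lambda>k::nat. (st ^^ k) (x,y))"
  define c where "c = (\<lambda>k. fst (p k))"
  have p0: "p 0 = (x,y)" and pS: "p (Suc k) = st (p k)" for k by (simp_all add: p_def)
  have d2: "dg A i = 2" if "i \<in> A" for i using cycle_V(1)[OF A that] .
  have snd_p: "snd (p k) = c (Suc k)" for k by (simp add: c_def pS st_def split_beta)
  have nbs: "j \<in> nb A i \<longleftrightarrow> i \<in> nb A j" if "i \<in> A" "j \<in> A" for i j using that gsym[of i j] by (auto simp: nb_def)
  have inv: "c k \<in> A & c (Suc k) \<in> nb A (c k)" for k
  proof (induction k)
    case 0 show ?case using xy p0 snd_p[of 0] by (simp add: c_def)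
  next
    case (Suc k)
    have cS: "c (Suc k) \<in> A" using Suc by (auto simp: nb_def)
    obtain z where "z \<in> nb A (c (Suc k))" "z ~= c k" by (rule two_nb'[OF d2[OF cS]])
    hence "\<exists>z. z \<in> nb A (c (Suc k)) & z ~= c k" by blast
    from someI_ex[OF this] have "snd (st (p k)) \<in> nb A (c (Suc k))"
      unfolding st_def split_beta snd_p by (simp add: c_def)
    thus ?case using cS snd_p[of "Suc k"] pS by simp
  qed
  have cA: "c k \<in> A" for k using inv by blast
  have cne: "c (Suc (Suc k)) ~= c k" for k
  proof -
    obtain z where "z \<in> nb A (c (Suc k))" "z ~= c k" by (rule two_nb'[OF d2[OF cA]])
    hence "\<exists>z. z \<in> nb A (c (Suc k)) & z ~= c k" by blast
    from someI_ex[OF this] have "snd (st (p k)) ~= c k"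
      unfolding st_def split_beta snd_p by (simp add: c_def)
    thus ?thesis using snd_p[of "Suc k"] pS by simp
  qed
  have nbc: "nb A (c (Suc k)) = {c k, c (Suc (Suc k))}" for k
    using nb2_eq[OF d2[OF cA[of "Suc k"]], of "c k" "c (Suc (Suc k))"] inv[of k] inv[of "Suc k"] nbs cA cne[of k] by metis
  have self: "c (Suc k) ~= c k" for k using inv[of k] by (auto simp: nb_def)
  have "~ inj c"
  proof
    assume "inj c"
    moreover have "finite (range c)" using cA V_fin[OF A(1)] finite_subset by (metis image_subsetI)
    ultimately show False using finite_imageD by fastforce
  qed
  then obtain i j where "c i = c j" "i ~= j" by (auto simp: inj_on_def)
  hence "\<exists>k. \<exists>j<k. c j = c k" by (metis linorder_neqE_nat)
  hence lk: "\<exists>j < (LEAST k. \<exists>j<k. c j = c k). c j = c (LEAST k. \<exists>j<k. c j = c k)" by (rule LeastI_ex)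
  define k where "k = (LEAST k. \<exists>j<k. c j = c k)"
  obtain j where j: "j < k" "c j = c k" using lk unfolding k_def by blast
  have least: "a = b" if "a < k" "b < k" "c a = c b" for a b
  proof (rule ccontr)
    assume "a ~= b"
    have "\<exists>j<max a b. c j = c (max a b)"
    proof (cases "a < b")
      case True thus ?thesis by (intro exI[of _ a]) (simp add: that(3) max_def)
    next
      case False thus ?thesis using \<open>a ~= b\<close> by (intro exI[of _ b]) (simp add: that(3) max_def)
    qed
    moreover have "max a b < k" using that by simp
    ultimately show False unfolding k_def using not_less_Least by blast
  qed
  obtain l where l: "k = Suc l" using j by (cases k) auto
  have j0: "j = 0"
  proof (rule ccontr)
    assume "j ~= 0"
    then obtain i where i: "j = Suc i" by (cases j) auto
    have "c l \<in> nb A (c k)" using nbc[of l] inv[of l] nbs cA l by metis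
    hence "c l = c i \<or> c l = c (Suc (Suc i))" using j nbc[of i] i by simp
    moreover have "j ~= l" using self[of l] j l by auto
    hence "j < l" using j l by simp
    ultimately have "l = Suc (Suc i)" using least[of l i] least[of l "Suc (Suc i)"] l i by auto
    thus False using cne[of j] j l i by simp
  qed
  have k3: "3 <= k"
  proof (rule ccontr)
    assume "~ 3 <= k"
    hence "k = 1 \<or> k = 2" using j by linarith
    thus False using self[of 0] cne[of 0] j j0 by (auto simp: numeral_2_eq_2)
  qed
  have nb0: "nb A (c 0) = {c 1, c l}"
  proof (rule nb2_eq[OF d2[OF cA]])
    show "c 1 \<in> nb A (c 0)" using inv[of 0] by simp
    have "c l \<in> nb A (c k)" using inv[of l] nbs cA l by metis
    thus "c l \<in> nb A (c 0)" using j j0 by simp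
    show "c 1 ~= c l" using least[of 1 l] k3 l by auto
  qed
  have closed: "j \<in> c ` {..<k}" if "j \<in> nb A (c a)" "a < k" for j a
  proof (cases a)
    case 0 thus ?thesis using that nb0 l k3 by auto
  next
    case (Suc b)
    hence "j = c b \<or> j = c (Suc (Suc b))" using that nbc by auto
    moreover have "c (Suc (Suc b)) \<in> c ` {..<k}"
    proof (cases "Suc (Suc b) = k")
      case True thus ?thesis using j j0 by (metis imageI lessThan_iff)
    next
      case False thus ?thesis using Suc that by auto
    qed
    ultimately show ?thesis using Suc that by auto
  qed
  have img: "c ` {..<k} = A"
  proof (rule ccontr)
    assume "c ` {..<k} ~= A"
    moreover have "c 0 \<in> c ` {..<k}" using k3 by auto
    ultimately have "c ` {..<k} \<subset> A" "c ` {..<k} ~= {}" using cA by auto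
    from connD[OF conn_V[OF A(1)] this] obtain u v where uv: "u \<in> c ` {..<k}" "v \<in> A - c ` {..<k}" "g u v ~= 0" by (elim bexE)
    then obtain a where "a < k" "u = c a" by auto
    moreover have "v \<in> nb A u" using uv by (auto simp: nb_def)
    ultimately show False using closed[of v a] uv by blast
  qed
  have inj: "inj_on c {..<k}" using least by (auto simp: inj_on_def)
  have kn: "k = n" using card_image[OF inj] img V_card[OF A(1)] by simp
  have ci: "(c a = c b) = (a = b)" if "a < n" "b < n" for a b using least[of a b] that kn by auto
  have gv: "g (c i) (c j) = (if i = j then 1 else if j = Suc i \<or> i = Suc j \<or> (i = 0 & j = n - 1) \<or> (j = 0 & i = n - 1) then -1/2 else 0)" if ij: "i < n" "j < n" for i j
  proof (cases "i = j")
    case True thus ?thesis using diag V_I[OF A(1) cA] by simp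
  next
    case ne: False
    have cn: "c i ~= c j" using inj ij ne kn by (auto simp: inj_on_def)
    have "c j \<in> nb A (c i) \<longleftrightarrow> (j = Suc i \<or> i = Suc j \<or> (i = 0 & j = n - 1) \<or> (j = 0 & i = n - 1))"
    proof (cases i)
      case 0
      have "c j \<in> nb A (c i) \<longleftrightarrow> c j = c 1 \<or> c j = c l" using nb0 0 by simp
      also have "\<dots> \<longleftrightarrow> j = 1 \<or> j = l" using ci[OF ij(2), of 1] ci[OF ij(2), of l] kn k3 l by simp
      also have "\<dots> \<longleftrightarrow> (j = Suc i \<or> i = Suc j \<or> (i = 0 & j = n - 1) \<or> (j = 0 & i = n - 1))" using 0 l kn k3 by arith
      finally show ?thesis .
    next
      case (Suc b)
      have cc: "c (Suc (Suc b)) = c (if Suc (Suc b) = n then 0 else Suc (Suc b))" using j j0 kn by auto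
      have "c j \<in> nb A (c i) \<longleftrightarrow> c j = c b \<or> c j = c (if Suc (Suc b) = n then 0 else Suc (Suc b))" using nbc[of b] Suc cc by auto
      also have "\<dots> \<longleftrightarrow> j = b \<or> j = (if Suc (Suc b) = n then 0 else Suc (Suc b))"
        using ci[OF ij(2), of b] ci[OF ij(2), of "if Suc (Suc b) = n then 0 else Suc (Suc b)"] ij Suc by simp
      also have "\<dots> \<longleftrightarrow> (j = Suc i \<or> i = Suc j \<or> (i = 0 & j = n - 1) \<or> (j = 0 & i = n - 1))"
        using Suc ij by (cases "Suc (Suc b) = n") auto
      finally show ?thesis .
    qed
    moreover have "c j \<in> nb A (c i) \<longleftrightarrow> g (c i) (c j) ~= 0" using cA cn by (auto simp: nb_def)
    moreover have "g (c i) (c j) = -1/2" if "g (c i) (c j) ~= 0" using cycle_V(2)[OF A cA cA, of i j] cn that by auto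
    ultimately show ?thesis using ne by auto
  qed
  have "cyc A c" unfolding cyc_def using A inj img kn gv by auto
  moreover have "c 0 = x" "c 1 = y" using p0 snd_p[of 0] by (simp_all add: c_def)
  ultimately show ?thesis by blast
qed

lemma cyc_reflect: assumes "cyc A c" shows "cyc A (\<lambda>i. if i = 0 then c 0 else c (n - i))"
proof -
  let ?r = "\<lambda>i::nat. if i = 0 then 0 else n - i"
  have e: "(\<lambda>i. if i = 0 then c 0 else c (n - i)) = c \<circ> ?r" by auto
  have r: "?r ` {..<n} = {..<n}"
  proof
    show "{..<n} \<subseteq> ?r ` {..<n}"
    proof
      fix i assume "i \<in> {..<n}"
      hence "i = ?r (?r i)" "?r i \<in> {..<n}" by auto
      thus "i \<in> ?r ` {..<n}" by blast
    qed
  qed (use n9 in auto)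
  have ir: "inj_on ?r {..<n}" by (auto simp: inj_on_def split: if_splits)
  show ?thesis unfolding e cyc_def
  proof (intro conjI allI impI)
    show "inj_on (c \<circ> ?r) {..<n}" by (rule comp_inj_on[OF ir]) (use r cycD(2)[OF assms] in simp)
    have "(c \<circ> ?r) ` {..<n} = c ` (?r ` {..<n})" by (simp only: image_comp)
    thus "(c \<circ> ?r) ` {..<n} = A" unfolding r cycD(3)[OF assms] .
    fix i j assume ij: "i < n" "j < n"
    have "?r i < n" "?r j < n" using ij by auto
    note v = cycD(5)[OF assms this]
    have e1: "(?r i = ?r j) = (i = j)" using ij by (cases "i = 0"; cases "j = 0") (simp_all, arith+)
    have e2: "(?r j = Suc (?r i) \<or> ?r i = Suc (?r j) \<or> (?r i = 0 & ?r j = n - 1) \<or> (?r j = 0 & ?r i = n - 1)) = (j = Suc i \<or> i = Suc j \<or> (i = 0 & j = n - 1) \<or> (j = 0 & i = n - 1))"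
      using ij n9 by (cases "i = 0"; cases "j = 0") (simp_all, arith+)
    show "g ((c \<circ> ?r) i) ((c \<circ> ?r) j) = (if i = j then 1 else if j = Suc i \<or> i = Suc j \<or> (i = 0 & j = n - 1) \<or> (j = 0 & i = n - 1) then -1/2 else 0)"
      using v unfolding e1 e2 by (simp only: o_apply)
  qed (use cycD(1)[OF assms] in simp)
qed

lemma lin_seq: fixes a :: "nat => real" assumes "a 0 = 0" "!!k. 1 <= k ==> k < N ==> a k = (a (k-1) + a (Suc k)) / 2" "k <= N"
  shows "a k = real k * a 1"
  using assms(3)
proof (induction k rule: less_induct)
  case (less k)
  show ?case
  proof (cases "k <= 1")
    case True thus ?thesis using assms(1) by (cases k) auto
  next
    case False
    then obtain j where j: "k = Suc (Suc j)" by (metis One_nat_def Suc_le_eq less_imp_Suc_add not_less_eq_eq add_0 not0_implies_Suc zero_less_Suc le_SucE less_Suc0)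
    have "a (Suc j) = (a j + a k) / 2" using assms(2)[of "Suc j"] less.prems j by simp
    moreover have "a (Suc j) = real (Suc j) * a 1" "a j = real j * a 1" using less.IH[of "Suc j"] less.IH[of j] less.prems j by auto
    ultimately show ?thesis using j by (simp add: algebra_simps)
  qed
qed

text \<open>Solutions of 1/p + 1/q = 1 or 1/2; the condition on the sum removes (2, 2) and (4,
  4).\<close>

lemma nat_sol: fixes p q :: nat assumes "1 <= p" "1 <= q" "9 <= p + q" "p * q = p + q \<or> p * q = 2 * (p + q)"
  shows "(p = 3 & q = 6) \<or> (p = 6 & q = 3)"
proof -
  have "3 <= p"
  proof (rule ccontr)
    assume "~ 3 <= p" hence "p = 1 \<or> p = 2" using assms by linarith
    thus False using assms by auto
  qed
  moreover have "3 <= q"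
  proof (rule ccontr)
    assume "~ 3 <= q" hence "q = 1 \<or> q = 2" using assms by linarith
    thus False using assms by auto
  qed
  ultimately obtain P Q where PQ: "p = P + 3" "q = Q + 3" by (metis le_add_diff_inverse2)
  have "p * q ~= p + q" using PQ by (simp add: algebra_simps)
  hence "p * q = 2 * (p + q)" using assms by blast
  hence e: "P * Q + P + Q = 3" using PQ by (simp add: algebra_simps)
  hence "P <= 3" by linarith
  hence "P = 0 \<or> P = 1 \<or> P = 2 \<or> P = 3" by linarith
  thus ?thesis
  proof (elim disjE)
    assume P: "P = 1"
    hence "1 * Q + 1 + Q = 3" using e by simp
    hence "Q = 1" by linarith
    thus ?thesis using PQ P assms(3) by simp
  next
    assume P: "P = 2"
    hence "2 * Q + 2 + Q = 3" using e by simp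
    thus ?thesis by presburger
  qed (use e PQ in auto)
qed

lemma cyc_nb0: assumes "cyc A c" shows "nb A (c 0) = {c 1, c (n-1)}" "ed A = 2 * n"
proof -
  note c = cycD[OF assms]
  have "nb A (c i) = c ` {j. j < n & j ~= i & (j = Suc i \<or> i = Suc j \<or> (i = 0 & j = n - 1) \<or> (j = 0 & i = n - 1))}" if i: "i < n" for i
  proof -
    have 1: "c j ~= c i \<longleftrightarrow> j ~= i" if "j < n" for j using c(2) i that by (auto simp: inj_on_def)
    have 2: "g (c i) (c j) ~= 0 \<longleftrightarrow> i = j \<or> j = Suc i \<or> i = Suc j \<or> (i = 0 & j = n - 1) \<or> (j = 0 & i = n - 1)" if "j < n" for j
      unfolding c(5)[OF i that] by simp
    have "nb A (c i) = c ` {j. j < n & c j ~= c i & g (c i) (c j) ~= 0}"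
      unfolding nb_def c(3)[symmetric] by auto
    also have "{j. j < n & c j ~= c i & g (c i) (c j) ~= 0} = {j. j < n & j ~= i & (j = Suc i \<or> i = Suc j \<or> (i = 0 & j = n - 1) \<or> (j = 0 & i = n - 1))}"
      using 1 2 by blast
    finally show ?thesis .
  qed note nbi = this
  have 0: "{j. j < n & j ~= 0 & (j = Suc 0 \<or> 0 = Suc j \<or> (0 = (0::nat) & j = n - 1) \<or> (j = 0 & 0 = n - 1))} = {1, n-1}" using n9 by auto
  show nb0: "nb A (c 0) = {c 1, c (n-1)}" using nbi[of 0] n9 unfolding 0 by auto
  show "ed A = 2 * n"
  proof (rule ccontr)
    assume "ed A ~= 2 * n"
    hence t: "ed A = 2 * n - 2" using ed_V_cases[OF c(1)] by blast
    have "2 <= dg A a" if "a \<in> A" for a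
    proof -
      have "a \<in> c ` {..<n}" using that c(3) by simp
      then obtain i where i: "i < n" "a = c i" by auto
      let ?S = "{j. j < n & j ~= i & (j = Suc i \<or> i = Suc j \<or> (i = 0 & j = n - 1) \<or> (j = 0 & i = n - 1))}"
      have "card (c ` ?S) = card ?S" by (rule card_image) (use c(2) in \<open>auto simp: inj_on_def\<close>)
      moreover have "{(if Suc i = n then 0 else Suc i), (if i = 0 then n - 1 else i - 1)} \<subseteq> ?S" using i n9 by auto
      hence "card {(if Suc i = n then 0 else Suc i), (if i = 0 then n - 1 else i - 1)} <= card ?S" by (intro card_mono) auto
      moreover have "(if Suc i = n then 0 else Suc i) ~= (if i = 0 then n - 1 else i - 1)" using i n9 by auto
      ultimately show ?thesis using nbi[OF i(1)] i by (simp add: dg_def)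
    qed
    hence "(\<Sum>a\<in>A. 2) <= (\<Sum>a\<in>A. dg A a)" by (intro sum_mono)
    thus False using t V_card[OF c(1)] n9 by (simp add: ed_def)
  qed
qed

text \<open>Without \<open>c 0\<close> the cycle is a path, and \<open>x'\<close> hangs on one of
  its nodes, \<open>c t\<close>. The positive null vector is linear along both arms and would vanish
  one step beyond their ends. Its balance at \<open>c t\<close> reads 1/t + 1/(n - t) = 2 w^2, and
  for n >= 9 the only solution is affine E8.\<close>

lemma path_label:
  assumes c: "cyc A c" and A': "insert x' (A - {c 0}) \<in> V" "x' ~: A" and tr: "ed (insert x' (A - {c 0})) ~= 2 * n"
  shows "\<exists>t\<in>{3,6}. n = 9 & g x' (c t) = -1/2 & (\<forall>j\<in>{1..<n}. j ~= t --> g x' (c j) = 0)"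
proof -
  note cD = cycD[OF c]
  have A: "A \<in> V" by (rule cD)
  have c0A: "c 0 \<in> A" using cD(4) n9 by simp
  have insA: "insert (c 0) (A - {c 0}) = A" using c0A by blast
  interpret ed: edge_diagram I g V n "A - {c 0}" "c 0" x'
    by unfold_locales (use A A' c0A insA in auto)
  interpret sw: edge_diagram I g V n "A - {c 0}" x' "c 0" by (rule ed.swap)
  have "dg A (c 0) = 2" by (rule cycle_V(1)[OF A cyc_nb0(2)[OF c] c0A])
  moreover have "nb (A - {c 0}) (c 0) = nb A (c 0)" by (auto simp: nb_def)
  ultimately have d2: "dg (A - {c 0}) (c 0) = 2" by (simp add: dg_def)
  have "ed (insert x' (A - {c 0})) = 2 * n - 2" using ed_V_cases[OF A'(1)] tr by blast
  hence "dg (A - {c 0}) x' = 1" using ed.dg_x sw.dg_x cyc_nb0(2)[OF c] d2 n9 insA by simp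
  then obtain s where s: "s \<in> A - {c 0}" "g x' s ~= 0" "!!t. t \<in> A - {c 0} ==> t ~= s ==> g x' t = 0" using sw.nb_single by metis
  then obtain t where t: "t < n" "s = c t" using cD(3) by auto
  have t0: "t ~= 0"
  proof
    assume "t = 0" thus False using s(1) t(2) by simp
  qed
  define w where "w = - g x' (c t)"
  have "x' ~= s" using s A'(2) by auto
  hence wv: "w = 1/2 \<or> w = rt" using ed.G_heavy'[of x' s] s t A'(2) by (auto simp: w_def)
  have cj: "c j \<in> A - {c 0}" if "j \<in> {1..<n}" for j
    using that cD(4)[of j] inj_onD[OF cD(2), of j 0] n9 by auto
  have z: "g x' (c j) = 0" if "j \<in> {1..<n}" "j ~= t" for j
    by (rule s(3)[OF cj[OF that(1)]]) (use that inj_onD[OF cD(2), of j t] t in auto)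
  obtain m where m: "\<forall>i\<in>insert x' (A - {c 0}). 0 < m i" "\<forall>i\<in>insert x' (A - {c 0}). (\<Sum>j\<in>insert x' (A - {c 0}). m j * g i j) = 0" using null[OF A'(1)] by blast
  have img: "A - {c 0} = c ` {1..<n}"
  proof
    show "A - {c 0} \<subseteq> c ` {1..<n}"
    proof
      fix v assume v: "v \<in> A - {c 0}"
      then obtain i where "i < n" "v = c i" using cD(3) by auto
      moreover have "i ~= 0" using v calculation by (metis Diff_iff insertI1)
      ultimately show "v \<in> c ` {1..<n}" by auto
    qed
  qed (use cj in auto)
  have injc: "inj_on c {1..<n}" using cD(2) by (auto simp: inj_on_def)
  have sumA: "(\<Sum>j\<in>insert x' (A - {c 0}). m j * F j) = m x' * F x' + (\<Sum>j=1..<n. m (c j) * F (c j))" for F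
  proof -
    have "finite (A - {c 0})" "x' ~: A - {c 0}" using V_fin[OF A] A'(2) by auto
    moreover have "(\<Sum>j\<in>A - {c 0}. m j * F j) = (\<Sum>j=1..<n. m (c j) * F (c j))" unfolding img by (rule sum.reindex[OF injc, unfolded o_def])
    ultimately show ?thesis by simp
  qed
  \<comment> \<open>The null vector along the path, continued by 0 at the positions 0 and n where
    the cycle is cut, so that the two end nodes satisfy the same relation as inner ones.\<close>
  define a where "a = (\<lambda>k. if k = 0 \<or> n <= k then 0 else m (c k))"
  have x'I: "g x' x' = 1" using diag sw.xI by simp
  have rowx: "m x' = w * a t"
  proof -
    have "m x' * g x' x' + (\<Sum>j=1..<n. m (c j) * g x' (c j)) = 0" using m(2) sumA by simp
    moreover have "(\<Sum>j=1..<n. m (c j) * g x' (c j)) = (\<Sum>j\<in>{t}. m (c j) * g x' (c j))"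
      by (rule sum.mono_neutral_right) (use t t0 z in auto)
    ultimately show ?thesis using x'I t t0 by (simp add: w_def a_def algebra_simps)
  qed
  have row: "a k = (a (k-1) + a (Suc k)) / 2 + (if k = t then w * m x' else 0)" if k: "1 <= k" "k < n" for k
  proof -
    let ?h = "\<lambda>j. if j = k then 1 else if j = Suc k \<or> k = Suc j then -1/2 else (0::real)"
    have "m x' * g (c k) x' + (\<Sum>j=1..<n. m (c j) * g (c k) (c j)) = 0" using m(2) sumA[of "g (c k)"] cj[of k] k by auto
    moreover have "(\<Sum>j=1..<n. m (c j) * g (c k) (c j)) = (\<Sum>j=1..<n. a j * ?h j)"
      by (rule sum.cong) (use cD(5)[of k] k in \<open>auto simp: a_def\<close>)
    moreover have "(\<Sum>j=1..<n. a j * ?h j) = (\<Sum>j\<in>{..n}. a j * ?h j)"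
      by (rule sum.mono_neutral_left) (auto simp: a_def)
    moreover have "(\<Sum>j\<in>{..n}. a j * ?h j) = (\<Sum>j\<in>{k-1,k,Suc k}. a j * ?h j)"
      by (rule sum.mono_neutral_right) (use k in auto)
    moreover have "(\<Sum>j\<in>{k-1,k,Suc k}. a j * ?h j) = a k - a (k-1)/2 - a (Suc k)/2" using k by (cases k) auto
    moreover have "g (c k) x' = (if k = t then - w else 0)" using z[of k] k gsym[of "c k" x'] by (auto simp: w_def)
    ultimately show ?thesis by (auto simp: field_simps)
  qed
  have a0: "a 0 = 0" "a n = 0" by (simp_all add: a_def)
  have rowL: "a k = (a (k-1) + a (Suc k)) / 2" if "1 <= k" "k < t" for k using row[of k] that t(1) by simp
  have L1: "a k = real k * a 1" if "k <= t" for k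
    by (rule lin_seq[OF a0(1) rowL that])
  have L2: "a (n - k) = real k * a (n - 1)" if "k <= n - t" for k
  proof (rule lin_seq[of "\<lambda>k. a (n - k)" "n - t" k])
    fix j assume j: "1 <= j" "j < n - t"
    have nj: "1 <= n - j" "n - j < n" "n - j ~= t" using j t(1) by arith+
    have "a (n - j) = (a (n - j - 1) + a (Suc (n - j))) / 2" using row[OF nj(1,2)] nj(3) by simp
    moreover have "Suc (n - j) = n - (j - 1)" "n - j - 1 = n - Suc j" using j by arith+
    ultimately show "a (n - j) = (a (n - (j - 1)) + a (n - Suc j)) / 2" by simp
  qed (use that a0 in simp_all)
  obtain q where q: "n = t + q" "1 <= q" using t by (metis less_imp_add_positive Suc_leI One_nat_def)
  define \<alpha> \<beta> where "\<alpha> = a 1" and "\<beta> = a (n - 1)"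
  have M: "a t = real t * \<alpha>" "a t = real q * \<beta>" using L1[of t] L2[of q] q by (simp_all add: \<alpha>_def \<beta>_def)
  have "a (t - 1) = real (t - 1) * \<alpha>" "a (Suc t) = real (q - 1) * \<beta>"
  proof -
    show "a (t - 1) = real (t - 1) * \<alpha>" using L1[of "t-1"] by (simp add: \<alpha>_def)
    have "n - (q - 1) = Suc t" using q by simp
    thus "a (Suc t) = real (q - 1) * \<beta>" using L2[of "q-1"] q by (simp add: \<beta>_def)
  qed
  moreover have "a t = (a (t-1) + a (Suc t)) / 2 + w * (w * a t)" using row[of t] rowx t t0 by auto
  moreover have "real (t - 1) * \<alpha> = a t - \<alpha>" "real (q - 1) * \<beta> = a t - \<beta>" using M t0 q by (simp_all add: of_nat_diff algebra_simps)
  ultimately have "a t = ((a t - \<alpha>) + (a t - \<beta>)) / 2 + w * (w * a t)" by metis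
  hence "\<alpha> + \<beta> = 2 * (w * (w * a t))" by (simp add: field_simps)
  hence "\<alpha> + \<beta> = 2 * (w * w) * a t" by simp
  moreover have ap: "0 < a t" using m(1) s t t0 by (auto simp: a_def)
  moreover have "\<alpha> = a t / real t" using M(1) t0 by simp
  moreover have "\<beta> = a t / real q" using M(2) q by simp
  ultimately have "a t / real t + a t / real q = 2 * (w * w) * a t" by simp
  hence "a t * (1 / real t + 1 / real q) = a t * (2 * (w * w))" by (simp add: distrib_left mult.commute)
  hence "1 / real t + 1 / real q = 2 * (w * w)" using ap by simp
  hence e: "real t + real q = 2 * (w * w) * (real t * real q)" using t0 q by (simp add: field_simps)
  have "w * w = 1/4 \<or> w * w = 1/2" using wv
  proof
    assume "w = 1/2"
    hence "w * w = (1/2) * (1/2)" by (simp only:)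
    thus ?thesis by simp
  qed (use rt_sq in simp)
  hence "2 * (real t + real q) = real t * real q \<or> real t + real q = real t * real q" using e by auto
  hence "t * q = t + q \<or> t * q = 2 * (t + q)" by (metis (mono_tags) of_nat_add of_nat_mult of_nat_eq_iff of_nat_numeral)
  hence tq: "(t = 3 & q = 6) \<or> (t = 6 & q = 3)" using nat_sol[of t q] t0 q n9 by auto
  hence n: "n = 9" "t \<in> {3,6}" using q by auto
  have "w ~= rt"
  proof
    assume "w = rt"
    hence "real t + real q = real t * real q" using e rt_sq by simp
    thus False using tq by auto
  qed
  thus ?thesis using n wv z t by (intro bexI[of _ t]) (auto simp: w_def)
qed

end

section \<open>Edges with a cyclic end vertex\<close>

context edge_diagram begin

lemma nbx_A: "nb (insert x G) x = nb G x" by (auto simp: nb_def)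

text \<open>After a reflection \<open>x'\<close> hangs on \<open>c 3\<close>. The value 0 is
  excluded because \<open>x'\<close> is orthogonal to the cycle without \<open>c 3\<close>, the
  value -1/2 by affine A4 on the five-cycle through \<open>c 1, c 2, c 3\<close>, the value
  \<open>-rt\<close> by affine F4.\<close>

lemma EL_mixed:
  assumes cy: "ed (insert x G) = 2 * n" and tr: "ed (insert x' G) ~= 2 * n" shows "g x x' < -1"
proof (rule ccontr)
  assume no: "~ ?thesis"
  have d: "dg (insert x G) x = 2" using cycle_V(1)[OF AV cy] by simp
  obtain y where "y \<in> nb (insert x G) x" using d unfolding dg_def by (metis card.empty ex_in_conv zero_neq_numeral)
  then obtain c0 where c0: "cyc (insert x G) c0" "c0 0 = x" using cyc_enum[OF AV cy, of x y] by auto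
  have GA: "insert x G - {x} = G" using xG by auto
  have x'A: "x' ~: insert x G" using xG' xx by auto
  have AV2: "insert x' (insert x G - {c0 0}) \<in> V" "ed (insert x' (insert x G - {c0 0})) ~= 2 * n" using AV' tr GA c0(2) by simp_all
  note pl = path_label[OF c0(1) AV2(1) x'A AV2(2)]
  have n: "n = 9" using pl by blast
  have "\<exists>c. cyc (insert x G) c & c 0 = x & g x' (c 3) = -1/2 & (\<forall>j\<in>{1..<n}. j ~= 3 --> g x' (c j) = 0)"
  proof -
    obtain t where t: "t \<in> {3,6}" "g x' (c0 t) = -1/2" "\<forall>j\<in>{1..<n}. j ~= t --> g x' (c0 j) = 0"
      using pl by blast
    show ?thesis
    proof (cases "t = 3")
      case True thus ?thesis using c0 t by blast
    next
      case False
      hence "t = 6" using t by auto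
      thus ?thesis using cyc_reflect[OF c0(1)] t c0 n by (intro exI[of _ "\<lambda>i. if i = 0 then c0 0 else c0 (n - i)"]) auto
    qed
  qed
  then obtain c where c: "cyc (insert x G) c" "c 0 = x" "g x' (c 3) = -1/2" and z: "!!j. 1 <= j ==> j < 9 ==> j ~= 3 ==> g x' (c j) = 0" using n by auto
  note cD = cycD[OF c(1)]
  have gv: "g (c i) (c j) = (if i = j then 1 else if j = Suc i \<or> i = Suc j \<or> (i = 0 & j = 8) \<or> (j = 0 & i = 8) then -1/2 else 0)" if "i < 9" "j < 9" for i j
    using cD(5)[of i j] that n by simp
  have cI: "c j \<in> I" if "j < 9" for j using cD(4) V_I[OF AV] that n by auto
  have z': "g (c j) x' = 0" if "1 <= j" "j < 9" "j ~= 3" for j using z[OF that] gsym[of "c j" x'] by simp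
  have c3': "g (c 3) x' = -1/2" using c(3) gsym[of "c 3" x'] by simp
  have cinj: "c i = c j \<longleftrightarrow> i = j" if "i < 9" "j < 9" for i j using cD(2) that n by (auto simp: inj_on_def)
  have cjG: "c j \<in> G" if "1 <= j" "j < 9" for j using cD(4)[of j] that n cinj[of j 0] c(2) by auto
  have xz: "g x x' = 0 \<or> g x x' = -1/2 \<or> g x x' = -rt" using g_vals[OF xI xI' xx] no by blast
  moreover have False if h: "g x x' = 0"
  proof (rule FU[of "{x'}" "insert x (G - {c 3})"])
    show "pd g {x'}" by (rule pd1[OF xI'])
    show "pd g (insert x (G - {c 3}))"
    proof (rule pdp[OF AV])
      have "c 3 \<in> insert x G - insert x (G - {c 3})" using cjG[of 3] xG by auto
      thus "insert x (G - {c 3}) \<subset> insert x G" by blast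
    qed
    have "card (insert x (G - {c 3})) = Suc (card (G - {c 3}))" using fG xG by simp
    moreover have "card (G - {c 3}) = n - 2" using cjG[of 3] fG by (simp add: cG)
    ultimately show "n <= card {x'} + card (insert x (G - {c 3}))" using n9 by simp
    fix i j assume ij: "i \<in> {x'}" "j \<in> insert x (G - {c 3})"
    show "g i j = 0"
    proof (cases "j = x")
      case True thus ?thesis using ij h gsym[of x' x] by simp
    next
      case False
      then obtain k where k: "k < 9" "j = c k" using ij cD(3) n by auto
      moreover have "k ~= 0" using k False c(2) by metis
      moreover have "k ~= 3" using k False ij by (metis Diff_iff insertE insertI1)
      ultimately show ?thesis using z[of k] ij by auto
    qed
  qed (use xI xI' GI xG' xx in auto)
  moreover have False if h: "g x x' = -1/2"
  proof (rule parab5[of x "c 1" "c 2" "c 3" x' 1 1 1 1 1])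
    show "distinct [x, c 1, c 2, c 3, x']" using cinj cjG xG xG' xx c(2) by (auto simp: cinj)
  qed (use h cI xI xI' z' c3' gv[of 0] gv[of 1] gv[of 2] c(2) in auto)
  moreover have False if h: "g x x' = -rt"
    using F4[of "c 3" x' x "c 8" "c 7"] h cI xI xI' z' z c3' gv[of 0] gv[of 3] gv[of 8] gv[of 7] c(2) gsym[of x' x] gsym[of "c 3" x]
     gv[of 3 0] by auto
  ultimately show False by blast
qed

text \<open>In \<open>B\<close> the heavy edge continues from \<open>x\<close> to \<open>r\<close>
  and from there to a single node \<open>q\<close>, an end of the path \<open>?S\<close>. As in
  \<open>T0_row\<close>, the rows of \<open>x\<close> and \<open>x'\<close> cancel against the
  all-ones vector, that of \<open>r\<close> vanishes and the others are nonnegative; so all vanish.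
  Then \<open>q\<close> is adjacent to both \<open>e1\<close> and \<open>e2\<close>, and
  \<open>x, e1, q, e2\<close> is a forbidden square.\<close>

lemma EL_cc_rt:
  assumes cy: "ed (insert x G) = 2 * n" and nbs: "nb G x = {e1,e2}" "e1 ~= e2" and eq: "!!j. j \<in> G ==> g x' j = g x j" and h: "g x x' = -rt"
    and B: "B \<in> V" "B = insert r (insert x (insert x' (G - {e1,e2})))" "r ~: insert x (insert x' (G - {e1,e2}))" and rx: "g r x ~= 0"
  shows False
proof -
  let ?S = "G - {e1,e2}"
  have eG: "e1 \<in> G" "e2 \<in> G" "g x e1 ~= 0" "g x e2 ~= 0" using nbs by (auto simp: nb_def)
  have half: "g i j = -1/2" if "i \<in> insert x G" "j \<in> insert x G" "i ~= j" "g i j ~= 0" for i j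
    using cycle_V(2)[OF AV cy that(1,2)] that by auto
  have d2: "dg (insert x G) j = 2" if "j \<in> insert x G" for j using cycle_V(1)[OF AV cy that] .
  have SG: "j \<in> G & j ~= e1 & j ~= e2 & j ~= x & j ~= x' & j \<in> I" if "j \<in> ?S" for j using that xG xG' GI' by auto
  have xS: "g x j = 0" "g x' j = 0" "g j x = 0" "g j x' = 0" if "j \<in> ?S" for j
  proof -
    have "j ~: nb G x" "j \<in> G" using that nbs by auto
    moreover have "x ~= j" using \<open>j \<in> G\<close> xG by auto
    ultimately show "g x j = 0" "g x' j = 0" using eq by (auto simp: nb_def)
    thus "g j x = 0" "g j x' = 0" using gsym[of j x] gsym[of j x'] by simp_all
  qed
  have hx: "g x' x = -rt" using h gsym[of x' x] by simp
  have rI: "r \<in> I" using B V_sub by blast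
  have r: "r ~= x" "r ~= x'" "r ~: ?S" using B(3) by auto
  have rx': "g x' r = 0" by (rule no_tri[OF B(1), of x' x r]) (use B r xx hx rt_bounds rx gsym[of x r] in auto)
  have xr: "g x r ~= 0" using rx gsym[of x r] by simp
  have vr: "g x r = -1/2"
    using heavy_value[OF B(1), of x r] B(2) r xr C2[of x' x r] xI xI' rI hx rx' by auto
  have half_rx: "g r x = -1/2" "g r x' = 0" using vr rx' gsym[of r x] gsym[of r x'] by simp_all
  obtain q where q: "q \<in> B" "q ~= x" "q ~= x'" "q ~= r" "adj x q \<or> adj x' q \<or> adj r q"
    by (rule conn_step3[OF B(1), of x x' r]) (use B(2) in auto)
  have qS: "q \<in> ?S" using q B(2) by auto
  have rq0: "g r q ~= 0" using q xS[OF qS] by auto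
  have vq: "g r j = -1/2" if "j \<in> ?S" "g r j ~= 0" for j
    using heavy_value[OF B(1), of r j] B(2) r that C3[of x' x r j] xI xI' rI hx vr rx' xS[OF that(1)] SG[OF that(1)] by auto
  have uq: "j = q" if j: "j \<in> ?S" "g r j ~= 0" for j
  proof (rule ccontr)
    assume ne: "j ~= q"
    have "r ~= j" "r ~= q" using r j qS by auto
    have "g j q = 0" by (rule no_tri[OF B(1), of j r q]) (use B(2) j qS ne rq0 \<open>r ~= j\<close> \<open>r ~= q\<close> gsym[of j r] in auto)
    thus False using B4[of j q r x x'] SG[OF j(1)] SG[OF qS] rI xI xI' vq[OF j] vq[OF qS rq0] half_rx h ne xS[OF j(1)] xS[OF qS] gsym[of j r] gsym[of q r] by auto
  qed
  have rq: "g q r = -1/2" using vq[OF qS rq0] gsym[of q r] by simp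
  have uq': "g j r = 0" if "j \<in> ?S" "j ~= q" for j using uq[of j] that gsym[of j r] by auto
  have dq: "dg (insert x G) q = 2" using d2 qS by auto
  obtain a where a: "a \<in> nb (insert x G) q" "a ~= q" by (rule two_nb[OF dq])
  obtain b where b: "b \<in> nb (insert x G) q" "b ~= a" by (rule two_nb[OF dq])
  have ab: "a \<in> G" "b \<in> G" "g q a ~= 0" "g q b ~= 0" "b ~= q" using a b xS[OF qS] by (auto simp: nb_def)
  have qend: "g q e1 ~= 0 \<or> g q e2 ~= 0"
  proof (rule ccontr)
    assume "~ ?thesis"
    hence abS: "a \<in> ?S" "b \<in> ?S" using ab by auto
    have "g a b = 0" by (rule no_tri[OF AV, of a q b]) (use ab qS a b gsym[of a q] in auto)
    moreover have "g q a = -1/2" "g q b = -1/2" using half[of q a] half[of q b] ab a qS by auto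
    ultimately show False using B5[of a b q r x x'] SG[OF abS(1)] SG[OF abS(2)] SG[OF qS] rI xI xI' rq half_rx h b(2) uq'[OF abS(1)] uq'[OF abS(2)] a(2) ab(5) xS[OF abS(1)] xS[OF abS(2)] xS[OF qS] gsym[of a q] gsym[of b q] by auto
  qed
  have fS: "finite ?S" using fG by simp
  have sumB: "(\<Sum>j\<in>B. F j) = F r + F x + F x' + (\<Sum>j\<in>?S. F j)" for F :: "'a => real"
    using B(2,3) fS xG xG' xx by (auto simp: algebra_simps)
  obtain m where m0: "(\<forall>i\<in>B. 0 < m i) & (\<forall>i\<in>B. (\<Sum>j\<in>B. m j * g i j) = 0) & (\<Sum>j\<in>B. m j * (\<Sum>i\<in>B. g j i)) = 0"
    using null_rows[OF B(1)] by (rule exE)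
  have xB: "x' \<in> B" using B(2) by auto
  have mx': "m x' = rt * m x"
  proof -
    have "(\<Sum>j\<in>B. m j * g x' j) = 0" using m0 xB by blast
    thus ?thesis unfolding sumB using rx' hx diag[OF xI'] xS by simp
  qed
  have g1: "g x x = 1" "g x' x' = 1" "g r r = 1" using diag xI xI' rI by auto
  have Rx': "(\<Sum>i\<in>B. g x' i) = 1 - rt" unfolding sumB using rx' hx g1 xS by simp
  have Rx: "(\<Sum>i\<in>B. g x i) = 1/2 - rt" unfolding sumB using vr h g1 xS by simp
  have Rr: "(\<Sum>i\<in>B. g r i) = 0"
  proof -
    have "(\<Sum>j\<in>?S. g r j) = (\<Sum>j\<in>{q}. g r j)" by (rule sum.mono_neutral_right) (use fS qS uq in auto)
    thus ?thesis unfolding sumB using half_rx g1 vq[OF qS rq0] by simp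
  qed
  have sumA: "(\<Sum>j\<in>insert x G. F j) = F x + F e1 + F e2 + (\<Sum>j\<in>?S. F j)" for F :: "'a => real"
  proof -
    have "G = insert e1 (insert e2 ?S)" using eG by auto
    hence "(\<Sum>j\<in>G. F j) = F e1 + F e2 + (\<Sum>j\<in>?S. F j)" using fS nbs(2) by (metis (no_types, lifting) Diff_iff add.assoc finite_insert insert_iff sum.insert)
    thus ?thesis using fG xG by simp
  qed
  have RS: "(\<Sum>i\<in>B. g j i) = - g j e1 - g j e2 + g j r" if "j \<in> ?S" for j
  proof -
    have "(\<Sum>i\<in>insert x G. g j i) = 0" by (rule cycle_row[OF AV d2]) (use that in auto)
    thus ?thesis unfolding sumA sumB using xS[OF that] by simp
  qed
  have le: "g j e1 = 0 \<or> g j e1 = -1/2" "g j e2 = 0 \<or> g j e2 = -1/2" if "j \<in> ?S" for j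
    using half[of j e1] half[of j e2] that eG by auto
  have RSn: "0 <= (\<Sum>i\<in>B. g j i)" if "j \<in> ?S" for j
  proof (cases "j = q")
    case True thus ?thesis using RS[OF that] le[OF that] qend rq by auto
  next
    case False thus ?thesis using RS[OF that] le[OF that] uq'[OF that] by auto
  qed
  have "(\<Sum>j\<in>B. m j * (\<Sum>i\<in>B. g j i)) = 0" using m0 by blast
  hence "m r * 0 + m x * (1/2 - rt) + m x' * (1 - rt) + (\<Sum>j\<in>?S. m j * (\<Sum>i\<in>B. g j i)) = 0"
    by (subst (asm) sumB) (simp add: Rr Rx Rx')
  moreover have "m x * (1/2 - rt) + m x' * (1 - rt) = 0" unfolding mx' by (simp add: algebra_simps rt_sq rt_sq_left)
  ultimately have s0: "(\<Sum>j\<in>?S. m j * (\<Sum>i\<in>B. g j i)) = 0" by simp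
  have nn: "0 <= m j * (\<Sum>i\<in>B. g j i)" if "j \<in> ?S" for j
    using RSn[OF that] m0 that B(2) by (intro mult_nonneg_nonneg) (auto intro: less_imp_le)
  have zero: "(\<Sum>i\<in>B. g j i) = 0" if "j \<in> ?S" for j
  proof -
    have "m j * (\<Sum>i\<in>B. g j i) = 0" using sum_nonneg_eq_0_iff[OF fS, of "\<lambda>j. m j * (\<Sum>i\<in>B. g j i)"] nn s0 that by blast
    moreover have "0 < m j" using m0 that B(2) by blast
    ultimately show ?thesis by auto
  qed
  have ee: "g e1 e2 = 0" by (rule no_tri[OF AV, of e1 x e2]) (use eG xG nbs gsym[of e1 x] in auto)
  have fq: "\<exists>f\<in>?S. g f e ~= 0 & f = q" if e: "e \<in> {e1,e2}" for e
  proof -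
    have "dg (insert x G) e = 2" using d2 e eG by auto
    then obtain f where f: "f \<in> nb (insert x G) e" "f ~= x" by (rule two_nb)
    have "f ~= e1" "f ~= e2" using f e ee gsym[of e2 e1] by (auto simp: nb_def)
    hence fS': "f \<in> ?S" "g f e ~= 0" using f gsym[of f e] by (auto simp: nb_def)
    have "f = q"
    proof (rule ccontr)
      assume "f ~= q"
      hence "- g f e1 - g f e2 = 0" using zero[OF fS'(1)] RS[OF fS'(1)] uq'[OF fS'(1)] by simp
      thus False using le[OF fS'(1)] fS'(2) e by auto
    qed
    thus ?thesis using fS' by blast
  qed
  have "g q e1 ~= 0" "g q e2 ~= 0" using fq[of e1] fq[of e2] by auto
  hence "g x e2 = 0" by (intro no_sq[OF AV, of x e1 q e2]) (use eG qS xG nbs gsym[of e1 q] in auto)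
  thus False using eG by simp
qed

text \<open>Two cycles through \<open>G\<close> give \<open>x\<close> and \<open>x'\<close> the same
  neighbours. A square or a triangle excludes 0 and -1/2. For \<open>-rt\<close>, the pair
  \<open>x, x'\<close> and \<open>G\<close> without their neighbours form n - 1 elliptic nodes,
  which one node \<open>r\<close> completes to a vertex.\<close>

lemma EL_cc:
  assumes cy: "ed (insert x G) = 2 * n" and cy': "ed (insert x' G) = 2 * n" shows "g x x' < -1"
proof (rule ccontr)
  assume no: "~ ?thesis"
  have half: "g i j = -1/2" if "i \<in> insert x G" "j \<in> insert x G" "i ~= j" "g i j ~= 0" for i j
    using cycle_V(2)[OF AV cy that(1,2)] that by auto
  have half': "g i j = -1/2" if "i \<in> insert x' G" "j \<in> insert x' G" "i ~= j" "g i j ~= 0" for i j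
    using cycle_V(2)[OF AV' cy' that(1,2)] that by auto
  have eq: "g x' j = g x j" if j: "j \<in> G" for j
  proof -
    have "j ~= x" "j ~= x'" using j xG xG' by auto
    have "2 = dg G j + (if g j x ~= 0 then 1 else 0)" using cycle_V(1)[OF AV cy, of j] dg_insert[OF fG xG \<open>j ~= x\<close>] j by simp
    moreover have "2 = dg G j + (if g j x' ~= 0 then 1 else 0)" using cycle_V(1)[OF AV' cy', of j] dg_insert[OF fG xG' \<open>j ~= x'\<close>] j by simp
    ultimately have "g j x ~= 0 \<longleftrightarrow> g j x' ~= 0" by (cases "g j x = 0"; cases "g j x' = 0") simp_all
    thus ?thesis using half[of x j] half'[of x' j] j \<open>j ~= x\<close> \<open>j ~= x'\<close> gsym[of j x] gsym[of j x'] by auto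
  qed
  have "dg (insert x G) x = 2" using cycle_V(1)[OF AV cy] by simp
  hence d: "dg G x = 2" by (simp add: dg_def nbx_A)
  obtain e1 where e1: "e1 \<in> nb G x" using d unfolding dg_def by (metis card.empty ex_in_conv zero_neq_numeral)
  obtain e2 where e2: "e2 \<in> nb G x" "e2 ~= e1" by (rule two_nb[OF d])
  have nbs: "nb G x = {e1,e2}" using nb2_eq[OF d e1 e2(1)] e2(2) by auto
  have eG: "e1 \<in> G" "e2 \<in> G" "g x e1 ~= 0" "g x e2 ~= 0" "e1 ~= x" "e2 ~= x" "e1 ~= x'" "e2 ~= x'" using e1 e2 xG xG' by (auto simp: nb_def)
  have v: "g x e1 = -1/2" "g x e2 = -1/2" "g x' e1 = -1/2" "g x' e2 = -1/2" using half[of x e1] half[of x e2] eG eq by auto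
  have I: "e1 \<in> I" "e2 \<in> I" using eG GI' by auto
  have ee: "g e1 e2 = 0" by (rule no_tri[OF AV, of e1 x e2]) (use eG xG e2 gsym[of e1 x] in auto)
  have "g x x' = 0 \<or> g x x' = -1/2 \<or> g x x' = -rt" using g_vals[OF xI xI' xx] no by blast
  moreover have False if h: "g x x' = 0"
    by (rule parab4[of x e1 x' e2 1 1 1 1]) (use h v ee I xI xI' eG e2 xx gsym[of e1 x'] in auto)
  moreover have False if h: "g x x' = -1/2"
    by (rule parab3[of x e1 x' 1 1 1]) (use h v I xI xI' eG xx gsym[of e1 x'] in auto)
  moreover have False if h: "g x x' = -rt"
  proof -
    let ?S = "G - {e1,e2}"
    have z: "g x j = 0" "g x' j = 0" "g j x = 0" "g j x' = 0" if "j \<in> ?S" for j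
    proof -
      have "j ~: nb G x" "j \<in> G" using that nbs by auto
      thus "g x j = 0" "g x' j = 0" using eq xG by (auto simp: nb_def)
      thus "g j x = 0" "g j x' = 0" using gsym[of j x] gsym[of j x'] by simp_all
    qed
    let ?E = "insert x (insert x' ?S)"
    have EI: "?E \<subseteq> I" using xI xI' GI by auto
    have fS: "finite ?S" using fG by simp
    have "pd g ({x,x'} \<union> ?S)"
      by (rule pd_Un[OF pd2 G_pd]) (use xI xI' xx h rt_bounds fS xG xG' z in auto)
    hence "pd g ?E" by simp
    then obtain B where B: "B \<in> V" "?E \<subseteq> B" using ell[OF EI] by blast
    have "card ?S = n - 3" using eG e2 fG cG by (simp add: card_Diff_subset)
    hence cE: "card ?E = n - 1" using fS xG xG' xx n9 by simp
    have "card (B - ?E) = 1" using cE B V_card V_fin n9 fS by (simp add: card_Diff_subset)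
    then obtain r where "B - ?E = {r}" by (rule card_1_singletonE)
    hence Br: "B = insert r ?E" "r ~: ?E" using B by auto
    have Br': "B = insert r (insert x' (insert x ?S))" "r ~: insert x' (insert x ?S)" using Br by auto
    obtain q where q: "q \<in> B" "q ~= x" "q ~= x'" "adj x q \<or> adj x' q"
      by (rule conn_step3[OF B(1), of x x' x']) (use B(2) in auto)
    have "q = r" using q Br z by auto
    hence "g r x ~= 0 \<or> g r x' ~= 0" using q gsym[of r x] gsym[of r x'] by auto
    thus False
    proof
      assume "g r x ~= 0" thus False using EL_cc_rt[OF cy nbs e2(2)[symmetric] eq h B(1) Br] by blast
    next
      interpret sw: edge_diagram I g V n G x' x by (rule swap)
      have "nb G x' = nb G x" using eq xG xG' by (auto simp: nb_def)
      hence nbs': "nb G x' = {e1,e2}" using nbs by simp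
      have h': "g x' x = -rt" using h gsym[of x' x] by simp
      assume "g r x' ~= 0" thus False using sw.EL_cc_rt[OF cy' nbs' e2(2)[symmetric] eq[symmetric] h' B(1) Br'] by blast
    qed
  qed
  ultimately show False by blast
qed

text \<open>All that the 2-faces use about edges: a cyclic end forces a dotted pair, and an undotted
  pair has label 4 and is not attached as a leaf.\<close>

theorem edge: "g x x' < -1 \<or> (g x x' = -rt & 2 <= dg G x & 2 <= dg G x' & ed (insert x G) ~= 2 * n & ed (insert x' G) ~= 2 * n)"
proof (cases "ed (insert x G) = 2 * n")
  case True
  thus ?thesis using EL_mixed EL_cc by blast
next
  case t: False
  show ?thesis
  proof (cases "ed (insert x' G) = 2 * n")
    case True
    thus ?thesis using edge_diagram.EL_mixed[OF swap True t] gsym[of x x'] by simp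
  next
    case False
    interpret te: tree_edge I g V n G x x' by unfold_locales (use t False in auto)
    show ?thesis using te.edge_tree te.dg_x' t False by auto
  qed
qed

end

section \<open>Timelike sets of facets\<close>

context ideal_diagram begin

lemma bil_rows:
  assumes "X \<subseteq> I" "Y \<subseteq> I" "!!i. i ~: X ==> c i = 0" "!!i. i ~: Y ==> d i = 0"
  shows "bil g I c d = (\<Sum>i\<in>X. c i * (\<Sum>j\<in>Y. d j * g i j))"
proof -
  have "bil g I c d = (\<Sum>i\<in>I. c i * (\<Sum>j\<in>I. d j * g i j))" by (simp add: bil_def sum_distrib_left mult.assoc)
  also have "\<dots> = (\<Sum>i\<in>X. c i * (\<Sum>j\<in>I. d j * g i j))"
    by (rule sum.mono_neutral_right) (use assms finI in auto)
  also have "\<dots> = (\<Sum>i\<in>X. c i * (\<Sum>j\<in>Y. d j * g i j))"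
    by (rule sum.cong[OF refl], rule arg_cong[where f="(*) _"], rule sum.mono_neutral_right) (use assms finI in auto)
  finally show ?thesis .
qed

text \<open>The normals in \<open>X\<close> span a timelike vector; two mutually orthogonal sets of
  this kind contradict \<open>lor\<close>.\<close>

definition tl where "tl X \<longleftrightarrow> X \<subseteq> I & (\<exists>c. (\<forall>i. i ~: X --> c i = 0) & bil g I c c < 0)"

lemma tl_orth: assumes "tl X" "tl Y" "!!i j. i \<in> X ==> j \<in> Y ==> g i j = 0" shows False
proof -
  obtain c where c: "!!i. i ~: X ==> c i = 0" "bil g I c c < 0" and X: "X \<subseteq> I" using assms(1) unfolding tl_def by blast
  obtain d where d: "!!i. i ~: Y ==> d i = 0" "bil g I d d < 0" and Y: "Y \<subseteq> I" using assms(2) unfolding tl_def by blast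
  have "bil g I c d = (\<Sum>i\<in>X. c i * (\<Sum>j\<in>Y. d j * g i j))" by (rule bil_rows) (use X Y c d in auto)
  also have "\<dots> = 0" using assms(3) by simp
  finally have "bil g I c c * bil g I d d <= 0" using lor[OF c(2), of d] by simp
  thus False using c(2) d(2) mult_neg_neg[of "bil g I c c" "bil g I d d"] by linarith
qed

lemma tl_mono: "tl X ==> X \<subseteq> Y ==> Y \<subseteq> I ==> tl Y" unfolding tl_def by blast

lemma tl_ones: assumes "X \<subseteq> I" "(\<Sum>i\<in>X. \<Sum>j\<in>X. g i j) < 0" shows "tl X"
proof -
  define c where "c = (\<lambda>i. if i \<in> X then 1 else (0::real))"
  have "bil g I c c = (\<Sum>i\<in>X. c i * (\<Sum>j\<in>X. c j * g i j))" by (rule bil_rows) (use assms in \<open>auto simp: c_def\<close>)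
  also have "\<dots> = (\<Sum>i\<in>X. \<Sum>j\<in>X. g i j)" by (simp add: c_def)
  finally show ?thesis unfolding tl_def using assms by (intro conjI exI[of _ c]) (auto simp: c_def)
qed

lemma tl_dotted: assumes "a \<in> I" "b \<in> I" "a ~= b" "g a b < -1" shows "tl {a,b}"
  by (rule tl_ones) (use assms diag gsym[of b a] in auto)

lemma sum3s: "a ~= b ==> a ~= c ==> b ~= c ==>
  (\<Sum>j\<in>{a,b,c}. F j) = F a + F b + (F c :: real)"
  by simp

text \<open>A cycle of label 3 edges has value 0 at the all-ones vector, so one label 4 makes the
  value negative. The same holds for lengths 4 and 5 and for cycles in general.\<close>

lemma tl3: assumes "a \<in> I" "b \<in> I" "c \<in> I" "distinct [a,b,c]" "g a b = -rt" "g b c <= -1/2" "g a c <= -1/2" shows "tl {a,b,c}"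
proof (rule tl_ones)
  have d: "a ~= b" "a ~= c" "b ~= c" using assms(4) by auto
  have e: "g a a = 1" "g b b = 1" "g c c = 1" using assms diag by auto
  show "(\<Sum>i\<in>{a,b,c}. \<Sum>j\<in>{a,b,c}. g i j) < 0"
    unfolding sum3s[OF d] using assms(5-) e  rt_bounds gsym[of b a] gsym[of c a] gsym[of c b] by linarith
  show "{a,b,c} \<subseteq> I" using assms by simp
qed

lemma sum4s: "a ~= b ==> a ~= c ==> a ~= d ==> b ~= c ==> b ~= d ==> c ~= d ==>
  (\<Sum>j\<in>{a,b,c,d}. F j) = F a + F b + F c + (F d :: real)"
  by simp

lemma tl4: assumes "a \<in> I" "b \<in> I" "c \<in> I" "d \<in> I" "distinct [a,b,c,d]" "g a b = -rt" "g b c <= -1/2" "g c d <= -1/2" "g a d <= -1/2" shows "tl {a,b,c,d}"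
proof (rule tl_ones)
  have d: "a ~= b" "a ~= c" "a ~= d" "b ~= c" "b ~= d" "c ~= d" using assms(5) by auto
  have e: "g a a = 1" "g b b = 1" "g c c = 1" "g d d = 1" using assms diag by auto
  have l: "g a c <= 0" "g b d <= 0" by (rule g_le0; fact assms d)+
  show "(\<Sum>i\<in>{a,b,c,d}. \<Sum>j\<in>{a,b,c,d}. g i j) < 0"
    unfolding sum4s[OF d] using assms(6-) e l rt_bounds gsym[of b a] gsym[of c a] gsym[of d a] gsym[of c b] gsym[of d b] gsym[of d c] by linarith
  show "{a,b,c,d} \<subseteq> I" using assms by simp
qed

lemma sum5s: "a ~= b ==> a ~= c ==> a ~= d ==> a ~= e ==> b ~= c ==> b ~= d ==> b ~= e ==> c ~= d ==> c ~= e ==> d ~= e ==>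
  (\<Sum>j\<in>{a,b,c,d,e}. F j) = F a + F b + F c + F d + (F e :: real)"
  by simp

lemma tl5: assumes "a \<in> I" "b \<in> I" "c \<in> I" "d \<in> I" "e \<in> I" "distinct [a,b,c,d,e]" "g a b = -rt" "g b c <= -1/2" "g c d <= -1/2" "g d e <= -1/2" "g a e <= -1/2" shows "tl {a,b,c,d,e}"
proof (rule tl_ones)
  have d: "a ~= b" "a ~= c" "a ~= d" "a ~= e" "b ~= c" "b ~= d" "b ~= e" "c ~= d" "c ~= e" "d ~= e" using assms(6) by auto
  have e: "g a a = 1" "g b b = 1" "g c c = 1" "g d d = 1" "g e e = 1" using assms diag by auto
  have l: "g a c <= 0" "g a d <= 0" "g b d <= 0" "g b e <= 0" "g c e <= 0" by (rule g_le0; fact assms d)+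
  show "(\<Sum>i\<in>{a,b,c,d,e}. \<Sum>j\<in>{a,b,c,d,e}. g i j) < 0"
    unfolding sum5s[OF d] using assms(7-) e l rt_bounds gsym[of b a] gsym[of c a] gsym[of d a] gsym[of e a] gsym[of c b] gsym[of d b] gsym[of e b] gsym[of d c] gsym[of e c] gsym[of e d] by linarith
  show "{a,b,c,d,e} \<subseteq> I" using assms by simp
qed

lemma tl_cycle:
  assumes W: "W \<subseteq> I" "!!i. i \<in> W ==> dg W i = 2" and uv: "u \<in> W" "v \<in> W" "u ~= v" "g u v = -rt"
  shows "tl W"
proof (rule tl_ones[OF W(1)])
  have fW: "finite W" using W fin_sub by blast
  have row: "(\<Sum>j\<in>W. g i j) = 1 + (\<Sum>j\<in>nb W i. g i j)" if i: "i \<in> W" for i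
  proof -
    have "(\<Sum>j\<in>W. g i j) = g i i + (\<Sum>j\<in>W-{i}. g i j)" using fW i by (simp add: sum.remove)
    also have "(\<Sum>j\<in>W-{i}. g i j) = (\<Sum>j\<in>nb W i. g i j)"
      by (rule sum.mono_neutral_right) (use fW in \<open>auto simp: nb_def\<close>)
    finally show ?thesis using diag i W by auto
  qed
  have le: "g i j <= -1/2" if "i \<in> W" "j \<in> nb W i" for i j using g_half[of i j] that W by (auto simp: nb_def)
  have row0: "(\<Sum>j\<in>W. g i j) <= 0" if i: "i \<in> W" for i
  proof -
    have "(\<Sum>j\<in>nb W i. g i j) <= (\<Sum>j\<in>nb W i. -1/2)" by (rule sum_mono) (rule le[OF i])
    thus ?thesis using row[OF i] W(2)[OF i] by (simp add: dg_def)
  qed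
  have "v \<in> nb W u" using uv rt_bounds by (auto simp: nb_def)
  hence "(\<Sum>j\<in>nb W u. g u j) < (\<Sum>j\<in>nb W u. -1/2)"
    by (intro sum_strict_mono_ex1) (use le[OF uv(1)] fW finite_nb uv rt_bounds in \<open>auto intro!: bexI[of _ v]\<close>)
  hence "(\<Sum>j\<in>W. g u j) < 0" using row[OF uv(1)] W(2)[OF uv(1)] by (simp add: dg_def)
  hence "(\<Sum>i\<in>W. \<Sum>j\<in>W. g i j) < (\<Sum>i\<in>W. 0)"
    by (intro sum_strict_mono_ex1) (use row0 fW uv in auto)
  thus "(\<Sum>i\<in>W. \<Sum>j\<in>W. g i j) < 0" by simp
qed

text \<open>To be read as "\<open>x\<close> touches the component of \<open>k\<close>";
  \<open>S\<close> will be the set of n - 2 facets through a 2-face.\<close>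

definition tch where "tch S x k \<longleftrightarrow> (\<exists>s\<in>rch S k. g x s ~= 0)"

lemma pair_unique:
  assumes "insert x (insert y S) \<in> V" "x ~: S" "x ~= y" "ed (insert x (insert y S)) ~= 2 * n"
    "k \<in> S" "s \<in> rch S k" "t \<in> rch S k" "g x s ~= 0" "g x t ~= 0"
  shows "s = t"
  by (rule nb_unique[OF assms(1) _ rch_conn[OF assms(5)], of x]) (use assms rch_sub[OF assms(5)] gsym[of s x] gsym[of t x] in auto)

lemma pair_or:
  assumes "insert x (insert y S) \<in> V" "x ~: S" "y ~: S" "k \<in> S" shows "tch S x k \<or> tch S y k"
proof -
  have "rch S k \<subset> insert x (insert y S)" "rch S k ~= {}" using rch_sub[OF assms(4)] assms(2) rch_self[of k S] by blast+
  from connD[OF conn_V[OF assms(1)] this] obtain i j where ij: "i \<in> rch S k" "j \<in> insert x (insert y S) - rch S k" "g i j ~= 0" by (elim bexE)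
  have "j = x \<or> j = y" using ij rch_sep(1)[OF assms(4)] by blast
  thus ?thesis using ij gsym[of i j] unfolding tch_def by auto
qed

text \<open>Two components touched by both \<open>x\<close> and \<open>y\<close> would give a tree
  vertex too many edges, whether or not \<open>x\<close> and \<open>y\<close> are adjacent.\<close>

lemma pair_uni:
  assumes A: "insert x (insert y S) \<in> V" and xy: "x ~: S" "y ~: S" "x ~= y" and t: "ed (insert x (insert y S)) ~= 2 * n"
    and k: "k \<in> S" "tch S x k" "tch S y k" and k': "k' \<in> S" "tch S x k'" "tch S y k'"
  shows "rch S k = rch S k'"
proof (rule ccontr)
  assume ne: "rch S k ~= rch S k'"
  let ?K = "rch S k" and ?K' = "rch S k'"
  have dj: "?K \<inter> ?K' = {}"
  proof (rule ccontr)
    assume "~ ?thesis"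
    then obtain j where "j \<in> ?K" "j \<in> ?K'" by blast
    hence "rch S j = ?K" "rch S j = ?K'" using rch_eq[OF k(1)] rch_eq[OF k'(1)] by blast+
    thus False using ne by simp
  qed
  have sub: "?K \<subseteq> S" "?K' \<subseteq> S" using rch_sub k k' by auto
  have fS: "finite S" using V_fin[OF A] by simp
  have f: "finite ?K" "finite ?K'" using sub fS finite_subset by auto
  have orth: "g i j = 0" if "i \<in> ?K" "j \<in> ?K'" for i j using rch_sep(1)[OF k(1) that(1), of j] that sub dj by blast
  have two: "2 <= dg (?K \<union> ?K') u" if u: "u ~: S" and tt: "tch S u k" "tch S u k'" for u
  proof -
    have ne: "?K' \<subseteq> S" "?K \<subseteq> S" using sub by auto
    have 1: "1 <= dg T u" if "s \<in> T" "g u s ~= 0" "T \<subseteq> S" for T s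
    proof -
      have "s \<in> nb T u" using that u by (auto simp: nb_def)
      moreover have "finite (nb T u)" using that fS finite_subset finite_nb by blast
      ultimately show ?thesis unfolding dg_def by (metis One_nat_def Suc_leI card_gt_0_iff empty_iff)
    qed
    have "1 <= dg ?K u" "1 <= dg ?K' u" using 1 tt sub unfolding tch_def by blast+
    thus ?thesis using dg_Un[OF f dj] by simp
  qed
  let ?T = "insert x (insert y (?K \<union> ?K'))"
  have n: "x ~: insert y (?K \<union> ?K')" "y ~: ?K \<union> ?K'" using xy sub by auto
  have TA: "?T \<subseteq> insert x (insert y S)" using sub by blast
  have "ed ?T + 2 <= 2 * card ?T" by (rule forest[OF A t TA]) simp
  moreover have "card ?T = card ?K + card ?K' + 2" using n f dj by (simp add: card_Un_disjoint)
  moreover have "ed ?T = ed (insert y (?K \<union> ?K')) + 2 * dg (insert y (?K \<union> ?K')) x" using ed_insert n f by simp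
  moreover have "dg (?K \<union> ?K') x <= dg (insert y (?K \<union> ?K')) x" unfolding dg_def by (rule card_mono) (use f finite_nb in \<open>auto simp: nb_def\<close>)
  moreover have "ed (insert y (?K \<union> ?K')) = ed (?K \<union> ?K') + 2 * dg (?K \<union> ?K') y" using ed_insert n f by simp
  moreover have "ed (?K \<union> ?K') = ed ?K + ed ?K'" by (rule ed_Un[OF f dj]) (rule orth)
  moreover have "2 * card ?K <= ed ?K + 2" "2 * card ?K' <= ed ?K' + 2"
    using conn_ed[OF rch_conn[OF k(1)] f(1)] conn_ed[OF rch_conn[OF k'(1)] f(2)] rch_self[of k S] rch_self[of k' S] by auto
  moreover note two[OF xy(1) k(2) k'(2)] two[OF xy(2) k(3) k'(3)]
  ultimately show False by linarith
qed

text \<open>There is a cycle among these nodes. It lies in neither of the two tree vertices, so it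
  contains both \<open>x\<close> and \<open>y\<close> and therefore the heavy edge between
  them.\<close>

lemma tl_comp:
  assumes A: "insert x (insert w S) \<in> V" "insert y (insert w S) \<in> V" and t: "ed (insert x (insert w S)) ~= 2 * n" "ed (insert y (insert w S)) ~= 2 * n"
    and ne: "x ~: S" "y ~: S" "x ~= y" "g x y = -rt" and k: "k \<in> S" "tch S x k" "tch S y k"
  shows "tl (insert x (insert y (rch S k)))"
proof -
  let ?K = "rch S k"
  have sub: "?K \<subseteq> S" using rch_sub k by auto
  have fS: "finite S" using V_fin[OF A(1)] by simp
  have f: "finite ?K" using sub fS finite_subset by auto
  have I: "x \<in> I" "y \<in> I" "S \<subseteq> I" using V_sub A by auto
  have n: "x ~: insert y ?K" "y ~: ?K" using ne sub by auto
  have 1: "1 <= dg ?K u" if u: "u ~: S" "tch S u k" for u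
  proof -
    obtain s where "s \<in> ?K" "g u s ~= 0" using u unfolding tch_def by blast
    hence "s \<in> nb ?K u" using u sub by (auto simp: nb_def)
    thus ?thesis using finite_nb[OF f] unfolding dg_def by (metis One_nat_def Suc_leI card_gt_0_iff empty_iff)
  qed
  let ?T = "insert x (insert y ?K)"
  have TI: "?T \<subseteq> I" using I sub by auto
  have "ed ?T = ed (insert y ?K) + 2 * dg (insert y ?K) x" using ed_insert n f by simp
  moreover have "dg (insert y ?K) x = dg ?K x + 1" using dg_insert[OF f n(2), of x] ne rt_bounds by simp
  moreover have "ed (insert y ?K) = ed ?K + 2 * dg ?K y" using ed_insert n f by simp
  moreover have "2 * card ?K <= ed ?K + 2" using conn_ed[OF rch_conn[OF k(1)] f] rch_self[of k S] by auto
  moreover have "card ?T = card ?K + 2" using n f by simp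
  ultimately have "2 * card ?T <= ed ?T" using 1[OF ne(1) k(2)] 1[OF ne(2) k(3)] by linarith
  from ex_cycle[OF TI insert_not_empty this] obtain W where W0: "W \<subseteq> ?T & W ~= {} & (\<forall>i\<in>W. dg W i = 2)" by (rule exE)
  hence W: "W \<subseteq> ?T" "W ~= {}" "!!i. i \<in> W ==> dg W i = 2" by simp_all
  have eW: "ed W = 2 * card W" using W(3) by (simp add: ed_def)
  have "~ W \<subseteq> insert x (insert w S)" using forest[OF A(1) t(1) _ W(2)] eW by auto
  hence y: "y \<in> W" using W(1) sub by blast
  have "~ W \<subseteq> insert y (insert w S)" using forest[OF A(2) t(2) _ W(2)] eW by auto
  hence x: "x \<in> W" using W(1) sub by blast
  have "W \<subseteq> I" using W(1) TI by blast
  hence "tl W" by (rule tl_cycle[OF _ W(3) x y ne(3,4)])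
  thus ?thesis using tl_mono W(1) TI by blast
qed

lemma null_scaled: assumes "A \<in> V" "x \<in> A"
  shows "\<exists>m. (\<forall>i\<in>A. 0 < m i) & (\<forall>i\<in>A. (\<Sum>j\<in>A. m j * g i j) = 0) & m x = 1"
proof -
  obtain m where m: "\<forall>i\<in>A. 0 < m i" "\<forall>i\<in>A. (\<Sum>j\<in>A. m j * g i j) = 0" using null[OF assms(1)] by blast
  have p: "0 < m x" using m assms by blast
  have "(\<Sum>j\<in>A. m j / m x * g i j) = (\<Sum>j\<in>A. m j * g i j) / m x" for i by (simp add: sum_divide_distrib)
  thus ?thesis using m p by (intro exI[of _ "\<lambda>j. m j / m x"]) auto
qed

lemma s0: "(!!j. j \<in> T ==> g i j = 0) ==> (\<Sum>j\<in>T. m j * g i j) = 0" by (rule sum.neutral) auto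
lemma s1: "finite T ==> a \<in> T ==> (!!j. j \<in> T ==> j ~= a ==> g i j = 0) ==> (\<Sum>j\<in>T. m j * g i j) = m a * g i a"
  by (rule trans[OF sum.mono_neutral_right[of T "{a}"]]) auto

lemma sum4: "finite T ==> a ~: T ==> b ~: T ==> c ~: T ==> d ~: T ==> a ~= b ==> a ~= c ==> a ~= d ==> b ~= c ==> b ~= d ==> c ~= d ==>
  (\<Sum>j\<in>insert a (insert b (insert c (insert d T))). F j) = F a + F b + F c + F d + (\<Sum>j\<in>T. F j :: real)"
  by simp
text \<open>Green's identity. It relates two null vectors on a common piece of the diagram whose
  shape is unknown.\<close>

lemma green: assumes "!!i. i \<in> T ==> (\<Sum>j\<in>T. u j * g i j) = p i" "!!i. i \<in> T ==> (\<Sum>j\<in>T. v j * g i j) = q i"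
  shows "(\<Sum>i\<in>T. v i * p i) = (\<Sum>i\<in>T. u i * q i)"
proof -
  have "(\<Sum>i\<in>T. v i * p i) = (\<Sum>i\<in>T. \<Sum>j\<in>T. v i * (u j * g i j))" using assms(1) by (simp add: sum_distrib_left[symmetric])
  also have "\<dots> = (\<Sum>j\<in>T. \<Sum>i\<in>T. v i * (u j * g i j))" by (rule sum.swap)
  also have "\<dots> = (\<Sum>j\<in>T. u j * (\<Sum>i\<in>T. v i * g j i))" by (simp add: sum_distrib_left gsym mult_ac)
  also have "\<dots> = (\<Sum>i\<in>T. u i * q i)" using assms(2) by simp
  finally show ?thesis .
qed

end

section \<open>Quadrangles with orthogonal tree corners: the critical configuration\<close>

text \<open>The side facets of the quadrangle are \<open>x1, x2, x3, x4\<close> in cyclic order. The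
  nodes of the 2-face fall into \<open>K\<close>, touched by \<open>x1, x2, x3\<close> at
  \<open>s1, t2, s3\<close>, into \<open>K'\<close>, touched by \<open>x1, x3, x4\<close> at
  \<open>z1, z3, t4\<close>, and into \<open>L\<close>, touched by \<open>x2\<close> and
  \<open>x4\<close> only.\<close>

locale hquad = ideal_diagram +
  fixes S K K' L :: "'a set" and x1 x2 x3 x4 s1 s3 t2 z1 z3 t4 :: 'a
  assumes V12: "insert x1 (insert x2 S) \<in> V" and V23: "insert x3 (insert x2 S) \<in> V" and V34: "insert x3 (insert x4 S) \<in> V" and V14: "insert x1 (insert x4 S) \<in> V"
    and xS: "x1 ~: S" "x2 ~: S" "x3 ~: S" "x4 ~: S" and ds: "distinct [x1,x2,x3,x4]"
    and z: "g x1 x2 = 0" "g x2 x1 = 0" "g x2 x3 = 0" "g x3 x2 = 0" "g x3 x4 = 0" "g x4 x3 = 0" "g x1 x4 = 0" "g x4 x1 = 0"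
    and h13: "g x1 x3 = -rt" "g x3 x1 = -rt" and h24: "g x2 x4 <= -rt" "g x4 x2 <= -rt"
    and SKL: "S = K \<union> K' \<union> L" and dj: "K \<inter> K' = {}" "K \<inter> L = {}" "K' \<inter> L = {}"
    and orth: "!!i j. i \<in> K ==> j \<in> K' ==> g i j = 0 & g j i = 0" "!!i j. i \<in> K ==> j \<in> L ==> g i j = 0 & g j i = 0" "!!i j. i \<in> K' ==> j \<in> L ==> g i j = 0 & g j i = 0"
    and mem: "s1 \<in> K" "s3 \<in> K" "t2 \<in> K" "z1 \<in> K'" "z3 \<in> K'" "t4 \<in> K'"
    and ad: "g x1 s1 ~= 0" "g x3 s3 ~= 0" "g x2 t2 ~= 0" "g x1 z1 ~= 0" "g x3 z3 ~= 0" "g x4 t4 ~= 0"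
    and o1: "!!k. k \<in> S ==> k ~= s1 ==> k ~= z1 ==> g x1 k = 0 & g k x1 = 0"
    and o3: "!!k. k \<in> S ==> k ~= s3 ==> k ~= z3 ==> g x3 k = 0 & g k x3 = 0"
    and o2: "!!k. k \<in> K ==> k ~= t2 ==> g x2 k = 0 & g k x2 = 0" "!!k. k \<in> K' ==> g x2 k = 0 & g k x2 = 0"
    and o4: "!!k. k \<in> K' ==> k ~= t4 ==> g x4 k = 0 & g k x4 = 0" "!!k. k \<in> K ==> g x4 k = 0 & g k x4 = 0"
    and cK: "conn K" "conn K'"
    and Y: "tl (insert x2 (insert x4 L))" and LL: "L ~= {} ==> \<exists>l\<in>L. g x2 l ~= 0" "L ~= {} ==> \<exists>l\<in>L. g x4 l ~= 0"
begin

lemma flip: "hquad I g V n S K K' L x3 x2 x1 x4 s3 s1 t2 z3 z1 t4"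
proof (unfold_locales)
  show "insert x1 (insert x2 S) \<in> V" "insert x3 (insert x2 S) \<in> V" "insert x3 (insert x4 S) \<in> V" "insert x1 (insert x4 S) \<in> V" using V12 V23 V34 V14 by auto
  show "distinct [x3,x2,x1,x4]" using ds by auto
qed (fact xS z h13 h24 SKL dj orth mem ad o1 o2 o3 o4 cK Y LL)+

lemma swap: "hquad I g V n S K' K L x1 x4 x3 x2 z1 z3 t4 s1 s3 t2"
proof (unfold_locales)
  show "distinct [x1,x4,x3,x2]" using ds by auto
  show "S = K' \<union> K \<union> L" using SKL by auto
  show "K' \<inter> K = {}" using dj by auto
  show "tl (insert x4 (insert x2 L))" using Y by (simp add: insert_commute)
  show "g i j = 0 & g j i = 0" if "i \<in> K'" "j \<in> K" for i j using orth(1)[OF that(2,1)] by simp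
  show "g x1 k = 0 & g k x1 = 0" if "k \<in> S" "k ~= z1" "k ~= s1" for k using o1 that by simp
  show "g x3 k = 0 & g k x3 = 0" if "k \<in> S" "k ~= z3" "k ~= s3" for k using o3 that by simp
qed (fact V12 V23 V34 V14 xS z h13 h24 SKL dj orth mem ad o1 o2 o3 o4 cK Y LL)+

lemma ne: "x1 ~= x2" "x1 ~= x3" "x1 ~= x4" "x2 ~= x3" "x2 ~= x4" "x3 ~= x4" "x2 ~= x1" "x3 ~= x1" "x4 ~= x1" "x3 ~= x2" "x4 ~= x2" "x4 ~= x3" using ds by auto
lemma xI: "x1 \<in> I" "x2 \<in> I" "x3 \<in> I" "x4 \<in> I" and SI: "S \<subseteq> I" using V_sub V12 V34 by auto
lemma fin: "finite S" "finite K" "finite K'" "finite L" using fin_sub[OF SI] SKL by auto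
lemma cS: "card S = n - 2" using V_card[OF V12] xS ne fin n9 by simp
lemma inS: "k \<in> K ==> k \<in> S" "k \<in> K' ==> k \<in> S" "k \<in> L ==> k \<in> S" using SKL by auto
lemma inI: "k \<in> S ==> k \<in> I" using SI by auto
lemma nx: "k \<in> S ==> k ~= x1 & k ~= x2 & k ~= x3 & k ~= x4 & x1 ~= k & x2 ~= k & x3 ~= k & x4 ~= k" using xS by auto
lemma KK': "k \<in> K ==> l \<in> K' ==> k ~= l" "k \<in> K ==> l \<in> L ==> k ~= l" "k \<in> K' ==> l \<in> L ==> k ~= l" using dj by auto

lemma oL: assumes "k \<in> L" shows "g x1 k = 0 & g k x1 = 0" "g x3 k = 0 & g k x3 = 0"
proof -
  have n: "k \<in> S" "k ~= s1" "k ~= z1" "k ~= s3" "k ~= z3"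
    using assms inS(3) KK'(2)[OF mem(1) assms] KK'(2)[OF mem(2) assms] KK'(3)[OF mem(4) assms] KK'(3)[OF mem(5) assms] by auto
  show "g x1 k = 0 & g k x1 = 0" by (rule o1[OF n(1-3)])
  show "g x3 k = 0 & g k x3 = 0" by (rule o3[OF n(1,4,5)])
qed
lemma oK: "k \<in> K ==> k ~= s1 ==> g x1 k = 0 & g k x1 = 0" "k \<in> K ==> k ~= s3 ==> g x3 k = 0 & g k x3 = 0"
  "k \<in> K' ==> k ~= z1 ==> g x1 k = 0 & g k x1 = 0" "k \<in> K' ==> k ~= z3 ==> g x3 k = 0 & g k x3 = 0"
proof -
  show "g x1 k = 0 & g k x1 = 0" if "k \<in> K" "k ~= s1" using o1[OF inS(1)[OF that(1)] that(2)] KK'(1)[OF that(1) mem(4)] by simp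
  show "g x3 k = 0 & g k x3 = 0" if "k \<in> K" "k ~= s3" using o3[OF inS(1)[OF that(1)] that(2)] KK'(1)[OF that(1) mem(5)] by simp
  show "g x1 k = 0 & g k x1 = 0" if "k \<in> K'" "k ~= z1" using o1[OF inS(2)[OF that(1)] _ that(2)] KK'(1)[OF mem(1) that(1)] by simp
  show "g x3 k = 0 & g k x3 = 0" if "k \<in> K'" "k ~= z3" using o3[OF inS(2)[OF that(1)] _ that(2)] KK'(1)[OF mem(2) that(1)] by simp
qed

text \<open>\<open>x2\<close>, \<open>x4\<close> and \<open>L\<close> see
  \<open>x1, x3, K, K'\<close> only at \<open>t2\<close> and \<open>t4\<close>; a set without these
  two nodes is orthogonal to the timelike set \<open>Y\<close>.\<close>

lemma Ylem: assumes "tl X" "X \<subseteq> insert x1 (insert x3 (K \<union> K'))" "t2 ~: X" "t4 ~: X" shows False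
proof (rule tl_orth[OF assms(1) Y])
  fix i j assume i: "i \<in> X" and j: "j \<in> insert x2 (insert x4 L)"
  have i': "i = x1 \<or> i = x3 \<or> (i \<in> K & i ~= t2) \<or> (i \<in> K' & i ~= t4)" using i assms by auto
  have j': "j = x2 \<or> j = x4 \<or> j \<in> L" using j by auto
  show "g i j = 0" using i' j' z oL[of j] o2[of i] o4[of i] orth(2,3)[of i j] by (elim disjE) simp_all
qed

lemma val: "A \<in> V ==> i \<in> A ==> j \<in> A ==> i ~= j ==> g i j ~= 0 ==> g i j = -1/2 \<or> g i j = -rt" using heavy_value by blast

lemma half_by_leaf: assumes "A \<in> V" "i \<in> A" "j \<in> A" "i ~= j" "g i j ~= 0" "a \<in> A" "a ~= i" "a ~= j" "g i a ~= 0" "b \<in> A" "b ~= i" "b ~= j" "g j b ~= 0"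
  shows "g i j = -1/2"
proof (rule ccontr)
  assume "g i j ~= -1/2"
  hence h: "g i j = -rt" using val[OF assms(1-5)] by blast
  have "a \<in> nb A i" "b \<in> nb A j" using assms by (auto simp: nb_def)
  thus False using heavy_leaf[OF assms(1-4)] h rt_bounds assms by auto
qed

lemma half_le: "i \<in> I ==> j \<in> I ==> i ~= j ==> g i j ~= 0 ==> g i j <= -1/2" using g_half by blast

lemma hs1: assumes "s1 ~= s3" shows "g x1 s1 = -1/2" "g s1 x1 = -1/2"
proof -
  have s: "s1 \<in> S" "s1 \<in> I" using inS inI mem by auto
  have "g s1 x3 = 0" using oK(2)[OF mem(1) assms] by simp
  hence "g x1 s1 ~= -rt" using C2[of s1 x1 x3] s xI h13 gsym[of s1 x1] by auto
  thus "g x1 s1 = -1/2" using val[OF V12, of x1 s1] s ad nx by auto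
  thus "g s1 x1 = -1/2" using gsym[of s1 x1] by simp
qed

text \<open>\<open>s1\<close> and \<open>z1\<close> fork at \<open>x1\<close>, which carries the
  heavy edge to \<open>x3\<close>: affine B3.\<close>

lemma caseA: assumes "s1 ~= s3" "z1 ~= z3" shows False
proof -
  have "g z1 x1 = -1/2" using hquad.hs1(2)[OF swap assms(2)] .
  moreover have "s1 \<in> I" "z1 \<in> I" using inS inI mem by auto
  moreover have "g s1 x3 = 0" "g z1 x3 = 0" "g s1 z1 = 0" "s1 ~= z1" using oK(2)[OF mem(1) assms(1)] oK(4)[OF mem(4) assms(2)] orth(1)[OF mem(1,4)] KK'(1)[OF mem(1,4)] by auto
  ultimately show False using B3[of s1 z1 x1 x3] hs1[OF assms(1)] xI h13 by auto
qed

text \<open>The triangle \<open>x1, x3, s1\<close> has a heavy edge and is timelike, so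
  \<open>Ylem\<close> puts \<open>t2\<close> on it.\<close>

lemma t2_eq: assumes "s1 = s3" shows "t2 = s1"
proof (rule ccontr)
  assume "t2 ~= s1"
  have s: "s1 \<in> S" "s1 \<in> I" "s1 ~= x1" "s1 ~= x3" using inS inI mem nx by auto
  have "tl {x1,x3,s1}" by (rule tl3) (use s xI ne h13 half_le ad assms in auto)
  thus False
    by (rule Ylem) (use \<open>t2 ~= s1\<close> mem KK'(1)[OF mem(1,6)] nx[OF inS(1)[OF mem(3)]] nx[OF inS(2)[OF mem(6)]] in auto)
qed

lemma t4_eq: assumes "z1 = z3" shows "t4 = z1"
  by (rule hquad.t2_eq[OF swap assms])

text \<open>Avoiding affine C3 and B4, \<open>r\<close> has at most one neighbour in
  \<open>?D\<close>, while connectedness of \<open>B\<close> requires one in each part of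
  \<open>?D\<close> orthogonal to the rest. The part with \<open>x2\<close> has it, so
  \<open>?U2\<close> is empty.\<close>

lemma caseB_r:
  assumes eq: "s1 = s3" "z1 = z3" and B: "B \<in> V" "B = insert r (insert x1 (insert x3 (insert x2 (S - {s1,z1}))))"
    "r ~: insert x1 (insert x3 (insert x2 (S - {s1,z1})))" and rx: "g x1 r ~= 0"
  shows "K = {s1} & K' = {z1}"
proof -
  let ?D = "insert x2 (S - {s1,z1})"
  have D: "g x1 j = 0" "g j x1 = 0" "g x3 j = 0" "g j x3 = 0" "j \<in> I" "j ~= x1" "j ~= x3" "j \<in> B" "j ~= r" if "j \<in> ?D" for j
    using that o1[of j] o3[of j] z eq xI inI nx[of j] ne B by auto
  have rI: "r \<in> I" and rn: "r ~= x1" "r ~= x3" using B V_sub by auto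
  have rB: "r \<in> B" "x1 \<in> B" "x3 \<in> B" using B by auto
  have x3r: "g x3 r = 0" by (rule no_tri[OF B(1), of x3 x1 r]) (use rB rn ne h13 rt_bounds rx in auto)
  have x1r: "g x1 r = -1/2"
    using val[OF B(1) rB(2,1)] rn rx C2[of x3 x1 r] xI rI h13 x3r by auto
  have r1: "g r x1 = -1/2" "g r x3 = 0" using x1r x3r gsym[of r x1] gsym[of r x3] by simp_all
  have half: "g j r = -1/2" if "j \<in> ?D" "g j r ~= 0" for j
    using val[OF B(1) D(8)[OF that(1)] rB(1)] D[OF that(1)] that C3[of j r x1 x3] xI rI h13 r1 by auto
  have uq: "i = j" if "i \<in> ?D" "j \<in> ?D" "g i r ~= 0" "g j r ~= 0" for i j
  proof (rule ccontr)
    assume nij: "i ~= j"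
    have "g i j = 0" by (rule no_tri[OF B(1), of i r j]) (use D(8,9)[OF that(1)] D(8,9)[OF that(2)] rB that nij gsym[of r j] in auto)
    thus False using B4[of i j r x1 x3] D[OF that(1)] D[OF that(2)] rI xI half[OF that(1,3)] half[OF that(2,4)] r1 h13 nij by auto
  qed
  note t2 = t2_eq[OF eq(1)]
  let ?U1 = "insert x2 L" and ?U2 = "(K \<union> K') - {s1,z1}"
  have Deq: "?D = ?U1 \<union> ?U2" using SKL dj mem by auto
  have z12: "g i j = 0" "g j i = 0" if "i \<in> ?U1" "j \<in> ?U2" for i j
    using that t2 o2[of j] orth(2)[of j i] orth(3)[of j i] by auto
  have dis: "?U1 \<inter> ?U2 = {}" using dj xS SKL by auto
  have ex: "\<exists>i\<in>U. g i r ~= 0" if U: "U ~= {}" "U \<subseteq> ?D" and c: "!!i j. i \<in> U ==> j \<in> ?D - U ==> g i j = 0" for U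
  proof -
    have "x1 ~: U" using U(2) D(6) by blast
    hence "U \<subset> B" using U B(2) by auto
    from connD[OF conn_V[OF B(1)] this U(1)] obtain i j where ij: "i \<in> U" "j \<in> B - U" "g i j ~= 0" by (elim bexE)
    have "i \<in> ?D" using ij U by blast
    have "j = r" using ij B(2) D(2,4)[OF \<open>i \<in> ?D\<close>] c[OF ij(1), of j] by auto
    thus ?thesis using ij by blast
  qed
  have "\<exists>i\<in>?U1. g i r ~= 0" by (rule ex) (use Deq z12 in auto)
  then obtain i where i: "i \<in> ?U1" "g i r ~= 0" by (elim bexE)
  have "?U2 = {}"
  proof (rule ccontr)
    assume "?U2 ~= {}"
    hence "\<exists>i\<in>?U2. g i r ~= 0" by (rule ex) (use Deq z12 in auto)
    then obtain j where j: "j \<in> ?U2" "g j r ~= 0" by (elim bexE)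
    have "i \<in> ?D" "j \<in> ?D" using i j Deq by auto
    hence "i = j" using uq i j by blast
    thus False using i j dis by blast
  qed
  thus ?thesis using mem KK'(1)[OF mem(1)] KK'(1)[OF _ mem(4)] by auto
qed

lemma ext: assumes "E \<subseteq> I" "pd g E" "card E = n - 1" obtains B r where "B \<in> V" "B = insert r E" "r ~: E"
proof -
  obtain B where B: "B \<in> V" "E \<subseteq> B" using ell[OF assms(1,2)] by blast
  have "card (B - E) = 1" using assms B V_card[OF B(1)] fin_sub[OF assms(1)] n9 by (simp add: card_Diff_subset)
  then obtain r where "B - E = {r}" by (rule card_1_singletonE)
  hence "B = insert r E" "r ~: E" using B by auto
  thus thesis using that B by blast
qed

text \<open>The heavy pair and the orthogonal set \<open>?D\<close> form n - 1 elliptic nodes; the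
  node \<open>r\<close> completing them to a vertex must attach to the pair.\<close>

lemma caseB_single: assumes eq: "s1 = s3" "z1 = z3" shows "K = {s1} & K' = {z1}"
proof -
  let ?D = "insert x2 (S - {s1,z1})"
  let ?E = "insert x1 (insert x3 ?D)"
  have D: "g x1 j = 0" "g j x1 = 0" "g x3 j = 0" "g j x3 = 0" if "j \<in> ?D" for j
    using that o1[of j] o3[of j] z eq by auto
  have pdD: "pd g ?D"
  proof (rule pdp[OF V12])
    have "x1 ~: ?D" using xS ne by auto
    thus "?D \<subset> insert x1 (insert x2 S)" by blast
  qed
  have "pd g ({x1,x3} \<union> ?D)"
    by (rule pd_Un[OF pd2 pdD]) (use xI ne h13 rt_bounds fin D xS in auto)
  moreover have "{x1,x3} \<union> ?D = ?E" by blast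
  ultimately have pdE: "pd g ?E" by metis
  have "s1 \<in> S" "z1 \<in> S" "s1 ~= z1" using inS mem KK'(1)[OF mem(1,4)] by auto
  hence "card (S - {s1,z1}) = n - 4" using cS fin n9 by (simp add: card_Diff_subset)
  hence "card ?E = n - 1" using fin ne xS n9 by simp
  moreover have "?E \<subseteq> I" using xI SI by auto
  ultimately obtain B r where B: "B \<in> V" "B = insert r ?E" "r ~: ?E" using ext pdE by metis
  obtain e where e: "e \<in> B" "e ~= x1" "e ~= x3" "adj x1 e \<or> adj x3 e \<or> adj x3 e"
    by (rule conn_step3[OF B(1), of x1 x3 x3]) (use B in auto)
  have "e = r"
  proof (rule ccontr)
    assume "e ~= r" hence "e \<in> ?D" using e B by auto
    thus False using D[of e] e by auto
  qed
  hence "g x1 r ~= 0 \<or> g x3 r ~= 0" using e by auto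
  thus ?thesis
  proof
    assume "g x1 r ~= 0" thus ?thesis by (rule caseB_r[OF eq B])
  next
    assume r: "g x3 r ~= 0"
    have B': "B = insert r (insert x3 (insert x1 (insert x2 (S - {s3,z3}))))" "r ~: insert x3 (insert x1 (insert x2 (S - {s3,z3})))"
      using B eq by (auto simp: insert_commute)
    show ?thesis using hquad.caseB_r[OF flip eq(1)[symmetric] eq(2)[symmetric] B(1) B' r] eq by simp
  qed
qed

lemma caseB_half: assumes eq: "s1 = s3" "z1 = z3" shows "g x1 s1 = -1/2" "g x2 s1 = -1/2" and "K = {s1}" "K' = {z1}" "L ~= {}"
proof -
  show K: "K = {s1}" "K' = {z1}" using caseB_single[OF eq] by auto
  have "card S = card (K \<union> K' \<union> L)" using SKL by (rule arg_cong)
  hence "card S <= card K + card K' + card L" using card_Un_le[of "K \<union> K'" L] card_Un_le[of K K'] by linarith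
  hence "card L ~= 0" using cS n9 K by simp
  thus L: "L ~= {}" by auto
  obtain l where l: "l \<in> L" "g x2 l ~= 0" using LL(1)[OF L] by blast
  note t2 = t2_eq[OF eq(1)]
  have m: "s1 \<in> S" "z1 \<in> S" "s1 ~= z1" "l \<in> S" "s1 ~= l" using inS mem KK'(1)[OF mem(1,4)] KK'(2)[OF mem(1) l(1)] l by auto
  note nn = nx[OF m(1)] nx[OF m(2)] nx[OF m(4)]
  have a: "g s1 x1 ~= 0" "g s1 x2 ~= 0" "g x2 s1 ~= 0" using ad t2 gsym[of s1 x1] gsym[of s1 x2] by auto
  show "g x1 s1 = -1/2" by (rule half_by_leaf[OF V12, of x1 s1 z1 x2]) (use m(1-3) nx[OF m(1)] nx[OF m(2)] a ad(1,4) ne(1,7) in simp_all)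
  show "g x2 s1 = -1/2" by (rule half_by_leaf[OF V12, of x2 s1 l x1]) (use m(1,4,5) nx[OF m(1)] nx[OF m(4)] a l(2) ne(1,7) in simp_all)
qed

text \<open>The null vector of the vertex with \<open>x1, x2\<close> takes the values 1, 2, 3, 4
  along \<open>z1, x1, s1, x2\<close>. Dropping \<open>z1\<close> and \<open>x1\<close> and lowering
  \<open>s1\<close> from 3 to 2 keeps the rows of \<open>s1\<close> and \<open>L\<close> zero and
  leaves 1/2 at \<open>x2\<close>.\<close>

lemma caseB_null: assumes eq: "s1 = s3" "z1 = z3"
  shows "\<exists>p. (\<forall>j\<in>L. 0 < p j) & (\<forall>j. j ~: insert x2 (insert s1 L) --> p j = 0) & p x2 = 4 & p s1 = 2 &
     (\<forall>i\<in>insert s1 L. (\<Sum>j\<in>insert x2 (insert s1 L). p j * g i j) = 0) & (\<Sum>j\<in>insert x2 (insert s1 L). p j * g x2 j) = 1/2"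
proof -
  note K = caseB_half(3,4)[OF eq]
  note v = caseB_half(1,2)[OF eq]
  have v': "g x1 z1 = -1/2" using hquad.caseB_half(1)[OF swap eq(2,1)] .
  have m: "s1 \<in> S" "z1 \<in> S" "s1 ~= z1" using inS mem KK'(1)[OF mem(1,4)] by auto
  have Seq: "S = insert s1 (insert z1 L)" using SKL K by auto
  have nn: "s1 ~: L" "z1 ~: L" "x1 ~: L" "x2 ~: L" using KK'(2)[OF mem(1)] KK'(3)[OF mem(4)] xS inS(3) by auto
  have gI: "g x1 x1 = 1" "g x2 x2 = 1" "g s1 s1 = 1" "g z1 z1 = 1" using diag xI inI m by auto
  obtain m where m0: "\<forall>i\<in>insert x1 (insert x2 S). 0 < m i" "\<forall>i\<in>insert x1 (insert x2 S). (\<Sum>j\<in>insert x1 (insert x2 S). m j * g i j) = 0" "m z1 = 1"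
    using null_scaled[OF V12, of z1] m by auto
  have sum: "(\<Sum>j\<in>insert x1 (insert x2 S). m j * g i j) = m x1 * g i x1 + m x2 * g i x2 + m s1 * g i s1 + m z1 * g i z1 + (\<Sum>j\<in>L. m j * g i j)" for i
    unfolding Seq by (rule sum4) (use nn m(3) fin(4) nx[OF m(1)] nx[OF m(2)] ne(1) in auto)
  have row: "m x1 * g i x1 + m x2 * g i x2 + m s1 * g i s1 + m z1 * g i z1 + (\<Sum>j\<in>L. m j * g i j) = 0" if "i \<in> insert x1 (insert x2 S)" for i
    using m0(2) that sum by metis
  have sym: "g z1 x1 = -1/2" "g s1 x1 = -1/2" "g s1 x2 = -1/2" using v v' gsym[of z1 x1] gsym[of s1 x1] gsym[of s1 x2] by simp_all
  have o: "g z1 x2 = 0" "g x2 z1 = 0" "g z1 s1 = 0" "g s1 z1 = 0" using o2(2)[OF mem(4)] orth(1)[OF mem(1,4)] by auto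
  have "(\<Sum>j\<in>L. m j * g z1 j) = 0" by (rule s0) (use orth(3)[OF mem(4)] in auto)
  hence e1: "m x1 = 2" using row[of z1] m sym o gI m0(3) by simp
  have "(\<Sum>j\<in>L. m j * g x1 j) = 0" by (rule s0) (use oL in auto)
  hence e2: "m s1 = 3" using row[of x1] v v' z gI m0(3) e1 by simp
  have L3: "(\<Sum>j\<in>L. m j * g s1 j) = 0" by (rule s0) (use orth(2)[OF mem(1)] in auto)
  hence e3: "m x2 = 4" using row[of s1] m sym o gI e1 e2 by simp
  have e4: "(\<Sum>j\<in>L. m j * g x2 j) = -5/2" using row[of x2] v z o gI e3 e2 by simp
  define p where "p = (\<lambda>j. if j = s1 then 2 else if j \<in> insert x2 L then m j else 0)"
  have ns: "s1 ~= x2" using nx m by auto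
  have pv: "p x2 = 4" "p s1 = 2" "!!j. j \<in> L ==> p j = m j" using e3 ns nn by (auto simp: p_def)
  have psum: "(\<Sum>j\<in>insert x2 (insert s1 L). p j * g i j) = 4 * g i x2 + 2 * g i s1 + (\<Sum>j\<in>L. m j * g i j)" for i
    using nn ns fin pv by (simp cong: sum.cong)
  have A: "(\<Sum>j\<in>insert x2 (insert s1 L). p j * g s1 j) = 0" unfolding psum using L3 sym gI by simp
  have B: "(\<Sum>j\<in>insert x2 (insert s1 L). p j * g i j) = 0" if i: "i \<in> L" for i
  proof -
    have "i \<in> S" using inS i by auto
    thus ?thesis unfolding psum using row[of i] orth(2)[OF mem(1) i] orth(3)[OF mem(4) i] oL(1)[OF i] e3 by auto
  qed
  have C: "(\<Sum>j\<in>insert x2 (insert s1 L). p j * g x2 j) = 1/2" unfolding psum using e4 v gI by simp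
  show ?thesis
    by (intro exI[of _ p] conjI) (use A B C pv m0(1) inS in \<open>auto simp: p_def\<close>)
qed

text \<open>\<open>u\<close> is the all-ones vector on the square \<open>x1, s1, x3, z1\<close> with
  its heavy diagonal, and \<open>v\<close> is the sum of the vectors of \<open>caseB_null\<close>
  for both sides. Their product is -4, their norms are \<open>- 2 * rt\<close> and at most
  \<open>4 - 32 * rt\<close>; reverse Cauchy-Schwarz would give 32 - 8 \<open>rt\<close> <=
  16.\<close>

lemma caseB: assumes eq: "s1 = s3" "z1 = z3" shows False
proof -
  let ?P = "insert x2 (insert s1 L)" and ?Q = "insert x4 (insert z1 L)"
  obtain p where p: "!!j. j \<in> L ==> 0 < p j" "!!j. j ~: ?P ==> p j = 0" "p x2 = 4" "p s1 = 2"
    "!!i. i \<in> insert s1 L ==> (\<Sum>j\<in>?P. p j * g i j) = 0" "(\<Sum>j\<in>?P. p j * g x2 j) = 1/2" using caseB_null[OF eq] by auto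
  obtain q where q: "!!j. j \<in> L ==> 0 < q j" "!!j. j ~: ?Q ==> q j = 0" "q x4 = 4" "q z1 = 2"
    "!!i. i \<in> insert z1 L ==> (\<Sum>j\<in>?Q. q j * g i j) = 0" "(\<Sum>j\<in>?Q. q j * g x4 j) = 1/2" using hquad.caseB_null[OF swap eq(2,1)] by auto
  have m: "s1 \<in> S" "z1 \<in> S" "s1 ~= z1" using inS mem KK'(1)[OF mem(1,4)] by auto
  have nn: "s1 ~: L" "z1 ~: L" "x1 ~: L" "x2 ~: L" "x3 ~: L" "x4 ~: L" using KK'(2)[OF mem(1)] KK'(3)[OF mem(4)] xS inS(3) by auto
  note nm = nx[OF m(1)] nx[OF m(2)]
  have PI: "?P \<subseteq> I" "?Q \<subseteq> I" using xI SI m inS by auto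
  have zr: "(\<Sum>j\<in>?P. p j * g z1 j) = 0" by (rule s0) (use o2(2)[OF mem(4)] orth(1)[OF mem(1,4)] orth(3)[OF mem(4)] in auto)
  have "(\<Sum>j\<in>?P. p j * g x4 j) = 4 * g x4 x2 + 2 * g x4 s1 + (\<Sum>j\<in>L. p j * g x4 j)" using nn nm fin p by simp
  moreover have "(\<Sum>j\<in>L. p j * g x4 j) <= 0"
  proof (rule sum_nonpos)
    fix j assume j: "j \<in> L"
    have "g x4 j <= 0" by (rule g_le0) (use xI inI inS j nn in auto)
    thus "p j * g x4 j <= 0" using p(1)[OF j] by (simp add: mult_nonneg_nonpos)
  qed
  moreover have "g x4 s1 = 0" using o4(2)[OF mem(1)] by simp
  ultimately have x4r: "(\<Sum>j\<in>?P. p j * g x4 j) <= - 4 * rt" using h24 by simp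
  have fPQ: "finite L" "x2 ~: insert s1 L" "x4 ~: insert z1 L" using fin nn nm by auto
  have pp: "bil g I p p = 2"
  proof -
    have "bil g I p p = (\<Sum>i\<in>?P. p i * (\<Sum>j\<in>?P. p j * g i j))" by (rule bil_rows) (use PI p in auto)
    also have "\<dots> = p x2 * (1/2) + (\<Sum>i\<in>insert s1 L. p i * (\<Sum>j\<in>?P. p j * g i j))" using fPQ p(6) by (subst sum.insert) auto
    also have "(\<Sum>i\<in>insert s1 L. p i * (\<Sum>j\<in>?P. p j * g i j)) = 0" by (rule sum.neutral) (use p(5) in simp)
    finally show ?thesis using p(3) by simp
  qed
  have qq: "bil g I q q = 2"
  proof -
    have "bil g I q q = (\<Sum>i\<in>?Q. q i * (\<Sum>j\<in>?Q. q j * g i j))" by (rule bil_rows) (use PI q in auto)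
    also have "\<dots> = q x4 * (1/2) + (\<Sum>i\<in>insert z1 L. q i * (\<Sum>j\<in>?Q. q j * g i j))" using fPQ q(6) by (subst sum.insert) auto
    also have "(\<Sum>i\<in>insert z1 L. q i * (\<Sum>j\<in>?Q. q j * g i j)) = 0" by (rule sum.neutral) (use q(5) in simp)
    finally show ?thesis using q(3) by simp
  qed
  have qp: "bil g I q p <= -16 * rt"
  proof -
    have "bil g I q p = (\<Sum>i\<in>?Q. q i * (\<Sum>j\<in>?P. p j * g i j))" by (rule bil_rows) (use PI p q in auto)
    also have "\<dots> = q x4 * (\<Sum>j\<in>?P. p j * g x4 j) + (\<Sum>i\<in>insert z1 L. q i * (\<Sum>j\<in>?P. p j * g i j))" using fPQ by (subst sum.insert) auto
    also have "(\<Sum>i\<in>insert z1 L. q i * (\<Sum>j\<in>?P. p j * g i j)) = 0" by (rule sum.neutral) (use p(5) zr in auto)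
    finally show ?thesis using q(3) x4r by simp
  qed
  have pq: "bil g I p q = bil g I q p"
    unfolding bil_def by (subst sum.swap) (simp add: gsym mult.commute)
  define v where "v = (\<lambda>j. p j + q j)"
  have "bil g I v v = bil g I p p + bil g I p q + bil g I q p + bil g I q q"
    unfolding bil_def v_def by (simp add: algebra_simps sum.distrib)
  hence vv: "bil g I v v <= 4 - 32 * rt" using pp qq qp pq by linarith
  define u where "u = (\<lambda>j. if j \<in> {x1,x3,s1,z1} then 1 else (0::real))"
  have U: "{x1,x3,s1,z1} \<subseteq> I" using xI inI m by auto
  note va = caseB_half(1,2)[OF eq] hquad.caseB_half(1,2)[OF swap eq(2,1)] hquad.caseB_half(1)[OF flip eq(1)[symmetric] eq(2)[symmetric]] hquad.caseB_half(1)[OF hquad.swap[OF flip] eq(2)[symmetric] eq(1)[symmetric]]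
  have va': "g x3 s1 = -1/2" "g x3 z1 = -1/2" using va eq by auto
  have sy: "g s1 x1 = -1/2" "g s1 x3 = -1/2" "g z1 x1 = -1/2" "g z1 x3 = -1/2" "g s1 x2 = -1/2" "g z1 x4 = -1/2" "g s1 z1 = 0" "g z1 s1 = 0"
    using va va' orth(1)[OF mem(1,4)] gsym[of s1 x1] gsym[of s1 x3] gsym[of z1 x1] gsym[of z1 x3] gsym[of s1 x2] gsym[of z1 x4] by simp_all
  have gI: "g x1 x1 = 1" "g x3 x3 = 1" "g s1 s1 = 1" "g z1 z1 = 1" using diag U by auto
  have dd: "x1 ~= x3" "x1 ~= s1" "x1 ~= z1" "x3 ~= s1" "x3 ~= z1" "s1 ~= z1" using ne nm m by auto
  have uu: "bil g I u u = - 2 * rt"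
  proof -
    have "bil g I u u = (\<Sum>i\<in>{x1,x3,s1,z1}. u i * (\<Sum>j\<in>{x1,x3,s1,z1}. u j * g i j))" by (rule bil_rows) (use U in \<open>auto simp: u_def\<close>)
    also have "\<dots> = (\<Sum>i\<in>{x1,x3,s1,z1}. (\<Sum>j\<in>{x1,x3,s1,z1}. g i j))" unfolding sum4s[OF dd] u_def by simp
    also have "\<dots> = - 2 * rt" using dd gI sy va va' h13 by simp
    finally show ?thesis .
  qed
  have up: "bil g I u p = -2"
  proof -
    have "bil g I u p = (\<Sum>i\<in>{x1,x3,s1,z1}. u i * (\<Sum>j\<in>?P. p j * g i j))" by (rule bil_rows) (use U PI p in \<open>auto simp: u_def\<close>)
    also have "\<dots> = (\<Sum>j\<in>?P. p j * g x1 j) + (\<Sum>j\<in>?P. p j * g x3 j)" unfolding sum4s[OF dd] using p(5)[of s1] zr by (simp add: u_def del: sum.insert)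
    also have "(\<Sum>j\<in>?P. p j * g x1 j) = p s1 * g x1 s1" by (rule s1) (use fin z oL in auto)
    also have "(\<Sum>j\<in>?P. p j * g x3 j) = p s1 * g x3 s1" by (rule s1) (use fin z oL in auto)
    finally show ?thesis using p(4) va va' by simp
  qed
  have zq: "(\<Sum>j\<in>?Q. q j * g s1 j) = 0" by (rule s0) (use o4(2)[OF mem(1)] orth(1)[OF mem(1,4)] orth(2)[OF mem(1)] in auto)
  have uq: "bil g I u q = -2"
  proof -
    have "bil g I u q = (\<Sum>i\<in>{x1,x3,s1,z1}. u i * (\<Sum>j\<in>?Q. q j * g i j))" by (rule bil_rows) (use U PI q in \<open>auto simp: u_def\<close>)
    also have "\<dots> = (\<Sum>j\<in>?Q. q j * g x1 j) + (\<Sum>j\<in>?Q. q j * g x3 j)" unfolding sum4s[OF dd] using q(5)[of z1] zq by (simp add: u_def del: sum.insert)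
    also have "(\<Sum>j\<in>?Q. q j * g x1 j) = q z1 * g x1 z1" by (rule s1) (use fin z oL in auto)
    also have "(\<Sum>j\<in>?Q. q j * g x3 j) = q z1 * g x3 z1" by (rule s1) (use fin z oL in auto)
    finally show ?thesis using q(4) va va' by simp
  qed
  have uv: "bil g I u v = -4"
  proof -
    have "bil g I u v = bil g I u p + bil g I u q" unfolding bil_def v_def by (simp add: algebra_simps sum.distrib)
    thus ?thesis using up uq by simp
  qed
  have "bil g I u u * bil g I v v <= (bil g I u v)\<^sup>2" by (rule lor) (use uu rt_bounds in simp)
  hence "(- 2 * rt) * bil g I v v <= 16" unfolding uu uv by simp
  moreover have "(- 2 * rt) * (4 - 32 * rt) <= (- 2 * rt) * bil g I v v" by (rule mult_left_mono_neg) (use vv rt_bounds in auto)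
  moreover have "(- 2 * rt) * (4 - 32 * rt) = 32 - 8 * rt" using rt_sq by (simp add: algebra_simps rt_sq_left)
  ultimately show False using rt_bounds by linarith
qed

end

context hquad begin

lemmas hs3 = hquad.hs1[OF flip]

text \<open>The path through \<open>s1, x1, x3, s3, t\<close> would otherwise contain affine C3 or
  be affine F4.\<close>

lemma D1: assumes "s1 ~= s3" "g s1 s3 = 0" "t \<in> K" "t ~= s3" "g s3 t ~= 0"
  shows "g s3 t = -1/2 & g s1 t ~= 0 & t ~= s1"
proof -
  have ss: "g s3 s1 = 0" using assms(2) gsym[of s3 s1] by simp
  have t1: "t ~= s1" using assms ss by auto
  have tS: "t \<in> S" "s1 \<in> S" "s3 \<in> S" using inS(1) mem assms by auto
  have I: "t \<in> I" "s1 \<in> I" "s3 \<in> I" using tS inI by auto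
  have z0: "g t x1 = 0" "g t x3 = 0" "g x1 t = 0" "g x3 t = 0" using oK(1)[OF assms(3) t1] oK(2)[OF assms(3,4)] by auto
  have z1: "g s3 x1 = 0" "g x1 s3 = 0" "g s1 x3 = 0" using oK(1)[OF mem(2) assms(1)[symmetric]] oK(2)[OF mem(1) assms(1)] by auto
  note h1 = hs1[OF assms(1)] and h3 = hs3[OF assms(1)[symmetric]]
  have w: "g s3 t = -1/2"
  proof (rule ccontr)
    assume "g s3 t ~= -1/2"
    hence "g s3 t = -rt" using val[OF V12, of s3 t] tS assms(4,5) by auto
    hence "g t s3 = -rt" using gsym[of t s3] by simp
    thus False using C3[of t s3 x3 x1] I xI h3 h13 z0 z1 by auto
  qed
  have "g s1 t ~= 0"
  proof
    assume "g s1 t = 0"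
    thus False using F4[of s1 x1 x3 s3 t] I xI h1 h3 h13 w z0 z1 assms(2) by auto
  qed
  thus ?thesis using w t1 by simp
qed

lemma D2: assumes "s1 ~= s3" "g s1 s3 = 0" "s \<in> K" "s ~= s3" "g s3 s ~= 0" shows "t2 ~= s3"
proof
  assume t: "t2 = s3"
  note d = D1[OF assms]
  have sS: "s \<in> S" "s1 \<in> S" "s3 \<in> S" using inS(1) mem assms by auto
  have I: "s \<in> I" "s1 \<in> I" "s3 \<in> I" using sS inI by auto
  have z0: "g s x1 = 0" "g s x3 = 0" using oK(1)[OF assms(3)] oK(2)[OF assms(3,4)] d by auto
  have z1: "g s3 x1 = 0" using oK(1)[OF mem(2) assms(1)[symmetric]] by auto
  have z2: "g x2 s = 0" using o2(1)[OF assms(3)] t assms(4) by simp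
  note h3 = hs3[OF assms(1)[symmetric]]
  have nn: "x2 ~= s" "x2 ~= s3" using nx[OF sS(1)] nx[OF sS(3)] by auto
  have "g x2 s3 = -1/2"
  proof (rule ccontr)
    assume "g x2 s3 ~= -1/2"
    hence "g x2 s3 = -rt" using val[OF V12, of x2 s3] sS ad(3) t nn by auto
    thus False using C3[of x2 s3 x3 x1] I xI h3 h13 z z1 by auto
  qed
  moreover have "g s s3 = -1/2" using d gsym[of s s3] by simp
  ultimately show False using B4[of x2 s s3 x3 x1] I xI h3 h13 z z0 z1 z2 nn by auto
qed

text \<open>The five-cycle through a common neighbour \<open>s\<close> of \<open>s1\<close> and
  \<open>s3\<close> is timelike, so \<open>t2\<close> is \<open>s\<close>. Then elliptic F4 on
  \<open>s1, x1, x3, s3\<close> and the orthogonal set \<open>?D\<close> have n - 1 nodes; a vertex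
  containing them would have a heavy edge without a leaf.\<close>

lemma dist2: assumes "s1 ~= s3" "z1 = z3" "g s1 s3 = 0" shows False
proof -
  have ss: "g s3 s1 = 0" using assms(3) gsym[of s3 s1] by simp
  interpret f: hquad I g V n S K K' L x3 x2 x1 x4 s3 s1 t2 z3 z1 t4 by (rule flip)
  have "{s3} \<subset> K" using mem assms(1) by auto
  from connD[OF cK(1) this insert_not_empty] obtain s where s: "s \<in> K" "s ~= s3" "g s3 s ~= 0" by auto
  note d = D1[OF assms(1,3) s]
  have s1: "g s1 s ~= 0" "s ~= s1" using d by auto
  note d' = f.D1[OF assms(1)[symmetric] ss s(1) s1(2) s1(1)]
  have sy: "g s s1 = -1/2" "g s s3 = -1/2" using d d' gsym[of s s1] gsym[of s s3] by auto
  have sS: "s \<in> S" "s1 \<in> S" "s3 \<in> S" "z1 \<in> S" using inS mem s by auto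
  have I: "s \<in> I" "s1 \<in> I" "s3 \<in> I" using sS inI by auto
  note nn = nx[OF sS(1)] nx[OF sS(2)] nx[OF sS(3)] nx[OF sS(4)]
  have u3: "t = s" if t: "t \<in> K" "t ~= s3" "g s3 t ~= 0" for t
  proof (rule ccontr)
    assume ne: "t ~= s"
    note e = D1[OF assms(1,3) t]
    have "t \<in> S" using inS(1) t by auto
    have "g s3 s = 0" by (rule no_sq[OF V12, of s3 t s1 s]) (use sS \<open>t \<in> S\<close> t e ne s s1 gsym[of t s1] assms(1) in auto)
    thus False using s by simp
  qed
  have u1: "t = s" if t: "t \<in> K" "t ~= s1" "g s1 t ~= 0" for t
    using f.D1[OF assms(1)[symmetric] ss t] u3[of t] t(1) by auto
  have h1: "g x1 s1 = -1/2" "g s1 x1 = -1/2" using hs1[OF assms(1)] by auto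
  have h3: "g x3 s3 = -1/2" "g s3 x3 = -1/2" using hs3[OF assms(1)[symmetric]] by auto
  have "tl {x1,x3,s3,s,s1}"
    by (rule tl5) (use I xI nn ne assms(1) s s1 h1 h3 h13 d sy in auto)
  hence "t2 \<in> {x1,x3,s3,s,s1} \<or> t4 \<in> {x1,x3,s3,s,s1}" using Ylem[of "{x1,x3,s3,s,s1}"] mem s by blast
  moreover have "t4 ~= s3" "t4 ~= s" "t4 ~= s1" using KK'(1)[OF _ mem(6)] mem s by auto
  moreover have "t4 ~= x1" "t4 ~= x3" "t2 ~= x1" "t2 ~= x3" using nx inS mem by blast+
  moreover have "t2 ~= s3" by (rule D2[OF assms(1,3) s])
  moreover have "t2 ~= s1" by (rule f.D2[OF assms(1)[symmetric] ss s(1) s1(2,1)])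
  ultimately have t2: "t2 = s" by auto
  let ?D = "insert x2 (S - {s,z1,s1,s3})"
  let ?E = "{s1,x1,x3,s3} \<union> ?D"
  have zK: "s ~= z1" "s1 ~= z1" "s3 ~= z1" using KK'(1)[OF _ mem(4)] mem s by auto
  have pd1: "pd g {s1,x1,x3,s3}" by (rule pdF4) (use I xI h1 h3 h13 assms(1,3) oK(1)[OF mem(2)] oK(2)[OF mem(1)] in auto)
  have pd2: "pd g ?D"
  proof (rule pdp[OF V12])
    have "x1 ~: ?D" using xS ne by auto
    thus "?D \<subset> insert x1 (insert x2 S)" by blast
  qed
  have zero: "g i j = 0 & g j i = 0" if i: "i \<in> {s1,x1,x3,s3}" and j: "j \<in> ?D" for i j
  proof (cases "j = x2")
    case True
    have "g x2 s1 = 0 & g s1 x2 = 0" "g x2 s3 = 0 & g s3 x2 = 0" using o2(1)[OF mem(1)] o2(1)[OF mem(2)] t2 s1 s by auto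
    thus ?thesis using i True z by auto
  next
    case False
    hence j': "j \<in> S" "j ~= s" "j ~= z1" "j ~= s1" "j ~= s3" using j by auto
    have a: "g s1 j = 0" "g s3 j = 0"
    proof -
      have "j \<in> K \<or> j \<in> K' \<or> j \<in> L" using j' SKL by auto
      thus "g s1 j = 0" using u1[of j] j' orth(1,2)[OF mem(1), of j] by auto
      show "g s3 j = 0" using \<open>j \<in> K \<or> j \<in> K' \<or> j \<in> L\<close> u3[of j] j' orth(1,2)[OF mem(2), of j] by auto
    qed
    have a': "g j s1 = 0" "g j s3 = 0" using a gsym[of j s1] gsym[of j s3] by simp_all
    show ?thesis using i a a' o1[OF j'(1,4,3)] o3[OF j'(1,5)] j'(3) assms(2) by auto
  qed
  have dis: "{s1,x1,x3,s3} \<inter> ?D = {}" using nn xS ne by auto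
  have "pd g ?E" by (rule pd_Un[OF pd1 pd2 _ _ _ dis]) (use fin zero in auto)
  moreover have "card ?E = n - 1"
  proof -
    have "card (S - {s,z1,s1,s3}) = n - 2 - 4" using sS zK s s1 assms(1) cS fin by (simp add: card_Diff_subset)
    hence "card ?D = n - 5" using fin xS n9 by simp
    moreover have "card {s1,x1,x3,s3} = 4" using nn ne assms(1) by simp
    ultimately show ?thesis using dis fin n9 by (subst card_Un_disjoint) auto
  qed
  moreover have "?E \<subseteq> I" using I xI SI by auto
  ultimately obtain B r where B: "B \<in> V" "B = insert r ?E" using ext[of ?E] by metis
  have "x1 \<in> B" "x3 \<in> B" "s1 \<in> B" "s3 \<in> B" using B by auto
  hence "s1 \<in> nb B x1" "s3 \<in> nb B x3" using h1 h3 nn by (auto simp: nb_def)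
  moreover have "nb B x1 = {x3} \<or> nb B x3 = {x1}" by (rule heavy_leaf) (use B(1) \<open>x1 \<in> B\<close> \<open>x3 \<in> B\<close> ne h13 rt_bounds in auto)
  ultimately show False using nn by auto
qed

lemma sumS: assumes "x ~: S" "y ~: S" "x ~= y" "s1 ~= s3"
  shows "(\<Sum>j\<in>insert x (insert y S). H j) = H x + H y + H s1 + H s3 + (\<Sum>j\<in>K-{s1,s3}. H j) + (\<Sum>j\<in>K'. H j) + (\<Sum>j\<in>L. H j :: real)"
proof -
  have "(\<Sum>j\<in>insert x (insert y S). H j) = H x + H y + (\<Sum>j\<in>S. H j)" using assms fin by (simp add: add.assoc)
  also have "(\<Sum>j\<in>S. H j) = (\<Sum>j\<in>K. H j) + (\<Sum>j\<in>K'. H j) + (\<Sum>j\<in>L. H j)"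
  proof -
    have "(K \<union> K') \<inter> L = {}" using dj by auto
    thus ?thesis unfolding SKL using fin dj by (simp add: sum.union_disjoint)
  qed
  also have "(\<Sum>j\<in>K. H j) = H s1 + H s3 + (\<Sum>j\<in>K-{s1,s3}. H j)"
  proof -
    have "K = insert s1 (insert s3 (K - {s1,s3}))" using mem by auto
    hence "(\<Sum>j\<in>K. H j) = (\<Sum>j\<in>insert s1 (insert s3 (K - {s1,s3})). H j)" by metis
    thus ?thesis using assms(4) fin by simp
  qed
  finally show ?thesis by simp
qed

text \<open>The null vectors \<open>m\<close> and \<open>m'\<close> of the two vertices with
  \<open>x2\<close> are normalised at \<open>x1\<close> and \<open>x3\<close>. The unknown pieces
  \<open>?F\<close>, \<open>K'\<close> and \<open>L\<close> enter only through \<open>green\<close>,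
  which leaves algebraic equations for the coefficients near the heavy edge.\<close>

lemma caseC1: assumes ns: "s1 ~= s3" "z1 = z3" and a: "g s1 s3 ~= 0" and t: "t2 = s1" shows False
proof -
  let ?F = "K - {s1,s3}"
  have t4: "t4 = z1" by (rule t4_eq[OF ns(2)])
  have sS: "s1 \<in> S" "s3 \<in> S" "z1 \<in> S" using inS mem by auto
  have I: "s1 \<in> I" "s3 \<in> I" "z1 \<in> I" using sS inI by auto
  note nn = nx[OF sS(1)] nx[OF sS(2)] nx[OF sS(3)]
  note h1 = hs1[OF ns(1)] and h3 = hs3[OF ns(1)[symmetric]]
  have z13: "g s3 x1 = 0" "g x1 s3 = 0" "g s1 x3 = 0" "g x3 s1 = 0" using oK(1)[OF mem(2) ns(1)[symmetric]] oK(2)[OF mem(1) ns(1)] by auto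
  have x2s: "g x2 s1 ~= 0" "g s1 x2 ~= 0" using ad t gsym[of s1 x2] by auto
  have v13: "g s1 s3 = -1/2"
    by (rule half_by_leaf[OF V23, of s1 s3 x2 x3]) (use sS ns a nn x2s h3 in simp_all)
  hence v31: "g s3 s1 = -1/2" using gsym[of s3 s1] by simp
  have v2: "g x2 s1 = -1/2"
  proof (rule ccontr)
    assume "g x2 s1 ~= -1/2"
    hence "g x2 s1 = -rt" using val[OF V12, of x2 s1] sS x2s nn by auto
    thus False using C3[of x2 s1 x1 x3] I xI h1 h13 z z13 by auto
  qed
  hence v2': "g s1 x2 = -1/2" using gsym[of s1 x2] by simp
  have zx: "g z1 x4 ~= 0" "g x3 z1 ~= 0" using ad t4 ns gsym[of z1 x4] by auto
  have vz1: "g x1 z1 = -1/2" by (rule half_by_leaf[OF V14, of x1 z1 s1 x4]) (use sS nn ad(1,4) zx KK'(1)[OF mem(1,4)] ne in simp_all)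
  have vz3: "g x3 z1 = -1/2" by (rule half_by_leaf[OF V34, of x3 z1 s3 x4]) (use sS nn ad(2) zx KK'(1)[OF mem(2,4)] ne in simp_all)
  have vz: "g z1 x1 = -1/2" "g z1 x3 = -1/2" using vz1 vz3 gsym[of z1 x1] gsym[of z1 x3] by simp_all
  have FK: "y \<in> K & y \<in> S & y \<in> I & y ~= s1 & y ~= s3" if "y \<in> ?F" for y using that inS(1) inI by auto
  have F1: "g s1 y = 0 & g y s1 = 0" if y: "y \<in> ?F" for y
  proof -
    note f = FK[OF y]
    have yz: "g y x1 = 0" "g y x3 = 0" using oK(1,2) f by auto
    have yx2: "g x2 y = 0" using o2(1) f t by auto
    have "g y s1 = 0"
    proof (rule ccontr)
      assume nz: "g y s1 ~= 0"
      have "g y s1 = -1/2 \<or> g y s1 = -rt" using val[OF V12, of y s1] f sS nz by auto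
      thus False
      proof
        assume "g y s1 = -1/2"
        thus False using B4[of x2 y s1 x1 x3] f I xI v2 h1 h13 z z13 yz yx2 nx[of y] by auto
      next
        assume "g y s1 = -rt"
        thus False using C3[of y s1 x1 x3] f I xI h1 h13 z13 yz by auto
      qed
    qed
    thus ?thesis using gsym[of s1 y] by simp
  qed
  have Fz: "g x1 y = 0 & g y x1 = 0 & g x3 y = 0 & g y x3 = 0 & g x2 y = 0 & g y x2 = 0 & g x4 y = 0 & g y x4 = 0" if "y \<in> ?F" for y
    using FK[OF that] oK(1,2)[of y] o2(1)[of y] o4(2)[of y] t by auto
  have sz: "g x2 s3 = 0" "g s3 x2 = 0" "g x4 s1 = 0" "g s1 x4 = 0" "g x4 s3 = 0" "g s3 x4 = 0"
    using o2(1)[OF mem(2)] o4(2)[OF mem(1)] o4(2)[OF mem(2)] t ns by auto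
  have gI: "g x1 x1 = 1" "g x2 x2 = 1" "g x3 x3 = 1" "g x4 x4 = 1" "g s1 s1 = 1" "g s3 s3 = 1" "g z1 z1 = 1" using diag xI I by auto
  have fF: "finite ?F" using fin by simp
  have K'1: "(\<Sum>j\<in>K'. (m j::real) * g x1 j) = - m z1 / 2" for m
    by (subst s1[of K' z1]) (use fin mem oK(3) vz1 in auto)
  have K'3: "(\<Sum>j\<in>K'. (m j::real) * g x3 j) = - m z1 / 2" for m
    by (subst s1[of K' z1]) (use fin mem oK(4) vz3 ns in auto)
  have K'1': "(\<Sum>i\<in>K'. (m i::real) * (- g i x1)) = m z1 / 2" for m
    using K'1[of m] by (simp add: sum_negf gsym[of _ x1])
  have K'3': "(\<Sum>i\<in>K'. (m i::real) * (- g i x3)) = m z1 / 2" for m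
    using K'3[of m] by (simp add: sum_negf gsym[of _ x3])
  have ze: "(\<Sum>j\<in>?F. (m j::real) * g x1 j) = 0" "(\<Sum>j\<in>?F. m j * g x3 j) = 0" "(\<Sum>j\<in>?F. m j * g x2 j) = 0" "(\<Sum>j\<in>?F. m j * g x4 j) = 0" "(\<Sum>j\<in>?F. m j * g s1 j) = 0"
    "(\<Sum>j\<in>L. m j * g x1 j) = 0" "(\<Sum>j\<in>L. m j * g x3 j) = 0" "(\<Sum>j\<in>L. m j * g s1 j) = 0" "(\<Sum>j\<in>L. m j * g s3 j) = 0"
    "(\<Sum>j\<in>K'. m j * g s1 j) = 0" "(\<Sum>j\<in>K'. m j * g s3 j) = 0" "(\<Sum>j\<in>K'. m j * g x2 j) = 0" for m
    by (rule s0; use Fz F1 oL orth(2)[OF mem(1)] orth(2)[OF mem(2)] orth(1)[OF mem(1)] orth(1)[OF mem(2)] o2(2) in blast)+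
  have zeF: "(\<Sum>j\<in>K'. (m j::real) * g i j) = 0" "(\<Sum>j\<in>L. m j * g i j) = 0" if "i \<in> ?F" for m i
    by (rule s0; use orth(1,2) FK[OF that] in blast)+
  have zeL: "(\<Sum>j\<in>?F. (m j::real) * g i j) = 0" "(\<Sum>j\<in>K'. m j * g i j) = 0" if "i \<in> L" for m i
    by (rule s0; use orth(2,3) FK that in blast)+
  have zeK: "(\<Sum>j\<in>?F. (m j::real) * g i j) = 0" "(\<Sum>j\<in>L. m j * g i j) = 0" if "i \<in> K'" for m i
    by (rule s0; use orth(1,3) FK that in blast)+
  have sL: "g i s1 = 0" "g i s3 = 0" if "i \<in> L" for i using orth(2)[OF mem(1) that] orth(2)[OF mem(2) that] by auto
  have sK: "g i s1 = 0" "g i s3 = 0" if "i \<in> K'" for i using orth(1)[OF mem(1) that] orth(1)[OF mem(2) that] by auto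

  obtain m where m0: "(\<forall>i\<in>insert x1 (insert x2 S). 0 < m i) & (\<forall>i\<in>insert x1 (insert x2 S). (\<Sum>j\<in>insert x1 (insert x2 S). m j * g i j) = 0) & m x1 = 1"
    using null_scaled[OF V12 insertI1] by (rule exE)
  hence mx: "m x1 = 1" by blast
  have R: "m x1 * g i x1 + m x2 * g i x2 + m s1 * g i s1 + m s3 * g i s3 + (\<Sum>j\<in>?F. m j * g i j) + (\<Sum>j\<in>K'. m j * g i j) + (\<Sum>j\<in>L. m j * g i j) = 0" if "i \<in> insert x1 (insert x2 S)" for i
  proof -
    have "(\<Sum>j\<in>insert x1 (insert x2 S). m j * g i j) = 0" using m0 that by blast
    thus ?thesis unfolding sumS[OF xS(1,2) ne(1) ns(1)] .
  qed
  have mp: "0 < m i" if "i \<in> insert x1 (insert x2 S)" for i using m0 that by blast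
  have e1: "1 - m s1 / 2 - m z1 / 2 = 0" using R[of x1] mx gI z h1 z13 ze K'1 by simp
  have e2: "m s1 - 1/2 - m x2 / 2 - m s3 / 2 = 0" using R[of s1] sS mx gI h1 v2' v13 ze by simp
  have e3: "m s3 - m s1 / 2 + (\<Sum>j\<in>?F. m j * g s3 j) = 0" using R[of s3] sS mx gI z13 sz v31 ze by simp
  have e4: "m x2 - m s1 / 2 + (\<Sum>j\<in>L. m j * g x2 j) = 0" using R[of x2] gI z v2 sz ze by simp
  have eF: "(\<Sum>j\<in>?F. m j * g i j) = - m s3 * g i s3" if "i \<in> ?F" for i using R[of i] FK[OF that] Fz[OF that] F1[OF that] zeF[OF that] by simp
  have eL: "(\<Sum>j\<in>L. m j * g i j) = - m x2 * g i x2" if "i \<in> L" for i using R[of i] inS(3)[OF that] oL[OF that] sL[OF that] zeL[OF that] by simp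
  have eK: "(\<Sum>j\<in>K'. m j * g i j) = - g i x1" if "i \<in> K'" for i using R[of i] mx inS(2)[OF that] o2(2)[OF that] sK[OF that] zeK[OF that] by simp

  obtain m' where m0': "(\<forall>i\<in>insert x3 (insert x2 S). 0 < m' i) & (\<forall>i\<in>insert x3 (insert x2 S). (\<Sum>j\<in>insert x3 (insert x2 S). m' j * g i j) = 0) & m' x3 = 1"
    using null_scaled[OF V23 insertI1] by (rule exE)
  hence mx': "m' x3 = 1" by blast
  have R': "m' x3 * g i x3 + m' x2 * g i x2 + m' s1 * g i s1 + m' s3 * g i s3 + (\<Sum>j\<in>?F. m' j * g i j) + (\<Sum>j\<in>K'. m' j * g i j) + (\<Sum>j\<in>L. m' j * g i j) = 0" if "i \<in> insert x3 (insert x2 S)" for i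
  proof -
    have "(\<Sum>j\<in>insert x3 (insert x2 S). m' j * g i j) = 0" using m0' that by blast
    thus ?thesis unfolding sumS[OF xS(3,2) ne(10) ns(1)] .
  qed
  have mp': "0 < m' i" if "i \<in> insert x3 (insert x2 S)" for i using m0' that by blast
  have e1': "1 - m' s3 / 2 - m' z1 / 2 = 0" using R'[of x3] mx' gI z h3 z13 ze K'3 by simp
  have e2': "m' s1 - m' x2 / 2 - m' s3 / 2 = 0" using R'[of s1] sS gI z13 v2' v13 ze by simp
  have e3': "m' s3 - 1/2 - m' s1 / 2 + (\<Sum>j\<in>?F. m' j * g s3 j) = 0" using R'[of s3] sS mx' gI h3 sz v31 ze by simp
  have e4': "m' x2 - m' s1 / 2 + (\<Sum>j\<in>L. m' j * g x2 j) = 0" using R'[of x2] gI z v2 sz ze by simp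
  have eF': "(\<Sum>j\<in>?F. m' j * g i j) = - m' s3 * g i s3" if "i \<in> ?F" for i using R'[of i] FK[OF that] Fz[OF that] F1[OF that] zeF[OF that] by simp
  have eL': "(\<Sum>j\<in>L. m' j * g i j) = - m' x2 * g i x2" if "i \<in> L" for i using R'[of i] inS(3)[OF that] oL[OF that] sL[OF that] zeL[OF that] by simp
  have eK': "(\<Sum>j\<in>K'. m' j * g i j) = - g i x3" if "i \<in> K'" for i using R'[of i] mx' inS(2)[OF that] o2(2)[OF that] sK[OF that] zeK[OF that] by simp

  have pull: "(\<Sum>i\<in>T. (u i::real) * (- w * g i y)) = - w * (\<Sum>i\<in>T. u i * g y i)" for T u w y
    by (simp add: sum_distrib_left gsym[of y] mult_ac)
  have GF: "m s3 * (\<Sum>i\<in>?F. m' i * g s3 i) = m' s3 * (\<Sum>i\<in>?F. m i * g s3 i)"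
    using green[of ?F m "\<lambda>i. - m s3 * g i s3" m' "\<lambda>i. - m' s3 * g i s3"] eF eF' unfolding pull by simp
  have GL: "m x2 * (\<Sum>i\<in>L. m' i * g x2 i) = m' x2 * (\<Sum>i\<in>L. m i * g x2 i)"
    using green[of L m "\<lambda>i. - m x2 * g i x2" m' "\<lambda>i. - m' x2 * g i x2"] eL eL' unfolding pull by simp
  have GK: "m' z1 = m z1"
    using green[of K' m "\<lambda>i. - g i x1" m' "\<lambda>i. - g i x3"] eK eK' K'1'[of m'] K'3'[of m] by simp
  \<comment> \<open>In these unknowns the three Green identities reduce to \<sigma> = \<tau> and A^2
    = \<tau> + \<tau>^2, with a = 2 A - 1 - \<tau>.\<close>
  define A \<tau> \<sigma> a a' where "A = m s1" and "\<tau> = m s3" and "\<sigma> = m' s1" and "a = m x2" and "a' = m' x2"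
  have A': "m' s3 = A" using e1 e1' GK by (simp add: A_def)
  have pos: "0 < A" "0 < \<tau>" "0 < \<sigma>" "0 < a" "0 < m z1" using mp mp' sS by (auto simp: A_def \<tau>_def \<sigma>_def a_def)
  have Ea: "a = 2 * A - 1 - \<tau>" using e2 by (simp add: A_def \<tau>_def a_def)
  have Ea': "a' = 2 * \<sigma> - A" using e2' A' by (simp add: \<sigma>_def a'_def)
  have EF: "(\<Sum>i\<in>?F. m i * g s3 i) = A/2 - \<tau>" using e3 by (simp add: A_def \<tau>_def)
  have EF': "(\<Sum>i\<in>?F. m' i * g s3 i) = 1/2 + \<sigma>/2 - A" using e3' A' by (simp add: \<sigma>_def)
  have EL: "(\<Sum>i\<in>L. m i * g x2 i) = A/2 - a" using e4 by (simp add: A_def a_def)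
  have EL': "(\<Sum>i\<in>L. m' i * g x2 i) = \<sigma>/2 - a'" using e4' by (simp add: \<sigma>_def a'_def)
  have q1: "\<tau> + \<tau> * \<sigma> = A * A" using GF unfolding EF EF' A' \<tau>_def[symmetric] by (simp add: algebra_simps)
  have "a * \<sigma> = a' * A" using GL unfolding EL EL' a_def[symmetric] a'_def[symmetric] by (simp add: algebra_simps)
  hence q2: "\<sigma> + \<tau> * \<sigma> = A * A" unfolding Ea Ea' by (simp add: algebra_simps)
  have ts: "\<sigma> = \<tau>" using q1 q2 by linarith
  hence q: "A * A = \<tau> + \<tau> * \<tau>" using q1 by simp
  have mI: "g i j <= 0" if "i \<in> I" "j \<in> I" "i ~= j" for i j using g_le0 that .
  have c: "1/2 <= m z1"
  proof -
    have "(\<Sum>j\<in>K'. m j * g z1 j) = 1/2" using eK[OF mem(4)] vz by simp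
    moreover have "(\<Sum>j\<in>K'. m j * g z1 j) = m z1 + (\<Sum>j\<in>K'-{z1}. m j * g z1 j)" using sum.remove[OF fin(3) mem(4), of "\<lambda>j. m j * g z1 j"] gI by simp
    moreover have "(\<Sum>j\<in>K'-{z1}. m j * g z1 j) <= 0"
    proof (rule sum_nonpos)
      fix j assume j: "j \<in> K' - {z1}"
      hence "g z1 j <= 0" by (intro mI) (use I inS(2) inI in auto)
      moreover have "0 < m j" using mp[of j] j inS(2) by auto
      ultimately show "m j * g z1 j <= 0" by (simp add: mult_nonneg_nonpos)
    qed
    ultimately show ?thesis by linarith
  qed
  have A32: "A <= 3/2" using e1 c by (simp add: A_def)
  show False
  proof (cases "L = {}")
    case False
    then obtain l where l: "l \<in> L" "g x2 l ~= 0" using LL(1) by blast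
    have lS: "l \<in> S" "l \<in> I" "x2 ~= l" using l inS(3) inI nx by blast+
    have gl: "g x2 l <= -1/2" by (rule half_le) (use xI lS l in auto)
    have neg: "(\<Sum>j\<in>L-{l}. m j * g y j) <= 0" if y: "y \<in> I" "y ~: L - {l}" for y
    proof (rule sum_nonpos)
      fix j assume j: "j \<in> L - {l}"
      hence "g y j <= 0" by (intro mI) (use y inS(3) inI in auto)
      moreover have "0 < m j" using mp[of j] j inS(3) by auto
      ultimately show "m j * g y j <= 0" by (simp add: mult_nonneg_nonpos)
    qed
    have rem: "(\<Sum>j\<in>L. m j * g y j) = m l * g y l + (\<Sum>j\<in>L-{l}. m j * g y j)" for y by (rule sum.remove[OF fin(4) l(1)])
    have "- m x2 * g l x2 <= m l" using eL[OF l(1)] rem[of l] neg[of l] lS diag[OF lS(2)] by simp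
    moreover have "a * (-1/2) \<ge> a * g x2 l" by (rule mult_left_mono) (use gl pos in auto)
    ultimately have ml: "a / 2 <= m l" using gsym[of l x2] by (simp add: a_def)
    have "A/2 - a <= m l * g x2 l" using EL rem[of x2] neg[of x2] xI nx inS(3) by force
    moreover have "m l * g x2 l <= m l * (-1/2)" by (rule mult_left_mono) (use gl ml pos in auto)
    \<comment> \<open>The node \<open>l\<close> with its positive coefficient takes away at least a
      / 4. The resulting bound on \<tau> means A >= 12/7, against A <= 3/2.\<close>
    ultimately have "2 * A / 3 <= a" using ml by linarith
    hence t1: "\<tau> <= 4 * A / 3 - 1" using Ea by linarith
    have "\<tau> * (1 + \<tau>) <= (4 * A / 3 - 1) * (1 + (4 * A / 3 - 1))" by (rule mult_mono) (use t1 pos in auto)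
    hence "A * A <= 16 * (A * A) / 9 - 4 * A / 3" using q by (simp add: algebra_simps)
    hence "0 <= A * (7 * A / 9 - 4/3)" by (simp add: algebra_simps)
    hence "0 <= 7 * A / 9 - 4/3" using pos by (simp add: zero_le_mult_iff)
    thus False using A32 by linarith
  next
    case True
    \<comment> \<open>With \<open>L\<close> empty all coefficients are determined. The null vector
      \<open>p\<close> of the vertex with \<open>x1, x4\<close> then requires 9/40 as the square of
      an entry, but a label gives 1/4 or 1/2.\<close>
    have aA: "a = A/2" using EL True by simp
    hence tA: "\<tau> = 3 * A / 2 - 1" using Ea by linarith
    have "A * (5 * A / 4 - 3/2) = 0" using q unfolding tA by (simp add: algebra_simps)
    hence Av: "A = 6/5" using pos by auto
    hence tv: "\<tau> = 4/5" using tA by simp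
    have cv: "m z1 = 4/5" using e1 Av by (simp add: A_def)
    obtain p where p0: "(\<forall>i\<in>insert x1 (insert x4 S). 0 < p i) & (\<forall>i\<in>insert x1 (insert x4 S). (\<Sum>j\<in>insert x1 (insert x4 S). p j * g i j) = 0) & p x1 = 1"
      using null_scaled[OF V14 insertI1] by (rule exE)
    hence px: "p x1 = 1" by blast
    have P: "p x1 * g i x1 + p x4 * g i x4 + p s1 * g i s1 + p s3 * g i s3 + (\<Sum>j\<in>?F. p j * g i j) + (\<Sum>j\<in>K'. p j * g i j) = 0" if "i \<in> insert x1 (insert x4 S)" for i
    proof -
      have "(\<Sum>j\<in>insert x1 (insert x4 S). p j * g i j) = 0" using p0 that by blast
      hence "p x1 * g i x1 + p x4 * g i x4 + p s1 * g i s1 + p s3 * g i s3 + (\<Sum>j\<in>?F. p j * g i j) + (\<Sum>j\<in>K'. p j * g i j) + (\<Sum>j\<in>L. p j * g i j) = 0"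
        unfolding sumS[OF xS(1,4) ne(3) ns(1)] .
      thus ?thesis unfolding True sum.empty by (simp only: add_0_right)
    qed
    have p1: "1 - p s1 / 2 - p z1 / 2 = 0" using P[of x1] px gI z h1 z13 ze K'1 by simp
    have p2: "p s1 - 1/2 - p s3 / 2 = 0" using P[of s1] sS px gI h1 sz v13 ze by simp
    have p3: "p s3 - p s1 / 2 + (\<Sum>j\<in>?F. p j * g s3 j) = 0" using P[of s3] sS gI z13 sz v31 ze by simp
    have K'4: "(\<Sum>j\<in>K'. p j * g x4 j) = p z1 * g x4 z1" by (rule s1) (use fin mem o4(1) t4 in auto)
    have p4: "p x4 = - p z1 * g x4 z1" using P[of x4] gI z sz ze K'4 by simp
    have pF: "(\<Sum>j\<in>?F. p j * g i j) = - p s3 * g i s3" if "i \<in> ?F" for i using P[of i] FK[OF that] Fz[OF that] F1[OF that] zeF[OF that] by simp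
    have pK: "(\<Sum>j\<in>K'. p j * g i j) = - g i x1 + (- p x4 * g i x4)" if "i \<in> K'" for i using P[of i] px inS(2)[OF that] sK[OF that] zeK[OF that] by simp
    have G1: "m s3 * (\<Sum>i\<in>?F. p i * g s3 i) = p s3 * (\<Sum>i\<in>?F. m i * g s3 i)"
      using green[of ?F m "\<lambda>i. - m s3 * g i s3" p "\<lambda>i. - p s3 * g i s3"] eF pF unfolding pull by simp
    have ps: "p s3 = 1/2" "p s1 = 3/4" "p z1 = 5/4"
    proof -
      have msv: "m s3 = 4/5" using tv by (simp add: \<tau>_def)
      have EFv: "(\<Sum>i\<in>?F. m i * g s3 i) = -1/5" using EF Av tv by simp
      have "4/5 * (\<Sum>i\<in>?F. p i * g s3 i) = p s3 * (-1/5)" using G1 unfolding msv EFv .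
      hence "(\<Sum>i\<in>?F. p i * g s3 i) = - p s3 / 4" by simp
      thus "p s3 = 1/2" "p s1 = 3/4" "p z1 = 5/4" using p1 p2 p3 by simp_all
    qed
    have K'4': "(\<Sum>i\<in>K'. m i * g x4 i) = m z1 * g x4 z1" by (rule s1) (use fin mem o4(1) t4 in auto)
    have "(\<Sum>i\<in>K'. p i * (- g i x1)) = (\<Sum>i\<in>K'. m i * (- g i x1 + (- p x4 * g i x4)))"
      by (rule green) (use eK pK in auto)
    also have "\<dots> = m z1 / 2 + (- p x4 * (m z1 * g x4 z1))"
      unfolding distrib_left sum.distrib K'1' pull K'4' ..
    finally have "p z1 / 2 = m z1 / 2 - p x4 * (m z1 * g x4 z1)" unfolding K'1' by simp
    hence "5/8 = 4/5 * (1/2) + 5/4 * (4/5) * (g x4 z1 * g x4 z1)" unfolding p4 ps cv by (simp add: algebra_simps)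
    hence w: "g x4 z1 * g x4 z1 = 9/40" by simp
    have "g x4 z1 = -1/2 \<or> g x4 z1 = -rt" using val[OF V14, of x4 z1] sS nn ad(6) t4 by auto
    hence "g x4 z1 * g x4 z1 = 1/4 \<or> g x4 z1 * g x4 z1 = 1/2"
    proof
      assume "g x4 z1 = -1/2"
      hence "g x4 z1 * g x4 z1 = (-1/2) * (-1/2)" by (simp only:)
      thus ?thesis by simp
    qed (use rt_sq in simp)
    thus False using w by simp
  qed
qed

text \<open>If \<open>s1\<close> and \<open>s3\<close> are adjacent, the square
  \<open>x1, x3, s3, s1\<close> is timelike and \<open>t2\<close> must be one of them; the two
  possibilities are mirror images.\<close>

lemma caseC: assumes ns: "s1 ~= s3" "z1 = z3" shows False
proof (cases "g s1 s3 = 0")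
  case True thus False using dist2 ns by blast
next
  case False
  interpret f: hquad I g V n S K K' L x3 x2 x1 x4 s3 s1 t2 z3 z1 t4 by (rule flip)
  have sS: "s1 \<in> S" "s3 \<in> S" using inS mem by auto
  have I: "s1 \<in> I" "s3 \<in> I" using sS inI by auto
  have F': "g s3 s1 ~= 0" using False gsym[of s3 s1] by simp
  have "g s3 s1 <= -1/2" using half_le I ns F' by auto
  hence "tl {x1,x3,s3,s1}"
    by (intro tl4) (use I xI nx[OF sS(1)] nx[OF sS(2)] ne ns h13 hs1[OF ns(1)] hs3[OF ns(1)[symmetric]] in auto)
  hence "t2 \<in> {x1,x3,s3,s1} \<or> t4 \<in> {x1,x3,s3,s1}" using Ylem[of "{x1,x3,s3,s1}"] mem by blast
  moreover have "t4 ~= s3" "t4 ~= s1" using KK'(1)[OF _ mem(6)] mem by auto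
  moreover have "t4 ~= x1" "t4 ~= x3" "t2 ~= x1" "t2 ~= x3" using nx inS mem by blast+
  ultimately have "t2 = s1 \<or> t2 = s3" by auto
  thus False
  proof
    assume "t2 = s1" thus False using caseC1[OF ns False] by simp
  next
    assume "t2 = s3" thus False using f.caseC1[OF ns(1)[symmetric] ns(2)[symmetric] F'] by simp
  qed
qed

lemma contradiction: False
proof (cases "s1 = s3")
  case s: True
  show False
  proof (cases "z1 = z3")
    case True thus False using caseB s by blast
  next
    case False thus False using hquad.caseC[OF swap False] s by blast
  qed
next
  case s: False
  show False
  proof (cases "z1 = z3")
    case True thus False using caseC s by blast
  next
    case False thus False using caseA s by blast
  qed
qed

end

section \<open>Quadrangles with orthogonal tree corners: reduction\<close>

locale zquad = ideal_diagram +
  fixes S :: "'a set" and x1 x2 x3 x4 :: 'a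
  assumes V12: "insert x1 (insert x2 S) \<in> V" and V23: "insert x3 (insert x2 S) \<in> V" and V34: "insert x3 (insert x4 S) \<in> V" and V14: "insert x1 (insert x4 S) \<in> V"
    and xS: "x1 ~: S" "x2 ~: S" "x3 ~: S" "x4 ~: S" and ds: "distinct [x1,x2,x3,x4]"
    and z: "g x1 x2 = 0" "g x2 x1 = 0" "g x2 x3 = 0" "g x3 x2 = 0" "g x3 x4 = 0" "g x4 x3 = 0" "g x1 x4 = 0" "g x4 x1 = 0"
    and D13: "g x1 x3 < -1 \<or> (g x1 x3 = -rt & 2 <= dg S x1)"
    and D24: "g x2 x4 < -1 \<or> (g x2 x4 = -rt & 2 <= dg S x2)"
    and trs: "ed (insert x1 (insert x2 S)) ~= 2 * n" "ed (insert x3 (insert x2 S)) ~= 2 * n" "ed (insert x3 (insert x4 S)) ~= 2 * n" "ed (insert x1 (insert x4 S)) ~= 2 * n"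
begin

lemma rot: "zquad I g V n S x2 x1 x4 x3"
proof (unfold_locales)
  show "distinct [x2,x1,x4,x3]" using ds by auto
qed (use V12 V23 V34 V14 xS z D13 D24 trs in \<open>simp_all add: insert_commute\<close>)

lemma xI: "x1 \<in> I" "x2 \<in> I" "x3 \<in> I" "x4 \<in> I" and SI: "S \<subseteq> I" using V_sub V12 V34 by auto
lemma ne: "x1 ~= x2" "x1 ~= x3" "x1 ~= x4" "x2 ~= x3" "x2 ~= x4" "x3 ~= x4" "x2 ~= x1" "x3 ~= x1" "x4 ~= x1" "x3 ~= x2" "x4 ~= x2" "x4 ~= x3" using ds by auto

lemma V': "insert x2 (insert x1 S) \<in> V" "insert x2 (insert x3 S) \<in> V" "insert x4 (insert x3 S) \<in> V" "insert x4 (insert x1 S) \<in> V"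
  using V12 V23 V34 V14 by (simp_all add: insert_commute)
lemma trs': "ed (insert x2 (insert x1 S)) ~= 2 * n" "ed (insert x2 (insert x3 S)) ~= 2 * n" "ed (insert x4 (insert x3 S)) ~= 2 * n" "ed (insert x4 (insert x1 S)) ~= 2 * n"
  using trs by (simp_all add: insert_commute)

text \<open>\<open>x1\<close> and \<open>x3\<close> produce a timelike vector supported on nodes
  that \<open>x2\<close> and \<open>x4\<close> do not touch; \<open>P\<close> collects these
  nodes.\<close>

definition good where "good \<longleftrightarrow> g x1 x3 < -1 \<or> (g x1 x3 = -rt & (\<exists>k\<in>S. tch S x1 k & tch S x3 k & ~ tch S x2 k & ~ tch S x4 k))"
definition P where "P = insert x1 (insert x3 {k\<in>S. tch S x1 k & ~ tch S x2 k & ~ tch S x4 k})"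

lemma tch_eq: "k \<in> S ==> j \<in> rch S k ==> tch S x j = tch S x k" unfolding tch_def using rch_eq by metis

lemma good_tl: assumes good shows "tl P"
  using assms unfolding good_def
proof (elim disjE conjE bexE)
  assume "g x1 x3 < -1"
  hence "tl {x1,x3}" using tl_dotted xI ne by auto
  thus "tl P" by (rule tl_mono) (use xI SI in \<open>auto simp: P_def\<close>)
next
  fix k assume k: "g x1 x3 = -rt" "k \<in> S" "tch S x1 k" "tch S x3 k" "~ tch S x2 k" "~ tch S x4 k"
  have "tl (insert x1 (insert x3 (rch S k)))" by (rule tl_comp[OF V12 V23 trs(1,2)]) (use xS ne k in auto)
  moreover have "insert x1 (insert x3 (rch S k)) \<subseteq> P" unfolding P_def using tch_eq[OF k(2)] k rch_sub[OF k(2)] by auto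
  moreover have "P \<subseteq> I" unfolding P_def using xI SI by auto
  ultimately show "tl P" by (rule tl_mono)
qed

lemma not_tch: "k \<in> S ==> ~ tch S x k ==> g x k = 0" unfolding tch_def using rch_self by blast

text \<open>The two supports meet different components of \<open>S\<close>, so they are orthogonal
  timelike sets.\<close>

lemma good_both: assumes good "zquad.good g S x2 x1 x4 x3" shows False
proof -
  interpret r: zquad I g V n S x2 x1 x4 x3 by (rule rot)
  show False
  proof (rule tl_orth[OF good_tl[OF assms(1)] r.good_tl[OF assms(2)]])
    fix i j assume i: "i \<in> P" and j: "j \<in> r.P"
    have i': "i = x1 \<or> i = x3 \<or> (i \<in> S & tch S x1 i & ~ tch S x2 i & ~ tch S x4 i)" using i P_def by auto
    have j': "j = x2 \<or> j = x4 \<or> (j \<in> S & tch S x2 j & ~ tch S x1 j & ~ tch S x3 j)" using j r.P_def by auto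
    show "g i j = 0"
    proof (cases "i \<in> S & j \<in> S")
      case True
      show ?thesis
      proof (rule ccontr)
        assume "g i j ~= 0"
        hence "j \<in> rch S i" using rch_closed[of i S i j] True rch_self by blast
        thus False using tch_eq[of i j x1] i' j' True xS by auto
      qed
    next
      case False
      thus ?thesis using i' j' z not_tch[of j x1] not_tch[of j x3] not_tch[of i x2] not_tch[of i x4] gsym[of i x2] gsym[of i x4] by auto
    qed
  qed
qed

text \<open>\<open>x1\<close> touches two components of \<open>S\<close>. Each of them is touched by
  \<open>x2\<close> or \<open>x4\<close> too, and by \<open>pair_uni\<close> each of these shares at
  most one component with \<open>x1\<close>. So one component goes with \<open>x2\<close> and the
  other with \<open>x4\<close>; these are \<open>K\<close> and \<open>K'\<close> of
  \<open>hquad\<close>.\<close>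

lemma bad: assumes "~ good" shows False
proof -
  have h: "g x1 x3 = -rt" "2 <= dg S x1" using D13 assms good_def by auto
  have ng: "~ (tch S x1 k & tch S x3 k & ~ tch S x2 k & ~ tch S x4 k)" if "k \<in> S" for k using assms h that unfolding good_def by blast
  have t12: "tch S x1 k \<or> tch S x2 k" "tch S x3 k \<or> tch S x2 k" "tch S x3 k \<or> tch S x4 k" "tch S x1 k \<or> tch S x4 k" if "k \<in> S" for k
    using pair_or[OF V12 xS(1,2) that] pair_or[OF V23 xS(3,2) that] pair_or[OF V34 xS(3,4) that] pair_or[OF V14 xS(1,4) that] by auto
  have t24: "tch S x2 k \<or> tch S x4 k" if "k \<in> S" "tch S x1 k" for k using ng[OF that(1)] t12[OF that(1)] that by blast
  have t24': "tch S x2 k \<or> tch S x4 k \<or> tch S x1 k" if "k \<in> S" for k using t12[OF that] by blast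
  have fS: "finite S" using SI fin_sub by blast
  have nbS: "k \<in> nb S y \<longleftrightarrow> k \<in> S & g y k ~= 0" if "y ~: S" for y k using that by (auto simp: nb_def)
  obtain u v where uv: "u \<in> nb S x1" "v \<in> nb S x1" "u ~= v"
  proof -
    obtain u where u: "u \<in> nb S x1" using h unfolding dg_def by (metis card.empty ex_in_conv not_numeral_le_zero)
    have "~ nb S x1 \<subseteq> {u}"
    proof
      assume "nb S x1 \<subseteq> {u}"
      hence "card (nb S x1) <= card {u}" by (intro card_mono) auto
      thus False using h by (simp add: dg_def)
    qed
    thus thesis using that u by blast
  qed
  have U: "u \<in> S" "v \<in> S" "g x1 u ~= 0" "g x1 v ~= 0" using uv nbS xS by auto
  have tu: "tch S x1 u" "tch S x1 v" unfolding tch_def using U rch_self by blast+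
  have uvr: "rch S u ~= rch S v"
  proof
    assume "rch S u = rch S v"
    hence "v \<in> rch S u" using rch_self by metis
    thus False using pair_unique[OF V12 xS(1) ne(1) trs(1) U(1) rch_self _ U(3,4)] uv by blast
  qed
  note uni12 = pair_uni[OF V12 xS(1,2) ne(1) trs(1)] and uni14 = pair_uni[OF V14 xS(1,4) ne(3) trs(4)]
    and uni32 = pair_uni[OF V23 xS(3,2) ne(10) trs(2)] and uni34 = pair_uni[OF V34 xS(3,4) ne(6) trs(3)]
  have "\<exists>a b. a \<in> S & b \<in> S & tch S x1 a & tch S x1 b & tch S x2 a & ~ tch S x4 a & tch S x4 b & ~ tch S x2 b"
  proof (cases "tch S x2 u")
    case True
    hence "~ tch S x2 v" using uni12[OF U(1) tu(1) True U(2) tu(2)] uvr by blast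
    hence "tch S x4 v" using t24 U tu by blast
    hence "~ tch S x4 u" using uni14[OF U(1) tu(1) _ U(2) tu(2)] uvr by blast
    thus ?thesis using True \<open>~ tch S x2 v\<close> \<open>tch S x4 v\<close> U tu by blast
  next
    case False
    hence "tch S x4 u" using t24 U tu by blast
    hence "~ tch S x4 v" using uni14[OF U(1) tu(1) _ U(2) tu(2)] uvr by blast
    hence "tch S x2 v" using t24 U tu by blast
    thus ?thesis using False \<open>~ tch S x4 v\<close> \<open>tch S x4 u\<close> U tu by blast
  qed
  then obtain a b where ab: "a \<in> S" "b \<in> S" "tch S x1 a" "tch S x1 b" "tch S x2 a" "~ tch S x4 a" "tch S x4 b" "~ tch S x2 b" by blast
  have ab3: "tch S x3 a" "tch S x3 b" using t12(3)[OF ab(1)] t12(2)[OF ab(2)] ab by auto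
  let ?K = "rch S a" and ?K' = "rch S b"
  define L where "L = S - ?K - ?K'"
  have KS: "?K \<subseteq> S" "?K' \<subseteq> S" using rch_sub ab by auto
  have dj: "?K \<inter> ?K' = {}"
  proof (rule ccontr)
    assume "~ ?thesis"
    then obtain j where "j \<in> ?K" "j \<in> ?K'" by blast
    thus False using tch_eq[OF ab(1), of j x2] tch_eq[OF ab(2), of j x2] ab by auto
  qed
  have Kcl: "j \<in> ?K" if "tch S x1 j & tch S x2 j \<or> tch S x3 j & tch S x2 j" "j \<in> S" for j
    using uni12[OF ab(1,3,5) that(2)] uni32[OF ab(1) ab3(1) ab(5) that(2)] that(1) rch_self[of j S] by auto
  have Kcl': "j \<in> ?K'" if "tch S x1 j & tch S x4 j \<or> tch S x3 j & tch S x4 j" "j \<in> S" for j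
    using uni14[OF ab(2,4,7) that(2)] uni34[OF ab(2) ab3(2) ab(7) that(2)] that(1) rch_self[of j S] by auto
  have L1: "~ tch S x1 j" "~ tch S x3 j" if "j \<in> L" for j
  proof -
    have j: "j \<in> S" "j ~: ?K" "j ~: ?K'" using that L_def by auto
    show n1: "~ tch S x1 j" using t24[OF j(1)] Kcl[OF _ j(1)] Kcl'[OF _ j(1)] j by blast
    show "~ tch S x3 j" using t12(1)[OF j(1)] n1 Kcl[OF _ j(1)] j by blast
  qed
  have L2: "tch S x2 j" "tch S x4 j" if "j \<in> L" for j using L1[OF that] t12 that L_def by auto
  have Lr: "rch S j \<subseteq> L" if "j \<in> L" for j
  proof
    fix k assume k: "k \<in> rch S j"
    have jS: "j \<in> S" using that L_def by auto
    have kS: "k \<in> S" using rch_sub[OF jS] k by auto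
    have "~ tch S x1 k" using tch_eq[OF jS k] L1[OF that] by simp
    hence "k ~: ?K" "k ~: ?K'" using tch_eq[OF ab(1)] tch_eq[OF ab(2)] ab by auto
    thus "k \<in> L" using kS L_def by auto
  qed
  have LL: "\<exists>l\<in>L. g x2 l ~= 0" "\<exists>l\<in>L. g x4 l ~= 0" if nL: "L ~= {}"
  proof -
    obtain j where "j \<in> L" using nL by blast
    thus "\<exists>l\<in>L. g x2 l ~= 0" "\<exists>l\<in>L. g x4 l ~= 0" using L2[of j] Lr[of j] unfolding tch_def by blast+
  qed
  have LI: "insert x2 (insert x4 L) \<subseteq> I" using xI SI L_def by auto
  obtain s1 s3 t2 z1 z3 t4 where el: "s1 \<in> ?K" "g x1 s1 ~= 0" "s3 \<in> ?K" "g x3 s3 ~= 0" "t2 \<in> ?K" "g x2 t2 ~= 0" "z1 \<in> ?K'" "g x1 z1 ~= 0" "z3 \<in> ?K'" "g x3 z3 ~= 0" "t4 \<in> ?K'" "g x4 t4 ~= 0"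
    using ab ab3 unfolding tch_def by blast
  have tchI: "tch S y k" if "g y k ~= 0" for y k unfolding tch_def using that rch_self by blast
  have o1: "g x1 k = 0" if k: "k \<in> S" "k ~= s1" "k ~= z1" for k
  proof (rule ccontr)
    assume nz: "g x1 k ~= 0"
    have "tch S x1 k" by (rule tchI[OF nz])
    hence "k \<in> ?K \<or> k \<in> ?K'" using t24[OF k(1)] Kcl Kcl' k by blast
    thus False using pair_unique[OF V12 xS(1) ne(1) trs(1) ab(1) _ el(1) nz el(2)] pair_unique[OF V12 xS(1) ne(1) trs(1) ab(2) _ el(7) nz el(8)] k by blast
  qed
  have o3: "g x3 k = 0" if k: "k \<in> S" "k ~= s3" "k ~= z3" for k
  proof (rule ccontr)
    assume nz: "g x3 k ~= 0"
    have t: "tch S x3 k" by (rule tchI[OF nz])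
    hence "k \<in> ?K \<or> k \<in> ?K'" using L1(2)[of k] L_def k by blast
    thus False using pair_unique[OF V23 xS(3) ne(10) trs(2) ab(1) _ el(3) nz el(4)] pair_unique[OF V23 xS(3) ne(10) trs(2) ab(2) _ el(9) nz el(10)] k by blast
  qed
  have o2: "g x2 k = 0" if k: "k \<in> ?K" "k ~= t2" for k
    using pair_unique[OF V'(1) xS(2) ne(7) trs'(1) ab(1) k(1) el(5) _ el(6)] k by blast
  have o4: "g x4 k = 0" if k: "k \<in> ?K'" "k ~= t4" for k
    using pair_unique[OF V'(4) xS(4) ne(9) trs'(4) ab(2) k(1) el(11) _ el(12)] k by blast
  have o2': "g x2 k = 0" if k: "k \<in> ?K'" for k using tchI[of x2 k] tch_eq[OF ab(2) k] ab by blast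
  have o4': "g x4 k = 0" if k: "k \<in> ?K" for k using tchI[of x4 k] tch_eq[OF ab(1) k] ab by blast
  have both: "g i j = 0 ==> g i j = 0 & g j i = 0" for i j using gsym[of j i] by simp
  have sep: "g i j = 0" if "k \<in> S" "i \<in> rch S k" "j \<in> S" "j ~: rch S k" for i j k by (rule rch_sep(1)[OF that])
  have hq: "hquad I g V n S ?K ?K' L x1 x2 x3 x4 s1 s3 t2 z1 z3 t4"
  proof (unfold_locales)
    show "distinct [x1,x2,x3,x4]" by (rule ds)
    show "g x3 x1 = -rt" using h gsym[of x3 x1] by simp
    show r24: "g x2 x4 <= -rt" using D24 rt_bounds by linarith
    show "g x4 x2 <= -rt" using r24 gsym[of x4 x2] by simp
    show "S = ?K \<union> ?K' \<union> L" using KS L_def by auto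
    show "?K \<inter> L = {}" "?K' \<inter> L = {}" using L_def by auto
    show "g i j = 0 & g j i = 0" if "i \<in> ?K" "j \<in> ?K'" for i j by (rule both, rule sep[OF ab(1) that(1)]) (use that KS dj in auto)
    show "g i j = 0 & g j i = 0" if "i \<in> ?K" "j \<in> L" for i j by (rule both, rule sep[OF ab(1) that(1)]) (use that L_def in auto)
    show "g i j = 0 & g j i = 0" if "i \<in> ?K'" "j \<in> L" for i j by (rule both, rule sep[OF ab(2) that(1)]) (use that L_def in auto)
    show "g x1 k = 0 & g k x1 = 0" if "k \<in> S" "k ~= s1" "k ~= z1" for k by (rule both[OF o1[OF that]])
    show "g x3 k = 0 & g k x3 = 0" if "k \<in> S" "k ~= s3" "k ~= z3" for k by (rule both[OF o3[OF that]])
    show "g x2 k = 0 & g k x2 = 0" if "k \<in> ?K" "k ~= t2" for k by (rule both[OF o2[OF that]])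
    show "g x2 k = 0 & g k x2 = 0" if "k \<in> ?K'" for k by (rule both[OF o2'[OF that]])
    show "g x4 k = 0 & g k x4 = 0" if "k \<in> ?K'" "k ~= t4" for k by (rule both[OF o4[OF that]])
    show "g x4 k = 0 & g k x4 = 0" if "k \<in> ?K" for k by (rule both[OF o4'[OF that]])
    show "conn ?K" "conn ?K'" using rch_conn ab by auto
    show "\<exists>l\<in>L. g x2 l ~= 0" "\<exists>l\<in>L. g x4 l ~= 0" if "L ~= {}" using LL[OF that] by auto
    show "tl (insert x2 (insert x4 L))"
    proof (cases "g x2 x4 < -1")
      case True
      hence "tl {x2,x4}" using tl_dotted xI ne by auto
      thus ?thesis by (rule tl_mono) (use LI in auto)
    next
      case False
      hence h24: "g x2 x4 = -rt" "2 <= dg S x2" using D24 by auto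
      have "~ nb S x2 \<subseteq> {t2}"
      proof
        assume "nb S x2 \<subseteq> {t2}"
        hence "card (nb S x2) <= card {t2}" by (intro card_mono) auto
        thus False using h24 by (simp add: dg_def)
      qed
      then obtain l where l: "l \<in> S" "g x2 l ~= 0" "l ~= t2" using nbS[OF xS(2)] by blast
      hence lL: "l \<in> L" using o2[of l] o2'[of l] L_def by auto
      have "tl (insert x2 (insert x4 (rch S l)))"
        by (rule tl_comp[OF V'(1) V'(4) trs'(1,4)]) (use xS ne h24 l L2[OF lL] in auto)
      thus ?thesis by (rule tl_mono) (use LI Lr[OF lL] in auto)
    qed
  qed (fact V12 V23 V34 V14 xS z h(1) dj el)+
  show False by (rule hquad.contradiction[OF hq])
qed

lemma impossible: False
proof (cases good)
  case g1: True
  show False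
  proof (cases "zquad.good g S x2 x1 x4 x3")
    case True thus False using good_both g1 by blast
  next
    case False thus False using zquad.bad[OF rot] by blast
  qed
next
  case False thus False by (rule bad)
qed

end

context edge_diagram begin

lemma clone:
  assumes cy: "ed (insert x G) = 2 * n" and cy': "ed (insert x' G) = 2 * n" and j: "j \<in> G" shows "g x' j = g x j"
proof -
  have half: "g i j = -1/2" if "i \<in> insert x G" "j \<in> insert x G" "i ~= j" "g i j ~= 0" for i j
    using cycle_V(2)[OF AV cy that(1,2)] that by auto
  have half': "g i j = -1/2" if "i \<in> insert x' G" "j \<in> insert x' G" "i ~= j" "g i j ~= 0" for i j
    using cycle_V(2)[OF AV' cy' that(1,2)] that by auto
  have "j ~= x" "j ~= x'" using j xG xG' by auto
  have "2 = dg G j + (if g j x ~= 0 then 1 else 0)" using cycle_V(1)[OF AV cy, of j] dg_insert[OF fG xG \<open>j ~= x\<close>] j by simp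
  moreover have "2 = dg G j + (if g j x' ~= 0 then 1 else 0)" using cycle_V(1)[OF AV' cy', of j] dg_insert[OF fG xG' \<open>j ~= x'\<close>] j by simp
  ultimately have "g j x ~= 0 \<longleftrightarrow> g j x' ~= 0" by (cases "g j x = 0"; cases "g j x' = 0") simp_all
  thus ?thesis using half[of x j] half'[of x' j] j \<open>j ~= x\<close> \<open>j ~= x'\<close> gsym[of j x] gsym[of j x'] by auto
qed

end

section \<open>Triangular 2-faces, and Lorentzian estimates over a nine-cycle\<close>

context ideal_diagram begin

text \<open>Any two of the three facets share a vertex, so the pairs are undotted. By
  \<open>edge\<close> they have label 4 and are not attached as leaves, which leaves a heavy edge
  without a leaf in one vertex.\<close>

lemma no_triangle:
  assumes V: "insert x (insert y S) \<in> V" "insert x (insert w S) \<in> V" "insert y (insert w S) \<in> V"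
    and S: "x ~: S" "y ~: S" "w ~: S" and ne: "x ~= y" "x ~= w" "y ~= w"
  shows False
proof -
  have V': "insert y (insert x S) \<in> V" "insert w (insert x S) \<in> V" "insert w (insert y S) \<in> V" using V by (simp_all add: insert_commute)
  interpret e1: edge_diagram I g V n "insert w S" x y by unfold_locales (use V S ne in auto)
  interpret e2: edge_diagram I g V n "insert y S" x w by unfold_locales (use V V' S ne in auto)
  interpret e3: edge_diagram I g V n "insert x S" y w by unfold_locales (use V V' S ne in auto)
  have "-1 < g x y" "-1 < g x w" "-1 < g y w" using meets[OF V(1), of x y] meets[OF V(2), of x w] meets[OF V(3), of y w] ne by auto
  hence r: "g x y = -rt" "2 <= dg (insert w S) x" "2 <= dg (insert w S) y" "2 <= dg (insert y S) x" "2 <= dg (insert x S) y" using e1.edge e2.edge e3.edge by linarith+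
  have f: "finite S" using V_fin[OF V(1)] by simp
  have d: "dg (insert x (insert y S)) x = dg (insert y S) x" "dg (insert x (insert y S)) y = dg (insert x S) y"
    by (simp_all add: dg_def nb_def) (metis)+
  have "nb (insert x (insert y S)) x = {y} \<or> nb (insert x (insert y S)) y = {x}"
    by (rule heavy_leaf[OF V(1)]) (use ne r rt_bounds in auto)
  hence "dg (insert x (insert y S)) x = 1 \<or> dg (insert x (insert y S)) y = 1" unfolding dg_def by auto
  thus False using d r by linarith
qed

lemma cyc_rot: assumes "cyc A c" "k < n" shows "cyc A (\<lambda>i. c ((i + k) mod n))"
proof -
  let ?r = "\<lambda>i::nat. (i + k) mod n"
  have rv: "?r i = (if i + k < n then i + k else i + k - n)" if "i < n" for i
    using that assms(2) by (simp add: mod_if)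
  have e: "(\<lambda>i. c ((i + k) mod n)) = c \<circ> ?r" by auto
  have ir: "inj_on ?r {..<n}"
  proof (rule inj_onI)
    fix i j assume ij: "i \<in> {..<n}" "j \<in> {..<n}" "?r i = ?r j"
    have "i < n" "j < n" using ij by auto
    thus "i = j" using ij(3) rv[of i] rv[of j] assms(2) by (simp split: if_splits)
  qed
  have "?r ` {..<n} \<subseteq> {..<n}" using n9 by auto
  hence r: "?r ` {..<n} = {..<n}" using ir by (simp add: endo_inj_surj)
  show ?thesis unfolding e cyc_def
  proof (intro conjI allI impI)
    show "inj_on (c \<circ> ?r) {..<n}" by (rule comp_inj_on[OF ir]) (use r cycD(2)[OF assms(1)] in simp)
    have "(c \<circ> ?r) ` {..<n} = c ` (?r ` {..<n})" by (simp only: image_comp)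
    thus "(c \<circ> ?r) ` {..<n} = A" unfolding r cycD(3)[OF assms(1)] .
    fix i j assume ij: "i < n" "j < n"
    have "?r i < n" "?r j < n" using n9 by auto
    note v = cycD(5)[OF assms(1) this]
    have e1: "(?r i = ?r j) = (i = j)" using inj_on_eq_iff[OF ir, of i j] ij by auto
    have e2: "(?r j = Suc (?r i) \<or> ?r i = Suc (?r j) \<or> (?r i = 0 & ?r j = n - 1) \<or> (?r j = 0 & ?r i = n - 1)) = (j = Suc i \<or> i = Suc j \<or> (i = 0 & j = n - 1) \<or> (j = 0 & i = n - 1))"
    proof -
      obtain N where N: "n = Suc N" using ij by (cases n) auto
      define a b where "a = ?r i" and "b = ?r j"
      have a: "a < n" "a = i + k \<or> a + n = i + k" using rv[OF ij(1)] ij assms(2) by (auto simp: a_def)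
      have b: "b < n" "b = j + k \<or> b + n = j + k" using rv[OF ij(2)] ij assms(2) by (auto simp: b_def)
      have "(b = Suc a \<or> a = Suc b \<or> (a = 0 & b = n - 1) \<or> (b = 0 & a = n - 1)) = (j = Suc i \<or> i = Suc j \<or> (i = 0 & j = n - 1) \<or> (j = 0 & i = n - 1))"
        using a(2) b(2)
      proof (elim disjE)
        assume "a = i + k" "b = j + k" thus ?thesis using a(1) b(1) assms(2) ij unfolding N by auto
      next
        assume "a + n = i + k" "b + n = j + k" thus ?thesis using a(1) b(1) assms(2) ij unfolding N by auto
      next
        assume h: "a = i + k" "b + n = j + k" thus ?thesis using a(1) b(1) assms(2) ij unfolding N by auto
      next
        assume h: "a + n = i + k" "b = j + k" thus ?thesis using a(1) b(1) assms(2) ij unfolding N by auto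
      qed
      thus ?thesis unfolding a_def b_def .
    qed
    show "g ((c \<circ> ?r) i) ((c \<circ> ?r) j) = (if i = j then 1 else if j = Suc i \<or> i = Suc j \<or> (i = 0 & j = n - 1) \<or> (j = 0 & i = n - 1) then -1/2 else 0)"
      using v unfolding e1 e2 by (simp only: o_apply)
  qed (use cycD(1)[OF assms(1)] in simp)
qed

lemma sum9: "(\<Sum>j<(9::nat). f j) = f 0 + f 1 + f 2 + f 3 + f 4 + f 5 + f 6 + f 7 + (f 8 :: real)"
  by (simp add: numeral_eq_Suc lessThan_Suc)

lemma cyc9: assumes "cyc A c" "n = 9" "i < 9" "j < 9"
  shows "g (c i) (c j) = (if i = j then 1 else if j = Suc i \<or> i = Suc j \<or> (i = 0 & j = 8) \<or> (j = 0 & i = 8) then -1/2 else 0)"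
  using cycD(5)[OF assms(1), of i j] assms by simp

lemma cyc9_inj: assumes "cyc A c" "n = 9" "i < 9" "j < 9" shows "c i = c j \<longleftrightarrow> i = j"
  using cycD(2)[OF assms(1)] assms inj_on_eq_iff by fastforce

text \<open>Reverse Cauchy-Schwarz for the vector \<open>U\<close> on the cycle with
  \<open>u3\<close> at \<open>x3\<close> and the vector \<open>W\<close> on the cycle with
  \<open>w4\<close> at \<open>x4\<close>, written out for concrete lists. The indices j + 1 and j +
  8 are the two neighbours modulo 9.\<close>

lemma lor_cyc:
  fixes U W :: "nat => real"
  assumes c: "cyc A c" "n = 9" and x: "x3 \<in> I" "x4 \<in> I" "x3 ~: A" "x4 ~: A" "x3 ~= x4"
    and r3: "!!j. j < 9 ==> g x3 (c j) = r3 j" and r4: "!!j. j < 9 ==> g x4 (c j) = r4 j"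
    and uu: "uu = (\<Sum>j<9. U j * (U j - U ((j+1) mod 9) / 2 - U ((j+8) mod 9) / 2)) + 2 * u3 * (\<Sum>j<9. U j * r3 j) + u3 * u3"
    and ww: "ww = (\<Sum>j<9. W j * (W j - W ((j+1) mod 9) / 2 - W ((j+8) mod 9) / 2)) + 2 * w4 * (\<Sum>j<9. W j * r4 j) + w4 * w4"
    and uw: "uw = (\<Sum>j<9. U j * (W j - W ((j+1) mod 9) / 2 - W ((j+8) mod 9) / 2)) + u3 * (\<Sum>j<9. W j * r3 j) + w4 * (\<Sum>j<9. U j * r4 j) + u3 * w4 * g x3 x4"
    and neg: "uu < 0"
  shows "uu * ww <= uw\<^sup>2"
proof -
  note cD = cycD[OF c(1)]
  have AI: "A \<subseteq> I" using V_sub cD(1) by auto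
  have fA: "finite A" using AI fin_sub by blast
  have inj: "inj_on c {..<9}" and im: "c ` {..<9} = A" using cD(2,3) c(2) by auto
  define vec where "vec = (\<lambda>(X::nat=>real) a b i. if i = x3 then a else if i = x4 then b else if i \<in> A then X (inv_into {..<9} c i) else 0)"
  have v3: "vec X a b x3 = a" and v4: "vec X a b x4 = b" for X a b using x by (auto simp: vec_def)
  have vc: "vec X a b (c j) = X j" if "j < 9" for X a b j
  proof -
    have "c j \<in> A" using im that by auto
    thus ?thesis using x inv_into_f_f[OF inj, of j] that by (auto simp: vec_def)
  qed
  have sumX: "(\<Sum>i\<in>insert x3 (insert x4 A). F i) = F x3 + F x4 + (\<Sum>j<9. F (c j))" for F :: "'f => real"
  proof -
    have "(\<Sum>i\<in>A. F i) = (\<Sum>j<9. F (c j))" unfolding im[symmetric] by (rule sum.reindex[OF inj, unfolded o_def])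
    thus ?thesis using x fA by simp
  qed
  have g3: "g x3 x3 = 1" "g x4 x4 = 1" using diag x by auto
  have sy: "g (c j) x3 = r3 j" "g (c j) x4 = r4 j" if "j < 9" for j using r3[OF that] r4[OF that] gsym[of "c j"] by auto
  have circ: "(\<Sum>k<9. Y k * g (c j) (c k)) = Y j - Y ((j+1) mod 9) / 2 - Y ((j+8) mod 9) / 2" if "j < 9" for Y :: "nat => real" and j
  proof -
    have "j = 0 \<or> j = 1 \<or> j = 2 \<or> j = 3 \<or> j = 4 \<or> j = 5 \<or> j = 6 \<or> j = 7 \<or> j = 8" using that by linarith
    thus ?thesis unfolding sum9 by (elim disjE) (simp_all add: cyc9[OF c] numeral_2_eq_2)
  qed
  have vc': "vec X a b (c j) = X j" if "j \<in> {..<9}" for X a b j using vc that by simp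
  have r3': "g x3 (c j) = r3 j" and r4': "g x4 (c j) = r4 j" if "j \<in> {..<9}" for j using r3 r4 that by simp_all
  have sy': "g (c j) x3 = r3 j" "g (c j) x4 = r4 j" if "j \<in> {..<9}" for j using sy that by simp_all
  have key: "bil g I (vec X a b) (vec Y a' b') = (\<Sum>j<9. X j * (Y j - Y ((j+1) mod 9) / 2 - Y ((j+8) mod 9) / 2))
     + a * (\<Sum>j<9. Y j * r3 j) + a' * (\<Sum>j<9. X j * r3 j) + b * (\<Sum>j<9. Y j * r4 j) + b' * (\<Sum>j<9. X j * r4 j)
     + a * a' + b * b' + (a * b' + b * a') * g x3 x4" for X Y a b a' b'
  proof -
    let ?X = "insert x3 (insert x4 A)"
    let ?v = "vec X a b" and ?w = "vec Y a' b'"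
    have "bil g I ?v ?w = (\<Sum>i\<in>?X. ?v i * (\<Sum>j\<in>?X. ?w j * g i j))"
      by (rule bil_rows) (use AI x in \<open>auto simp: vec_def\<close>)
    also have "\<dots> = a * (a' + b' * g x3 x4 + (\<Sum>j<9. Y j * r3 j)) + b * (a' * g x3 x4 + b' + (\<Sum>j<9. Y j * r4 j))
       + (\<Sum>i<9. X i * (a' * r3 i + b' * r4 i + (\<Sum>k<9. Y k * g (c i) (c k))))"
    proof -
      have S1: "(\<Sum>j<9. ?w (c j) * g x3 (c j)) = (\<Sum>j<9. Y j * r3 j)" by (rule sum.cong[OF refl]) (simp add: vc r3)
      have S2: "(\<Sum>j<9. ?w (c j) * g x4 (c j)) = (\<Sum>j<9. Y j * r4 j)" by (rule sum.cong[OF refl]) (simp add: vc r4)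
      have S3: "(\<Sum>j<9. ?w (c j) * g y (c j)) = (\<Sum>j<9. Y j * g y (c j))" for y by (rule sum.cong[OF refl]) (simp add: vc)
      have S4: "(\<Sum>i<9. ?v (c i) * (a' * g (c i) x3 + b' * g (c i) x4 + (\<Sum>k<9. Y k * g (c i) (c k)))) = (\<Sum>i<9. X i * (a' * r3 i + b' * r4 i + (\<Sum>k<9. Y k * g (c i) (c k))))"
        by (rule sum.cong[OF refl]) (simp add: vc sy)
      show ?thesis unfolding sumX v3 v4 S1 S2 unfolding S3 S4 using g3 gsym[of x4 x3] by simp
    qed
    also have "(\<Sum>i<9. X i * (a' * r3 i + b' * r4 i + (\<Sum>k<9. Y k * g (c i) (c k)))) =
       a' * (\<Sum>j<9. X j * r3 j) + b' * (\<Sum>j<9. X j * r4 j) + (\<Sum>i<9. X i * (\<Sum>k<9. Y k * g (c i) (c k)))"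
      by (simp add: distrib_left sum.distrib sum_distrib_left mult_ac)
    also have "(\<Sum>i<9. X i * (\<Sum>k<9. Y k * g (c i) (c k))) = (\<Sum>j<9. X j * (Y j - Y ((j+1) mod 9) / 2 - Y ((j+8) mod 9) / 2))"
      by (rule sum.cong[OF refl]) (simp only: circ lessThan_iff)
    finally show ?thesis by (simp add: algebra_simps)
  qed
  have 1: "bil g I (vec U u3 0) (vec U u3 0) = uu" unfolding key uu by (simp add: algebra_simps)
  have 2: "bil g I (vec W 0 w4) (vec W 0 w4) = ww" unfolding key ww by (simp add: algebra_simps)
  have 3: "bil g I (vec U u3 0) (vec W 0 w4) = uw" unfolding key uw by (simp add: algebra_simps)
  show ?thesis using lor[of "vec U u3 0" "vec W 0 w4"] neg unfolding 1 2 3 by blast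
qed

text \<open>Affine D6: marks 2 on the inner chain \<open>c, d, e\<close> and 1 on the four
  leaves.\<close>

lemma parab7:
  assumes "a \<in> I" "b \<in> I" "c \<in> I" "d \<in> I" "e \<in> I" "h \<in> I" "k \<in> I" "distinct [a,b,c,d,e,h,k]"
    "g a b = 0" "g a c = -1/2" "g a d = 0" "g a e = 0" "g a h = 0" "g a k = 0"
    "g b c = -1/2" "g b d = 0" "g b e = 0" "g b h = 0" "g b k = 0"
    "g c d = -1/2" "g c e = 0" "g c h = 0" "g c k = 0" "g d e = -1/2" "g d h = 0" "g d k = 0" "g e h = -1/2" "g e k = -1/2" "g h k = 0"
  shows False
proof -
  define f where "f = (\<lambda>i. if i \<in> {c,d,e} then 2 else (1::real))"
  have f: "f a = 1" "f b = 1" "f c = 2" "f d = 2" "f e = 2" "f h = 1" "f k = 1" using assms(8) by (auto simp: f_def)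
  have G: "g b a = g a b" "g c a = g a c" "g d a = g a d" "g e a = g a e" "g h a = g a h" "g k a = g a k" "g c b = g b c" "g d b = g b d" "g e b = g b e" "g h b = g b h" "g k b = g b k" "g d c = g c d" "g e c = g c e" "g h c = g c h" "g k c = g c k" "g e d = g d e" "g h d = g d h" "g k d = g d k" "g h e = g e h" "g k e = g e k" "g k h = g h k"
    by (rule gsym)+
  have gI: "g a a = 1" "g b b = 1" "g c c = 1" "g d d = 1" "g e e = 1" "g h h = 1" "g k k = 1" using assms(1-7) diag by auto
  have s: "(\<Sum>j\<in>{a,b,c,d,e,h,k}. f j * F j) = F a + F b + 2 * F c + 2 * F d + 2 * F e + F h + F k" for F
    using assms(8) by (simp add: f)
  have "card {a,b,c,d,e,h,k} = n"
  proof (rule par_card[of _ f])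
    fix i assume "i \<in> {a,b,c,d,e,h,k}"
    hence "i = a \<or> i = b \<or> i = c \<or> i = d \<or> i = e \<or> i = h \<or> i = k" by simp
    thus "(\<Sum>j\<in>{a,b,c,d,e,h,k}. f j * g i j) = 0" unfolding s by (elim disjE) (simp_all add: G gI assms(9-))
  qed (use assms(1-7) in \<open>simp_all add: f_def\<close>)
  moreover have "card {a,b,c,d,e,h,k} = 7" using assms(8) by simp
  ultimately show False using n9 by simp
qed

lemma D5: assumes "a \<in> I" "b \<in> I" "c \<in> I" "d \<in> I" "e \<in> I" "h \<in> I" "distinct [a,b,c,d,e,h]"
    "g a b = 0" "g a c = -1/2" "g a d = 0" "g a e = 0" "g a h = 0"  "g b c = -1/2" "g b d = 0" "g b e = 0" "g b h = 0"
    "g c d = -1/2" "g c e = 0" "g c h = 0" "g d e = -1/2" "g d h = -1/2" "g e h = 0"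
  shows False
  by (rule parab6[of a b c d e h 1 1 2 2 1 1]) (use assms in simp_all)

end

section \<open>Corners of a quadrangular 2-face\<close>

locale quad = ideal_diagram +
  fixes S :: "'a set" and x1 x2 x3 x4 :: 'a
  assumes V12: "insert x1 (insert x2 S) \<in> V" and V23: "insert x3 (insert x2 S) \<in> V" and V34: "insert x3 (insert x4 S) \<in> V" and V14: "insert x1 (insert x4 S) \<in> V"
    and xS: "x1 ~: S" "x2 ~: S" "x3 ~: S" "x4 ~: S" and ds: "distinct [x1,x2,x3,x4]"
begin

lemma flip13: "quad I g V n S x3 x2 x1 x4"
proof (unfold_locales)
  show "distinct [x3,x2,x1,x4]" using ds by auto
qed (fact V12 V23 V34 V14 xS)+
lemma flip24: "quad I g V n S x1 x4 x3 x2"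
proof (unfold_locales)
  show "distinct [x1,x4,x3,x2]" using ds by auto
qed (fact V12 V23 V34 V14 xS)+
lemma V': "insert x2 (insert x1 S) \<in> V" "insert x2 (insert x3 S) \<in> V" "insert x4 (insert x3 S) \<in> V" "insert x4 (insert x1 S) \<in> V"
  using V12 V23 V34 V14 by (simp_all add: insert_commute)
lemma rot: "quad I g V n S x2 x1 x4 x3"
proof (unfold_locales)
  show "distinct [x2,x1,x4,x3]" using ds by auto
qed (fact V' xS)+
lemma ne: "x1 ~= x2" "x1 ~= x3" "x1 ~= x4" "x2 ~= x3" "x2 ~= x4" "x3 ~= x4" "x2 ~= x1" "x3 ~= x1" "x4 ~= x1" "x3 ~= x2" "x4 ~= x2" "x4 ~= x3" using ds by auto
lemma xI: "x1 \<in> I" "x2 \<in> I" "x3 \<in> I" "x4 \<in> I" and SI: "S \<subseteq> I" using V_sub V12 V34 by auto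
lemma fS: "finite S" using SI fin_sub by blast

lemma E132: "edge_diagram I g V n (insert x2 S) x1 x3" by unfold_locales (use V12 V23 xS ne in auto)
lemma E134: "edge_diagram I g V n (insert x4 S) x1 x3" by unfold_locales (use V14 V34 xS ne in auto)
lemma E241: "edge_diagram I g V n (insert x1 S) x2 x4" by unfold_locales (use V' xS ne in auto)
lemma E243: "edge_diagram I g V n (insert x3 S) x2 x4" by unfold_locales (use V' xS ne in auto)

abbreviation "ch12 \<equiv> ed (insert x1 (insert x2 S)) = 2 * n"
abbreviation "ch23 \<equiv> ed (insert x3 (insert x2 S)) = 2 * n"
abbreviation "ch34 \<equiv> ed (insert x3 (insert x4 S)) = 2 * n"
abbreviation "ch14 \<equiv> ed (insert x1 (insert x4 S)) = 2 * n"

lemma dotted: assumes "ch12 \<or> ch23 \<or> ch34 \<or> ch14" shows "g x1 x3 < -1" "g x2 x4 < -1"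
  using assms edge_diagram.edge[OF E132] edge_diagram.edge[OF E134] edge_diagram.edge[OF E241] edge_diagram.edge[OF E243]
  by (auto simp: insert_commute)

text \<open>A cyclic corner makes both opposite pairs dotted, giving two orthogonal timelike pairs.
  Otherwise all corners are trees and \<open>zquad\<close> applies.\<close>

lemma not_all_zero: assumes z: "g x1 x2 = 0" "g x2 x3 = 0" "g x3 x4 = 0" "g x4 x1 = 0" shows False
proof -
  have z': "g x2 x1 = 0" "g x3 x2 = 0" "g x4 x3 = 0" "g x1 x4 = 0" using z gsym[of x2 x1] gsym[of x3 x2] gsym[of x4 x3] gsym[of x1 x4] by auto
  show False
  proof (cases "ch12 \<or> ch23 \<or> ch34 \<or> ch14")
    case True
    have "tl {x1,x3}" "tl {x2,x4}" using tl_dotted xI ne dotted[OF True] by auto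
    thus False by (rule tl_orth) (use z z' in auto)
  next
    case False
    have d: "dg (insert x2 S) x1 = dg S x1" "dg (insert x1 S) x2 = dg S x2"
      using dg_insert[OF fS xS(2) ne(1)] dg_insert[OF fS xS(1) ne(7)] z z' by auto
    interpret zq: zquad I g V n S x1 x2 x3 x4
    proof (unfold_locales)
      show "g x1 x3 < -1 \<or> (g x1 x3 = -rt & 2 <= dg S x1)" using edge_diagram.edge[OF E132] d by auto
      show "g x2 x4 < -1 \<or> (g x2 x4 = -rt & 2 <= dg S x2)" using edge_diagram.edge[OF E241] d by auto
    qed (use V12 V23 V34 V14 xS ds z z' False in auto)
    show False by (rule zq.impossible)
  qed
qed

definition ep :: "'a => 'a => nat" where "ep x y = (if g x y = 0 then 0 else 1)"
definition chi :: "'a set => nat" where "chi A = (if ed A = 2 * n then 1 else 0)"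

lemma ep_sym: "ep x y = ep y x" by (simp add: ep_def gsym[of x y])

lemma ed_pair: assumes "x ~: S" "y ~: S" "x ~= y" shows "ed (insert x (insert y S)) = ed S + 2 * dg S x + 2 * dg S y + 2 * ep x y"
proof -
  have "ed (insert x (insert y S)) = ed (insert y S) + 2 * dg (insert y S) x" using ed_insert fS assms by simp
  moreover have "ed (insert y S) = ed S + 2 * dg S y" using ed_insert fS assms by simp
  moreover have "dg (insert y S) x = dg S x + ep x y" using dg_insert[OF fS assms(2,3)] by (simp add: ep_def)
  ultimately show ?thesis by simp
qed

lemma chi_ed: "A \<in> V ==> ed A = 2 * n - 2 + 2 * chi A" using ed_V_cases[of A] n9 by (auto simp: chi_def)

text \<open>In the alternating sum of the edge counts of the four corners, the edges within
  \<open>S\<close> and from \<open>S\<close> to the side facets cancel. Modulo 2 this compares the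
  numbers of cyclic and of nonorthogonal corners.\<close>

lemma relation: "chi (insert x1 (insert x2 S)) + chi (insert x3 (insert x4 S)) + ep x2 x3 + ep x4 x1 = chi (insert x3 (insert x2 S)) + chi (insert x1 (insert x4 S)) + ep x1 x2 + ep x3 x4"
  using ed_pair[OF xS(1,2) ne(1)] ed_pair[OF xS(3,2) ne(10)] ed_pair[OF xS(3,4) ne(6)] ed_pair[OF xS(1,4) ne(3)]
    chi_ed[OF V12] chi_ed[OF V23] chi_ed[OF V34] chi_ed[OF V14] ep_sym[of x3 x2] ep_sym[of x1 x4] by linarith

lemma A12: "insert x1 (insert x2 S) - {x1} = insert x2 S" "insert x1 (insert x2 S) - {x2} = insert x1 S" using xS ne by auto

lemma lab3: assumes "cyc (insert x1 (insert x2 S)) c" "c 0 = x1" "~ ch23"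
  shows "\<exists>t\<in>{3,6}. n = 9 & g x3 (c t) = -1/2 & (\<forall>j\<in>{1..<n}. j ~= t --> g x3 (c j) = 0)"
  by (rule path_label[OF assms(1)]) (use assms(2,3) A12 V23 xS ne in auto)

text \<open>The corner exchanging \<open>x2\<close> for \<open>x4\<close> is affine E8, its
  positions being counted from \<open>x2\<close>, which sits at \<open>k\<close>.\<close>

lemma lab4: assumes c: "cyc (insert x1 (insert x2 S)) c" and k: "c k = x2" "k < n" and tr: "~ ch14"
  shows "\<exists>t\<in>{3,6}. n = 9 & g x4 (c ((t + k) mod 9)) = -1/2 & (\<forall>j<9. j ~= k --> j ~= (t + k) mod 9 --> g x4 (c j) = 0)"
proof -
  have c0: "(\<lambda>i. c ((i + k) mod n)) 0 = x2" using k by simp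
  have "\<exists>t\<in>{3,6}. n = 9 & g x4 (c ((t + k) mod n)) = -1/2 & (\<forall>j\<in>{1..<n}. j ~= t --> g x4 (c ((j + k) mod n)) = 0)"
    by (rule path_label[OF cyc_rot[OF c k(2)], of x4]) (use c0 A12 V' xS ne tr in \<open>auto simp: insert_commute\<close>)
  then obtain t where t: "t \<in> {3,6}" "n = 9" "g x4 (c ((t + k) mod 9)) = -1/2" "\<forall>j\<in>{1..<9}. j ~= t --> g x4 (c ((j + k) mod 9)) = 0" by auto
  have "g x4 (c j) = 0" if j: "j < 9" "j ~= k" "j ~= (t + k) mod 9" for j
  proof -
    define i where "i = (if k <= j then j - k else j + 9 - k)"
    have k9: "k < 9" using k t by simp
    have i: "i < 9" "(i + k) mod 9 = j" "i ~= 0" using j k9 by (auto simp: i_def split: if_splits)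
    hence "i ~= t" using j by auto
    thus ?thesis using t(4) i by force
  qed
  thus ?thesis using t by blast
qed

lemma not_ch34: assumes "a \<in> S" "b \<in> S" "d \<in> S" "b ~= d" "a ~= b" "a ~= d" "g a b ~= 0" "g a d ~= 0" "g a x3 ~= 0" shows "~ ch34"
proof
  assume ch34
  hence "dg (insert x3 (insert x4 S)) a = 2" using cycle_V(1)[OF V34] assms by auto
  moreover have "{b,d,x3} \<subseteq> nb (insert x3 (insert x4 S)) a" using assms xS by (auto simp: nb_def)
  hence "card {b,d,x3} <= dg (insert x3 (insert x4 S)) a" unfolding dg_def by (intro card_mono finite_nb) (use fS in auto)
  moreover have "b ~= x3" "d ~= x3" using assms(2,3) xS by metis+
  hence "card {b,d,x3} = 3" using assms(4) by simp
  ultimately show False by simp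
qed

lemma cS: assumes "cyc (insert x1 (insert x2 S)) c" "n = 9" "c a = x1" "c b = x2" "a < 9" "b < 9" "j < 9" "j ~= a" "j ~= b" shows "c j \<in> S"
  using cycD(4)[OF assms(1), of j] cyc9_inj[OF assms(1,2), of j a] cyc9_inj[OF assms(1,2), of j b] assms by auto

text \<open>Both neighbouring corners are affine E8, so n = 9 and each of \<open>x3\<close>,
  \<open>x4\<close> hangs on one of two nodes; \<open>relation\<close> makes \<open>x3\<close> and
  \<open>x4\<close> orthogonal. Three of the four placements contain affine D5 or D6, the last one
  contradicts reverse Cauchy-Schwarz for the two dotted pairs.\<close>

lemma alpha: assumes ch12 "~ ch23" "~ ch14" "g x1 x2 ~= 0" shows False
proof -
  let ?A = "insert x1 (insert x2 S)"
  have "x2 \<in> nb ?A x1" using assms ne by (auto simp: nb_def)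
  then obtain c where c: "cyc ?A c" "c 0 = x1" "c 1 = x2" using cyc_enum[OF V12 assms(1)] by auto
  obtain t where t: "t \<in> {3,6}" "n = 9" "g x3 (c t) = -1/2" "\<forall>j\<in>{1..<n}. j ~= t --> g x3 (c j) = 0" using lab3[OF c(1,2) assms(2)] by blast
  have n: "n = 9" by (rule t)
  have n1: "1 < n" using n by simp
  note l4 = lab4[OF c(1,3) n1 assms(3)]
  obtain t' where t': "t' \<in> {3,6}" "g x4 (c ((t' + 1) mod 9)) = -1/2" "\<forall>j<9. j ~= 1 --> j ~= (t' + 1) mod 9 --> g x4 (c j) = 0" using l4 by blast
  have z3: "g x3 (c j) = 0" if "1 <= j" "j < 9" "j ~= t" for j using t(4) that n by auto
  note gv = cyc9[OF c(1) n]
  note inS = cS[OF c(1) n c(2,3)]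
  have cS: "c j \<in> S" if "2 <= j" "j < 9" for j using inS[of j] that by auto
  have cI: "c j \<in> I" if "j < 9" for j using cycD(4)[OF c(1), of j] V_I[OF V12] that n by auto
  have "~ ch34"
    by (rule not_ch34[of "c t" "c (t-1)" "c (t+1)"]) (use t cS gv cyc9_inj[OF c(1) n] gsym[of "c t" x3] in auto)
  have e: "ep x2 x3 = 0" "ep x4 x1 = 0" "ep x1 x2 = 1"
  proof -
    have "g x3 x2 = 0" using z3[of 1] c t(1) by auto
    thus "ep x2 x3 = 0" using gsym[of x2 x3] by (simp add: ep_def)
    have "(0::nat) ~= (t' + 1) mod 9" using t'(1) by auto
    hence "g x4 x1 = 0" using t'(3) c(2) by force
    thus "ep x4 x1 = 0" by (simp add: ep_def)
    show "ep x1 x2 = 1" using assms by (simp add: ep_def)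
  qed
  have "ep x3 x4 = 0" using relation e assms \<open>~ ch34\<close> by (simp add: chi_def)
  hence h: "g x3 x4 = 0" "g x4 x3 = 0" using gsym[of x4 x3] by (auto simp: ep_def split: if_splits)
  have xA: "x3 ~: ?A" "x4 ~: ?A" using xS ne by auto
  have xc: "x3 ~= c j" "x4 ~= c j" "c j ~= x3" "c j ~= x4" if "j < 9" for j using xA cycD(4)[OF c(1), of j] that n by auto
  have sy: "g (c j) x3 = g x3 (c j)" "g (c j) x4 = g x4 (c j)" for j using gsym by auto
  have ij: "c i = c j \<longleftrightarrow> i = j" if "i < 9" "j < 9" for i j using cyc9_inj[OF c(1) n that] .
  have d: "g x1 x3 < -1" "g x2 x4 < -1" using dotted assms by auto
  have z4: "g x4 (c j) = 0" if "j < 9" "j ~= 1" "j ~= (t' + 1) mod 9" for j using t'(3) that by auto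
  have t3: "g x3 (c a) = -1/2" if "t = a" for a using t(3) that by simp
  have t4: "t' = 3 ==> g x4 (c 4) = -1/2" "t' = 6 ==> g x4 (c 7) = -1/2" using t'(2) by auto
  consider "t = 3" "t' = 3" | "t = 6" "t' = 6" | "t = 6" "t' = 3" | "t = 3" "t' = 6" using t(1) t'(1) by auto
  thus False
  proof cases
    case 1
    show False by (rule D5[of "c 2" x3 "c 3" "c 4" x4 "c 5"]) (simp_all add: 1 t3[OF 1(1)] t4 cI xI ij xc ne h gv z3 z4 sy)
  next
    case 2
    show False by (rule D5[of "c 5" x3 "c 6" "c 7" x4 "c 8"]) (simp_all add: 2 t3[OF 2(1)] t4 cI xI ij xc ne h gv z3 z4 sy)
  next
    case 3
    show False by (rule parab7[of "c 3" x4 "c 4" "c 5" "c 6" x3 "c 7"]) (simp_all add: 3 t3[OF 3(1)] t4 cI xI ij xc ne h gv z3 z4 sy)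
  next
    case 4
    \<comment> \<open>Solved from linear equations: \<open>U\<close> with 3 at \<open>x3\<close>
      vanishes at \<open>x2\<close> and is orthogonal to all of \<open>S\<close>; \<open>W\<close>
      with 3 at \<open>x4\<close> vanishes at \<open>x1\<close> and is orthogonal to all of
      \<open>S\<close>. Both norms would equal the product -9 if the dotted entries were -1, so
      their strictness decides.\<close>
    define U where "U = (!) [2,0,5/2,5,9/2,4,7/2,3,5/2::real]"
    define W where "W = (!) [0,2,5/2,3,7/2,4,9/2,5,5/2::real]"
    define uu where "uu = 3 + 12 * g x1 x3"
    define ww where "ww = 3 + 12 * g x2 x4"
    have "uu * ww <= (-9)\<^sup>2"
    proof (rule lor_cyc[OF c(1) n xI(3,4) xA ne(6), of "\<lambda>j. g x3 (c j)" "\<lambda>j. g x4 (c j)" uu U 3 ww W 3 "-9"])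
      have v: "g x3 (c 0) = g x1 x3" "g x4 (c 1) = g x2 x4" "g x3 (c 3) = -1/2" "g x4 (c 7) = -1/2" using c gsym[of x3 x1] gsym[of x4 x2] t(3) t'(2) 4 by auto
      have zz: "g x3 (c 1) = 0" "g x3 (c 2) = 0" "g x3 (c 4) = 0" "g x3 (c 5) = 0" "g x3 (c 6) = 0" "g x3 (c 7) = 0" "g x3 (c 8) = 0"
         "g x4 (c 0) = 0" "g x4 (c 2) = 0" "g x4 (c 3) = 0" "g x4 (c 4) = 0" "g x4 (c 5) = 0" "g x4 (c 6) = 0" "g x4 (c 8) = 0" using z3 z4 4 by auto
      show "uu = (\<Sum>j<9. U j * (U j - U ((j+1) mod 9) / 2 - U ((j+8) mod 9) / 2)) + 2 * 3 * (\<Sum>j<9. U j * g x3 (c j)) + 3 * 3"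
        unfolding sum9 uu_def U_def v zz by simp
      show "ww = (\<Sum>j<9. W j * (W j - W ((j+1) mod 9) / 2 - W ((j+8) mod 9) / 2)) + 2 * 3 * (\<Sum>j<9. W j * g x4 (c j)) + 3 * 3"
        unfolding sum9 ww_def W_def v zz by simp
      show "-9 = (\<Sum>j<9. U j * (W j - W ((j+1) mod 9) / 2 - W ((j+8) mod 9) / 2)) + 3 * (\<Sum>j<9. W j * g x3 (c j)) + 3 * (\<Sum>j<9. U j * g x4 (c j)) + 3 * 3 * g x3 x4"
        unfolding sum9 U_def W_def v zz h by simp
      show "uu < 0" using d by (simp add: uu_def)
    qed auto
    moreover have "uu < -9" "ww < -9" using d by (auto simp: uu_def ww_def)
    moreover have "(-9) * (-9) < uu * ww" using mult_strict_mono'[of 9 "-uu" 9 "-ww"] calculation(2,3) by simp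
    ultimately show False by simp
  qed
qed

text \<open>A stretch of the cycle touched by neither \<open>x3\<close> nor \<open>x4\<close> would
  be cut off in the corner opposite to the cyclic one. One placement survives, and there the dotted
  pairs contradict reverse Cauchy-Schwarz. The assumption \<open>sym\<close> sets aside placements
  that are reached by exchanging \<open>x1\<close> and \<open>x2\<close>.\<close>

lemma beta_aux: assumes c: "cyc (insert x1 (insert x2 S)) c" "c 0 = x1" "c k = x2" "2 <= k" "k <= 4"
    and a: ch12 "~ ch23" "~ ch14" "g x2 x3 = 0" "g x4 x1 = 0" "g x3 x4 ~= 0"
    and sym: "k = 4 ==> g x3 (c 6) = 0"
  shows False
proof -
  let ?A = "insert x1 (insert x2 S)" and ?B = "insert x3 (insert x4 S)"
  obtain t where t: "t \<in> {3,6}" "n = 9" "g x3 (c t) = -1/2" "\<forall>j\<in>{1..<n}. j ~= t --> g x3 (c j) = 0" using lab3[OF c(1,2) a(2)] by blast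
  have n: "n = 9" by (rule t)
  have kn: "k < n" using c n by simp
  note l4 = lab4[OF c(1,3) kn a(3)]
  obtain t' where t': "t' \<in> {3,6}" "g x4 (c ((t' + k) mod 9)) = -1/2" "\<forall>j<9. j ~= k --> j ~= (t' + k) mod 9 --> g x4 (c j) = 0" using l4 by blast
  have z3: "g x3 (c j) = 0" if "1 <= j" "j < 9" "j ~= t" for j using t(4) that n by auto
  have z4: "g x4 (c j) = 0" if "j < 9" "j ~= k" "j ~= (t' + k) mod 9" for j using t'(3) that by auto
  have sy: "g (c j) x3 = g x3 (c j)" "g (c j) x4 = g x4 (c j)" for j using gsym by auto
  note gv = cyc9[OF c(1) n]
  have ij: "c i = c j \<longleftrightarrow> i = j" if "i < 9" "j < 9" for i j using cyc9_inj[OF c(1) n that] .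
  have inS: "c j \<in> S" if "1 <= j" "j < 9" "j ~= k" for j using cS[OF c(1) n c(2,3), of j] that c by auto
  have xA: "x3 ~: ?A" "x4 ~: ?A" using xS ne by auto
  have Sc: "\<exists>j. 1 <= j & j < 9 & j ~= k & s = c j" if "s \<in> S" for s
  proof -
    have "s \<in> c ` {..<9}" using cycD(3)[OF c(1)] n that by auto
    then obtain j where j: "j < 9" "s = c j" by auto
    moreover have "c 0 ~: S" "c k ~: S" using c(2,3) xS by simp_all
    hence "j ~= 0" "j ~= k" using j that by metis+
    ultimately show ?thesis by (intro exI[of _ j]) auto
  qed
  have disc: False if U: "U \<subseteq> {1..<9} - {k}" "U ~= {}" and nz: "!!i j. i \<in> U ==> 1 <= j ==> j < 9 ==> j ~= k ==> j ~: U ==> g (c i) (c j) = 0"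
      "!!i. i \<in> U ==> g x3 (c i) = 0 & g x4 (c i) = 0" for U
  proof -
    have US: "c ` U \<subseteq> S"
    proof (rule image_subsetI)
      fix i assume "i \<in> U"
      hence "i \<in> {1..<9} - {k}" using U(1) by blast
      thus "c i \<in> S" using inS[of i] by simp
    qed
    hence "x3 ~: c ` U" using xS by blast
    moreover note US
    ultimately have "c ` U \<subset> ?B" "c ` U ~= {}" using U by auto
    from connD[OF conn_V[OF V34] this] obtain p q where pq: "p \<in> c ` U" "q \<in> ?B - c ` U" "g p q ~= 0" by (elim bexE)
    obtain i where i: "i \<in> U" "p = c i" using pq by auto
    show False
    proof (cases "q = x3 \<or> q = x4")
      case True thus False using pq i nz(2)[OF i(1)] sy by auto
    next
      case False
      hence "q \<in> S" using pq by auto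
      then obtain j where j: "1 <= j" "j < 9" "j ~= k" "q = c j" using Sc by blast
      hence "j ~: U" using pq by auto
      thus False using nz(1)[OF i(1) j(1-3)] pq i j by simp
    qed
  qed
  have k3: "c k ~= c t"
  proof
    assume "c k = c t"
    hence "g x3 x2 = -1/2" using c t by simp
    thus False using a gsym[of x2 x3] by simp
  qed
  have k4: "c ((t' + k) mod 9) ~= c 0"
  proof
    assume "c ((t' + k) mod 9) = c 0"
    hence "g x4 x1 = -1/2" using c t' by simp
    thus False using a by simp
  qed
  consider "k = 2" | "k = 3" | "k = 4" using c by linarith
  thus False
  proof cases
    case 1
    show False by (rule disc[of "{1}"]) (use 1 gv z3[of 1] z4[of 1] t(1) t'(1) in auto)
  next
    case 2
    have "t = 6" "t' = 3" using k3 k4 2 t(1) t'(1) by auto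
    thus False by (intro disc[of "{1,2}"]) (use 2 gv z3 z4 in auto)
  next
    case 3
    have t3: "t = 3" using sym[OF 3] t(1,3) by auto
    show False
    proof (cases "t' = 6")
      case True
      thus False by (intro disc[of "{5,6,7,8}"]) (use 3 t3 gv z3 z4 in auto)
    next
      case False
      hence t4: "t' = 3" using t' by auto
      have d: "g x1 x3 < -1" "g x2 x4 < -1" using dotted a by auto
      have v: "g x3 (c 0) = g x1 x3" "g x4 (c 4) = g x2 x4" "g x3 (c 3) = -1/2" "g x4 (c 7) = -1/2" using c gsym[of x3 x1] gsym[of x4 x2] t(3) t'(2) 3 t3 t4 by auto
      have zz: "g x3 (c 1) = 0" "g x3 (c 2) = 0" "g x3 (c 4) = 0" "g x3 (c 5) = 0" "g x3 (c 6) = 0" "g x3 (c 7) = 0" "g x3 (c 8) = 0"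
         "g x4 (c 0) = 0" "g x4 (c 2) = 0" "g x4 (c 3) = 0" "g x4 (c 1) = 0" "g x4 (c 5) = 0" "g x4 (c 6) = 0" "g x4 (c 8) = 0" using z3 z4 3 t3 t4 by auto
      have h: "g x3 x4 = -1/2"
      proof (rule ccontr)
        assume "g x3 x4 ~= -1/2"
        hence hv: "g x3 x4 = -rt" using heavy_value[OF V34, of x3 x4] ne a(6) by auto
        have "nb ?B x3 = {x4} \<or> nb ?B x4 = {x3}" by (rule heavy_leaf[OF V34]) (use ne hv rt_bounds in auto)
        moreover have "c 3 \<in> nb ?B x3" "c 7 \<in> nb ?B x4" using inS[of 3] inS[of 7] 3 v xS by (auto simp: nb_def)
        ultimately show False using inS[of 3] inS[of 7] 3 xS by auto
      qed
      \<comment> \<open>The same linear equations as in \<open>alpha\<close>, now with 6 at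
        \<open>x3\<close> and 15 at \<open>x4\<close>: orthogonal to \<open>S\<close>, and zero at
        \<open>x2\<close> and \<open>x1\<close> respectively.\<close>
      define U where "U = (!) [10,9,8,7,0,2,4,6,8::real]"
      define W where "W = (!) [0,5,10,15,20,22,24,26,13::real]"
      define uu where "uu = 30 + 120 * g x1 x3"
      define ww where "ww = 60 + 600 * g x2 x4"
      have "uu * ww <= (-180)\<^sup>2"
      proof (rule lor_cyc[OF c(1) n xI(3,4) xA ne(6), of "\<lambda>j. g x3 (c j)" "\<lambda>j. g x4 (c j)" uu U 6 ww W 15 "-180"])
        show "uu = (\<Sum>j<9. U j * (U j - U ((j+1) mod 9) / 2 - U ((j+8) mod 9) / 2)) + 2 * 6 * (\<Sum>j<9. U j * g x3 (c j)) + 6 * 6"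
          unfolding sum9 uu_def U_def v zz by simp
        show "ww = (\<Sum>j<9. W j * (W j - W ((j+1) mod 9) / 2 - W ((j+8) mod 9) / 2)) + 2 * 15 * (\<Sum>j<9. W j * g x4 (c j)) + 15 * 15"
          unfolding sum9 ww_def W_def v zz by simp
        show "-180 = (\<Sum>j<9. U j * (W j - W ((j+1) mod 9) / 2 - W ((j+8) mod 9) / 2)) + 6 * (\<Sum>j<9. W j * g x3 (c j)) + 15 * (\<Sum>j<9. U j * g x4 (c j)) + 6 * 15 * g x3 x4"
          unfolding sum9 U_def W_def v zz h by simp
        show "uu < 0" using d by (simp add: uu_def)
      qed auto
      moreover have "uu < -90" "ww < -540" using d by (auto simp: uu_def ww_def)
      moreover have "90 * 540 < uu * ww" using mult_strict_mono'[of 90 "-uu" 540 "-ww"] calculation(2,3) by simp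
      ultimately show False by simp
    qed
  qed
qed

text \<open>A reflection brings \<open>x2\<close> to position 2, 3 or 4. The placement excluded by
  \<open>sym\<close> is treated after exchanging \<open>x1\<close> with \<open>x2\<close> and
  \<open>x3\<close> with \<open>x4\<close>; the numbering \<open>e\<close> starts at
  \<open>x2\<close> and runs backwards.\<close>

lemma beta: assumes a: ch12 "~ ch23" "~ ch14" "g x1 x2 = 0" "g x2 x3 = 0" "g x4 x1 = 0" "g x3 x4 ~= 0" shows False
proof -
  let ?A = "insert x1 (insert x2 S)"
  interpret r: quad I g V n S x2 x1 x4 x3 by (rule rot)
  have d2: "dg ?A x1 = 2" by (rule cycle_V(1)[OF V12 a(1)]) simp
  obtain y where "y \<in> nb ?A x1" by (rule two_nb'[OF d2])
  then obtain c0 where c0: "cyc ?A c0" "c0 0 = x1" using cyc_enum[OF V12 a(1), of x1 y] by auto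
  have n: "n = 9" using lab3[OF c0 a(2)] by blast
  have ex: "\<exists>c k. cyc ?A c & c 0 = x1 & c k = x2 & 2 <= k & k <= 4"
  proof -
    have "x2 \<in> c0 ` {..<9}" using cycD(3)[OF c0(1)] n by auto
    then obtain k where k: "k < 9" "c0 k = x2" by auto
    have k0: "k ~= 0"
    proof
      assume "k = 0" thus False using k c0 ne by simp
    qed
    have "g (c0 0) (c0 k) = 0" using k c0 a(4) by simp
    hence k18: "k ~= 1" "k ~= 8" using cyc9[OF c0(1) n, of 0 k] by auto
    show ?thesis
    proof (cases "k <= 4")
      case True thus ?thesis using c0 k k0 k18 by (intro exI[of _ c0] exI[of _ k]) auto
    next
      case False
      show ?thesis using cyc_reflect[OF c0(1)] c0 k k18 False n
        by (intro exI[of _ "\<lambda>i. if i = 0 then c0 0 else c0 (n - i)"] exI[of _ "9 - k"]) auto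
    qed
  qed
  then obtain c k where c: "cyc ?A c" "c 0 = x1" "c k = x2" "2 <= k" "k <= 4" by blast
  show False
  proof (cases "k = 4 & g x3 (c 6) ~= 0")
    case False
    show False by (rule beta_aux[OF c a(1-3,5-7)]) (use False in blast)
  next
    case True
    have z4: "g x4 (c 1) = 0 \<or> g x4 (c 1) ~= 0" by simp
    have A': "insert x2 (insert x1 S) = ?A" by (simp add: insert_commute)
    have ch: "r.ch12" "~ ed (insert x4 (insert x1 S)) = 2 * n" "~ ed (insert x2 (insert x3 S)) = 2 * n" using a by (simp_all add: insert_commute)
    define d where "d = (\<lambda>i. c ((i + 4) mod n))"
    define e where "e = (\<lambda>i. if i = 0 then d 0 else d (n - i))"
    have d: "cyc ?A d" unfolding d_def by (rule cyc_rot[OF c(1)]) (use n in simp)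
    have e: "cyc ?A e" unfolding e_def by (rule cyc_reflect[OF d])
    have ev: "e 0 = x2" "e 4 = x1" "e 6 = c 7" using c True n by (simp_all add: e_def d_def)
    have "g x4 (c 7) = 0"
    proof (rule ccontr)
      assume nz: "g x4 (c 7) ~= 0"
      obtain t where t: "t \<in> {3,6}" "\<forall>j\<in>{1..<n}. j ~= t --> g x3 (c j) = 0" using lab3[OF c(1,2) a(2)] by blast
      hence t6: "t = 6" using True n by auto
      have kn: "k < n" using c n by simp
      note l4 = lab4[OF c(1,3) kn a(3)]
      obtain t' where t': "t' \<in> {3,6}" "\<forall>j<9. j ~= k --> j ~= (t' + k) mod 9 --> g x4 (c j) = 0" using l4 by blast
      hence t3: "t' = 3" using nz True by force
      have inS: "c j \<in> S" if "1 <= j" "j < 9" "j ~= 4" for j using cS[OF c(1) n c(2,3), of j] that c True by auto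
      let ?B = "insert x3 (insert x4 S)" and ?U = "c ` {1,2,3}"
      have US: "?U \<subseteq> S" using inS by auto
      moreover have "x3 ~: ?U" using US xS by blast
      ultimately have "?U \<subset> ?B" "?U ~= {}" by blast+
      from connD[OF conn_V[OF V34] this] obtain p q where pq: "p \<in> ?U" "q \<in> ?B - ?U" "g p q ~= 0" by (elim bexE)
      obtain i where i: "i \<in> {1,2,3}" "p = c i" using pq by auto
      have z: "g x3 (c i) = 0" "g x4 (c i) = 0" using i t(2) t6 t'(2) t3 True n by auto
      have "q ~= x3" "q ~= x4" using pq z i gsym[of "c i" x3] gsym[of "c i" x4] by auto
      hence "q \<in> S" using pq by auto
      moreover have "q \<in> c ` {..<9}" using \<open>q \<in> S\<close> cycD(3)[OF c(1)] n by auto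
      then obtain j where j: "j < 9" "q = c j" by auto
      moreover have "c 0 ~: S" "c 4 ~: S" using c(2,3) True xS by simp_all
      ultimately have "j ~= 0" "j ~= 4" by metis+
      moreover have "j ~: {1,2,3}" using pq j by auto
      ultimately have "g (c i) (c j) = 0" using cyc9[OF c(1) n _ j(1), of i] i by auto
      thus False using pq i j by simp
    qed
    hence e6: "g x4 (e 6) = 0" using ev by simp
    have e': "cyc (insert x2 (insert x1 S)) e" using e A' by simp
    have g0: "g x1 x4 = 0" "g x3 x2 = 0" "g x4 x3 ~= 0" using a gsym[of x1 x4] gsym[of x3 x2] gsym[of x4 x3] by simp_all
    show False by (rule r.beta_aux[OF e' ev(1,2) _ _ ch g0]) (use e6 in simp_all)
  qed
qed

text \<open>By \<open>relation\<close> the cyclic corner or its opposite one is nonorthogonal; these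
  are \<open>alpha\<close> and \<open>beta\<close>.\<close>

lemma one_cycle: assumes ch12 "~ ch23" "~ ch34" "~ ch14" shows False
proof -
  have e: "1 + ep x2 x3 + ep x4 x1 = ep x1 x2 + ep x3 x4" using relation assms by (simp add: chi_def)
  have le: "ep x y <= 1" for x y by (simp add: ep_def)
  show False
  proof (cases "g x1 x2 = 0")
    case False thus False using alpha assms by blast
  next
    case True
    hence "ep x1 x2 = 0" by (simp add: ep_def)
    hence "ep x3 x4 = 1" "ep x2 x3 = 0" "ep x4 x1 = 0" using e le[of x3 x4] by linarith+
    thus False using beta[OF assms(1,2,4) True] by (auto simp: ep_def split: if_splits)
  qed
qed

lemma cc_eps: "ch12 ==> ch23 ==> ep x2 x3 = ep x1 x2" "ch12 ==> ch14 ==> ep x4 x1 = ep x1 x2"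
proof -
  show "ep x2 x3 = ep x1 x2" if ch12 ch23
    using edge_diagram.clone[OF E132 that, of x2] by (simp add: ep_def gsym[of x2 x3])
  show "ep x4 x1 = ep x1 x2" if ch12 ch14
    using edge_diagram.clone[OF E241, of x1] that by (simp add: ep_def gsym[of x2 x1] insert_commute)
qed

lemma nu_three: assumes ch12 ch23 ch14 "~ ch34" shows "2 <= ep x1 x2 + ep x2 x3 + ep x3 x4 + ep x4 x1"
  using relation cc_eps assms by (simp add: chi_def)

text \<open>If the number of cyclic corners is even, so is the number of nonorthogonal ones by
  \<open>relation\<close>, and it is not 0. One cyclic corner is impossible, and three force two
  nonorthogonal corners.\<close>

lemma nu_ge2: "2 <= ep x1 x2 + ep x2 x3 + ep x3 x4 + ep x4 x1"
proof -
  interpret a: quad I g V n S x3 x2 x1 x4 by (rule flip13)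
  interpret b: quad I g V n S x1 x4 x3 x2 by (rule flip24)
  interpret ab: quad I g V n S x3 x4 x1 x2 by (rule b.flip13)
  have s: "ep x3 x2 = ep x2 x3" "ep x2 x1 = ep x1 x2" "ep x4 x3 = ep x3 x4" "ep x1 x4 = ep x4 x1" by (rule ep_sym)+
  have pos: "ep x1 x2 + ep x2 x3 + ep x3 x4 + ep x4 x1 ~= 0" using not_all_zero by (auto simp: ep_def split: if_splits)
  have o: "~ (ch12 & ~ ch23 & ~ ch34 & ~ ch14)" "~ (~ ch12 & ch23 & ~ ch34 & ~ ch14)" "~ (~ ch12 & ~ ch23 & ch34 & ~ ch14)" "~ (~ ch12 & ~ ch23 & ~ ch34 & ch14)"
    using one_cycle a.one_cycle b.one_cycle ab.one_cycle by blast+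
  have th: "ch12 ==> ch23 ==> ch14 ==> ~ ch34 ==> ?thesis" "ch23 ==> ch12 ==> ch34 ==> ~ ch14 ==> ?thesis"
     "ch14 ==> ch34 ==> ch12 ==> ~ ch23 ==> ?thesis" "ch34 ==> ch14 ==> ch23 ==> ~ ch12 ==> ?thesis"
    using nu_three a.nu_three b.nu_three ab.nu_three unfolding s by (simp_all add: ac_simps)
  have par: ?thesis if "chi (insert x1 (insert x2 S)) + chi (insert x3 (insert x4 S)) + chi (insert x3 (insert x2 S)) + chi (insert x1 (insert x4 S)) \<in> {0,2,4}"
  proof -
    have "2 <= i + e + j + h" if s: "a + b + c + d = 0 \<or> a + b + c + d = 2 \<or> a + b + c + d = 4" and r: "a + b + e + h = c + d + i + j" and p: "i + e + j + h ~= 0" for a b c d e h i j :: nat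
    proof (rule ccontr)
      assume no: "~ ?thesis"
      have w: "i + e + j + h = 1" using p no by linarith
      have "2 * (a + b) + 1 = (a + b + c + d) + 2 * (i + j)" using r w by simp
      moreover have "even (a + b + c + d)" using s by (elim disjE) (simp_all only:, simp_all)
      ultimately show False by presburger
    qed
    from this[OF _ relation pos] show ?thesis using that by simp
  qed
  show ?thesis
  proof (rule ccontr)
    assume no: "~ ?thesis"
    have bool: "(if a then 1 else 0) + (if c then 1 else 0) + (if b then 1 else 0) + (if d then 1 else 0) \<in> {0,2,4::nat} \<or>
      (a & ~ b & ~ c & ~ d) \<or> (~ a & b & ~ c & ~ d) \<or> (~ a & ~ b & c & ~ d) \<or> (~ a & ~ b & ~ c & d) \<or>
      (a & b & d & ~ c) \<or> (b & a & c & ~ d) \<or> (d & c & a & ~ b) \<or> (c & d & b & ~ a)" for a b c d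
      by (cases a; cases b; cases c; cases d) simp_all
    note D = bool[of ch12 ch34 ch23 ch14, folded chi_def]
    have p': "~ (chi (insert x1 (insert x2 S)) + chi (insert x3 (insert x4 S)) + chi (insert x3 (insert x2 S)) + chi (insert x1 (insert x4 S)) \<in> {0,2,4})"
      using par no by blast
    have t': "~ (ch12 & ch23 & ch14 & ~ ch34)" "~ (ch23 & ch12 & ch34 & ~ ch14)" "~ (ch14 & ch34 & ch12 & ~ ch23)" "~ (ch34 & ch14 & ch23 & ~ ch12)"
      using th no by blast+
    show False using D by (simp only: p' o t' simp_thms)
  qed
qed

text \<open>If the fourth corner were a tree, it would be affine E8 beside a cyclic corner, with
  \<open>x4\<close> hanging at position 3 or 6 from \<open>x2\<close>. But \<open>x4\<close> is a
  clone of \<open>x2\<close> and is adjacent to its neighbour at position 1.\<close>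

lemma nu_cc: assumes ch12 ch23 ch14 "g x1 x2 ~= 0" shows "g x1 x2 ~= 0 & g x2 x3 ~= 0 & g x3 x4 ~= 0 & g x4 x1 ~= 0"
proof -
  let ?A = "insert x1 (insert x2 S)"
  interpret a: quad I g V n S x3 x2 x1 x4 by (rule flip13)
  have e: "ep x1 x2 = 1" using assms by (simp add: ep_def)
  hence e': "ep x2 x3 = 1" "ep x4 x1 = 1" using cc_eps assms by auto
  have ch34
  proof (rule ccontr)
    assume n34: "~ ch34"
    have d2: "dg ?A x2 = 2" by (rule cycle_V(1)[OF V12 assms(1)]) simp
    obtain v where v: "v \<in> nb ?A x2" "v ~= x1" by (rule two_nb'[OF d2])
    have vS: "v \<in> S" "g x2 v ~= 0" using v by (auto simp: nb_def)
    have v4: "g x4 v ~= 0" using edge_diagram.clone[OF E241, of v] assms vS by (simp add: insert_commute)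
    have V32: "insert x2 (insert x3 S) \<in> V" by (rule V')
    have "v \<in> nb (insert x2 (insert x3 S)) x2" using vS xS by (auto simp: nb_def)
    then obtain c where c: "cyc (insert x2 (insert x3 S)) c" "c 0 = x2" "c 1 = v" using cyc_enum[OF V32, of x2 v] assms by (auto simp: insert_commute)
    have rm: "insert x2 (insert x3 S) - {x2} = insert x3 S" using xS ne by auto
    have "\<exists>t\<in>{3,6}. n = 9 & g x4 (c t) = -1/2 & (\<forall>j\<in>{1..<n}. j ~= t --> g x4 (c j) = 0)"
      by (rule path_label[OF c(1)]) (use c(2) rm V' n34 xS ne in \<open>auto simp: insert_commute\<close>)
    hence "g x4 (c 1) = 0" by force
    thus False using v4 c by simp
  qed
  hence "ep x3 x4 = 1" using relation assms e e' by (simp add: chi_def)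
  moreover have "g x y ~= 0" if "ep x y = 1" for x y using that by (simp add: ep_def split: if_splits)
  ultimately show ?thesis using e e' by blast
qed

text \<open>\<open>x4\<close> is a clone of \<open>x2\<close>, and \<open>x3\<close> hangs on
  \<open>c 3\<close>, counted from \<open>x1\<close> in the direction away from \<open>x2\<close>.
  By \<open>relation\<close> they are orthogonal, and the two dotted pairs contradict reverse
  Cauchy-Schwarz.\<close>

lemma gamma: assumes ch12 "~ ch23" ch14 and c: "cyc (insert x1 (insert x2 S)) c" "c 0 = x1" "c (n-1) = x2" "g x3 (c 3) ~= 0" shows False
proof -
  let ?A = "insert x1 (insert x2 S)"
  obtain t where t: "t \<in> {3,6}" "n = 9" "g x3 (c t) = -1/2" "\<forall>j\<in>{1..<n}. j ~= t --> g x3 (c j) = 0" using lab3[OF c(1,2) assms(2)] by blast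
  have n: "n = 9" by (rule t)
  have t3: "t = 3" using t c(4) by auto
  have c8: "c 8 = x2" using c n by simp
  have z3: "g x3 (c j) = 0" if "1 <= j" "j < 9" "j ~= 3" for j using t(4) that n t3 by auto
  note gv = cyc9[OF c(1) n]
  have cS: "c j \<in> S" if "1 <= j" "j < 8" for j using cS[OF c(1) n c(2) c8, of j] that by auto
  have ij: "c i = c j \<longleftrightarrow> i = j" if "i < 9" "j < 9" for i j using cyc9_inj[OF c(1) n that] .
  have "~ ch34"
    by (rule not_ch34[of "c 3" "c 2" "c 4"]) (use t t3 cS gv ij gsym[of "c 3" x3] in auto)
  have g12: "g x1 x2 = -1/2" using gv[of 0 8] c c8 by simp
  have cl: "g x4 j = g x2 j" if "j \<in> insert x1 S" for j
    using edge_diagram.clone[OF E241, of j] assms that by (simp add: insert_commute)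
  have v4: "g x4 (c j) = (if j = 0 \<or> j = 7 then -1/2 else 0)" if "j < 8" for j
  proof -
    have "c j \<in> insert x1 S" using cS[of j] c(2) that by (cases "j = 0") auto
    hence "g x4 (c j) = g (c 8) (c j)" using cl c8 by simp
    thus ?thesis using gv[of 8 j] that by auto
  qed
  have "g x3 x2 = 0" using z3[of 8] c8 by simp
  hence "ep x2 x3 = 0" using gsym[of x2 x3] by (simp add: ep_def)
  moreover have "ep x4 x1 = 1" using v4[of 0] c(2) by (simp add: ep_def)
  moreover have "ep x1 x2 = 1" using g12 by (simp add: ep_def)
  ultimately have "ep x3 x4 = 0" using relation assms \<open>~ ch34\<close> by (simp add: chi_def)
  hence h: "g x3 x4 = 0" by (simp add: ep_def split: if_splits)
  have xA: "x3 ~: ?A" "x4 ~: ?A" using xS ne by auto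
  have d: "g x1 x3 < -1" "g x2 x4 < -1" using dotted assms by auto
  have v: "g x3 (c 0) = g x1 x3" "g x4 (c 8) = g x2 x4" "g x3 (c 3) = -1/2" "g x4 (c 7) = -1/2" "g x4 (c 0) = -1/2"
    using c(2) c8 gsym[of x3 x1] gsym[of x4 x2] t(3) t3 v4[of 7] v4[of 0] by auto
  have zz: "g x3 (c 1) = 0" "g x3 (c 2) = 0" "g x3 (c 4) = 0" "g x3 (c 5) = 0" "g x3 (c 6) = 0" "g x3 (c 7) = 0" "g x3 (c 8) = 0"
     "g x4 (c 1) = 0" "g x4 (c 2) = 0" "g x4 (c 3) = 0" "g x4 (c 4) = 0" "g x4 (c 5) = 0" "g x4 (c 6) = 0" using z3 v4 by auto
  \<comment> \<open>Again solved for orthogonality to \<open>S\<close>, with 12 at \<open>x3\<close>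
    and 4 at \<open>x4\<close>; here \<open>x4\<close> has two neighbours on the cycle, as a clone
    of \<open>x2\<close>.\<close>
  define U where "U = (!) [4,11,18,25,20,15,10,5,0::real]"
  define W where "W = (!) [0,1,2,3,4,5,6,7,4::real]"
  define uu where "uu = -12 + 96 * g x1 x3"
  define ww where "ww = 4 + 32 * g x2 x4"
  have "uu * ww <= (-36)\<^sup>2"
  proof (rule lor_cyc[OF c(1) n xI(3,4) xA ne(6), of "\<lambda>j. g x3 (c j)" "\<lambda>j. g x4 (c j)" uu U 12 ww W 4 "-36"])
    show "uu = (\<Sum>j<9. U j * (U j - U ((j+1) mod 9) / 2 - U ((j+8) mod 9) / 2)) + 2 * 12 * (\<Sum>j<9. U j * g x3 (c j)) + 12 * 12"
      unfolding sum9 uu_def U_def v zz by simp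
    show "ww = (\<Sum>j<9. W j * (W j - W ((j+1) mod 9) / 2 - W ((j+8) mod 9) / 2)) + 2 * 4 * (\<Sum>j<9. W j * g x4 (c j)) + 4 * 4"
      unfolding sum9 ww_def W_def v zz by simp
    show "-36 = (\<Sum>j<9. U j * (W j - W ((j+1) mod 9) / 2 - W ((j+8) mod 9) / 2)) + 12 * (\<Sum>j<9. W j * g x3 (c j)) + 4 * (\<Sum>j<9. U j * g x4 (c j)) + 12 * 4 * g x3 x4"
      unfolding sum9 U_def W_def v zz h by simp
    show "uu < 0" using d by (simp add: uu_def)
  qed auto
  moreover have "uu < -108" "ww < -28" using d by (auto simp: uu_def ww_def)
  moreover have "108 * 28 < uu * ww" using mult_strict_mono'[of 108 "-uu" 28 "-ww"] calculation(2,3) by simp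
  ultimately show False by simp
qed

end

section \<open>Counting 2-faces and charges of quadrangles\<close>

context ideal_diagram begin

lemma nbrD: assumes "A \<in> V" "x \<in> A" obtains y where "y \<in> I" "y ~: A" "insert y (A - {x}) \<in> V" "!!B. B \<in> V ==> A - {x} \<subseteq> B ==> B = A \<or> B = insert y (A - {x})"
proof -
  obtain y where y: "y \<in> I - A" "{A'\<in>V. A - {x} \<subseteq> A'} = {A, insert y (A - {x})}" using nbr[OF assms] by blast
  have "insert y (A - {x}) \<in> {A'\<in>V. A - {x} \<subseteq> A'}" using y(2) by simp
  hence "insert y (A - {x}) \<in> V" by simp
  moreover have "B = A \<or> B = insert y (A - {x})" if "B \<in> V" "A - {x} \<subseteq> B" for B using y(2) that by blast
  ultimately show thesis using that y(1) by blast
qed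

text \<open>Two edges at the given vertex and one more step around the 2-face give four vertices,
  distinct because there are no triangles. If there are no others, the step from the other side ends
  at the same vertex.\<close>

lemma face_four:
  assumes A: "insert x (insert y S) \<in> V" and S: "x ~: S" "y ~: S" "x ~= y"
  shows "4 <= card {B\<in>V. S \<subseteq> B}" "card {B\<in>V. S \<subseteq> B} = 4 ==> \<exists>x3 x4. quad I g V n S x y x3 x4 &
     {B\<in>V. S \<subseteq> B} = {insert x (insert y S), insert x3 (insert y S), insert x3 (insert x4 S), insert x (insert x4 S)}"
proof -
  let ?F = "{B\<in>V. S \<subseteq> B}"
  have fV: "finite V" using V_sub finI by (meson Pow_iff finite_Pow_iff finite_subset subsetI)
  have r1: "insert x (insert y S) - {x} = insert y S" "insert x (insert y S) - {y} = insert x S" using S by auto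
  obtain x3 where x3: "x3 ~: insert x (insert y S)" "insert x3 (insert y S) \<in> V" by (rule nbrD[OF A, of x]) (use r1 in auto)
  obtain x4 where x4: "x4 ~: insert x (insert y S)" "insert x4 (insert x S) \<in> V" by (rule nbrD[OF A, of y]) (use r1 in auto)
  have ne34: "x3 ~= x4"
  proof
    assume "x3 = x4"
    thus False using no_triangle[of x y S x3] A x3 x4 S by (auto simp: insert_commute)
  qed
  have r2: "insert x3 (insert y S) - {y} = insert x3 S" using x3 S by auto
  obtain w where w: "w ~: insert x3 (insert y S)" "insert w (insert x3 S) \<in> V" by (rule nbrD[OF x3(2), of y]) (use r2 in auto)
  have r3: "insert x4 (insert x S) - {x} = insert x4 S" using x4 S by auto
  obtain v where v: "v ~: insert x4 (insert x S)" "insert v (insert x4 S) \<in> V" by (rule nbrD[OF x4(2), of x]) (use r3 in auto)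
  let ?Q = "{insert x (insert y S), insert x3 (insert y S), insert x4 (insert x S), insert w (insert x3 S)}"
  have d: "insert x (insert y S) ~= insert x3 (insert y S)" "insert x (insert y S) ~= insert x4 (insert x S)" "insert x (insert y S) ~= insert w (insert x3 S)"
    "insert x3 (insert y S) ~= insert x4 (insert x S)" "insert x3 (insert y S) ~= insert w (insert x3 S)" "insert x4 (insert x S) ~= insert w (insert x3 S)"
    using x3 x4 w ne34 S by blast+
  have c4: "card ?Q = 4" using d by simp
  have sub: "?Q \<subseteq> ?F" using A x3 x4 w by auto
  have fF: "finite ?F" using fV by simp
  show "4 <= card ?F" using card_mono[OF fF sub] c4 by simp
  assume "card ?F = 4"
  hence eq: "?Q = ?F" using card_subset_eq[OF fF sub] c4 by simp
  have "insert v (insert x4 S) \<in> ?F" using v by auto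
  hence "insert v (insert x4 S) \<in> ?Q" using eq by simp
  moreover have "insert v (insert x4 S) ~= insert x (insert y S)" using x4 by blast
  moreover have "x4 ~: insert x3 (insert y S)" using x4 ne34 by auto
  hence "insert v (insert x4 S) ~= insert x3 (insert y S)" by blast
  moreover have "x ~: insert v (insert x4 S)" using v x4 S by auto
  hence "insert v (insert x4 S) ~= insert x4 (insert x S)" by blast
  ultimately have e: "insert v (insert x4 S) = insert w (insert x3 S)" by blast
  have "x4 \<in> insert w (insert x3 S)" using e by blast
  hence "w = x4" using x4 ne34 by auto
  hence V34: "insert x3 (insert x4 S) \<in> V" using w by (simp add: insert_commute)
  have "quad I g V n S x y x3 x4"
    by unfold_locales (use A x3 x4 V34 S ne34 in \<open>auto simp: insert_commute\<close>)
  moreover have "?F = {insert x (insert y S), insert x3 (insert y S), insert x3 (insert x4 S), insert x (insert x4 S)}"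
    unfolding eq[symmetric] \<open>w = x4\<close> by (auto simp: insert_commute)
  ultimately show "\<exists>x3 x4. quad I g V n S x y x3 x4 & ?F = {insert x (insert y S), insert x3 (insert y S), insert x3 (insert x4 S), insert x (insert x4 S)}" by blast
qed

end

lemma two_choose: "2 * (d choose 2) = d * (d - 1)"
proof -
  have "even (d * (d - 1))" by (cases d) auto
  thus ?thesis by (simp add: choose_two)
qed

lemma int_two_choose: "1 <= d ==> 2 * int (d choose 2) = int d * (int d - 1)"
  using arg_cong[OF two_choose[of d], of int] by (simp add: of_nat_diff)

text \<open>With s = d + u the right-hand side is s^2 - 2 s + (d - u)^2. The parity term records
  that d and u differ when s is odd.\<close>

lemma choose_pair_bound:
  fixes d u n :: nat assumes "n <= d + u" "1 <= n"
  shows "int n * (int n - 2) + int (n mod 2) <= 4 * (int (d choose 2) + int (u choose 2))"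
proof -
  have c: "2 * int (k choose 2) = int k * int k - int k" for k
  proof -
    have "2 * int (k choose 2) = int (k * (k - 1))" using two_choose[of k] by (metis of_nat_mult of_nat_numeral)
    thus ?thesis by (cases k) (auto simp: algebra_simps)
  qed
  define D U N where "D = int d" and "U = int u" and "N = int n"
  have e: "4 * (int (d choose 2) + int (u choose 2)) = (D + U) * (D + U) - 2 * (D + U) + (D - U) * (D - U)"
    using c[of d] c[of u] by (simp add: D_def U_def algebra_simps)
  have N: "N <= D + U" "1 <= N" using assms by (auto simp: D_def U_def N_def)
  show ?thesis
  proof (cases "d + u = n")
    case True
    hence s: "D + U = N" by (auto simp: D_def U_def N_def)
    have "int (n mod 2) <= (D - U) * (D - U)"
    proof (cases "d = u")
      case True
      hence "n mod 2 = 0" using \<open>d + u = n\<close> by auto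
      thus ?thesis by simp
    next
      case False
      hence "D ~= U" by (simp add: D_def U_def)
      hence "0 < (D - U) * (D - U)" by (auto simp: zero_less_mult_iff linorder_neq_iff)
      thus ?thesis by linarith
    qed
    thus ?thesis unfolding e s by (simp add: N_def algebra_simps)
  next
    case False
    hence s: "N + 1 <= D + U" using assms by (auto simp: D_def U_def N_def)
    have "N * N <= (D + U - 1) * (D + U - 1)" by (rule mult_mono) (use s N in auto)
    moreover have "(D + U - 1) * (D + U - 1) = (D + U) * (D + U) - 2 * (D + U) + 1" by (simp add: algebra_simps)
    moreover have "0 <= (D - U) * (D - U)" by simp
    moreover have "int (n mod 2) <= 1" by simp
    ultimately have "N * N - 2 * N + int (n mod 2) <= (D + U) * (D + U) - 2 * (D + U) + (D - U) * (D - U)" using N by linarith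
    thus ?thesis unfolding e by (simp add: N_def algebra_simps)
  qed
qed

context quad begin

end

context ideal_diagram begin

text \<open>The two side facets of the 2-face \<open>S\<close> at its vertex \<open>A\<close> are
  not orthogonal. In \<open>F2\<close> a 2-face is represented by the n - 2 facets containing
  it.\<close>

definition eps where "eps S A \<longleftrightarrow> (\<exists>x y. A - S = {x,y} & x ~= y & g x y ~= 0)"
definition F2 where "F2 = {S. \<exists>A\<in>V. \<exists>x\<in>A. \<exists>y\<in>A. x ~= y & S = A - {x,y}}"
definition Q4 where "Q4 = {S\<in>F2. card {B\<in>V. S \<subseteq> B} = 4}"
definition nu where "nu S = card {B\<in>V. S \<subseteq> B & eps S B}"

lemma nbr2: assumes "A \<in> V" "x \<in> A" shows "\<exists>y. \<forall>C\<in>V. A - {x} \<subseteq> C --> C = A \<or> C = insert y (A - {x})"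
  by (rule nbrD[OF assms]) blast
lemma fV: "finite V" using V_sub finI by (meson Pow_iff finite_Pow_iff finite_subset subsetI)
lemma fF2: "finite F2"
proof -
  have "F2 \<subseteq> Pow I" using V_sub by (auto simp: F2_def)
  thus ?thesis using finI by (meson finite_Pow_iff finite_subset)
qed

lemma eps_iff: assumes "x ~: S" "y ~: S" "x ~= y" shows "eps S (insert x (insert y S)) \<longleftrightarrow> g x y ~= 0"
proof -
  have e: "insert x (insert y S) - S = {x,y}" using assms by auto
  show ?thesis unfolding eps_def e using assms gsym[of x y] by (auto simp: doubleton_eq_iff)
qed

lemma F2D: assumes "S \<in> F2" "A \<in> V" "S \<subseteq> A" obtains x y where "x ~: S" "y ~: S" "x ~= y" "A = insert x (insert y S)"
proof -
  obtain B a b where B: "B \<in> V" "a \<in> B" "b \<in> B" "a ~= b" "S = B - {a,b}" using assms(1) by (auto simp: F2_def)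
  have cS: "card S = n - 2" using B V_card[OF B(1)] V_fin[OF B(1)] by (simp add: card_Diff_subset)
  hence "card (A - S) = 2" using assms V_card[OF assms(2)] V_fin[OF assms(2)] n9 finite_subset by (subst card_Diff_subset) auto
  then obtain x y where "A - S = {x,y}" "x ~= y" by (meson card_2_iff)
  thus thesis using that[of x y] assms(3) by auto
qed

lemma Q4_quad: assumes "insert x (insert y S) \<in> V" "x ~: S" "y ~: S" "x ~= y" "S \<in> Q4"
  obtains x3 x4 where "quad I g V n S x y x3 x4"
    "nu S = quad.ep g x y + quad.ep g y x3 + quad.ep g x3 x4 + quad.ep g x4 x"
proof -
  obtain x3 x4 where q: "quad I g V n S x y x3 x4" and F: "{B\<in>V. S \<subseteq> B} = {insert x (insert y S), insert x3 (insert y S), insert x3 (insert x4 S), insert x (insert x4 S)}"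
    using face_four(2)[OF assms(1-4)] assms(5) unfolding Q4_def by blast
  interpret q: quad I g V n S x y x3 x4 by (rule q)
  have "nu S = card {B \<in> {B\<in>V. S \<subseteq> B}. eps S B}" unfolding nu_def by (rule arg_cong[where f=card]) auto
  also have "\<dots> = (\<Sum>B\<in>{B\<in>V. S \<subseteq> B}. if eps S B then 1 else 0)" using fV by (simp add: sum.If_cases Int_def)
  also have "\<dots> = (if eps S (insert x (insert y S)) then 1 else 0) + (if eps S (insert x3 (insert y S)) then 1 else 0) + (if eps S (insert x3 (insert x4 S)) then 1 else 0) + (if eps S (insert x (insert x4 S)) then 1 else 0)"
  proof -
    have d: "insert x (insert y S) ~= insert x3 (insert y S)" "insert x (insert y S) ~= insert x3 (insert x4 S)" "insert x (insert y S) ~= insert x (insert x4 S)"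
      "insert x3 (insert y S) ~= insert x3 (insert x4 S)" "insert x3 (insert y S) ~= insert x (insert x4 S)" "insert x3 (insert x4 S) ~= insert x (insert x4 S)"
      using q.xS q.ne by blast+
    show ?thesis unfolding F using d by simp
  qed
  also have "\<dots> = q.ep x y + q.ep y x3 + q.ep x3 x4 + q.ep x4 x"
    using eps_iff[OF q.xS(1,2) q.ne(1)] eps_iff[OF q.xS(3,2) q.ne(10)] eps_iff[OF q.xS(3,4) q.ne(6)] eps_iff[OF q.xS(1,4) q.ne(3)]
      gsym[of x3 y] gsym[of x4 x] by (simp add: q.ep_def)
  finally show thesis using that[OF q] by simp
qed

lemma nu_ge2: assumes "S \<in> Q4" shows "2 <= nu S"
proof -
  obtain A x y where A: "A \<in> V" "x \<in> A" "y \<in> A" "x ~= y" "S = A - {x,y}" using assms by (auto simp: Q4_def F2_def)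
  have e: "insert x (insert y S) = A" "x ~: S" "y ~: S" using A by auto
  obtain x3 x4 where "quad I g V n S x y x3 x4" "nu S = quad.ep g x y + quad.ep g y x3 + quad.ep g x3 x4 + quad.ep g x4 x"
    by (rule Q4_quad[of x y S]) (use e A assms in auto)
  thus ?thesis using quad.nu_ge2 by metis
qed

text \<open>The unit charge of a quadrangle is shared equally by its nonorthogonal corners;
  \<open>EB B\<close> consists of the quadrangles that charge \<open>B\<close>.\<close>

definition wt where "wt S = 1 / real (nu S)"
definition EB where "EB B = {S\<in>Q4. S \<subseteq> B & eps S B}"

lemma wt_le: "S \<in> Q4 ==> 0 <= wt S & wt S <= 1/2" using nu_ge2[of S] by (auto simp: wt_def field_simps)

text \<open>A quadrangle charging \<open>B\<close> is determined by an edge of the diagram of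
  \<open>B\<close>. The factor \<open>bool\<close> orients the edge, since \<open>ed\<close> counts
  ordered pairs.\<close>

lemma EB_ed: assumes "B \<in> V" shows "2 * card (EB B) <= ed B"
proof -
  have "\<forall>S\<in>EB B. \<exists>p. B - S = {fst p, snd p} & fst p ~= snd p & g (fst p) (snd p) ~= 0"
    unfolding EB_def eps_def by force
  then obtain p where p: "\<forall>S\<in>EB B. B - S = {fst (p S), snd (p S)} & fst (p S) ~= snd (p S) & g (fst (p S)) (snd (p S)) ~= 0" by metis
  let ?h = "\<lambda>(S,b). if b then p S else (snd (p S), fst (p S))"
  let ?P = "SIGMA i:B. nb B i"
  have sub: "S \<subseteq> B" if "S \<in> EB B" for S using that by (simp add: EB_def)
  have "card (EB B \<times> (UNIV::bool set)) <= card ?P"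
  proof (rule card_inj_on_le)
    show "finite ?P" using V_fin[OF assms] finite_nb by blast
    show "?h ` (EB B \<times> UNIV) \<subseteq> ?P"
    proof
      fix q assume "q \<in> ?h ` (EB B \<times> UNIV)"
      then obtain S b where S: "S \<in> EB B" "q = ?h (S,b)" by auto
      obtain x y where xy: "p S = (x,y)" by (cases "p S")
      have f: "B - S = {x,y}" "x ~= y" "g x y ~= 0" using p[rule_format, OF S(1)] xy by auto
      have f': "x \<in> B" "y \<in> B" "g y x ~= 0" using f(1,3) gsym[of x y] by auto
      show "q \<in> ?P" using S(2) f f' xy by (cases b) (auto simp: nb_def)
    qed
    show "inj_on ?h (EB B \<times> UNIV)"
    proof (rule inj_onI)
      fix a a' assume a: "a \<in> EB B \<times> UNIV" "a' \<in> EB B \<times> UNIV" "?h a = ?h a'"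
      obtain S b S' b' where e: "a = (S,b)" "a' = (S',b')" "S \<in> EB B" "S' \<in> EB B" using a by auto
      have "{fst (p S), snd (p S)} = {fst (p S'), snd (p S')}" using a(3) e by (cases b; cases b') (auto simp: prod_eq_iff)
      hence "B - S = B - S'" using p e by metis
      hence "S = S'" using sub e by blast
      moreover have "b = b'" using a(3) e p \<open>S = S'\<close> by (cases b; cases b') (auto simp: prod_eq_iff)
      ultimately show "a = a'" using e by simp
    qed
  qed
  moreover have "card ?P = ed B" using V_fin[OF assms] finite_nb by (simp add: card_SigmaI ed_def dg_def)
  ultimately show ?thesis by (simp add: card_cartesian_product)
qed

text \<open>For cyclic \<open>B\<close>: exchanging \<open>p\<close> leads to another cyclic vertex.
  Quantifying over all vertices through the edge avoids naming the new facet.\<close>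

definition ctype where "ctype B p \<longleftrightarrow> (\<forall>B'\<in>V. B - {p} \<subseteq> B' --> ed B' = 2 * n)"

lemma ctype_quad: assumes "quad I g V n S p q x3 x4" "B = insert p (insert q S)" "ed B = 2 * n"
  shows "ctype B p \<longleftrightarrow> ed (insert x3 (insert q S)) = 2 * n" "ctype B q \<longleftrightarrow> ed (insert p (insert x4 S)) = 2 * n"
proof -
  interpret q: quad I g V n S p q x3 x4 by (rule assms(1))
  have r: "B - {p} = insert q S" "B - {q} = insert p S" using q.xS q.ne assms(2) by auto
  have BV: "B \<in> V" "p \<in> B" "q \<in> B" using q.V12 assms(2) by auto
  obtain y where y0: "\<forall>C\<in>V. B - {p} \<subseteq> C --> C = B \<or> C = insert y (B - {p})" using nbr2[OF BV(1,2)] by (rule exE)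
  note y = y0[rule_format]
  have "insert x3 (insert q S) ~= B" using q.xS q.ne assms(2) by auto
  hence n1: "C = B \<or> C = insert x3 (insert q S)" if "C \<in> V" "B - {p} \<subseteq> C" for C
    using y[OF that] y[OF q.V23] r by auto
  show "ctype B p \<longleftrightarrow> ed (insert x3 (insert q S)) = 2 * n"
    unfolding ctype_def using n1 q.V23 r assms(3) by auto
  obtain w where w0: "\<forall>C\<in>V. B - {q} \<subseteq> C --> C = B \<or> C = insert w (B - {q})" using nbr2[OF BV(1,3)] by (rule exE)
  note w = w0[rule_format]
  have "insert p (insert x4 S) ~= B" using q.xS q.ne assms(2) by auto
  hence n2: "C = B \<or> C = insert p (insert x4 S)" if "C \<in> V" "B - {q} \<subseteq> C" for C
    using w[OF that] w[OF q.V14] r by auto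
  show "ctype B q \<longleftrightarrow> ed (insert p (insert x4 S)) = 2 * n"
    unfolding ctype_def using n2 q.V14 r assms(3) by auto
qed

text \<open>If both exchanges lead to trees, \<open>alpha\<close> applies. If both lead to cycles,
  \<open>nu_cc\<close> makes all four corners nonorthogonal and the charge is 1/4.\<close>

lemma heavy_charge: assumes B: "B \<in> V" "ed B = 2 * n" and pq: "p \<in> B" "q \<in> B" "p ~= q" "g p q ~= 0" and S: "B - {p,q} \<in> Q4" "1/4 < wt (B - {p,q})"
  shows "ctype B p ~= ctype B q"
proof -
  let ?S = "B - {p,q}"
  have e: "insert p (insert q ?S) = B" "p ~: ?S" "q ~: ?S" using pq by auto
  obtain x3 x4 where q: "quad I g V n ?S p q x3 x4" and nu: "nu ?S = quad.ep g p q + quad.ep g q x3 + quad.ep g x3 x4 + quad.ep g x4 p"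
    by (rule Q4_quad[of p q ?S]) (use e B pq S in auto)
  interpret q: quad I g V n ?S p q x3 x4 by (rule q)
  note ct = ctype_quad[OF q e(1)[symmetric] B(2)]
  have ch: "ed (insert p (insert q ?S)) = 2 * n" using e B by simp
  show ?thesis
  proof
    assume eq: "ctype B p = ctype B q"
    show False
    proof (cases "ctype B p")
      case True
      hence "q.ep p q = 1" "q.ep q x3 = 1" "q.ep x3 x4 = 1" "q.ep x4 p = 1" using q.nu_cc[OF ch] ct eq pq(4) by (auto simp: q.ep_def)
      hence "nu ?S = 4" using nu by simp
      thus False using S(2) by (simp add: wt_def)
    next
      case False thus False using q.alpha[OF ch] ct eq pq(4) by blast
    qed
  qed
qed

text \<open>Both quadrangles exchange \<open>m\<close> for the same facet, which hangs at position 3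
  or 6 from \<open>m\<close>. In one of the two directions this is position 3, and
  \<open>gamma\<close> applies to the quadrangle on the other side.\<close>

lemma center: assumes B: "B \<in> V" "ed B = 2 * n" and pq: "m \<in> B" "p \<in> B" "q \<in> B" "p ~= q" "p ~= m" "q ~= m" "g m p ~= 0" "g m q ~= 0"
   and S: "B - {m,p} \<in> Q4" "B - {m,q} \<in> Q4" and t: "~ ctype B m" "ctype B p" "ctype B q"
  shows False
proof -
  let ?S = "B - {m,p}" and ?T = "B - {m,q}"
  have e: "insert m (insert p ?S) = B" "m ~: ?S" "p ~: ?S" "m ~= p" and e': "insert m (insert q ?T) = B" "m ~: ?T" "q ~: ?T" "m ~= q" using pq by auto
  obtain x3 x4 where q1: "quad I g V n ?S m p x3 x4" by (rule Q4_quad[of m p ?S]) (use e B S in auto)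
  obtain y3 y4 where q2: "quad I g V n ?T m q y3 y4" by (rule Q4_quad[of m q ?T]) (use e' B S in auto)
  interpret q1: quad I g V n ?S m p x3 x4 by (rule q1)
  interpret q2: quad I g V n ?T m q y3 y4 by (rule q2)
  note ct1 = ctype_quad[OF q1 e(1)[symmetric] B(2)] and ct2 = ctype_quad[OF q2 e'(1)[symmetric] B(2)]
  have "q \<in> nb B m" using pq by (auto simp: nb_def)
  then obtain c where c: "cyc B c" "c 0 = m" "c 1 = q" using cyc_enum[OF B pq(1)] by blast
  have "p \<in> nb B (c 0)" using pq c by (auto simp: nb_def)
  hence cp: "c (n-1) = p" using cyc_nb0(1)[OF c(1)] pq c by auto
  have c1: "cyc (insert m (insert p ?S)) c" "cyc (insert m (insert q ?T)) c" using c e e' by simp_all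
  have ch: "ed (insert m (insert p ?S)) = 2 * n" "ed (insert m (insert q ?T)) = 2 * n" using e e' B by simp_all
  obtain t where tt: "t \<in> {3,6}" "n = 9" "g x3 (c t) = -1/2" using q1.lab3[OF c1(1) c(2)] ct1 t by blast
  have r1: "insert p ?S = B - {m}" "insert q ?T = B - {m}" using pq by auto
  obtain w where w0: "\<forall>C\<in>V. B - {m} \<subseteq> C --> C = B \<or> C = insert w (B - {m})" using nbr2[OF B(1) pq(1)] by (rule exE)
  note w = w0[rule_format]
  have xB: "x3 ~: B" "y3 ~: B" using q1.xS q1.ne q2.xS q2.ne by auto
  have "insert x3 (B - {m}) \<in> V" "insert y3 (B - {m}) \<in> V" using q1.V23 q2.V23 r1 by simp_all
  hence "insert x3 (B - {m}) = insert w (B - {m})" "insert y3 (B - {m}) = insert w (B - {m})" using w xB by blast+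
  hence xy: "y3 = x3" using xB by blast
  show False
  proof (cases "t = 3")
    case True
    show False by (rule q1.gamma[OF ch(1) _ _ c1(1) c(2) cp]) (use ct1 t tt True in auto)
  next
    case False
    hence t6: "t = 6" using tt by auto
    have r: "cyc (insert m (insert q ?T)) (\<lambda>i. if i = 0 then c 0 else c (n - i))" by (rule cyc_reflect[OF c1(2)])
    show False by (rule q2.gamma[OF ch(2) _ _ r]) (use ct2 t tt t6 c xy in auto)
  qed
qed

definition ch where "ch B p q = (if B - {p,q} \<in> Q4 then wt (B - {p,q}) else 0)"

lemma ch_le: "ch B p q <= 1/2" using wt_le by (auto simp: ch_def)
text \<open>Each charge is at most 1/2, so a sum above 5/4 makes all three exceed 1/4. By
  \<open>heavy_charge\<close> the types alternate, and one of the inner nodes is a tree type between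
  two cycle types, against \<open>center\<close>.\<close>

lemma three_edges: assumes B: "B \<in> V" "ed B = 2 * n" and y: "y0 \<in> B" "y1 \<in> B" "y2 \<in> B" "y3 \<in> B" "distinct [y0,y1,y2,y3]"
   and e: "g y0 y1 ~= 0" "g y1 y2 ~= 0" "g y2 y3 ~= 0"
  shows "ch B y0 y1 + ch B y1 y2 + ch B y2 y3 <= 5/4"
proof (rule ccontr)
  assume no: "~ ?thesis"
  hence b: "1/4 < ch B y0 y1" "1/4 < ch B y1 y2" "1/4 < ch B y2 y3"
    using ch_le[of B y0 y1] ch_le[of B y1 y2] ch_le[of B y2 y3] by linarith+
  have Q: "B - {p,q} \<in> Q4 & 1/4 < wt (B - {p,q})" if "1/4 < ch B p q" for p q using that by (auto simp: ch_def split: if_splits)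
  have t: "ctype B y0 ~= ctype B y1" "ctype B y1 ~= ctype B y2" "ctype B y2 ~= ctype B y3"
    by (rule heavy_charge[OF B]; use y e Q[OF b(1)] Q[OF b(2)] Q[OF b(3)] in auto)+
  have e': "g y1 y0 ~= 0" "g y2 y1 ~= 0" using e gsym[of y1 y0] gsym[of y2 y1] by auto
  have Q': "B - {y1,y0} \<in> Q4" "B - {y1,y2} \<in> Q4" "B - {y2,y1} \<in> Q4" "B - {y2,y3} \<in> Q4"
    using Q[OF b(1)] Q[OF b(2)] Q[OF b(3)] by (simp_all add: insert_commute)
  show False
  proof (cases "ctype B y1")
    case True
    show False by (rule center[OF B, of y2 y1 y3]) (use y e e' Q' t True in auto)
  next
    case False
    show False by (rule center[OF B, of y1 y0 y2]) (use y e e' Q' t False in auto)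
  qed
qed

text \<open>The nine edges of the cycle in three runs of three give at most 15/4.\<close>

lemma cycle_charge9: assumes B: "B \<in> V" "ed B = 2 * n" and n: "n = 9" shows "(\<Sum>S\<in>EB B. wt S) <= 4"
proof -
  obtain x where x: "x \<in> B" using V_card[OF B(1)] n by fastforce
  obtain y where "y \<in> nb B x" by (rule two_nb'[OF cycle_V(1)[OF B x]])
  then obtain c where c: "cyc B c" using cyc_enum[OF B x] by blast
  note gv = cyc9[OF c n] and ij = cyc9_inj[OF c n]
  have cB: "c j \<in> B" if "j < 9" for j using cycD(4)[OF c, of j] that n by simp
  define f where "f = (\<lambda>i. B - {c i, c (Suc i mod 9)})"
  have sub: "EB B \<subseteq> f ` {..<9}"
  proof
    fix S assume S: "S \<in> EB B"
    then obtain p q where pq: "B - S = {p,q}" "p ~= q" "g p q ~= 0" by (auto simp: EB_def eps_def)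
    have SB: "S = B - {p,q}" using S pq by (auto simp: EB_def)
    have "p \<in> c ` {..<9}" "q \<in> c ` {..<9}" using pq cycD(3)[OF c] n by auto
    then obtain i j where ijx: "i < 9" "j < 9" "p = c i" "q = c j" by auto
    hence "j = Suc i \<or> i = Suc j \<or> (i = 0 & j = 8) \<or> (j = 0 & i = 8)" using pq gv[OF ijx(1,2)] by (auto split: if_splits)
    hence "j = Suc i mod 9 \<or> i = Suc j mod 9" using ijx by auto
    thus "S \<in> f ` {..<9}"
    proof
      assume "j = Suc i mod 9" thus ?thesis using SB ijx by (auto simp: f_def)
    next
      assume "i = Suc j mod 9" thus ?thesis using SB ijx by (auto simp: f_def insert_commute)
    qed
  qed
  define a where "a = (\<lambda>S. if S \<in> Q4 then wt S else 0)"
  have a0: "0 <= a S" for S using wt_le by (auto simp: a_def)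
  have "(\<Sum>S\<in>EB B. wt S) = (\<Sum>S\<in>EB B. a S)" by (rule sum.cong) (auto simp: a_def EB_def)
  also have "\<dots> <= (\<Sum>S\<in>f ` {..<9}. a S)" by (rule sum_mono2) (use sub a0 in auto)
  also have "\<dots> <= (\<Sum>i<9. a (f i))" using sum_image_le[of "{..<9}" a f] a0 by (simp add: o_def)
  also have "\<dots> = (\<Sum>i<9. ch B (c i) (c (Suc i mod 9)))" by (simp add: a_def f_def ch_def)
  also have "\<dots> = (ch B (c 0) (c 1) + ch B (c 1) (c 2) + ch B (c 2) (c 3)) + (ch B (c 3) (c 4) + ch B (c 4) (c 5) + ch B (c 5) (c 6)) + (ch B (c 6) (c 7) + ch B (c 7) (c 8) + ch B (c 8) (c 0))"
    unfolding sum9 by (simp add: numeral_2_eq_2)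
  also have "\<dots> <= 5/4 + 5/4 + 5/4"
    by (intro add_mono three_edges[OF B]) (simp_all add: cB gv ij)
  finally show ?thesis by simp
qed

text \<open>Every edge carries at most 1/2, and a tree has n - 1 edges; so only the cycle needs the
  finer bound when n = 9.\<close>

lemma charge: assumes "B \<in> V" shows "2 * (\<Sum>S\<in>EB B. wt S) <= (if n = 9 then 8 else real n)"
proof -
  have "(\<Sum>S\<in>EB B. wt S) <= (\<Sum>S\<in>EB B. 1/2)" by (rule sum_mono) (use wt_le in \<open>auto simp: EB_def\<close>)
  also have "\<dots> = real (card (EB B)) / 2" by simp
  finally have 1: "4 * (\<Sum>S\<in>EB B. wt S) <= real (2 * card (EB B))" by simp
  have 2: "real (2 * card (EB B)) <= real (ed B)" using EB_ed[OF assms] of_nat_le_iff by blast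
  consider "ed B = 2 * n - 2" | "ed B = 2 * n" "n ~= 9" | "ed B = 2 * n" "n = 9" using ed_V_cases[OF assms] by blast
  thus ?thesis
  proof cases
    case 1
    hence "real (ed B) = 2 * real n - 2" using n9 by (simp add: of_nat_diff)
    thus ?thesis using \<open>4 * _ <= _\<close> 2 by auto
  next
    case 2
    thus ?thesis using \<open>4 * _ <= _\<close> \<open>real (2 * card (EB B)) <= real (ed B)\<close> by auto
  next
    case 3
    thus ?thesis using cycle_charge9[OF assms] by simp
  qed
qed

lemma quads_bound: "2 * real (card Q4) <= (if n = 9 then 8 else real n) * real (card V)"
proof -
  have fQ: "finite Q4" using fF2 by (simp add: Q4_def)
  have one: "(\<Sum>B\<in>{B\<in>V. S \<subseteq> B & eps S B}. wt S) = 1" if "S \<in> Q4" for S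
    using nu_ge2[OF that] by (simp add: wt_def nu_def)
  have "real (card Q4) = (\<Sum>S\<in>Q4. \<Sum>B\<in>{B\<in>V. S \<subseteq> B & eps S B}. wt S)" using one by simp
  also have "\<dots> = (\<Sum>S\<in>Q4. \<Sum>B\<in>V. if S \<subseteq> B & eps S B then wt S else 0)"
    by (simp only: sum.inter_filter[OF fV])
  also have "\<dots> = (\<Sum>B\<in>V. \<Sum>S\<in>Q4. if S \<subseteq> B & eps S B then wt S else 0)" by (rule sum.swap)
  also have "\<dots> = (\<Sum>B\<in>V. \<Sum>S\<in>EB B. wt S)"
    by (rule sum.cong[OF refl]) (simp add: sum.inter_filter[OF fQ] EB_def)
  finally have "2 * real (card Q4) = (\<Sum>B\<in>V. 2 * (\<Sum>S\<in>EB B. wt S))" by (simp add: sum_distrib_left)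
  also have "\<dots> <= (\<Sum>B\<in>V. (if n = 9 then 8 else real n))" by (rule sum_mono) (rule charge)
  finally show ?thesis by (simp add: mult.commute)
qed

lemma card2_face: assumes "A \<in> V" "T \<subseteq> A" "card T = 2" shows "A - T \<in> F2"
proof -
  obtain x y where "T = {x,y}" "x ~= y" using assms(3) by (meson card_2_iff)
  thus ?thesis using assms unfolding F2_def by auto
qed

text \<open>Each vertex accounts for C(n,2) incidences with 2-faces, and a 2-face other than a
  quadrangle has at least five vertices.\<close>

lemma incidences: "5 * card F2 <= card V * (n choose 2) + card Q4"
proof -
  let ?k = "\<lambda>S. card {B\<in>V. S \<subseteq> B}"
  let ?P = "SIGMA S:F2. {B\<in>V. S \<subseteq> B}" and ?R = "SIGMA B:V. {T. T \<subseteq> B & card T = 2}"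
  have fR: "finite {T. T \<subseteq> B & card T = 2}" if "B \<in> V" for B using V_fin[OF that] by simp
  have "card ?P <= card ?R"
  proof (rule card_inj_on_le[of "\<lambda>(S,B). (B, B - S)"])
    show "inj_on (\<lambda>(S,B). (B, B - S)) ?P" by (rule inj_onI) (auto simp: double_diff)
    show "(\<lambda>(S,B). (B, B - S)) ` ?P \<subseteq> ?R"
    proof safe
      fix S B assume *: "S \<in> F2" "B \<in> V" "S \<subseteq> B"
      obtain x y where "x ~: S" "y ~: S" "x ~= y" "B = insert x (insert y S)" by (rule F2D[OF *])
      moreover hence "B - S = {x,y}" by auto
      ultimately show "card (B - S) = 2" by simp
    qed
    show "finite ?R" using fV fR by blast
  qed
  moreover have "card ?P = (\<Sum>S\<in>F2. ?k S)" using fF2 fV by (simp add: card_SigmaI)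
  moreover have "card ?R = (\<Sum>B\<in>V. n choose 2)"
    using fV fR by (subst card_SigmaI) (auto simp: n_subsets V_fin V_card)
  ultimately have 1: "(\<Sum>S\<in>F2. ?k S) <= card V * (n choose 2)" by simp
  have k4: "4 <= ?k S" if S: "S \<in> F2" for S
  proof -
    obtain A x y where A: "A \<in> V" "x \<in> A" "y \<in> A" "x ~= y" "S = A - {x,y}" using S by (auto simp: F2_def)
    have e: "insert x (insert y S) = A" "x ~: S" "y ~: S" using A by auto
    show ?thesis by (rule face_four(1)[of x y S]) (use e A in auto)
  qed
  have "(\<Sum>S\<in>F2. 5) <= (\<Sum>S\<in>F2. ?k S + (if S \<in> Q4 then 1 else 0))"
  proof (rule sum_mono)
    fix S assume S: "S \<in> F2"
    show "5 <= ?k S + (if S \<in> Q4 then 1 else 0)" using k4[OF S] S by (auto simp: Q4_def)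
  qed
  also have "\<dots> = (\<Sum>S\<in>F2. ?k S) + card Q4"
  proof -
    have "{S\<in>F2. S \<in> Q4} = Q4" by (auto simp: Q4_def)
    hence "(\<Sum>S\<in>F2. if S \<in> Q4 then 1 else 0) = card Q4" using fF2 by (simp add: sum.If_cases Int_def)
    thus ?thesis by (simp add: sum.distrib)
  qed
  finally show ?thesis using 1 by simp
qed

text \<open>Applied to descending and to ascending edges: a 2-face is selected at one vertex only,
  its highest or lowest one.\<close>

lemma select_count:
  assumes "!!A. A \<in> V ==> sel A \<subseteq> A"
    and "!!A A' T T'. A \<in> V ==> A' \<in> V ==> T \<subseteq> sel A ==> T' \<subseteq> sel A' ==> card T = 2 ==> card T' = 2 ==> A - T = A' - T' ==> A = A'"
  shows "(\<Sum>A\<in>V. card (sel A) choose 2) <= card F2"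
proof -
  have fs: "finite (sel A)" if "A \<in> V" for A using assms(1)[OF that] V_fin[OF that] finite_subset by blast
  let ?R = "SIGMA A:V. {T. T \<subseteq> sel A & card T = 2}"
  have "card ?R <= card F2"
  proof (rule card_inj_on_le[of "\<lambda>(A,T). A - T"])
    show "inj_on (\<lambda>(A,T). A - T) ?R"
    proof (rule inj_onI, clarify)
      fix A T A' T' assume *: "A \<in> V" "T \<subseteq> sel A" "card T = 2" "A' \<in> V" "T' \<subseteq> sel A'" "card T' = 2" "A - T = A' - T'"
      have "A = A'" by (rule assms(2)[OF *(1,4,2,5,3,6,7)])
      moreover have "T \<subseteq> A" "T' \<subseteq> A'" using assms(1) * by blast+
      ultimately show "A = A' & T = T'" using *(7) by blast
    qed
    show "(\<lambda>(A,T). A - T) ` ?R \<subseteq> F2" using card2_face assms(1) by fastforce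
  qed (rule fF2)
  moreover have "card ?R = (\<Sum>A\<in>V. card (sel A) choose 2)"
    using fV fs by (subst card_SigmaI) (auto simp: n_subsets)
  ultimately show ?thesis by simp
qed

end

section \<open>Height functions and the final inequality\<close>

text \<open>\<open>top\<close> and \<open>bot\<close> carry the convexity of the 2-faces: a vertex
  extremal on both of its edges in a 2-face is extremal on that 2-face.\<close>

locale height_diagram = ideal_diagram +
  fixes ht :: "'a set => real"
  assumes ht_inj: "inj_on ht V"
    and top: "A \<in> V ==> x \<in> A ==> y \<in> A ==> x ~= y ==> (!!B. B \<in> V ==> A - {x} \<subseteq> B ==> ht B <= ht A) ==> (!!B. B \<in> V ==> A - {y} \<subseteq> B ==> ht B <= ht A)
       ==> C \<in> V ==> A - {x,y} \<subseteq> C ==> ht C <= ht A"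
    and bot: "A \<in> V ==> x \<in> A ==> y \<in> A ==> x ~= y ==> (!!B. B \<in> V ==> A - {x} \<subseteq> B ==> ht A <= ht B) ==> (!!B. B \<in> V ==> A - {y} \<subseteq> B ==> ht A <= ht B)
       ==> C \<in> V ==> A - {x,y} \<subseteq> C ==> ht A <= ht C"
begin

definition dn where "dn A = {x\<in>A. \<forall>B\<in>V. A - {x} \<subseteq> B --> ht B <= ht A}"
definition up where "up A = {x\<in>A. \<forall>B\<in>V. A - {x} \<subseteq> B --> ht A <= ht B}"

lemma dn_up: assumes "A \<in> V" shows "n <= card (dn A) + card (up A)"
proof -
  have "A \<subseteq> dn A \<union> up A"
  proof
    fix x assume x: "x \<in> A"
    obtain y where y0: "\<forall>C\<in>V. A - {x} \<subseteq> C --> C = A \<or> C = insert y (A - {x})" using nbr2[OF assms x] by (rule exE)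
    have y: "C = A \<or> C = insert y (A - {x})" if "C \<in> V" "A - {x} \<subseteq> C" for C using y0 that by blast
    show "x \<in> dn A \<union> up A"
    proof (cases "ht (insert y (A - {x})) <= ht A")
      case True thus ?thesis using y x unfolding dn_def by force
    next
      case False thus ?thesis using y x unfolding up_def by force
    qed
  qed
  moreover have "finite (dn A \<union> up A)" using V_fin[OF assms] by (auto simp: dn_def up_def)
  ultimately have "card A <= card (dn A \<union> up A)" by (rule card_mono[rotated])
  thus ?thesis using V_card[OF assms] card_Un_le[of "dn A" "up A"] by linarith
qed

lemma dn_count: "(\<Sum>A\<in>V. card (dn A) choose 2) <= card F2"
proof (rule select_count)
  fix A A' T T' assume *: "A \<in> V" "A' \<in> V" "T \<subseteq> dn A" "T' \<subseteq> dn A'" "card T = 2" "card T' = 2" "A - T = A' - T'"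
  have le: "ht C' <= ht C" if C: "C \<in> V" "C' \<in> V" "U \<subseteq> dn C" "card U = 2" "C - U \<subseteq> C'" for C C' U
  proof -
    obtain x y where xy: "U = {x,y}" "x ~= y" using C(4) by (meson card_2_iff)
    thus ?thesis using top[OF C(1), of x y C'] C unfolding dn_def by auto
  qed
  have "ht A' <= ht A" "ht A <= ht A'" using le[OF *(1,2,3,5)] le[OF *(2,1,4,6)] *(7) by blast+
  thus "A = A'" using ht_inj * by (auto simp: inj_on_def)
qed (auto simp: dn_def)

lemma up_count: "(\<Sum>A\<in>V. card (up A) choose 2) <= card F2"
proof (rule select_count)
  fix A A' T T' assume *: "A \<in> V" "A' \<in> V" "T \<subseteq> up A" "T' \<subseteq> up A'" "card T = 2" "card T' = 2" "A - T = A' - T'"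
  have le: "ht C <= ht C'" if C: "C \<in> V" "C' \<in> V" "U \<subseteq> up C" "card U = 2" "C - U \<subseteq> C'" for C C' U
  proof -
    obtain x y where xy: "U = {x,y}" "x ~= y" using C(4) by (meson card_2_iff)
    thus ?thesis using bot[OF C(1), of x y C'] C unfolding up_def by auto
  qed
  have "ht A' <= ht A" "ht A <= ht A'" using le[OF *(1,2,3,5)] le[OF *(2,1,4,6)] *(7) by blast+
  thus "A = A'" using ht_inj * by (auto simp: inj_on_def)
qed (auto simp: up_def)

theorem impossible: False
proof -
  define Ln where "Ln = int n * (int n - 2) + int (n mod 2)"
  have Ln: "Ln <= 4 * (int (card (dn A) choose 2) + int (card (up A) choose 2))" if "A \<in> V" for A
    unfolding Ln_def by (rule choose_pair_bound) (use dn_up[OF that] n9 in auto)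
  have "\<exists>A\<in>V. \<forall>B\<in>V. ht B <= ht A"
  proof -
    have "Max (ht ` V) \<in> ht ` V" using fV V_ne by (intro Max_in) auto
    then obtain A where "A \<in> V" "ht A = Max (ht ` V)" by auto
    thus ?thesis using fV by (intro bexI[of _ A]) auto
  qed
  then obtain A where A: "A \<in> V" "!!B. B \<in> V ==> ht B <= ht A" by blast
  \<comment> \<open>All n edges at the highest vertex descend, which makes the inequality strict
    there. For n = 9 the contradiction rests on this strictness alone.\<close>
  have "dn A = A" using A by (auto simp: dn_def)
  hence "2 * int (card (dn A) choose 2) = int n * (int n - 1)" using int_two_choose[of n] V_card[OF A(1)] n9 by simp
  moreover have "int (n mod 2) <= 1" by simp
  moreover have "int n * 9 <= int n * int n" using n9 by (intro mult_left_mono) auto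
  ultimately have strict: "Ln < 4 * (int (card (dn A) choose 2) + int (card (up A) choose 2))"
    unfolding Ln_def using n9 by (simp add: algebra_simps)
  have "(\<Sum>A\<in>V. Ln) < (\<Sum>A\<in>V. 4 * (int (card (dn A) choose 2) + int (card (up A) choose 2)))"
    by (rule sum_strict_mono_ex1) (use fV Ln strict A in auto)
  also have "\<dots> = 4 * (int (\<Sum>A\<in>V. card (dn A) choose 2) + int (\<Sum>A\<in>V. card (up A) choose 2))"
    by (simp add: sum.distrib sum_distrib_left)
  also have "\<dots> <= 4 * (int (card F2) + int (card F2))" by (intro mult_left_mono add_mono of_nat_mono dn_count up_count) simp
  finally have 1: "int (card V) * Ln < 8 * int (card F2)" by simp
  have 2: "5 * int (card F2) <= int (card V) * int (n choose 2) + int (card Q4)" using incidences by (metis of_nat_add of_nat_le_iff of_nat_mult of_nat_numeral)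
  have c2: "2 * int (n choose 2) = int n * (int n - 1)" using int_two_choose[of n] n9 by simp
  define K where "K = (if n = 9 then 8 else int n)"
  have 3: "2 * int (card Q4) <= K * int (card V)"
  proof -
    have "real_of_int (2 * int (card Q4)) <= real_of_int (K * int (card V))" using quads_bound by (cases "n = 9") (simp_all add: K_def)
    thus ?thesis by linarith
  qed
  have f0: "0 < int (card V)" using fV V_ne by (simp add: card_gt_0_iff)
  have "5 * (int (card V) * Ln) < 40 * int (card F2)" using 1 by linarith
  also have "\<dots> <= 8 * (int (card V) * int (n choose 2)) + 8 * int (card Q4)" using 2 by linarith
  also have "8 * (int (card V) * int (n choose 2)) = 4 * (int (card V) * (int n * (int n - 1)))" unfolding c2[symmetric] by simp
  also have "4 * (int (card V) * (int n * (int n - 1))) + 8 * int (card Q4) <= 4 * (int (card V) * (int n * (int n - 1))) + 4 * (K * int (card V))" using 3 by linarith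
  also have "\<dots> = int (card V) * (4 * (int n * (int n - 1)) + 4 * K)" by (simp add: algebra_simps)
  finally have "int (card V) * (5 * Ln) < int (card V) * (4 * (int n * (int n - 1)) + 4 * K)" by (simp add: mult.left_commute)
  hence lt: "5 * Ln < 4 * (int n * (int n - 1)) + 4 * K" using f0 by (simp add: mult_less_cancel_left_pos)
  show False
  proof (cases "n = 9")
    case True thus False using lt by (simp add: Ln_def K_def)
  next
    case False
    hence "10 * int n <= int n * int n" using n9 by (intro mult_right_mono) auto
    moreover have "0 <= int (n mod 2)" by simp
    ultimately show False using lt False by (simp add: Ln_def K_def algebra_simps)
  qed
qed

end

section \<open>The Lorentzian form\<close>

text \<open>A Klein point \<open>x\<close> lies on the hyperplane with normal \<open>e\<close> when
  \<open>lf e (x,1) = 0\<close>, and on its inner side when the value is negative.\<close>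

definition lf :: "'a::euclidean_space \<times> real => 'a \<times> real => real" where
  "lf u w = fst u \<bullet> fst w - snd u * snd w"

lemma lf_sym: "lf u w = lf w u" by (simp add: lf_def inner_commute mult.commute)

lemma lf_lin [simp]:
  "lf (u + v) w = lf u w + lf v w" "lf w (u + v) = lf w u + lf w v"
  "lf (u - v) w = lf u w - lf v w" "lf w (u - v) = lf w u - lf w v"
  "lf (c *\<^sub>R u) w = c * lf u w" "lf w (c *\<^sub>R u) = c * lf w u" "lf 0 w = 0" "lf w 0 = 0"
  by (simp_all add: lf_def inner_add_left inner_add_right inner_diff_left inner_diff_right algebra_simps)

lemma lf_sum: "lf (sum f A) w = (\<Sum>i\<in>A. lf (f i) w)" "lf w (sum f A) = (\<Sum>i\<in>A. lf w (f i))"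
  by (induction A rule: infinite_finite_induct) simp_all

lemma lf_shift: "lf u (x + t *\<^sub>R w, 1) = lf u (x, 1) + t * (fst u \<bullet> w)"
  by (simp add: lf_def inner_add_right)

text \<open>Cauchy-Schwarz for the space parts, combined with the equation of orthogonality, bounds
  the time part of \<open>w\<close> strictly.\<close>

lemma timelike_perp:
  assumes "lf u u < 0" "lf u w = 0" "w ~= 0" shows "0 < lf w w"
proof -
  obtain p s q t where uw: "u = (p,s)" "w = (q,t)" by (cases u, cases w)
  have 1: "p \<bullet> p < s * s" "p \<bullet> q = s * t" using assms uw by (auto simp: lf_def)
  have s: "0 < s * s" using 1(1) inner_ge_zero[of p] by linarith
  have "q ~= 0" using 1 s assms(3) uw by (auto simp: zero_prod_def)
  hence q: "0 < q \<bullet> q" by simp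
  have "s * s * (t * t) = (p \<bullet> q)\<^sup>2" using 1(2) by (simp add: power2_eq_square)
  also have "\<dots> <= (p \<bullet> p) * (q \<bullet> q)" by (rule Cauchy_Schwarz_ineq)
  also have "\<dots> < s * s * (q \<bullet> q)" using 1(1) q by (rule mult_strict_right_mono)
  finally have "t * t < q \<bullet> q" using s by (simp only: mult_less_cancel_left_pos)
  thus ?thesis using uw by (simp add: lf_def)
qed

lemma timelike_perp_nonneg: "lf u u < 0 ==> lf u w = 0 ==> 0 <= lf w w"
  using timelike_perp[of u w] by (cases "w = 0") auto

text \<open>The component of \<open>w\<close> orthogonal to the timelike vector \<open>u\<close> has
  nonnegative norm.\<close>

lemma reverse_Cauchy_Schwarz:
  assumes "lf u u < 0" shows "lf u u * lf w w <= (lf u w)\<^sup>2"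
proof -
  define y where "y = w - (lf u w / lf u u) *\<^sub>R u"
  have "lf u y = 0" using assms by (simp add: y_def)
  hence "0 <= lf y y" using assms timelike_perp_nonneg by blast
  moreover have "lf y y = lf w w - (lf u w)\<^sup>2 / lf u u"
    using assms by (simp add: y_def lf_sym[of w u] power2_eq_square)
  ultimately have "lf u u * (lf w w - (lf u w)\<^sup>2 / lf u u) <= 0" using assms by (simp add: mult_nonpos_nonneg)
  thus ?thesis using assms by (simp add: right_diff_distrib)
qed

lemma norm_le_1_inner: "norm x <= 1 \<longleftrightarrow> x \<bullet> x <= 1" "norm x < 1 \<longleftrightarrow> x \<bullet> x < 1" "norm x = 1 \<longleftrightarrow> x \<bullet> x = 1"
  by (simp_all add: norm_eq_sqrt_inner)

lemma future:
  assumes "lf u u <= 0" "norm z < 1" "lf u (z,1) < 0" shows "0 < snd u"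
proof (rule ccontr)
  assume "~ 0 < snd u"
  hence s: "snd u <= 0" by simp
  have "(norm (fst u))\<^sup>2 <= (- snd u)\<^sup>2" using assms(1) by (simp add: lf_def power2_norm_eq_inner) (simp add: power2_eq_square)
  hence 1: "norm (fst u) <= - snd u" using s by (simp add: abs_le_square_iff[symmetric])
  have "\<bar>fst u \<bullet> z\<bar> <= norm (fst u) * norm z" by (rule Cauchy_Schwarz_ineq2)
  also have "\<dots> <= norm (fst u)" using assms(2) by (simp add: mult_left_le)
  finally show False using 1 assms(3) by (simp add: lf_def)
qed

lemma strict_midpoint:
  fixes x :: "'a::real_inner"
  assumes "norm x <= 1" "norm y <= 1" "x ~= y" shows "norm ((1/2) *\<^sub>R (x + y)) < 1"
proof -
  have "0 < (x - y) \<bullet> (x - y)" using assms(3) by simp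
  hence "(x + y) \<bullet> (x + y) < 4" using assms(1,2)
    by (simp add: norm_le_1_inner inner_add_left inner_add_right inner_diff_left inner_diff_right inner_commute)
  hence "(1/2) *\<^sub>R (x + y) \<bullet> (1/2) *\<^sub>R (x + y) < 1" by simp
  thus ?thesis unfolding norm_le_1_inner .
qed

text \<open>On the hyperplane orthogonal to an isotropic vector the form is semidefinite: it is the
  Euclidean form of the horospheres at the ideal point \<open>v\<close>.\<close>

lemma sphere_form:
  assumes "norm v = 1" "lf (v,1) u = 0" shows "lf u u = (fst u - snd u *\<^sub>R v) \<bullet> (fst u - snd u *\<^sub>R v)"
proof -
  have "v \<bullet> fst u = snd u" "v \<bullet> v = 1" using assms by (simp_all add: lf_def norm_le_1_inner)
  thus ?thesis by (simp add: lf_def inner_diff_left inner_diff_right inner_commute)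
qed

lemma sphere_zero:
  assumes "norm v = 1" "lf (v,1) u = 0" "lf u u = 0" shows "u = snd u *\<^sub>R (v,1)"
  using sphere_form[OF assms(1,2)] assms(3) by (cases u) auto

lemma bil_lf: "bil (\<lambda>i j. lf (e i) (e j)) T c d = lf (\<Sum>i\<in>T. c i *\<^sub>R e i) (\<Sum>j\<in>T. d j *\<^sub>R e j)"
  unfolding bil_def lf_sum(1) by (simp add: lf_sum(2) sum_distrib_left mult_ac)

lemma row_lf: "(\<Sum>j\<in>T. c j * lf (e i) (e j)) = lf (e i) (\<Sum>j\<in>T. c j *\<^sub>R e j)"
  by (simp add: lf_sum(2))

text \<open>Induction over the nodes; \<open>s\<close> is the Schur complement of the new node, and
  it is positive as the value of the form at \<open>c\<close>.\<close>

lemma pd_solve: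
  fixes g :: "'b => 'b => real"
  assumes gsym: "!!i j. g i j = g j i"
  shows "finite T ==> pd g T ==> \<exists>l. \<forall>i\<in>T. (\<Sum>j\<in>T. l j * g i j) = r i"
proof (induction T arbitrary: r rule: finite_induct)
  case (insert x T)
  have pdT: "pd g T" using pd_subset[OF insert.prems, of T] insert.hyps by auto
  obtain l where l: "\<forall>i\<in>T. (\<Sum>j\<in>T. l j * g i j) = r i" using insert.IH[OF pdT, of r] by (rule exE)
  obtain m where m: "\<forall>i\<in>T. (\<Sum>j\<in>T. m j * g i j) = g i x" using insert.IH[OF pdT, of "\<lambda>i. g i x"] by (rule exE)
  define s where "s = g x x - (\<Sum>j\<in>T. m j * g x j)"
  define c where "c = (\<lambda>j. if j = x then 1 else - m j)"
  have cT: "j \<in> T ==> c j = - m j" for j using insert.hyps by (auto simp: c_def)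
  have row: "(\<Sum>j\<in>insert x T. c j * g i j) = (if i = x then s else 0)" if "i \<in> insert x T" for i
  proof -
    have "(\<Sum>j\<in>insert x T. c j * g i j) = g i x + (\<Sum>j\<in>T. - (m j * g i j))"
      using insert.hyps by (simp add: c_def cong: sum.cong_simp) (intro sum.cong, auto)
    thus ?thesis using m that insert.hyps by (auto simp: s_def sum_negf)
  qed
  have "0 < bil g (insert x T) c c" using insert.prems unfolding pd_def by (rule allE[of _ c]) (auto simp: c_def)
  also have "bil g (insert x T) c c = (\<Sum>i\<in>insert x T. c i * (\<Sum>j\<in>insert x T. c j * g i j))"
    by (simp add: bil_def sum_distrib_left mult.assoc)
  also have "\<dots> = (\<Sum>i\<in>insert x T. c i * (if i = x then s else 0))" by (intro sum.cong) (simp_all add: row)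
  also have "\<dots> = s + (\<Sum>i\<in>T. 0)" using insert.hyps by (simp add: c_def) (intro sum.neutral, auto)
  finally have s: "0 < s" by simp
  define t where "t = (r x - (\<Sum>j\<in>T. l j * g x j)) / s"
  have "(\<Sum>j\<in>insert x T. (if j = x then t else l j - t * m j) * g i j) = r i" if i: "i \<in> insert x T" for i
  proof -
    have "(\<Sum>j\<in>insert x T. (if j = x then t else l j - t * m j) * g i j)
      = t * g i x + (\<Sum>j\<in>T. l j * g i j - t * (m j * g i j))"
      using insert.hyps by simp (intro sum.cong, auto simp: algebra_simps)
    also have "\<dots> = (\<Sum>j\<in>T. l j * g i j) + t * (g i x - (\<Sum>j\<in>T. m j * g i j))"
      by (simp add: sum_subtractf sum_distrib_left right_diff_distrib)
    finally show ?thesis using i l m s by (auto simp: t_def s_def[symmetric])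
  qed
  thus ?case by (intro exI[of _ "\<lambda>j. if j = x then t else l j - t * m j"] ballI)
qed simp

section \<open>The polytope near its ideal vertices\<close>

text \<open>\<open>C\<close> is the closed polytope in the closed Klein ball, \<open>FC\<close> the
  set of its facets, \<open>e\<close> their outer unit normals and \<open>z\<close> an interior
  point. The angle condition \<open>cox\<close> refers to facets that meet inside the open
  ball.\<close>

locale ipoly =
  fixes C :: "'a::euclidean_space set" and FC :: "'a set set" and e :: "'a set => 'a \<times> real" and z :: 'a
  assumes dim9: "9 <= DIM('a)" and finFC: "finite FC"
    and unit: "G \<in> FC ==> lf (e G) (e G) = 1"
    and mem: "G \<in> FC ==> x \<in> G \<longleftrightarrow> x \<in> C & lf (e G) (x,1) = 0"
    and Ceq: "x \<in> C \<longleftrightarrow> (\<forall>G\<in>FC. lf (e G) (x,1) <= 0)"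
    and conv: "convex C" and comp: "compact C" and C_ball: "x \<in> C ==> norm x <= 1"
    and z1: "norm z < 1" and z0: "G \<in> FC ==> lf (e G) (z,1) < 0"
    and ext_norm: "v extreme_point_of C ==> norm v = 1"
    and ext_card: "v extreme_point_of C ==> card {G\<in>FC. v \<in> G} = DIM('a)"
    and cox: "G \<in> FC ==> H \<in> FC ==> G ~= H ==> x \<in> G ==> x \<in> H ==> norm x < 1 ==> \<exists>m::nat. 2 <= m & lf (e G) (e H) = - cos (pi / m)"
    and facet_ball: "G \<in> FC ==> \<exists>x\<in>G. norm x < 1"
begin

definition g where "g G H = lf (e G) (e H)"
definition X where "X = {v. v extreme_point_of C}"
definition Fs where "Fs v = {G\<in>FC. v \<in> G}"
abbreviation a where "a G \<equiv> fst (e G)"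

lemma g_fun: "g = (\<lambda>G H. lf (e G) (e H))" by (simp add: g_def fun_eq_iff)
lemma g_sym: "g G H = g H G" by (simp add: g_def lf_sym)
lemma bil_g: "bil g T c d = lf (\<Sum>i\<in>T. c i *\<^sub>R e i) (\<Sum>j\<in>T. d j *\<^sub>R e j)" unfolding g_fun by (rule bil_lf)
lemma row_g: "(\<Sum>j\<in>T. c j * g i j) = lf (e i) (\<Sum>j\<in>T. c j *\<^sub>R e j)" unfolding g_fun by (rule row_lf)

lemma FsD: "G \<in> Fs v ==> G \<in> FC" "G \<in> Fs v ==> v \<in> G" by (auto simp: Fs_def)
lemma fin_Fs: "finite (Fs v)" using finFC by (simp add: Fs_def)
lemma X_C: "v \<in> X ==> v \<in> C" by (simp add: X_def extreme_point_of_def)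
lemma X_norm: "v \<in> X ==> norm v = 1" using ext_norm by (simp add: X_def)
lemma X_card: "v \<in> X ==> card (Fs v) = DIM('a)" using ext_card by (simp add: X_def Fs_def)
lemma Fs0: "G \<in> Fs v ==> lf (e G) (v,1) = 0" using mem[of G v] by (auto simp: Fs_def)
lemma C_le: "x \<in> C ==> G \<in> FC ==> lf (e G) (x,1) <= 0" using Ceq by blast
lemma sub_C: "G \<in> FC ==> x \<in> G ==> x \<in> C" using mem by blast

lemma facet_face: assumes "G \<in> FC" shows "G face_of C"
proof -
  have 1: "G = C \<inter> {x. a G \<bullet> x = snd (e G)}" using mem[OF assms] by (auto simp: lf_def)
  have "(C \<inter> {x. a G \<bullet> x = snd (e G)}) face_of C"
    by (rule face_of_Int_supporting_hyperplane_le[OF conv]) (use C_le[OF _ assms] in \<open>auto simp: lf_def\<close>)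
  thus ?thesis unfolding 1[symmetric] .
qed

lemma Int_face: assumes "T \<subseteq> FC" shows "\<Inter> (insert C T) face_of C"
  by (rule face_of_Inter) (use assms facet_face face_of_refl[OF conv] in auto)

lemma vertex_in:
  assumes "T \<subseteq> FC" "x \<in> C" "!!G. G \<in> T ==> x \<in> G" shows "\<exists>v\<in>X. T \<subseteq> Fs v"
proof -
  let ?E = "\<Inter> (insert C T)"
  have "compact ?E" "convex ?E" using Int_face[OF assms(1)] conv comp face_of_imp_compact face_of_imp_convex by blast+
  moreover have "?E ~= {}" using assms(2,3) by blast
  ultimately obtain v where v: "v extreme_point_of ?E" by (rule extreme_point_exists_convex)
  hence "v extreme_point_of C" "v \<in> ?E" using extreme_point_of_face[OF Int_face[OF assms(1)]] by blast+
  thus ?thesis using assms(1) by (intro bexI[of _ v]) (auto simp: X_def Fs_def)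
qed

text \<open>Only facets through \<open>x\<close> matter for small t; the inequalities of the others
  are strict and persist.\<close>

lemma push:
  assumes "x \<in> C" "!!G. G \<in> FC ==> x \<in> G ==> a G \<bullet> w <= 0"
  shows "\<forall>\<^sub>F t in at_right 0. x + t *\<^sub>R w \<in> C"
proof -
  have "\<forall>\<^sub>F t in at_right 0. lf (e G) (x,1) + t * (a G \<bullet> w) <= 0" if G: "G \<in> FC" for G
  proof (cases "x \<in> G")
    case True
    hence "lf (e G) (x,1) = 0" using mem[OF G] by blast
    thus ?thesis using assms(2)[OF G True] by (intro eventually_mono[OF eventually_at_right_less[of 0]]) (auto simp: mult_nonneg_nonpos)
  next
    case False
    hence "lf (e G) (x,1) < 0" using mem[OF G] assms(1) C_le[OF assms(1) G] by force
    moreover have "((\<lambda>t. lf (e G) (x,1) + t * (a G \<bullet> w)) \<longlongrightarrow> lf (e G) (x,1) + 0 * (a G \<bullet> w)) (at_right 0)"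
      by (intro tendsto_intros)
    ultimately have "\<forall>\<^sub>F t in at_right 0. lf (e G) (x,1) + t * (a G \<bullet> w) < 0"
      by (intro order_tendstoD) auto
    thus ?thesis by (rule eventually_mono) auto
  qed
  hence "\<forall>\<^sub>F t in at_right 0. \<forall>G\<in>FC. lf (e G) (x,1) + t * (a G \<bullet> w) <= 0"
    using finFC by (simp add: eventually_ball_finite)
  thus ?thesis by (rule eventually_mono) (use Ceq in \<open>auto simp: lf_shift\<close>)
qed

lemma pushE:
  assumes "\<forall>\<^sub>F t in at_right (0::real). P t" shows "\<exists>t>0. P t"
proof -
  have "\<forall>\<^sub>F t in at_right (0::real). 0 < t & P t" using assms eventually_at_right_less[of 0] by eventually_elim auto
  thus ?thesis using eventually_happens'[OF trivial_limit_at_right_real] by fast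
qed

text \<open>A direction parallel to all facets through \<open>v\<close> could be followed both ways
  inside \<open>C\<close>, so \<open>v\<close> would not be extreme.\<close>

lemma kernel:
  assumes v: "v \<in> X" and w: "!!G. G \<in> Fs v ==> a G \<bullet> w = 0" shows "w = 0"
proof (rule ccontr)
  assume w0: "w ~= 0"
  have "\<forall>\<^sub>F t in at_right 0. v + t *\<^sub>R w \<in> C" "\<forall>\<^sub>F t in at_right 0. v + t *\<^sub>R (- w) \<in> C"
    by (rule push; use X_C[OF v] w in \<open>force simp: Fs_def\<close>)+
  hence "\<forall>\<^sub>F t in at_right 0. v + t *\<^sub>R w \<in> C & v + t *\<^sub>R (- w) \<in> C" by (rule eventually_conj)
  from pushE[OF this] obtain t where t: "0 < t" "v + t *\<^sub>R w \<in> C" "v + t *\<^sub>R (- w) \<in> C" by blast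
  have "midpoint (v + t *\<^sub>R w) (v + t *\<^sub>R (- w)) = v"
    by (simp add: midpoint_def scaleR_2[symmetric])
  moreover have "v + t *\<^sub>R w ~= v + t *\<^sub>R (- w)"
  proof -
    have "(v + t *\<^sub>R w) - (v + t *\<^sub>R (- w)) = (2 * t) *\<^sub>R w" by (simp only: mult_2 scaleR_left_distrib scaleR_minus_right) simp
    moreover have "(2 * t) *\<^sub>R w ~= 0" using t w0 by simp
    ultimately show ?thesis by (metis right_minus_eq)
  qed
  ultimately have "v \<in> open_segment (v + t *\<^sub>R w) (v + t *\<^sub>R (- w))"
    by (metis midpoint_in_open_segment)
  thus False using v t by (auto simp: X_def extreme_point_of_def)
qed

text \<open>By \<open>kernel\<close> the normals at \<open>v\<close> span, and there are exactly as
  many as the dimension, so they have a dual basis. With the chosen sign, \<open>d\<close> is the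
  direction of the edge that leaves the facet \<open>G\<close>.\<close>

lemma dual_exists:
  assumes v: "v \<in> X" and G: "G \<in> Fs v"
  shows "\<exists>d. \<forall>H\<in>Fs v. a H \<bullet> d = (if G = H then -1 else 0)"
proof -
  let ?A = "Fs v"
  have sp: "span (a ` ?A) = UNIV"
  proof (rule ccontr)
    assume "span (a ` ?A) ~= UNIV"
    then obtain w where "w ~= 0" "\<forall>x\<in>span (a ` ?A). w \<bullet> x = 0" using span_not_UNIV_orthogonal by blast
    thus False using kernel[OF v, of w] by (auto simp: span_base inner_commute)
  qed
  have le: "card (a ` ?A) <= DIM('a)" using card_image_le[OF fin_Fs, of a v] X_card[OF v] by simp
  have ge: "DIM('a) <= card (a ` ?A)" using dim_le_card[of UNIV "a ` ?A"] sp fin_Fs by simp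
  have inj: "inj_on a ?A" using le ge X_card[OF v] by (intro eq_card_imp_inj_on fin_Fs) simp
  have "independent (a ` ?A)" by (rule card_le_dim_spanning[of _ UNIV]) (use sp fin_Fs le in auto)
  hence "a G ~: span (a ` ?A - {a G})" using G by (auto simp: dependent_def)
  moreover have "a ` ?A - {a G} = a ` (?A - {G})" using inj G by (auto simp: inj_on_def)
  ultimately have "span (a ` (?A - {G})) ~= UNIV" by auto
  then obtain w where w: "w ~= 0" "\<forall>x\<in>span (a ` (?A - {G})). w \<bullet> x = 0" using span_not_UNIV_orthogonal by blast
  have z: "a H \<bullet> w = 0" if "H \<in> ?A" "H ~= G" for H
  proof -
    have "w \<bullet> a H = 0" by (rule bspec[OF w(2)], rule span_base) (use that in blast)
    thus ?thesis by (simp add: inner_commute)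
  qed
  hence ne: "a G \<bullet> w ~= 0" using kernel[OF v, of w] w(1) by metis
  show ?thesis by (rule exI[of _ "(- 1 / (a G \<bullet> w)) *\<^sub>R w"]) (use z ne in auto)
qed

definition dl where "dl v G = (SOME d. \<forall>H\<in>Fs v. a H \<bullet> d = (if G = H then -1 else 0))"

lemma dlD: "v \<in> X ==> G \<in> Fs v ==> H \<in> Fs v ==> a H \<bullet> dl v G = (if G = H then -1 else 0)"
  using someI_ex[OF dual_exists, of v G] unfolding dl_def by blast

lemma dl_ne: "v \<in> X ==> G \<in> Fs v ==> dl v G ~= 0" using dlD[of v G G] by auto

lemma expand:
  assumes v: "v \<in> X" shows "w = (\<Sum>G\<in>Fs v. (- (a G \<bullet> w)) *\<^sub>R dl v G)"
proof -
  have "a H \<bullet> (w - (\<Sum>G\<in>Fs v. (- (a G \<bullet> w)) *\<^sub>R dl v G)) = 0" if H: "H \<in> Fs v" for H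
  proof -
    have "(\<Sum>G\<in>Fs v. - (a G \<bullet> w) * (a H \<bullet> dl v G)) = (\<Sum>G\<in>Fs v. if G = H then a G \<bullet> w else 0)"
      by (rule sum.cong) (use dlD[OF v _ H] in auto)
    thus ?thesis using H fin_Fs by (simp add: inner_diff_right inner_sum_right)
  qed
  from kernel[OF v this] show ?thesis by simp
qed

lemma dual_expand:
  assumes v: "v \<in> X" shows "u = (\<Sum>G\<in>Fs v. (- (u \<bullet> dl v G)) *\<^sub>R a G)"
proof -
  have "u \<bullet> w = (\<Sum>G\<in>Fs v. (- (u \<bullet> dl v G)) *\<^sub>R a G) \<bullet> w" for w
  proof -
    have "u \<bullet> w = u \<bullet> (\<Sum>G\<in>Fs v. (- (a G \<bullet> w)) *\<^sub>R dl v G)" using expand[OF v, of w] by simp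
    thus ?thesis by (simp add: inner_sum_right inner_sum_left mult.commute)
  qed
  thus ?thesis using vector_eq_rdot by blast
qed

lemma push_dl: assumes "v \<in> X" "G \<in> Fs v" shows "\<forall>\<^sub>F t in at_right 0. v + t *\<^sub>R dl v G \<in> C"
  by (rule push[OF X_C[OF assms(1)]]) (use dlD[OF assms] in \<open>auto simp: Fs_def\<close>)

text \<open>The edge leaves a point of the unit sphere into the ball. These numbers will be the
  coefficients of the null vector.\<close>

lemma null_pos: assumes v: "v \<in> X" "G \<in> Fs v" shows "0 < - (v \<bullet> dl v G)"
proof -
  from pushE[OF push_dl[OF assms]] obtain t where t: "0 < t" "v + t *\<^sub>R dl v G \<in> C" by blast
  have "(v + t *\<^sub>R dl v G) \<bullet> (v + t *\<^sub>R dl v G) <= 1" "v \<bullet> v = 1"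
    using C_ball[OF t(2)] X_norm[OF v(1)] by (simp_all add: norm_le_1_inner)
  hence "2 * t * (v \<bullet> dl v G) + t * t * (dl v G \<bullet> dl v G) <= 0"
    by (simp add: inner_add_left inner_add_right inner_commute algebra_simps)
  moreover have "0 < t * t * (dl v G \<bullet> dl v G)" using t dl_ne[OF v] by simp
  ultimately have "2 * t * (v \<bullet> dl v G) < 0" by linarith
  thus ?thesis using t(1) by (simp add: mult_less_0_iff)
qed

text \<open>The isotropic vector \<open>(v,1)\<close> itself, expanded in the normals at
  \<open>v\<close>, is the null vector of the diagram.\<close>

lemma null_sum: assumes v: "v \<in> X" shows "(\<Sum>G\<in>Fs v. (- (v \<bullet> dl v G)) *\<^sub>R e G) = (v,1)"
proof (rule prod_eqI)
  have 1: "(\<Sum>G\<in>Fs v. (- (v \<bullet> dl v G)) *\<^sub>R a G) = v" using dual_expand[OF v, of v] by simp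
  thus "fst (\<Sum>G\<in>Fs v. (- (v \<bullet> dl v G)) *\<^sub>R e G) = fst (v, 1::real)" by (simp add: fst_sum)
  have "(\<Sum>G\<in>Fs v. - (v \<bullet> dl v G) * snd (e G)) = (\<Sum>G\<in>Fs v. - (v \<bullet> dl v G) * (a G \<bullet> v))"
    by (rule sum.cong) (use Fs0 in \<open>force simp: lf_def\<close>)+
  also have "\<dots> = (\<Sum>G\<in>Fs v. (- (v \<bullet> dl v G)) *\<^sub>R a G) \<bullet> v" by (simp add: inner_sum_left)
  also have "\<dots> = 1" using 1 X_norm[OF v] by (simp add: norm_le_1_inner)
  finally show "snd (\<Sum>G\<in>Fs v. (- (v \<bullet> dl v G)) *\<^sub>R e G) = snd (v, 1)" by (simp add: snd_sum)
qed

lemma ax_null: assumes v: "v \<in> X"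
  shows "\<exists>m. (\<forall>i\<in>Fs v. 0 < m i) & (\<forall>i\<in>Fs v. (\<Sum>j\<in>Fs v. m j * g i j) = 0)"
proof (rule exI, intro conjI ballI)
  fix i assume i: "i \<in> Fs v"
  show "0 < - (v \<bullet> dl v i)" by (rule null_pos[OF v i])
  show "(\<Sum>j\<in>Fs v. - (v \<bullet> dl v j) * g i j) = 0" unfolding row_g null_sum[OF v] by (rule Fs0[OF i])
qed

lemma perp_v: assumes "T \<subseteq> Fs v" shows "lf (v,1) (\<Sum>i\<in>T. c i *\<^sub>R e i) = 0"
  using assms Fs0 by (simp add: lf_sum(2) lf_sym[of "(v,1)"] subset_iff)

lemma vertex_psd:
  assumes "v \<in> X" "T \<subseteq> Fs v" shows "0 <= bil g T c c"
  using sphere_form[OF X_norm[OF assms(1)] perp_v[OF assms(2), of c]] by (simp add: bil_g)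

lemma vertex_psd0:
  assumes "v \<in> X" "T \<subseteq> Fs v" "bil g T c c = 0" shows "\<exists>s. (\<Sum>i\<in>T. c i *\<^sub>R e i) = s *\<^sub>R (v,1)"
  using sphere_zero[OF X_norm[OF assms(1)] perp_v[OF assms(2), of c]] assms(3) by (auto simp: bil_g)

lemma ax_psd0:
  assumes "v \<in> X" "bil g (Fs v) c c = 0" "i \<in> Fs v" shows "(\<Sum>j\<in>Fs v. c j * g i j) = 0"
proof -
  obtain s where "(\<Sum>i\<in>Fs v. c i *\<^sub>R e i) = s *\<^sub>R (v,1)" using vertex_psd0[OF assms(1) subset_refl assms(2)] by (rule exE)
  thus ?thesis unfolding row_g by (simp only: lf_lin Fs0[OF assms(3)] mult_zero_right)
qed

text \<open>An isotropic combination of normals at \<open>v\<close> is a multiple of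
  \<open>(v,1)\<close>, whose expansion has no zero coefficient, while \<open>T\<close> omits a
  facet.\<close>

lemma ax_pdp: assumes v: "v \<in> X" and T: "T \<subset> Fs v" shows "pd g T"
  unfolding pd_def
proof (intro allI impI)
  fix c :: "'a set => real" assume c: "\<exists>i\<in>T. c i ~= 0"
  have T': "T \<subseteq> Fs v" "finite T" using T fin_Fs finite_subset by blast+
  show "0 < bil g T c c"
  proof (rule ccontr)
    assume "~ 0 < bil g T c c"
    hence "bil g T c c = 0" using vertex_psd[OF v T'(1), of c] by simp
    then obtain s where s: "(\<Sum>i\<in>T. c i *\<^sub>R e i) = s *\<^sub>R (v,1)" using vertex_psd0[OF v T'(1)] by blast
    hence "fst (\<Sum>i\<in>T. c i *\<^sub>R e i) = s *\<^sub>R v" by simp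
    hence f: "(\<Sum>i\<in>T. c i *\<^sub>R a i) = s *\<^sub>R v" by (simp add: fst_sum)
    have d: "(if H \<in> T then - c H else 0) = s * (v \<bullet> dl v H)" if H: "H \<in> Fs v" for H
    proof -
      have "s * (v \<bullet> dl v H) = (\<Sum>i\<in>T. c i *\<^sub>R a i) \<bullet> dl v H" using f by simp
      also have "\<dots> = (\<Sum>i\<in>T. if i = H then - c i else 0)" unfolding inner_sum_left
      proof (rule sum.cong[OF refl])
        fix i assume "i \<in> T"
        hence i: "i \<in> Fs v" using T' by blast
        show "c i *\<^sub>R a i \<bullet> dl v H = (if i = H then - c i else 0)" using dlD[OF v H i] by (cases "i = H") simp_all
      qed
      finally show ?thesis using T'(2) by simp
    qed
    obtain H where H: "H \<in> Fs v" "H ~: T" using T by blast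
    have "s = 0" using d[OF H(1)] H null_pos[OF v H(1)] by simp
    thus False using c d T' by force
  qed
qed

lemma Fs_inj: assumes "u \<in> X" "v \<in> X" "Fs u = Fs v" shows "u = v"
proof -
  have "a G \<bullet> (u - v) = 0" if "G \<in> Fs v" for G
    using Fs0[of G u] Fs0[of G v] that assms(3) by (simp add: lf_def inner_diff_right)
  from kernel[OF assms(2) this] show ?thesis by simp
qed

lemma fin_X: "finite X"
proof -
  have "inj_on Fs X" using Fs_inj by (auto simp: inj_on_def)
  moreover have "Fs ` X \<subseteq> Pow FC" using FsD by blast
  ultimately show ?thesis using finFC by (meson finite_Pow_iff finite_imageD finite_subset)
qed

lemma sphere_extreme: assumes "x \<in> C" "norm x = 1" shows "x \<in> X"
  unfolding X_def extreme_point_of_def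
proof (intro CollectI conjI ballI notI)
  fix p q assume pq: "p \<in> C" "q \<in> C" "x \<in> open_segment p q"
  have "dist 0 x < dist 0 p \<or> dist 0 x < dist 0 q" using dist_decreases_open_segment[OF pq(3), of 0] by blast
  thus False using C_ball[OF pq(1)] C_ball[OF pq(2)] assms(2) by auto
qed (fact assms)

lemma on_edge:
  assumes v: "v \<in> X" "G \<in> Fs v" and x: "x \<in> C" "!!H. H \<in> Fs v - {G} ==> x \<in> H"
  shows "\<exists>t\<ge>0. x = v + t *\<^sub>R dl v G"
proof -
  have z: "- (a H \<bullet> (x - v)) *\<^sub>R dl v H = 0" if "H \<in> Fs v - {G}" for H
    using Fs0[of H v] x(2)[OF that] mem[of H x] that FsD[of H v] by (simp add: lf_def inner_diff_right)
  have "x - v = (\<Sum>H\<in>Fs v. (- (a H \<bullet> (x - v))) *\<^sub>R dl v H)" by (rule expand[OF v(1)])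
  also have "\<dots> = (- (a G \<bullet> (x - v))) *\<^sub>R dl v G"
  proof -
    have "(\<Sum>H\<in>Fs v - {G}. (- (a H \<bullet> (x - v))) *\<^sub>R dl v H) = 0" by (rule sum.neutral, rule ballI, rule z)
    thus ?thesis using sum.remove[OF fin_Fs v(2), of "\<lambda>H. (- (a H \<bullet> (x - v))) *\<^sub>R dl v H"] by (simp only: add_0_right)
  qed
  finally have "x = v + (- (a G \<bullet> (x - v))) *\<^sub>R dl v G" by (simp add: algebra_simps)
  moreover have "0 <= - (a G \<bullet> (x - v))" using Fs0[OF v(2)] C_le[OF x(1) FsD(1)[OF v(2)]] by (simp add: lf_def inner_diff_right)
  ultimately show ?thesis by blast
qed

text \<open>Ideality makes edges into chords: a line through \<open>v\<close> meets the sphere in at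
  most one further point.\<close>

lemma edge_unique:
  assumes v: "v \<in> X" and u: "norm (v + s *\<^sub>R d) = 1" "norm (v + t *\<^sub>R d) = 1" "0 < s" "0 < t" and d: "d ~= 0" shows "s = t"
proof -
  have *: "r * (2 * (v \<bullet> d) + r * (d \<bullet> d)) = 0" if "norm (v + r *\<^sub>R d) = 1" for r
    using that X_norm[OF v] by (simp add: norm_le_1_inner inner_add_left inner_add_right inner_commute algebra_simps)
  have "2 * (v \<bullet> d) + s * (d \<bullet> d) = 0" "2 * (v \<bullet> d) + t * (d \<bullet> d) = 0" using *[OF u(1)] *[OF u(2)] u(3,4) by simp_all
  hence "s * (d \<bullet> d) = t * (d \<bullet> d)" by linarith
  thus ?thesis using d by simp
qed

text \<open>The face cut out by the other facets through \<open>v\<close> is more than a point, so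
  by Krein-Milman it has a second extreme point, which is a vertex of \<open>C\<close>.\<close>

lemma edge:
  assumes v: "v \<in> X" "G \<in> Fs v"
  shows "\<exists>u\<in>X. \<exists>t>0. u = v + t *\<^sub>R dl v G & Fs v - {G} \<subseteq> Fs u"
proof -
  let ?E = "\<Inter> (insert C (Fs v - {G}))"
  have F: "?E face_of C" by (rule Int_face) (use FsD in blast)
  have cc: "compact ?E" "convex ?E" using F conv comp face_of_imp_compact face_of_imp_convex by blast+
  from pushE[OF push_dl[OF v]] obtain t where t: "0 < t" "v + t *\<^sub>R dl v G \<in> C" by blast
  have tE: "v + t *\<^sub>R dl v G \<in> ?E"
  proof -
    have "v + t *\<^sub>R dl v G \<in> H" if "H \<in> Fs v - {G}" for H
      using mem[of H "v + t *\<^sub>R dl v G"] that FsD(1)[of H v] t(2) dlD[OF v, of H] Fs0[of H v] by (auto simp: lf_shift)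
    thus ?thesis using t by blast
  qed
  have "~ {u. u extreme_point_of ?E} \<subseteq> {v}"
  proof
    assume "{u. u extreme_point_of ?E} \<subseteq> {v}"
    from hull_mono[OF this] have "convex hull {u. u extreme_point_of ?E} \<subseteq> convex hull {v}" .
    from subset_trans[OF equalityD1[OF Krein_Milman_Minkowski[OF cc]] this] have "?E \<subseteq> {v}" by (simp only: convex_hull_singleton)
    thus False using tE t(1) dl_ne[OF v] by auto
  qed
  then obtain u where u: "u extreme_point_of ?E" "u ~= v" by blast
  have "u extreme_point_of C" "u \<in> ?E" using u(1) extreme_point_of_face[OF F] by blast+
  hence uX: "u \<in> X" "u \<in> C" "!!H. H \<in> Fs v - {G} ==> u \<in> H" by (auto simp: X_def)
  obtain r where r: "0 <= r" "u = v + r *\<^sub>R dl v G" using on_edge[OF v uX(2,3)] by blast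
  have "0 < r" using r u(2) by (cases "r = 0") auto
  moreover have "Fs v - {G} \<subseteq> Fs u" using uX(3) unfolding Fs_def by blast
  ultimately show ?thesis using r uX(1) by blast
qed

lemma ax_nbr:
  assumes v: "v \<in> X" and G: "G \<in> Fs v"
  shows "\<exists>y. y \<in> FC - Fs v & {A'\<in>Fs ` X. Fs v - {G} \<subseteq> A'} = {Fs v, insert y (Fs v - {G})}"
proof -
  obtain u t where u: "u \<in> X" "0 < t" "u = v + t *\<^sub>R dl v G" "Fs v - {G} \<subseteq> Fs u" using edge[OF assms] by blast
  have "u ~= v" using u dl_ne[OF assms] by auto
  hence ne: "Fs u ~= Fs v" using Fs_inj u v by blast
  have cA: "card (Fs u) = card (Fs v)" "card (Fs v - {G}) = card (Fs v) - 1" "0 < card (Fs v)"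
    using X_card u v G fin_Fs by (auto simp: card_gt_0_iff)
  have "card (Fs u - (Fs v - {G})) = 1" using card_Diff_subset[OF _ u(4)] fin_Fs cA by simp
  then obtain y where y: "Fs u - (Fs v - {G}) = {y}" by (meson card_1_singletonE)
  hence Fu: "Fs u = insert y (Fs v - {G})" using u(4) by blast
  have yv: "y ~: Fs v"
  proof
    assume "y \<in> Fs v"
    hence "y = G" using y by blast
    thus False using Fu ne G by (simp add: insert_absorb)
  qed
  have "Fs w = Fs v \<or> Fs w = Fs u" if w: "w \<in> X" "Fs v - {G} \<subseteq> Fs w" for w
  proof -
    obtain r where r: "0 <= r" "w = v + r *\<^sub>R dl v G"
      using on_edge[OF assms X_C[OF w(1)]] w(2) FsD(2) by blast
    show ?thesis
    proof (cases "r = 0")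
      case False
      have "r = t" by (rule edge_unique[OF v _ _ _ _ dl_ne[OF assms]]) (use r u False X_norm w in auto)
      thus ?thesis using r u by simp
    qed (use r in simp)
  qed
  hence "{A'\<in>Fs ` X. Fs v - {G} \<subseteq> A'} = {Fs v, Fs u}" using v u by blast
  moreover have "y \<in> FC - Fs v" using yv y FsD(1) by blast
  ultimately show ?thesis using Fu by auto
qed

text \<open>\<open>w - v\<close> is a nonnegative combination of the edge directions at
  \<open>v\<close>. On the 2-face only the directions leaving \<open>x\<close> and \<open>y\<close>
  have nonzero coefficients, and neither increases \<open>c\<close>.\<close>

lemma top_gen:
  assumes v: "v \<in> X" and xy: "x \<in> Fs v" "y \<in> Fs v" "x ~= y"
    and hx: "!!u. u \<in> X ==> Fs v - {x} \<subseteq> Fs u ==> c \<bullet> u <= c \<bullet> v"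
    and hy: "!!u. u \<in> X ==> Fs v - {y} \<subseteq> Fs u ==> c \<bullet> u <= c \<bullet> v"
    and w: "w \<in> X" "Fs v - {x,y} \<subseteq> Fs w"
  shows "c \<bullet> w <= c \<bullet> v"
proof -
  have dn: "c \<bullet> dl v G <= 0" if G: "G \<in> Fs v" "!!u. u \<in> X ==> Fs v - {G} \<subseteq> Fs u ==> c \<bullet> u <= c \<bullet> v" for G
  proof -
    obtain u t where u: "u \<in> X" "0 < t" "u = v + t *\<^sub>R dl v G" "Fs v - {G} \<subseteq> Fs u" using edge[OF v G(1)] by blast
    have "t * (c \<bullet> dl v G) <= 0" using G(2)[OF u(1,4)] u(3) by (simp add: inner_add_right)
    thus ?thesis using u(2) by (simp add: mult_le_0_iff)
  qed
  have "c \<bullet> (w - v) = c \<bullet> (\<Sum>H\<in>Fs v. (- (a H \<bullet> (w - v))) *\<^sub>R dl v H)" using expand[OF v, of "w - v"] by simp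
  also have "\<dots> = (\<Sum>H\<in>Fs v. - (a H \<bullet> (w - v)) * (c \<bullet> dl v H))" by (simp add: inner_sum_right)
  also have "\<dots> <= 0"
  proof (rule sum_nonpos)
    fix H assume H: "H \<in> Fs v"
    have le: "0 <= - (a H \<bullet> (w - v))" using Fs0[OF H] C_le[OF X_C[OF w(1)] FsD(1)[OF H]] by (simp add: lf_def inner_diff_right)
    show "- (a H \<bullet> (w - v)) * (c \<bullet> dl v H) <= 0"
    proof (cases "H = x \<or> H = y")
      case True
      hence "c \<bullet> dl v H <= 0" using dn[OF xy(1) hx] dn[OF xy(2) hy] by blast
      thus ?thesis using le mult_nonneg_nonpos by blast
    next
      case False
      hence "H \<in> Fs w" using w(2) H by blast
      hence "a H \<bullet> (w - v) = 0" using Fs0[OF H] Fs0[of H w] by (simp add: lf_def inner_diff_right)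
      thus ?thesis by simp
    qed
  qed
  finally show ?thesis by (simp add: inner_diff_right)
qed

text \<open>The directions on which two vertices agree fill finitely many hyperplanes, a negligible
  set.\<close>

lemma generic: "\<exists>c::'a. inj_on (\<lambda>v. c \<bullet> v) X"
proof -
  let ?D = "{(u,v) \<in> X \<times> X. u ~= v}"
  have "finite ?D" by (rule finite_subset[of _ "X \<times> X"]) (use fin_X in auto)
  hence "negligible (\<Union>p\<in>?D. {c. (fst p - snd p) \<bullet> c = 0})"
    by (intro negligible_Union finite_imageI) (auto intro: negligible_hyperplane)
  hence "(\<Union>p\<in>?D. {c. (fst p - snd p) \<bullet> c = 0}) ~= UNIV" by (metis non_negligible_UNIV)
  then obtain c where "c ~: (\<Union>p\<in>?D. {c. (fst p - snd p) \<bullet> c = 0})" by blast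
  hence "\<forall>u\<in>X. \<forall>v\<in>X. u ~= v --> (u - v) \<bullet> c ~= 0" by auto
  hence "x = y" if "x \<in> X" "y \<in> X" "c \<bullet> x = c \<bullet> y" for x y
    using that inner_diff_left[of x y c] inner_commute[of c x] inner_commute[of c y] by (metis right_minus_eq)
  hence "inj_on (\<lambda>v. c \<bullet> v) X" by (rule inj_onI)
  thus ?thesis by blast
qed

end

section \<open>Disjoint facets; elliptic and parabolic sets of facets\<close>

context ipoly begin

text \<open>The edge at \<open>v\<close> that leaves a third facet \<open>K\<close> stays in both
  facets, and the midpoint of two distinct points of the closed ball is in the open ball. So facets
  meeting at an ideal vertex have a dihedral angle.\<close>

lemma meet_ball:
  assumes G: "G \<in> FC" "H \<in> FC" and v: "v \<in> X" "v \<in> G" "v \<in> H" shows "\<exists>x. x \<in> G & x \<in> H & norm x < 1"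
proof -
  have "card {G,H} < card (Fs v)" using X_card[OF v(1)] dim9 card_insert_le_m1[of 2 "{H}" G] by simp
  hence "~ Fs v \<subseteq> {G,H}" using card_mono[of "{G,H}" "Fs v"] by auto
  then obtain K where K: "K \<in> Fs v" "K ~= G" "K ~= H" by blast
  from pushE[OF push_dl[OF v(1) K(1)]] obtain t where t: "0 < t" "v + t *\<^sub>R dl v K \<in> C" by blast
  let ?y = "v + t *\<^sub>R dl v K" and ?x = "(1/2) *\<^sub>R (v + (v + t *\<^sub>R dl v K))"
  have yv: "v ~= ?y" using t(1) dl_ne[OF v(1) K(1)] by simp
  have n: "norm ?x < 1" by (rule strict_midpoint) (use C_ball X_C v t yv in auto)
  have xe: "?x = v + (t/2) *\<^sub>R dl v K" by (simp add: scaleR_right_distrib flip: scaleR_left_distrib)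
  have l: "lf (e H') (?x,1) = lf (e H') (v,1) + (t/2) * (a H' \<bullet> dl v K)" for H' unfolding xe by (rule lf_shift)
  have C: "?x \<in> C" using convexD_alt[OF conv X_C[OF v(1)] t(2), of "1/2"] by (simp add: scaleR_right_distrib)
  have mx: "?x \<in> H'" if "H' \<in> Fs v" "H' ~= K" for H'
    using mem[OF FsD(1)[OF that(1)], of ?x] C l[of H'] Fs0[OF that(1)] dlD[OF v(1) K(1) that(1)] that(2) by simp
  have GH: "G \<in> Fs v" "H \<in> Fs v" using G v by (simp_all add: Fs_def)
  have xG: "?x \<in> G" by (rule mx[OF GH(1) K(2)[THEN not_sym]])
  have xH: "?x \<in> H" by (rule mx[OF GH(2) K(3)[THEN not_sym]])
  show ?thesis by (rule exI[of _ ?x]) (rule conjI[OF xG conjI[OF xH n]])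
qed

lemma cos_label_bounds: assumes "2 <= (m::nat)" shows "0 <= cos (pi / m)" "cos (pi / m) < 1"
  using cos_label[OF assms] rt_bounds by auto

lemma meet_le0:
  assumes "G \<in> FC" "H \<in> FC" "G ~= H" "x \<in> G" "x \<in> H" "norm x < 1" shows "g G H <= 0" "-1 < g G H"
proof -
  have "\<exists>m::nat. (2::nat) <= m & lf (e G) (e H) = - cos (pi / real m)" using cox[OF assms] by simp
  then obtain m :: nat where m0: "(2::nat) <= m & lf (e G) (e H) = - cos (pi / real m)" by (rule exE)
  note m = conjunct1[OF m0] conjunct2[OF m0]
  show "g G H <= 0" "-1 < g G H" using cos_label_bounds[OF m(1)] m(2) by (simp_all add: g_def)
qed

text \<open>For disjoint facets, the points realising the hyperbolic distance satisfy the following first-order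
  condition; the argument uses that all angles along a facet are non-obtuse.\<close>
lemma extremal:
  assumes i: "i \<in> FC" and p: "p \<in> i" "norm p < 1" and q: "q \<in> C" "norm q < 1"
    and max: "!!y. y \<in> i ==> lf (y,1) (y,1) * lf (q,1) (q,1) * (lf (p,1) (q,1))\<^sup>2 <= lf (p,1) (p,1) * lf (q,1) (q,1) * (lf (y,1) (q,1))\<^sup>2"
  shows "(q,1) = (lf (p,1) (q,1) / lf (p,1) (p,1)) *\<^sub>R (p,1) + lf (q,1) (e i) *\<^sub>R e i"
proof -
  define b P Q where "b = lf (p,1) (q,1)" and "P = lf (p,1) (p,1)" and "Q = lf (q,1) (q,1)"
  have P: "P < 0" and Q: "Q < 0" using p q by (simp_all add: P_def Q_def lf_def norm_le_1_inner)
  have pq: "norm p * norm q < 1" using p(2) q(2) norm_ge_zero[of p] norm_ge_zero[of q]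
    by (metis dual_order.strict_trans2 mult.right_neutral mult_left_mono less_eq_real_def)
  have b: "b < 0" using norm_cauchy_schwarz[of p q] pq by (simp add: b_def lf_def)
  have pC: "p \<in> C" and pi0: "lf (e i) (p,1) = 0" using mem[OF i] p by blast+
  define n1 :: "'a \<times> real" where "n1 = (q,1) - (b / P) *\<^sub>R (p,1)"
  define n2 :: "'a \<times> real" where "n2 = n1 - lf (q,1) (e i) *\<^sub>R e i"
  have n1p: "lf (p,1) n1 = 0"
  proof -
    have "lf (p,1) n1 = b - (b / P) * P" unfolding n1_def b_def P_def by (simp only: lf_lin)
    thus ?thesis using P by simp
  qed
  have n1i: "lf (e i) n1 = lf (q,1) (e i)"
  proof -
    have "lf (e i) n1 = lf (e i) (q,1) - (b / P) * lf (e i) (p,1)" unfolding n1_def by (simp only: lf_lin)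
    thus ?thesis using pi0 lf_sym[of "e i" "(q,1)"] by simp
  qed
  have n2p: "lf (p,1) n2 = 0"
  proof -
    have "lf (p,1) n2 = lf (p,1) n1 - lf (q,1) (e i) * lf (p,1) (e i)" unfolding n2_def by (simp only: lf_lin)
    thus ?thesis using pi0 n1p lf_sym[of "(p,1)" "e i"] by simp
  qed
  have n2i: "lf (e i) n2 = 0"
  proof -
    have "lf (e i) n2 = lf (e i) n1 - lf (q,1) (e i) * lf (e i) (e i)" unfolding n2_def by (simp only: lf_lin)
    thus ?thesis using n1i unit[OF i] by simp
  qed
  define S where "S = lf n2 n2"
  have n2n1: "lf n2 n1 = S"
  proof -
    have "n1 = n2 + lf (q,1) (e i) *\<^sub>R e i" by (simp add: n2_def)
    hence "lf n2 n1 = lf n2 (n2 + lf (q,1) (e i) *\<^sub>R e i)" by (rule arg_cong)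
    also have "\<dots> = S + lf (q,1) (e i) * lf n2 (e i)" unfolding S_def by (simp only: lf_lin)
    finally show ?thesis using n2i lf_sym[of n2 "e i"] by simp
  qed
  have n2q: "lf n2 (q,1) = S"
  proof -
    have "lf n2 n1 = lf n2 (q,1) - (b / P) * lf n2 (p,1)" unfolding n1_def by (simp only: lf_lin)
    thus ?thesis using n2n1 n2p lf_sym[of n2 "(p,1)"] by simp
  qed
  have S0: "0 <= S" using timelike_perp_nonneg[OF _ n2p] P by (simp add: S_def P_def)
  define nu where "nu = snd n2"
  \<comment> \<open>A multiple of \<open>(p,1)\<close> is subtracted to make the last coordinate 0,
    which turns \<open>n2\<close> into a displacement of the Klein point \<open>p\<close>.\<close>
  define w where "w = fst n2 - nu *\<^sub>R p"
  have w1: "(w,0) = n2 - nu *\<^sub>R (p,1)" by (simp add: w_def nu_def prod_eq_iff)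
  have aw: "a k \<bullet> w = lf (e k) n2 - nu * lf (e k) (p,1)" for k
  proof -
    have "a k \<bullet> w = lf (e k) (w,0)" by (simp add: lf_def)
    also have "\<dots> = lf (e k) n2 - nu * lf (e k) (p,1)" unfolding w1 by (simp only: lf_lin)
    finally show ?thesis .
  qed
  have "n2 = 0"
  proof (rule ccontr)
    assume n20: "n2 ~= 0"
    have S: "0 < S" using timelike_perp[OF _ n2p n20] P by (simp add: S_def P_def)
    have "\<forall>\<^sub>F t in at_right 0. p + t *\<^sub>R w \<in> C"
    proof (rule push[OF pC])
      fix k assume k: "k \<in> FC" "p \<in> k"
      have kp: "lf (e k) (p,1) = 0" using mem[OF k(1)] k(2) by blast
      show "a k \<bullet> w <= 0"
      proof (cases "k = i")
        case True thus ?thesis using n2i kp aw by simp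
      next
        case False
        \<comment> \<open>Non-obtuseness along \<open>i\<close> ensures that the displacement does
          not cross the other facets through \<open>p\<close>.\<close>
        have "g i k <= 0" using meet_le0(1)[OF i k(1) _ p(1) k(2) p(2)] False by blast
        hence "0 <= lf (q,1) (e i) * lf (e k) (e i)" using C_le[OF q(1) i]
          by (simp add: g_def lf_sym[of "(q,1)"] lf_sym[of "e k" "e i"] mult_nonpos_nonpos)
        moreover have "lf (e k) n2 = lf (e k) (q,1) - lf (q,1) (e i) * lf (e k) (e i)" unfolding n2_def n1_def by (simp only: lf_lin kp mult_zero_right diff_zero)
        ultimately show ?thesis using C_le[OF q(1) k(1)] aw[of k] kp by simp
      qed
    qed
    moreover have "\<forall>\<^sub>F t in at_right 0. 2 * P * (1 - t * nu) * b + P * t * S - t * b\<^sup>2 > 0"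
    proof (rule order_tendstoD(1))
      show "((\<lambda>t. 2 * P * (1 - t * nu) * b + P * t * S - t * b\<^sup>2) \<longlongrightarrow> 2 * P * (1 - 0 * nu) * b + P * 0 * S - 0 * b\<^sup>2) (at_right 0)"
        by (intro tendsto_intros)
      show "0 < 2 * P * (1 - 0 * nu) * b + P * 0 * S - 0 * b\<^sup>2" using P b by (simp add: mult_neg_neg)
    qed
    ultimately have "\<forall>\<^sub>F t in at_right 0. p + t *\<^sub>R w \<in> C & 2 * P * (1 - t * nu) * b + P * t * S - t * b\<^sup>2 > 0" by (rule eventually_conj)
    from pushE[OF this] obtain t where t: "0 < t" "p + t *\<^sub>R w \<in> C" "2 * P * (1 - t * nu) * b + P * t * S - t * b\<^sup>2 > 0" by blast
    define s where "s = 1 - t * nu"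
    have y: "(p + t *\<^sub>R w, 1) = s *\<^sub>R (p,1) + t *\<^sub>R n2"
      by (simp add: prod_eq_iff w_def s_def nu_def algebra_simps)
    have yi: "p + t *\<^sub>R w \<in> i" using mem[OF i, of "p + t *\<^sub>R w"] t(2) by (simp add: lf_shift pi0 aw n2i)
    have yy: "lf (p + t *\<^sub>R w, 1) (p + t *\<^sub>R w, 1) = s * s * P + t * t * S"
      unfolding y lf_lin using n2p lf_sym[of n2 "(p,1)"] by (simp add: P_def S_def algebra_simps)
    have yq: "lf (p + t *\<^sub>R w, 1) (q,1) = s * b + t * S" unfolding y lf_lin by (simp add: n2q b_def)
    have "(s * s * P + t * t * S) * Q * b\<^sup>2 <= P * Q * (s * b + t * S)\<^sup>2"
      using max[OF yi] unfolding yy yq P_def[symmetric] Q_def[symmetric] b_def[symmetric] .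
    hence "Q * ((s * s * P + t * t * S) * b\<^sup>2 - P * (s * b + t * S)\<^sup>2) <= 0" by (simp add: algebra_simps)
    hence "0 <= (s * s * P + t * t * S) * b\<^sup>2 - P * (s * b + t * S)\<^sup>2" using Q by (simp add: mult_le_0_iff)
    also have "\<dots> = t * S * (t * b\<^sup>2 - 2 * P * s * b - P * t * S)" by (simp add: algebra_simps power2_eq_square)
    finally have fin: "0 <= t * S * (t * b\<^sup>2 - 2 * P * s * b - P * t * S)" .
    have "0 <= t * b\<^sup>2 - 2 * P * s * b - P * t * S"
    proof (rule ccontr)
      assume "~ ?thesis"
      hence "t * S * (t * b\<^sup>2 - 2 * P * s * b - P * t * S) < 0" by (intro mult_pos_neg[OF mult_pos_pos[OF t(1) S]]) simp
      thus False using fin by linarith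
    qed
    thus False using t(3) s_def by simp
  qed
  hence "n1 = lf (q,1) (e i) *\<^sub>R e i" unfolding n2_def by (rule right_minus_eq[THEN iffD1])
  hence "(q,1) = lf (q,1) (e i) *\<^sub>R e i + (b / P) *\<^sub>R (p,1)" unfolding n1_def by (simp only: diff_eq_eq)
  thus ?thesis unfolding b_def P_def by (simp only: add.commute)
qed

lemma frac_cross: "0 < (B::real) ==> 0 < B' ==> A / B <= A' / B' ==> A * B' <= A' * B"
  by (simp add: field_simps)

text \<open>\<open>f\<close> is 1 / cosh^2 of the hyperbolic distance and vanishes when a point is
  ideal; it is continuous because disjoint facets have no common ideal point. At a maximum both
  normals lie in the plane of \<open>(p,1)\<close> and \<open>(q,1)\<close>, where they satisfy (g i
  j)^2 = b^2 / (P Q) > 1.\<close>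

lemma disjoint_lt:
  assumes ij: "i \<in> FC" "j \<in> FC" "i \<inter> j = {}" shows "g i j < -1"
proof -
  define f where "f = (\<lambda>y::'a \<times> 'a. lf (fst y,1) (fst y,1) * lf (snd y,1) (snd y,1) / (lf (fst y,1) (snd y,1))\<^sup>2)"
  have neg: "lf (p,1) (q,1) < 0" if "p \<in> i" "q \<in> j" for p q
  proof -
    have "p ~= q" using that ij(3) by blast
    hence "0 < (p - q) \<bullet> (p - q)" by simp
    moreover have "p \<bullet> p <= 1" "q \<bullet> q <= 1" using C_ball sub_C ij that by (simp_all flip: norm_le_1_inner)
    ultimately show ?thesis by (simp add: lf_def inner_diff_left inner_diff_right inner_commute)
  qed
  have neg1: "lf (p,1) (p,1) <= 0" if "p \<in> C" for p
    using C_ball[OF that] by (simp add: lf_def norm_le_1_inner)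
  have sq: "0 < (lf (p,1) (q,1))\<^sup>2" if "p \<in> i" "q \<in> j" for p q using neg[OF that] by simp
  obtain p0 q0 where p0: "p0 \<in> i" "norm p0 < 1" and q0: "q0 \<in> j" "norm q0 < 1" using facet_ball ij by blast
  have "compact i" "compact j" using face_of_imp_compact[OF conv comp] facet_face ij by blast+
  hence "compact (i \<times> j)" by (rule compact_Times)
  moreover have "continuous_on (i \<times> j) f" unfolding f_def lf_def
  proof (intro continuous_intros)
    show "\<forall>y\<in>i \<times> j. (fst (fst y, 1::real) \<bullet> fst (snd y, 1::real) - snd (fst y, 1::real) * snd (snd y, 1::real))\<^sup>2 ~= 0"
      using neg unfolding lf_def by (metis SigmaE fst_conv order_less_irrefl power_not_zero snd_conv)
  qed
  moreover have "i \<times> j ~= {}" using p0 q0 by blast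
  ultimately obtain y where y: "y \<in> i \<times> j" "\<forall>x\<in>i \<times> j. f x <= f y" using continuous_attains_sup by blast
  obtain p q where pq: "y = (p,q)" "p \<in> i" "q \<in> j" using y(1) by auto
  define b P Q where "b = lf (p,1) (q,1)" and "P = lf (p,1) (p,1)" and "Q = lf (q,1) (q,1)"
  have C: "p \<in> C" "q \<in> C" using sub_C ij pq by blast+
  have "0 < lf (p0,1) (p0,1) * lf (q0,1) (q0,1)" using p0 q0 by (intro mult_neg_neg) (simp_all add: lf_def norm_le_1_inner)
  hence "0 < f (p0,q0)" unfolding f_def using sq[OF p0(1) q0(1)] by simp
  also have "\<dots> <= f (p,q)" using y pq p0 q0 by blast
  finally have "0 < P * Q" using sq[OF pq(2,3)] by (simp add: f_def P_def Q_def zero_less_divide_iff)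
  hence PQ: "P < 0" "Q < 0" using neg1[OF C(1)] neg1[OF C(2)] by (auto simp: P_def Q_def zero_less_mult_iff)
  have n: "norm p < 1" "norm q < 1" using PQ by (simp_all add: P_def Q_def lf_def norm_le_1_inner)
  have m1: "lf (x,1) (x,1) * lf (q,1) (q,1) * (lf (p,1) (q,1))\<^sup>2 <= lf (p,1) (p,1) * lf (q,1) (q,1) * (lf (x,1) (q,1))\<^sup>2" if "x \<in> i" for x
    by (rule frac_cross[OF sq[OF that pq(3)] sq[OF pq(2,3)]]) (use y(2)[rule_format, of "(x,q)"] that pq in \<open>simp add: f_def\<close>)
  have m2: "lf (x,1) (x,1) * lf (p,1) (p,1) * (lf (q,1) (p,1))\<^sup>2 <= lf (q,1) (q,1) * lf (p,1) (p,1) * (lf (x,1) (p,1))\<^sup>2" if "x \<in> j" for x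
    unfolding lf_sym[of "(q,1)" "(p,1)"] lf_sym[of "(x,1)" "(p,1)"]
    by (rule frac_cross[OF sq[OF pq(2) that] sq[OF pq(2,3)]]) (use y(2)[rule_format, of "(p,x)"] that pq in \<open>simp add: f_def mult.commute\<close>)
  define s t where "s = lf (q,1) (e i)" and "t = lf (p,1) (e j)"
  have E1: "s *\<^sub>R e i = (q,1) - (b / P) *\<^sub>R (p,1)" using extremal[OF ij(1) pq(2) n(1) C(2) n(2) m1]
    unfolding s_def b_def P_def by (metis add_diff_cancel_left')
  have E2: "t *\<^sub>R e j = (p,1) - (b / Q) *\<^sub>R (q,1)" using extremal[OF ij(2) pq(3) n(2) C(1) n(1) m2]
    unfolding t_def b_def Q_def lf_sym[of "(q,1)" "(p,1)"] by (metis add_diff_cancel_left')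
  have st: "s < 0" "t < 0"
    using C_le[OF C(2) ij(1)] mem[OF ij(1), of q] C_le[OF C(1) ij(2)] mem[OF ij(2), of p] C pq ij(3)
    by (auto simp: s_def t_def lf_sym[of "(q,1)" "e i"] lf_sym[of "(p,1)" "e j"] less_le)
  have b: "b < 0" using neg pq by (simp add: b_def)
  have qp: "lf (q,1) (p,1) = b" by (simp add: b_def lf_sym)
  note [simp] = b_def[symmetric] P_def[symmetric] Q_def[symmetric] qp
  define D where "D = b * b - P * Q"
  have "s * s = lf (s *\<^sub>R e i) (s *\<^sub>R e i)" using unit[OF ij(1)] by simp
  also have "\<dots> = Q - b * b / P" unfolding E1 using PQ by (simp add: field_simps del: scaleR_Pair diff_Pair)
  finally have s2: "- P * (s * s) = D" using PQ by (simp add: D_def field_simps)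
  have "t * t = lf (t *\<^sub>R e j) (t *\<^sub>R e j)" using unit[OF ij(2)] by simp
  also have "\<dots> = P - b * b / Q" unfolding E2 using PQ by (simp add: field_simps del: scaleR_Pair diff_Pair)
  finally have t2: "- Q * (t * t) = D" using PQ by (simp add: D_def field_simps)
  define r where "r = g i j"
  have "s * t * r = lf (s *\<^sub>R e i) (t *\<^sub>R e j)" by (simp add: r_def g_def)
  also have "\<dots> = b * D / (P * Q)" unfolding E1 E2 using PQ by (simp add: D_def field_simps del: scaleR_Pair diff_Pair)
  finally have str: "s * t * r * (P * Q) = b * D" using PQ by (simp add: field_simps)
  have D: "0 < D" unfolding s2[symmetric] using PQ st by (simp add: mult_neg_neg mult_neg_pos)
  have pos: "0 < P * Q" "0 < s * t" using PQ st by (simp_all add: mult_neg_neg)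
  have neg_r: "(s * t * (P * Q)) * r < 0"
  proof -
    have "(s * t * (P * Q)) * r = b * D" using str by (simp only: mult_ac)
    thus ?thesis using mult_neg_pos[OF b D] by simp
  qed
  have r0: "r < 0"
  proof (rule ccontr)
    assume "~ r < 0"
    hence "0 <= (s * t * (P * Q)) * r" using pos by (intro mult_nonneg_nonneg[OF less_imp_le[OF mult_pos_pos[OF pos(2,1)]]]) simp
    thus False using neg_r by linarith
  qed
  have "(D * D) * (r * r * (P * Q)) = (s * t * r * (P * Q)) * (s * t * r * (P * Q))"
  proof -
    have "(D * D) * (r * r * (P * Q)) = (- P * (s * s)) * (- Q * (t * t)) * (r * r * (P * Q))" unfolding s2 t2 ..
    thus ?thesis by (simp add: algebra_simps)
  qed
  hence "(D * D) * (r * r * (P * Q)) = (D * D) * (b * b)" unfolding str by (simp add: mult_ac)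
  hence "r * r * (P * Q) = b * b" using D by simp
  hence "P * Q < r * r * (P * Q)" using D by (simp add: D_def)
  hence "0 < (r * r - 1) * (P * Q)" by (simp add: left_diff_distrib)
  from zero_less_mult_pos2[OF this pos(1)] have 1: "1 < r * r" by simp
  show ?thesis unfolding r_def[symmetric]
  proof (rule ccontr)
    assume "~ r < -1"
    hence "- r * - r <= 1 * 1" using r0 by (intro mult_mono) auto
    thus False using 1 by simp
  qed
qed

lemma meet_vertex: assumes "i \<in> FC" "j \<in> FC" "i \<inter> j ~= {}" shows "\<exists>v\<in>X. i \<in> Fs v & j \<in> Fs v"
proof -
  obtain x where "x \<in> i" "x \<in> j" using assms(3) by blast
  hence "\<exists>v\<in>X. {i,j} \<subseteq> Fs v" by (intro vertex_in[of _ x]) (use assms sub_C in auto)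
  thus ?thesis by auto
qed

lemma facets_meet: assumes "v \<in> X" "i \<in> Fs v" "j \<in> Fs v" shows "\<exists>x. x \<in> i & x \<in> j & norm x < 1"
  by (rule meet_ball[of i j v]) (use assms in \<open>auto simp: Fs_def\<close>)

lemma ax_off: assumes "i \<in> FC" "j \<in> FC" "i ~= j" shows "(\<exists>m::nat. 2 <= m & g i j = - cos (pi / m)) \<or> g i j < -1"
proof (cases "i \<inter> j = {}")
  case False
  then obtain v where v: "v \<in> X" "i \<in> Fs v" "j \<in> Fs v" using meet_vertex assms by blast
  obtain x where "x \<in> i" "x \<in> j" "norm x < 1" using facets_meet[OF v] by blast
  thus ?thesis using cox[OF assms] by (simp add: g_def)
qed (use disjoint_lt assms in blast)

lemma ax_common: assumes "i \<in> FC" "j \<in> FC" "-1 <= g i j" shows "\<exists>v\<in>X. i \<in> Fs v & j \<in> Fs v"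
  using disjoint_lt[of i j] meet_vertex[of i j] assms by fastforce

lemma ax_meets: assumes "v \<in> X" "i \<in> Fs v" "j \<in> Fs v" "i ~= j" shows "-1 < g i j"
proof -
  obtain x where "x \<in> i" "x \<in> j" "norm x < 1" using facets_meet[OF assms(1-3)] by blast
  thus ?thesis using meet_le0(2)[of i j x] assms FsD(1) by blast
qed

lemma g_le0: assumes "i \<in> FC" "j \<in> FC" "i ~= j" shows "g i j <= 0"
  using ax_off[OF assms] cos_label_bounds by fastforce

lemma project:
  assumes "lf u u <= 0" "lf u (z,1) < 0" "!!k. k \<in> FC ==> lf (e k) u <= 0"
  shows "\<exists>x\<in>C. \<exists>s>0. u = s *\<^sub>R (x,1)"
proof -
  have s: "0 < snd u" by (rule future[OF assms(1) z1 assms(2)])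
  define x where "x = (1 / snd u) *\<^sub>R fst u"
  have u: "u = snd u *\<^sub>R (x,1)" using s by (simp add: x_def prod_eq_iff)
  have "lf (e k) (x,1) <= 0" if "k \<in> FC" for k
  proof -
    have "lf (e k) u = snd u * lf (e k) (x,1)" by (subst u) (simp only: lf_lin)
    thus ?thesis using assms(3)[OF that] s by (simp add: mult_le_0_iff)
  qed
  hence "x \<in> C" using Ceq by blast
  thus ?thesis using s u by blast
qed

text \<open>\<open>z\<close> is projected orthogonally onto the common hyperplanes of
  \<open>T\<close>. As off-diagonal entries are nonpositive, the form at the positive part
  \<open>c\<close> of the solution is at most 0, so the solution is nonpositive. The projection then
  satisfies the other facet inequalities and is a point of \<open>C\<close> on all facets of
  \<open>T\<close>.\<close>

lemma ax_ell: assumes T: "T \<subseteq> FC" "pd g T" shows "\<exists>v\<in>X. T \<subseteq> Fs v"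
proof -
  have fT: "finite T" using T finFC finite_subset by blast
  define r where "r = (\<lambda>i. lf (e i) (z,1))"
  have r: "r i < 0" if "i \<in> FC" for i using z0[OF that] by (simp add: r_def)
  obtain l where l: "\<forall>i\<in>T. (\<Sum>j\<in>T. l j * g i j) = r i" using pd_solve[OF g_sym fT T(2), of r] by (rule exE)
  define c where "c = (\<lambda>i. max (l i) 0)"
  have "bil g T c c <= (\<Sum>i\<in>T. c i * (\<Sum>j\<in>T. l j * g i j))" unfolding bil_def sum_distrib_left
  proof (intro sum_mono)
    fix i j assume ij: "i \<in> T" "j \<in> T"
    show "c i * c j * g i j <= c i * (l j * g i j)"
    proof (cases "i = j")
      case True
      have "g i i = 1" using unit ij T by (auto simp: g_def)
      thus ?thesis using True by (simp add: c_def max_def)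
    next
      case False
      hence "g i j <= 0" using g_le0 ij T by blast
      hence "c j * g i j <= l j * g i j" by (intro mult_right_mono_neg) (simp_all add: c_def)
      thus ?thesis by (simp add: c_def mult_left_mono mult.assoc)
    qed
  qed
  also have "\<dots> = (\<Sum>i\<in>T. c i * r i)" using l by simp
  also have "\<dots> <= 0" by (rule sum_nonpos) (use r T in \<open>force simp: c_def intro!: mult_nonneg_nonpos\<close>)
  finally have "\<forall>i\<in>T. c i = 0" using T(2) unfolding pd_def by (metis not_less)
  hence l0: "l i <= 0" if "i \<in> T" for i using that by (force simp: c_def max_def split: if_splits)
  define p where "p = (z,1) - (\<Sum>j\<in>T. l j *\<^sub>R e j)"
  have kp: "lf (e k) p = r k - (\<Sum>j\<in>T. l j * g k j)" for k by (simp add: p_def r_def row_g)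
  have p0: "lf (e i) p = 0" if "i \<in> T" for i using l that by (simp add: kp)
  have le: "lf (e k) p <= 0" if k: "k \<in> FC" for k
  proof (cases "k \<in> T")
    case False
    have "0 <= (\<Sum>j\<in>T. l j * g k j)"
    proof (rule sum_nonneg)
      fix j assume j: "j \<in> T"
      hence "j \<in> FC" "k ~= j" using T False by auto
      thus "0 <= l j * g k j" using l0[OF j] g_le0[OF k] by (simp add: mult_nonpos_nonpos)
    qed
    thus ?thesis using r[OF k] by (simp add: kp)
  qed (simp add: p0)
  have "lf p (z,1) = lf (z,1) (z,1) - (\<Sum>j\<in>T. l j * r j)" by (simp add: p_def lf_sum(1) r_def)
  moreover have "0 <= (\<Sum>j\<in>T. l j * r j)"
  proof (rule sum_nonneg)
    fix j assume j: "j \<in> T"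
    hence "r j <= 0" using r[of j] T by auto
    thus "0 <= l j * r j" using l0[OF j] by (simp add: mult_nonpos_nonpos)
  qed
  moreover have "lf (z,1) (z,1) < 0" using z1 by (simp add: lf_def norm_le_1_inner)
  ultimately have pz: "lf p (z,1) < 0" by linarith
  have "lf p (\<Sum>j\<in>T. l j *\<^sub>R e j) = 0" unfolding lf_sum(2) by (rule sum.neutral) (simp add: p0 lf_sym[of p])
  hence "lf p p = lf p (z,1)" by (simp add: p_def)
  hence pp: "lf p p <= 0" using pz by simp
  obtain x s where x: "x \<in> C" "0 < s" "p = s *\<^sub>R (x,1)" using project[OF pp pz le] by blast
  have "x \<in> i" if "i \<in> T" for i
  proof -
    have "s * lf (e i) (x,1) = 0" using p0[OF that] x(3) by (simp only: lf_lin)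
    thus ?thesis using mem[of i x] x that T by auto
  qed
  thus ?thesis by (rule vertex_in[OF T(1) x(1)])
qed

text \<open>The null vector yields an isotropic vector that satisfies all facet inequalities, that
  is, an ideal point of \<open>C\<close> and hence a vertex. Its diagram is no larger than
  \<open>T\<close>, because proper subsets of it are elliptic.\<close>

lemma ax_par:
  assumes T: "T \<subseteq> FC" "T ~= {}" and c: "!!i. i \<in> T ==> 0 < c i" and z: "!!i. i \<in> T ==> (\<Sum>j\<in>T. c j * g i j) = 0"
  shows "T \<in> Fs ` X"
proof -
  have fT: "finite T" using T finFC finite_subset by blast
  define u where "u = (\<Sum>j\<in>T. c j *\<^sub>R e j)"
  have ku: "lf (e k) u = (\<Sum>j\<in>T. c j * g k j)" for k by (simp add: u_def row_g)
  have "lf u u = (\<Sum>i\<in>T. c i * lf (e i) u)" by (subst u_def) (simp add: lf_sum(1))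
  hence uu: "lf u u = 0" using z by (simp add: ku)
  have le: "lf (e k) u <= 0" if k: "k \<in> FC" for k
  proof (cases "k \<in> T")
    case False
    show ?thesis unfolding ku
    proof (rule sum_nonpos)
      fix j assume j: "j \<in> T"
      hence "j \<in> FC" "k ~= j" using T False by auto
      thus "c j * g k j <= 0" using c[OF j] g_le0[OF k] by (simp add: mult_nonneg_nonpos)
    qed
  qed (simp add: ku z)
  have "0 < (\<Sum>j\<in>T. c j * - lf (e j) (z,1))"
  proof (rule sum_pos[OF fT T(2)])
    fix j assume j: "j \<in> T"
    hence "j \<in> FC" using T(1) by blast
    from mult_pos_neg[OF c[OF j] z0[OF this]] show "0 < c j * - lf (e j) (z,1)" by simp
  qed
  hence uz: "lf u (z,1) < 0" by (simp add: u_def lf_sum(1) sum_negf)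
  obtain x s where x: "x \<in> C" "0 < s" "u = s *\<^sub>R (x,1)" using project[OF _ uz le] uu by auto
  have "s * (s * lf (x,1) (x,1)) = 0" using uu x(3) by (simp only: lf_lin)
  hence "norm x = 1" using x(2) by (simp add: lf_def norm_le_1_inner)
  hence xX: "x \<in> X" using sphere_extreme x(1) by blast
  have "lf (e i) (x,1) = 0" if "i \<in> T" for i
  proof -
    have "s * lf (e i) (x,1) = 0" using z[OF that] x(3) ku[of i] by (simp only: lf_lin)
    thus ?thesis using x(2) by simp
  qed
  hence sub: "T \<subseteq> Fs x" using T mem x(1) by (auto simp: Fs_def)
  have "T = Fs x"
  proof (rule ccontr)
    assume "T ~= Fs x"
    hence "pd g T" using ax_pdp[OF xX] sub by blast
    moreover obtain i where "i \<in> T" "c i ~= 0" using T(2) c by force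
    moreover have "bil g T c c = 0" using uu by (simp add: bil_g u_def)
    ultimately show False unfolding pd_def by (metis less_irrefl)
  qed
  thus ?thesis using xX by blast
qed

lemma X_ne: "X ~= {}"
proof -
  have "z \<in> C" using Ceq z0 by (auto intro: less_imp_le)
  thus ?thesis using vertex_in[of "{}" z] by auto
qed

end

section \<open>From the hyperbolic polytope to its facet description\<close>

text \<open>The obstacle is that the closure in the ball might have a curved boundary on the sphere.
  By simplicity an extreme point is determined by the facets through it, so there are finitely many,
  and Krein-Milman makes \<open>C\<close> a Euclidean polytope, whose frontier is the union of its
  facets.\<close>

lemma polytope_ipoly:
  fixes P :: "'a::euclidean_space set"
  assumes dim: "8 < DIM('a)" and hp: "hyp_polytope P" and hc: "hyp_coxeter P" and hs: "hyp_simple P" and hi: "hyp_ideal P"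
  shows "\<exists>C FC e (z::'a). ipoly C FC e z"
proof -
  obtain Q where Q: "polyhedron Q" "P = ball 0 1 \<inter> Q" and int: "interior P ~= {}"
    using hp unfolding hyp_polytope_def hyp_space_def by blast
  define C where "C = closure P"
  define FC where "FC = {G. G facet_of C}"
  have conv: "convex C" unfolding C_def Q(2) by (intro convex_closure convex_Int convex_ball polyhedron_imp_convex Q(1))
  have PQ: "P \<subseteq> Q" "P \<subseteq> ball 0 1" using Q(2) by blast+
  have CQ: "C \<subseteq> Q" unfolding C_def by (rule closure_minimal[OF PQ(1) polyhedron_imp_closed[OF Q(1)]])
  have Cball: "C \<subseteq> cball 0 1" unfolding C_def by (rule closure_minimal[OF subset_trans[OF PQ(2) ball_subset_cball] closed_cball])
  have C1: "norm x <= 1" if "x \<in> C" for x using Cball that by (auto simp: subset_iff)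
  have closC: "closed C" by (simp add: C_def)
  have comp: "compact C" using closC bounded_subset[OF bounded_cball Cball] by (simp add: compact_eq_bounded_closed)
  have PC: "P \<subseteq> C" unfolding C_def by (rule closure_subset)
  have intPC: "interior P \<subseteq> interior C" by (rule interior_mono[OF PC])
  have intC: "interior C ~= {}" using int intPC by blast
  have nC: "aff_dim C = int DIM('a)" using aff_dim_nonempty_interior[OF intC] by simp
  obtain H where H: "finite H" "Q = \<Inter> H" "\<forall>h\<in>H. \<exists>a b. a ~= 0 & h = {x. a \<bullet> x <= b}" using Q(1) unfolding polyhedron_def by blast
  obtain a where "\<forall>h\<in>H. \<exists>b. a h ~= 0 & h = {x. a h \<bullet> x <= b}" using bchoice[OF H(3)] by (rule exE)
  from bchoice[OF this] obtain b where ab: "\<forall>h\<in>H. a h ~= 0 & h = {x. a h \<bullet> x <= b h}" by (rule exE)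
  have hle: "a h \<bullet> x <= b h" if "h \<in> H" "x \<in> Q" for h x
  proof -
    have "x \<in> h" using that H(2) by blast
    thus ?thesis using bspec[OF ab that(1)] by blast
  qed
  have facet: "\<exists>h\<in>H. G = C \<inter> {x. a h \<bullet> x = b h} & (\<exists>x\<in>G. norm x < 1)" if G: "G facet_of C" for G
  proof -
    have GC: "G face_of C" "G ~= {}" "aff_dim G = int DIM('a) - 1" using G nC by (simp_all add: facet_of_def)
    have sub: "G \<subseteq> C" by (rule face_of_imp_subset[OF GC(1)])
    have cG: "convex G" by (rule face_of_imp_convex[OF GC(1)])
    have neq: "G ~= C" using GC(3) nC by auto
    obtain x where x: "x \<in> G" using GC(2) by blast
    have "G ~= {x}"
    proof
      assume "G = {x}"
      hence "aff_dim G = 0" by simp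
      thus False using GC(3) dim by simp
    qed
    then obtain y where y: "y \<in> G" "x ~= y" using x by blast
    \<comment> \<open>Midpoints of distinct points of the closed ball lie in the open ball.
      Averaging \<open>m\<close> with a relative interior point \<open>w\<close> gives a point
      \<open>u\<close> that is in the open ball and in the relative interior of the facet.\<close>
    define m where "m = (1/2) *\<^sub>R (x + y)"
    have mG: "m \<in> G" using convexD_alt[OF cG x y(1), of "1/2"] by (simp add: m_def scaleR_right_distrib)
    have m1: "norm m < 1" unfolding m_def by (rule strict_midpoint) (use C1 sub x y in auto)
    obtain w where w: "w \<in> rel_interior G" using rel_interior_eq_empty[OF cG] GC(2) by blast
    have wG: "w \<in> G" using w rel_interior_subset by blast
    define u where "u = m - (1/2) *\<^sub>R (m - w)"
    have ur: "u \<in> rel_interior G" unfolding u_def by (rule rel_interior_convex_shrink[OF cG w mG]) simp_all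
    have "u = (1/2) *\<^sub>R (m + w)"
    proof -
      have "(1/2) *\<^sub>R m + (1/2) *\<^sub>R m = m" by (simp flip: scaleR_left_distrib)
      hence f: "m - (1/2) *\<^sub>R m = (1/2) *\<^sub>R m" by (metis add_diff_cancel_left')
      have "u = (m - (1/2) *\<^sub>R m) + (1/2) *\<^sub>R w" unfolding u_def by (simp add: scaleR_diff_right)
      thus ?thesis unfolding f by (simp only: scaleR_right_distrib)
    qed
    hence "norm u <= (1/2) * (norm m + norm w)" using norm_triangle_ineq[of m w] by simp
    also have "\<dots> < 1" using m1 C1[of w] wG sub by (auto simp: subset_iff)
    finally have u1: "norm u < 1" .
    have uG: "u \<in> G" using ur rel_interior_subset by blast
    have uI: "u ~: interior C" using face_of_disjoint_interior[OF GC(1) neq] uG by blast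
    have "\<exists>h\<in>H. a h \<bullet> u = b h"
    proof (rule ccontr)
      assume no: "~ ?thesis"
      \<comment> \<open>If no defining half-space were active at \<open>u\<close>, this
        neighbourhood of \<open>u\<close> would lie in \<open>C\<close>, but a proper face avoids
        the interior.\<close>
      define U where "U = ball 0 1 \<inter> (\<Inter>h\<in>H. {x. a h \<bullet> x < b h})"
      have "open U" unfolding U_def using H(1) by (intro open_Int open_ball open_INT ballI open_halfspace_lt)
      moreover have "u \<in> U"
      proof -
        have "a h \<bullet> u < b h" if "h \<in> H" for h using hle[OF that, of u] no that uG sub CQ by (force simp: less_le)
        thus ?thesis using u1 by (simp add: U_def)
      qed
      moreover have "U \<subseteq> C"
      proof
        fix t assume t: "t \<in> U"
        have "t \<in> h" if "h \<in> H" for h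
        proof -
          have "a h \<bullet> t <= b h" using t that by (auto simp: U_def)
          thus ?thesis using bspec[OF ab that] by blast
        qed
        hence "t \<in> P" using t unfolding Q(2) H(2) U_def by blast
        thus "t \<in> C" using PC by blast
      qed
      ultimately show False using uI interior_maximal[of U C] by blast
    qed
    then obtain h where h: "h \<in> H" "a h \<bullet> u = b h" by blast
    let ?F = "C \<inter> {x. a h \<bullet> x = b h}"
    have F: "?F face_of C" by (rule face_of_Int_supporting_hyperplane_le[OF conv]) (use hle[OF h(1)] CQ in blast)
    have "?F \<inter> rel_interior G ~= {}" using ur h(2) uG sub by blast
    hence GF: "G \<subseteq> ?F" by (rule subset_of_face_of[OF F sub])
    have "?F ~= C"
    proof
      assume "?F = C"
      hence "C \<subseteq> {x. a h \<bullet> x = b h}" by blast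
      hence "interior C \<subseteq> interior {x. a h \<bullet> x = b h}" by (rule interior_mono)
      also have "\<dots> = {}" using ab h(1) by (intro interior_hyperplane) blast
      finally show False using intC by blast
    qed
    hence lt: "aff_dim ?F < int DIM('a)" using face_of_aff_dim_lt[OF conv F] nC by simp
    have "G = ?F"
    proof (rule ccontr)
      assume ne: "G ~= ?F"
      have "aff_dim G < aff_dim ?F"
        by (rule face_of_aff_dim_lt[OF face_of_imp_convex[OF F] face_of_subset[OF GC(1) GF Int_lower1] ne])
      thus False using lt GC(3) by simp
    qed
    thus ?thesis using h(1) uG u1 by blast
  qed
  have "FC \<subseteq> (\<lambda>h. C \<inter> {x. a h \<bullet> x = b h}) ` H" unfolding FC_def using facet by blast
  hence finFC: "finite FC" using H(1) finite_surj by blast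
  define e0 where "e0 = (\<lambda>G. SOME e. outer_normal (closure P) G e)"
  have on: "outer_normal C G (e0 G)" if "G \<in> FC" for G
  proof -
    obtain h where h: "h \<in> H" "G = C \<inter> {x. a h \<bullet> x = b h}" using facet \<open>G \<in> FC\<close> unfolding FC_def by blast
    have "a h ~= 0" using ab h(1) by blast
    moreover have "C \<subseteq> {x. a h \<bullet> x <= b h}" using hle[OF h(1)] CQ by blast
    ultimately have "outer_normal C G (a h, b h)" using h(2) unfolding outer_normal_def by simp
    hence "\<exists>e. outer_normal C G e" by (rule exI)
    thus ?thesis unfolding e0_def C_def[symmetric] by (rule someI_ex)
  qed
  have on1: "fst (e0 G) ~= 0" "x \<in> C ==> fst (e0 G) \<bullet> x <= snd (e0 G)" "x \<in> G \<longleftrightarrow> x \<in> C & fst (e0 G) \<bullet> x = snd (e0 G)"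
    if "G \<in> FC" for G x
  proof -
    have o: "fst (e0 G) ~= 0" "C \<subseteq> {x. fst (e0 G) \<bullet> x <= snd (e0 G)}" "G = C \<inter> {x. fst (e0 G) \<bullet> x = snd (e0 G)}"
      using on[OF that] by (simp_all add: outer_normal_def)
    show "fst (e0 G) ~= 0" by (rule o(1))
    show "x \<in> C ==> fst (e0 G) \<bullet> x <= snd (e0 G)" using o(2) by blast
    have "x \<in> G \<longleftrightarrow> x \<in> C \<inter> {x. fst (e0 G) \<bullet> x = snd (e0 G)}" using o(3) by (rule arg_cong)
    thus "x \<in> G \<longleftrightarrow> x \<in> C & fst (e0 G) \<bullet> x = snd (e0 G)" by simp
  qed
  define N where "N = (\<lambda>G. fst (e0 G) \<bullet> fst (e0 G) - (snd (e0 G))\<^sup>2)"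
  have ballx: "\<exists>x\<in>G. norm x < 1" if "G \<in> FC" for G using facet[of G] that unfolding FC_def by blast
  have N: "0 < N G" if G: "G \<in> FC" for G
  proof -
    obtain x where x: "x \<in> G" "norm x < 1" using ballx[OF G] by blast
    have "(snd (e0 G))\<^sup>2 = (fst (e0 G) \<bullet> x)\<^sup>2" using on1(3)[OF G] x(1) by simp
    also have "\<dots> <= (fst (e0 G) \<bullet> fst (e0 G)) * (x \<bullet> x)" by (rule Cauchy_Schwarz_ineq)
    also have "\<dots> < (fst (e0 G) \<bullet> fst (e0 G)) * 1" using x(2) on1(1)[OF G] by (intro mult_strict_left_mono) (simp_all add: norm_le_1_inner)
    finally show ?thesis by (simp add: N_def)
  qed
  define e where "e = (\<lambda>G. (1 / sqrt (N G)) *\<^sub>R e0 G)"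
  have lfx: "lf (e G) (x,1) = (fst (e0 G) \<bullet> x - snd (e0 G)) / sqrt (N G)" for G x by (simp add: e_def lf_def diff_divide_distrib)
  have le_iff: "lf (e G) (x,1) <= 0 \<longleftrightarrow> fst (e0 G) \<bullet> x <= snd (e0 G)" "lf (e G) (x,1) = 0 \<longleftrightarrow> fst (e0 G) \<bullet> x = snd (e0 G)"
    "lf (e G) (x,1) < 0 \<longleftrightarrow> fst (e0 G) \<bullet> x < snd (e0 G)" if "G \<in> FC" for G x
    unfolding lfx using N[OF that] by (auto simp: divide_le_0_iff divide_less_0_iff)
  have lor: "lf (e G) (e K) = - lorentz_angle_cos (e0 G) (e0 K)" for G K
    by (simp add: e_def lf_def lorentz_angle_cos_def N_def diff_divide_distrib power2_eq_square field_simps)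
  have unit: "lf (e G) (e G) = 1" if "G \<in> FC" for G
  proof -
    have l0: "lf (e0 G) (e0 G) = N G" by (simp add: lf_def N_def power2_eq_square)
    show ?thesis unfolding e_def lf_lin l0 using N[OF that] by simp
  qed
  have face: "{v} face_of C" if "v extreme_point_of C" for v using that by (simp add: face_of_singleton)
  have ext1: "norm v = 1" if "v extreme_point_of C" for v
    using hi face[OF that] by (simp add: hyp_ideal_def hyp_vertex_def C_def ideal_boundary_def)
  have simp_card: "int (card {G. G facet_of C & F \<subseteq> G}) = int DIM('a) - aff_dim F" if "F face_of C" "F ~= {}" for F
    using hs that unfolding hyp_simple_def C_def by blast
  have card: "card {G\<in>FC. v \<in> G} = DIM('a)" if "v extreme_point_of C" for v
    using simp_card[OF face[OF that]] by (simp add: FC_def)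
  have det: "u = v" if uv: "u extreme_point_of C" "v extreme_point_of C" "{G\<in>FC. u \<in> G} = {G\<in>FC. v \<in> G}" for u v
  proof -
    let ?E = "\<Inter> (insert C {G\<in>FC. v \<in> G})"
    have E: "?E face_of C" by (rule face_of_Inter) (use face_of_refl[OF conv] in \<open>auto simp: FC_def facet_of_def\<close>)
    have vE: "v \<in> ?E" "u \<in> ?E"
    proof -
      show "v \<in> ?E" using uv(2) by (auto simp: extreme_point_of_def)
      have "u \<in> G" if "G \<in> {G\<in>FC. v \<in> G}" for G using that unfolding uv(3)[symmetric] by blast
      moreover have "u \<in> C" using uv(1) by (simp add: extreme_point_of_def)
      ultimately show "u \<in> ?E" by blast
    qed
    \<comment> \<open>The smallest face \<open>?E\<close> cut out by the facets through
      \<open>v\<close> lies in exactly these facets, so simplicity gives it dimension 0.\<close>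
    have "{G. G facet_of C & ?E \<subseteq> G} = {G\<in>FC. v \<in> G}"
    proof (intro equalityI subsetI)
      fix G assume "G \<in> {G. G facet_of C & ?E \<subseteq> G}"
      thus "G \<in> {G\<in>FC. v \<in> G}" using vE(1) unfolding FC_def by blast
    next
      fix G assume "G \<in> {G\<in>FC. v \<in> G}"
      thus "G \<in> {G. G facet_of C & ?E \<subseteq> G}" unfolding FC_def by blast
    qed
    hence "aff_dim ?E = 0" using simp_card[OF E] vE(1) card[OF uv(2)] by auto
    then obtain y where "?E = {y}" unfolding aff_dim_eq_0 by blast
    thus ?thesis using vE by auto
  qed
  have "inj_on (\<lambda>v. {G\<in>FC. v \<in> G}) {v. v extreme_point_of C}" by (rule inj_onI) (use det in blast)
  moreover have "(\<lambda>v. {G\<in>FC. v \<in> G}) ` {v. v extreme_point_of C} \<subseteq> Pow FC" by blast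
  ultimately have "finite {v. v extreme_point_of C}" using finFC by (meson finite_Pow_iff finite_imageD finite_subset)
  hence pC: "polytope C" unfolding polytope_def using Krein_Milman_Minkowski[OF comp conv] by blast
  have fr: "frontier C = \<Union> FC"
    using rel_frontier_of_polyhedron[OF polytope_imp_polyhedron[OF pC]] rel_frontier_nonempty_interior[OF intC] by (simp add: FC_def)
  obtain z where z: "z \<in> interior P" using int by blast
  have zI: "z \<in> interior C" "z \<in> C" using z intPC interior_subset by blast+
  have z1: "norm z < 1" using z interior_subset PQ(2) by (auto simp: subset_iff)
  have z0: "fst (e0 G) \<bullet> z < snd (e0 G)" if G: "G \<in> FC" for G
  proof -
    have "G face_of C" "G ~= C" using G nC by (auto simp: FC_def facet_of_def)
    hence "z ~: G" using face_of_disjoint_interior zI(1) by blast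
    thus ?thesis using on1(2,3)[OF G, of z] zI(2) by simp
  qed
  have Ceq: "x \<in> C \<longleftrightarrow> (\<forall>G\<in>FC. fst (e0 G) \<bullet> x <= snd (e0 G))" for x
  proof
    assume le: "\<forall>G\<in>FC. fst (e0 G) \<bullet> x <= snd (e0 G)"
    show "x \<in> C"
    proof (rule ccontr)
      assume x: "x ~: C"
      have "closed_segment z x \<inter> frontier C ~= {}"
        by (rule connected_Int_frontier) (use x zI(2) in auto)
      then obtain y where y: "y \<in> closed_segment z x" "y \<in> \<Union> FC" unfolding fr by blast
      then obtain G where G: "G \<in> FC" "y \<in> G" by blast
      obtain t where t: "y = (1 - t) *\<^sub>R z + t *\<^sub>R x" "0 <= t" "t <= 1" using y(1) unfolding closed_segment_def by blast
      have yC: "y \<in> C" "fst (e0 G) \<bullet> y = snd (e0 G)" using on1(3)[OF G(1)] G(2) by blast+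
      have "t ~= 1" using t(1) yC(1) x by auto
      hence "(1 - t) * (fst (e0 G) \<bullet> z) < (1 - t) * snd (e0 G)" using z0[OF G(1)] t(3) by simp
      moreover have "t * (fst (e0 G) \<bullet> x) <= t * snd (e0 G)" using le G(1) t(2) by (simp add: mult_left_mono)
      ultimately have "(1 - t) * (fst (e0 G) \<bullet> z) + t * (fst (e0 G) \<bullet> x) < (1 - t) * snd (e0 G) + t * snd (e0 G)" by (rule add_less_le_mono)
      moreover have "(1 - t) * snd (e0 G) + t * snd (e0 G) = snd (e0 G)" by (simp add: algebra_simps)
      ultimately show False using yC(2) by (simp add: t(1) inner_add_right)
    qed
  qed (use on1(2) in blast)
  have "ipoly C FC e z"
  proof
    show "9 <= DIM('a)" using dim by simp
    show "finite FC" by (rule finFC)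
    show "lf (e G) (e G) = 1" if "G \<in> FC" for G by (rule unit[OF that])
    show "x \<in> G \<longleftrightarrow> x \<in> C & lf (e G) (x,1) = 0" if "G \<in> FC" for G x
      unfolding le_iff(2)[OF that] by (rule on1(3)[OF that])
    show "x \<in> C \<longleftrightarrow> (\<forall>G\<in>FC. lf (e G) (x,1) <= 0)" for x unfolding Ceq[of x] by (rule ball_cong[OF refl]) (simp add: le_iff(1))
    show "convex C" "compact C" by (rule conv comp)+
    show "norm x <= 1" if "x \<in> C" for x by (rule C1[OF that])
    show "norm z < 1" by (rule z1)
    show "lf (e G) (z,1) < 0" if "G \<in> FC" for G unfolding le_iff(3)[OF that] by (rule z0[OF that])
    show "norm v = 1" if "v extreme_point_of C" for v by (rule ext1[OF that])
    show "card {G\<in>FC. v \<in> G} = DIM('a)" if "v extreme_point_of C" for v by (rule card[OF that])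
    show "\<exists>x\<in>G. norm x < 1" if "G \<in> FC" for G by (rule ballx[OF that])
    show "\<exists>m::nat. 2 <= m & lf (e G) (e K) = - cos (pi / m)"
      if GK: "G \<in> FC" "K \<in> FC" "G ~= K" and x: "x \<in> G" "x \<in> K" "norm x < 1" for G K x
    proof -
      have tl: "lf (x,1) (x,1) < 0" using x(3) by (simp add: lf_def norm_le_1_inner)
      have p: "lf (x,1) (e G) = 0" "lf (x,1) (e K) = 0"
        using le_iff(2)[OF GK(1), of x] le_iff(2)[OF GK(2), of x] on1(3)[OF GK(1), of x] on1(3)[OF GK(2), of x] x by (simp_all add: lf_sym)
      \<comment> \<open>Both normals are orthogonal to the timelike vector of a common point, so
        their sum and difference have nonnegative norm. This puts the cosine into [-1, 1], where
        \<open>arccos\<close> can be inverted.\<close>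
      have "0 <= lf (e G + e K) (e G + e K)" "0 <= lf (e G - e K) (e G - e K)"
        by (rule timelike_perp_nonneg[OF tl]; simp add: p)+
      hence bd: "- 1 <= lorentz_angle_cos (e0 G) (e0 K)" "lorentz_angle_cos (e0 G) (e0 K) <= 1"
        using unit[OF GK(1)] unit[OF GK(2)] lor[of G K] by (simp_all add: lf_sym[of "e K" "e G"])
      have "G \<inter> K \<inter> hyp_space ~= {}" using x by (auto simp: hyp_space_def)
      then obtain m :: nat where m: "2 <= m" "hyp_dihedral_angle P G K = pi / real m"
        using hc GK unfolding hyp_coxeter_def FC_def C_def by blast
      have "hyp_dihedral_angle P G K = arccos (lorentz_angle_cos (e0 G) (e0 K))" by (simp add: hyp_dihedral_angle_def e0_def)
      hence "cos (pi / m) = lorentz_angle_cos (e0 G) (e0 K)" using m(2) cos_arccos[OF bd] by simp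
      thus ?thesis using m(1) lor[of G K] by (intro exI[of _ m]) simp
    qed
  qed
  thus ?thesis by blast
qed

section \<open>The facet diagram satisfies the axioms\<close>

context ipoly begin

lemma contradiction: False
proof -
  obtain c :: 'a where c: "inj_on (\<lambda>v. c \<bullet> v) X" using generic by (rule exE)
  define ht where "ht = (\<lambda>A. c \<bullet> inv_into X Fs A)"
  have inj: "inj_on Fs X" by (rule inj_onI) (rule Fs_inj)
  have ht: "ht (Fs v) = c \<bullet> v" if "v \<in> X" for v unfolding ht_def inv_into_f_f[OF inj that] ..
  have VE: "\<exists>v. v \<in> X & A = Fs v" if "A \<in> Fs ` X" for A using that by blast
  have dl_top: "c' \<bullet> w <= c' \<bullet> v" if "v \<in> X" "x \<in> Fs v" "y \<in> Fs v" "x ~= y"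
    "!!B. B \<in> Fs ` X ==> Fs v - {x} \<subseteq> B ==> c' \<bullet> inv_into X Fs B <= c' \<bullet> v"
    "!!B. B \<in> Fs ` X ==> Fs v - {y} \<subseteq> B ==> c' \<bullet> inv_into X Fs B <= c' \<bullet> v"
    "w \<in> X" "Fs v - {x,y} \<subseteq> Fs w" for c' v w x y
  proof (rule top_gen[OF that(1-4) _ _ that(7,8)])
    fix u assume u: "u \<in> X"
    show "Fs v - {x} \<subseteq> Fs u ==> c' \<bullet> u <= c' \<bullet> v" by (rule that(5)[OF imageI[OF u], unfolded inv_into_f_f[OF inj u]])
    show "Fs v - {y} \<subseteq> Fs u ==> c' \<bullet> u <= c' \<bullet> v" by (rule that(6)[OF imageI[OF u], unfolded inv_into_f_f[OF inj u]])
  qed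
  have inv: "inv_into X Fs (Fs v) = v" if "v \<in> X" for v by (rule inv_into_f_f[OF inj that])
  have "height_diagram FC g (Fs ` X) DIM('a) ht"
  proof
    show "finite FC" by (rule finFC)
    show "9 <= DIM('a)" by (rule dim9)
    show "g i j = g j i" for i j by (rule g_sym)
    show "g i i = 1" if "i \<in> FC" for i using unit[OF that] by (simp add: g_def)
    show "(\<exists>m::nat. 2 <= m & g i j = - cos (pi / m)) \<or> g i j < -1" if "i \<in> FC" "j \<in> FC" "i ~= j" for i j by (rule ax_off[OF that])
    show "\<exists>A\<in>Fs ` X. i \<in> A & j \<in> A" if "i \<in> FC" "j \<in> FC" "i ~= j" "-1 <= g i j" for i j
      using ax_common[OF that(1,2,4)] by (rule bexE) (rule bexI[OF _ imageI])
    show "-1 < g i j" if A: "A \<in> Fs ` X" and i: "i \<in> A" "j \<in> A" "i ~= j" for A i j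
    proof -
      obtain v where v: "v \<in> X" "A = Fs v" using VE[OF A] by blast
      show ?thesis using ax_meets[OF v(1)] i unfolding v(2) by blast
    qed
    show "A \<subseteq> FC" if "A \<in> Fs ` X" for A using VE[OF that] FsD(1) by blast
    show "card A = DIM('a)" if "A \<in> Fs ` X" for A using VE[OF that] X_card by blast
    show "Fs ` X ~= {}" using X_ne by simp
    show "\<exists>m. (\<forall>i\<in>A. 0 < m i) & (\<forall>i\<in>A. (\<Sum>j\<in>A. m j * g i j) = 0)" if A: "A \<in> Fs ` X" for A
    proof -
      obtain v where v: "v \<in> X" "A = Fs v" using VE[OF A] by blast
      show ?thesis unfolding v(2) by (rule ax_null[OF v(1)])
    qed
    show "pd g T" if A: "A \<in> Fs ` X" "T \<subset> A" for A T
    proof -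
      obtain v where v: "v \<in> X" "A = Fs v" using VE[OF A(1)] by blast
      show ?thesis by (rule ax_pdp[OF v(1) A(2)[unfolded v(2)]])
    qed
    show "0 <= bil g A d d" if A: "A \<in> Fs ` X" for A d
    proof -
      obtain v where v: "v \<in> X" "A = Fs v" using VE[OF A] by blast
      show ?thesis unfolding v(2) by (rule vertex_psd[OF v(1) subset_refl])
    qed
    show "(\<Sum>j\<in>A. d j * g i j) = 0" if A: "A \<in> Fs ` X" "bil g A d d = 0" "i \<in> A" for A d i
    proof -
      obtain v where v: "v \<in> X" "A = Fs v" using VE[OF A(1)] by blast
      show ?thesis unfolding v(2) by (rule ax_psd0[OF v(1) A(2,3)[unfolded v(2)]])
    qed
    show "\<exists>A\<in>Fs ` X. T \<subseteq> A" if "T \<subseteq> FC" "pd g T" for T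
      using ax_ell[OF that] by (rule bexE) (rule bexI[OF _ imageI])
    show "T \<in> Fs ` X" if "T \<subseteq> FC" "T ~= {}" "!!i. i \<in> T ==> 0 < d i" "!!i. i \<in> T ==> (\<Sum>j\<in>T. d j * g i j) = 0" for T d
      by (rule ax_par[OF that])
    show "bil g FC d d * bil g FC d' d' <= (bil g FC d d')\<^sup>2" if "bil g FC d d < 0" for d d'
      using that unfolding bil_g by (rule reverse_Cauchy_Schwarz)
    show "\<exists>y. y \<in> FC - A & {A'\<in>Fs ` X. A - {x} \<subseteq> A'} = {A, insert y (A - {x})}" if A: "A \<in> Fs ` X" "x \<in> A" for A x
    proof -
      obtain v where v: "v \<in> X" "A = Fs v" using VE[OF A(1)] by blast
      show ?thesis unfolding v(2) by (rule ax_nbr[OF v(1) A(2)[unfolded v(2)]])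
    qed
    show "inj_on ht (Fs ` X)"
    proof (rule inj_onI)
      fix A B assume A: "A \<in> Fs ` X" "B \<in> Fs ` X" "ht A = ht B"
      obtain v where v: "v \<in> X" "A = Fs v" using VE[OF A(1)] by blast
      obtain w where w: "w \<in> X" "B = Fs w" using VE[OF A(2)] by blast
      have "c \<bullet> v = c \<bullet> w" using A(3) unfolding v(2) w(2) ht[OF v(1)] ht[OF w(1)] .
      from inj_onD[OF c this v(1) w(1)] show "A = B" unfolding v(2) w(2) by (rule arg_cong)
    qed
    show "ht D <= ht A" if A: "A \<in> Fs ` X" "x \<in> A" "y \<in> A" "x ~= y"
      and B: "!!B. B \<in> Fs ` X ==> A - {x} \<subseteq> B ==> ht B <= ht A" "!!B. B \<in> Fs ` X ==> A - {y} \<subseteq> B ==> ht B <= ht A"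
      and D: "D \<in> Fs ` X" "A - {x,y} \<subseteq> D" for A D x y
    proof -
      obtain v where v: "v \<in> X" "A = Fs v" using VE[OF A(1)] by blast
      obtain w where w: "w \<in> X" "D = Fs w" using VE[OF D(1)] by blast
      have b: "c \<bullet> inv_into X Fs B <= c \<bullet> v" if "B \<in> Fs ` X" "Fs v - {x} \<subseteq> B \<or> Fs v - {y} \<subseteq> B" for B
        using B[OF that(1)] that(2) unfolding ht_def v(2) inv[OF v(1)] by (elim disjE) assumption+
      have "c \<bullet> w <= c \<bullet> v"
        by (rule dl_top[OF v(1) A(2)[unfolded v(2)] A(3)[unfolded v(2)] A(4) b b w(1) D(2)[unfolded v(2) w(2)]]) simp_all
      thus ?thesis unfolding v(2) w(2) ht[OF v(1)] ht[OF w(1)] .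
    qed
    show "ht A <= ht D" if A: "A \<in> Fs ` X" "x \<in> A" "y \<in> A" "x ~= y"
      and B: "!!B. B \<in> Fs ` X ==> A - {x} \<subseteq> B ==> ht A <= ht B" "!!B. B \<in> Fs ` X ==> A - {y} \<subseteq> B ==> ht A <= ht B"
      and D: "D \<in> Fs ` X" "A - {x,y} \<subseteq> D" for A D x y
    proof -
      obtain v where v: "v \<in> X" "A = Fs v" using VE[OF A(1)] by blast
      obtain w where w: "w \<in> X" "D = Fs w" using VE[OF D(1)] by blast
      \<comment> \<open>Minima of the height are maxima for the direction \<open>- c\<close>, so
        \<open>dl_top\<close> serves for both extremes.\<close>
      have b: "- c \<bullet> inv_into X Fs B <= - c \<bullet> v" if "B \<in> Fs ` X" "Fs v - {x} \<subseteq> B \<or> Fs v - {y} \<subseteq> B" for B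
        using B[OF that(1)] that(2) unfolding ht_def v(2) inv[OF v(1)] inner_minus_left neg_le_iff_le by (elim disjE) assumption+
      have "- c \<bullet> w <= - c \<bullet> v"
        by (rule dl_top[OF v(1) A(2)[unfolded v(2)] A(3)[unfolded v(2)] A(4) b b w(1) D(2)[unfolded v(2) w(2)]]) simp_all
      thus ?thesis unfolding v(2) w(2) ht[OF v(1)] ht[OF w(1)] inner_minus_left neg_le_iff_le .
    qed
  qed
  thus False by (rule height_diagram.impossible)
qed

end

theorem theorem1:
  assumes "DIM('a::euclidean_space) > 8"
  shows "\<not> (\<exists>P :: 'a set. hyp_polytope P \<and> hyp_coxeter P \<and> hyp_simple P \<and> hyp_ideal P)"
proof
  assume "\<exists>P :: 'a set. hyp_polytope P \<and> hyp_coxeter P \<and> hyp_simple P \<and> hyp_ideal P"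
  then obtain P :: "'a set" where P: "hyp_polytope P" "hyp_coxeter P" "hyp_simple P" "hyp_ideal P" by blast
  from polytope_ipoly[OF assms P] have "\<exists>C FC e (z::'a). ipoly C FC e z" .
  then obtain C FC e and z :: 'a where "ipoly C FC e z" by (elim exE)
  thus False by (rule ipoly.contradiction)
qed

end
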